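(* For every $p\in(1,\infty)$, the parabolic algebra $\mathcal{A}_{par}^p$ is equal to the Fourier binest algebra $\mathcal{A}_{FB}^p$.
   Context: All function spaces are complex. On $L^p(\mathbb{R})$ (Lebesgue measure), for $\lambda,\mu\in\mathbb{R}$, define the isometric operators $(M_\lambda f)(x)=e^{i\lambda x}f(x)$ and $(D_\mu f)(x)=f(x-\mu)$. The strong operator topology (SOT) on the bounded operators $B(X)$ of a Banach space $X$ is the topology of pointwise convergence on $X$. The parabolic algebra $\mathcal{A}_{par}^p$ is the SOT-closed operator algebra on $L^p(\mathbb{R})$ generated by $\{M_\lambda:\lambda\ge 0\}\cup\{D_\mu:\mu\ge 0\}$. $H^p(\mathbb{R})\subseteq L^p(\mathbb{R})$ denotes the usual Hardy space of the upper half plane (boundary values on $\mathbb{R}$). $L^p[t,\infty)$ denotes the functions in $L^p(\mathbb{R})$ vanishing a.e. outside $[t,\infty)$. The Fourier binest is the family of closed subspaces $$\mathcal{L}_{FB}^p=\{\{0\}\}\cup\{L^p[t,\infty):t\in\mathbb{R}\}\cup\{e^{i\lambda x}H^p(\mathbb{R}):\lambda\in\mathbb{R}\}\cup\{L^p(\mathbb{R})\}.$$ The Fourier binest algebra $\mathcal{A}_{FB}^p$ is the algebra of all bounded operators $T$ on $L^p(\mathbb{R})$ with $TK\subseteq K$ for every $K\in\mathcal{L}_{FB}^p$. *)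

theory Defs
  imports "HOL-Complex_Analysis.Complex_Analysis"
begin

section \<open>Measurable functions on the line modulo null sets\<close>

text \<open>
  The exponent \<open>p\<close> is a term variable, so \<open>L\<^sup>p(\<real>)\<close> cannot be a type of its own. All the spaces
  \<open>L\<^sup>p(\<real>)\<close> are carrier sets inside one type, the Borel functions \<open>\<real> \<rightarrow> \<complex>\<close> modulo equality
  almost everywhere. (Every Lebesgue measurable function agrees almost everywhere with a Borel one,
  so this is the same as taking Lebesgue measurable functions.)
\<close>

definition ae_rel :: "(real \<Rightarrow> complex) \<Rightarrow> (real \<Rightarrow> complex) \<Rightarrow> bool" where
  "ae_rel f g \<longleftrightarrow> f \<in> borel_measurable lborel \<and> g \<in> borel_measurable lborel \<and>
     (AE x in lborel. f x = g x)"

quotient_type ae_fun = "real \<Rightarrow> complex" / partial: ae_rel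
proof (rule part_equivpI)
  show "\<exists>f. ae_rel f f"
    by (intro exI[of _ "\<lambda>_. 0"]) (simp add: ae_rel_def)
  show "symp ae_rel"
    by (rule sympI) (auto simp: ae_rel_def elim: AE_mp)
  show "transp ae_rel"
    by (rule transpI) (auto simp: ae_rel_def elim: AE_mp)
qed

instantiation ae_fun :: ab_group_add
begin

lift_definition zero_ae_fun :: ae_fun is "\<lambda>_. 0"
  by (simp add: ae_rel_def)

lift_definition plus_ae_fun :: "ae_fun \<Rightarrow> ae_fun \<Rightarrow> ae_fun" is "\<lambda>f g x. f x + g x"
  by (auto simp: ae_rel_def)

lift_definition uminus_ae_fun :: "ae_fun \<Rightarrow> ae_fun" is "\<lambda>f x. - f x"
  by (auto simp: ae_rel_def)

lift_definition minus_ae_fun :: "ae_fun \<Rightarrow> ae_fun \<Rightarrow> ae_fun" is "\<lambda>f g x. f x - g x"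
  by (auto simp: ae_rel_def)

instance
  by standard (transfer; auto simp: ae_rel_def)+

end

lift_definition scale_ae :: "complex \<Rightarrow> ae_fun \<Rightarrow> ae_fun" (infixr \<open>*\<^sub>a\<close> 75)
  is "\<lambda>c f x. c * f x"
  by (auto simp: ae_rel_def)

interpretation ae: vector_space scale_ae
  by standard (transfer; auto simp: ae_rel_def algebra_simps)+


section \<open>The spaces \<open>L\<^sup>p(\<real>)\<close>\<close>

lift_definition p_integrable :: "real \<Rightarrow> ae_fun \<Rightarrow> bool"
  is "\<lambda>p f. integrable lborel (\<lambda>x. cmod (f x) powr p)"
  unfolding ae_rel_def by (intro integrable_cong_AE) auto

definition Lp :: "real \<Rightarrow> ae_fun set" where
  "Lp p = {f. p_integrable p f}"

lift_definition Lp_norm :: "real \<Rightarrow> ae_fun \<Rightarrow> real"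
  is "\<lambda>p f. (LINT x|lborel. cmod (f x) powr p) powr (1 / p)"
  unfolding ae_rel_def by (intro arg_cong[where f = "\<lambda>t. t powr _"] integral_cong_AE) auto

definition Lp_dist :: "real \<Rightarrow> ae_fun \<Rightarrow> ae_fun \<Rightarrow> real" where
  "Lp_dist p f g = Lp_norm p (f - g)"

lemma powr_convex_comb:
  fixes u v t p :: real
  assumes "p \<ge> 1" "u \<ge> 0" "v \<ge> 0" "0 \<le> t" "t \<le> 1"
  shows "((1 - t) * u + t * v) powr p \<le> (1 - t) * u powr p + t * v powr p"
proof -
  have scale: "(s * w) powr p \<le> s * w powr p" if "0 \<le> s" "s \<le> 1" "w \<ge> 0" for s w :: real
  proof -
    have "s powr p \<le> s"
      using powr_mono'[of 1 p s] that assms(1) by (cases "s = 0") auto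
    then show ?thesis
      using that by (simp add: powr_mult mult_right_mono)
  qed
  show ?thesis
  proof (cases "u = 0 \<or> v = 0")
    case True
    then show ?thesis
      using scale[of t v] scale[of "1 - t" u] assms by auto
  next
    case False
    then show ?thesis
      using convex_onD[OF powr_convex[OF assms(1)], of t u v] assms by auto
  qed
qed

lemma Lp_0: "0 \<in> Lp p"
  unfolding Lp_def mem_Collect_eq by transfer simp

lemma Lp_scale: "f \<in> Lp p \<Longrightarrow> c *\<^sub>a f \<in> Lp p"
  unfolding Lp_def mem_Collect_eq by transfer (simp add: norm_mult powr_mult)

lemma Lp_add:
  assumes "p \<ge> 1" "f \<in> Lp p" "g \<in> Lp p"
  shows "f + g \<in> Lp p"
  using assms(2,3) unfolding Lp_def mem_Collect_eq
proof (transfer fixing: p)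
  fix f g :: "real \<Rightarrow> complex"
  assume fg: "ae_rel f f" "ae_rel g g"
    and int: "integrable lborel (\<lambda>x. cmod (f x) powr p)" "integrable lborel (\<lambda>x. cmod (g x) powr p)"
  have [measurable]: "f \<in> borel_measurable borel" "g \<in> borel_measurable borel"
    using fg by (auto simp: ae_rel_def)
  have le: "cmod (f x + g x) powr p \<le>
      2 powr p * (1/2 * cmod (f x) powr p + 1/2 * cmod (g x) powr p)" for x
  proof -
    have "cmod (f x + g x) powr p \<le> (2 * ((1 - 1/2) * cmod (f x) + 1/2 * cmod (g x))) powr p"
      by (intro powr_mono2) (use assms(1) norm_triangle_ineq[of "f x" "g x"] in auto)
    also have "\<dots> = 2 powr p * ((1 - 1/2) * cmod (f x) + 1/2 * cmod (g x)) powr p"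
      by (rule powr_mult)
    also have "\<dots> \<le> 2 powr p * ((1 - 1/2) * cmod (f x) powr p + 1/2 * cmod (g x) powr p)"
      by (intro mult_left_mono powr_convex_comb) (use assms(1) in auto)
    finally show ?thesis by simp
  qed
  show "integrable lborel (\<lambda>x. cmod (f x + g x) powr p)"
  proof (rule Bochner_Integration.integrable_bound)
    show "integrable lborel (\<lambda>x. 2 powr p * (1/2 * cmod (f x) powr p + 1/2 * cmod (g x) powr p))"
      using int by (intro integrable_mult_right Bochner_Integration.integrable_add) auto
  qed (use le in \<open>auto intro!: AE_I2 order_trans[OF _ abs_ge_self]\<close>)
qed

lemma Lp_subspace: "p \<ge> 1 \<Longrightarrow> ae.subspace (Lp p)"
  by (simp add: ae.subspace_def Lp_0 Lp_scale Lp_add)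

lemma Lp_norm_nonneg: "Lp_norm p f \<ge> 0"
  by transfer simp

lemma Lp_norm_scale:
  assumes "p > 0"
  shows "Lp_norm p (c *\<^sub>a f) = cmod c * Lp_norm p f"
  by (transfer fixing: p) (use assms in \<open>simp add: norm_mult powr_mult powr_powr\<close>)

lemma Lp_norm_eq_0:
  assumes "p > 0" "f \<in> Lp p"
  shows "Lp_norm p f = 0 \<longleftrightarrow> f = 0"
  using assms(2) unfolding Lp_def mem_Collect_eq
  by (transfer fixing: p) (use assms(1) in \<open>auto simp: ae_rel_def integral_nonneg_eq_0_iff_AE\<close>)

lemma Lp_norm_triangle:
  assumes p: "p \<ge> 1" and f: "f \<in> Lp p" and g: "g \<in> Lp p"
  shows "Lp_norm p (f + g) \<le> Lp_norm p f + Lp_norm p g"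
proof (cases "f = 0 \<or> g = 0")
  case True
  then show ?thesis
    using Lp_norm_nonneg[of p 0] by auto
next
  case False
  define a b where "a = Lp_norm p f" and "b = Lp_norm p g"
  have ab: "a > 0" "b > 0"
    using False Lp_norm_eq_0[of p f] Lp_norm_eq_0[of p g] Lp_norm_nonneg[of p f]
      Lp_norm_nonneg[of p g] p f g by (auto simp: a_def b_def)
  define t where "t = b / (a + b)"
  have t: "0 \<le> t" "t \<le> 1" "1 - t = a / (a + b)"
    using ab by (auto simp: t_def field_simps)
  have "Lp_norm p (f + g) \<le> a + b"
    using f g a_def b_def Lp_add[OF p f g] unfolding Lp_def mem_Collect_eq
  proof (transfer fixing: p a b)
    fix f g :: "real \<Rightarrow> complex"
    assume int: "integrable lborel (\<lambda>x. cmod (f x) powr p)"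
        "integrable lborel (\<lambda>x. cmod (g x) powr p)"
        "integrable lborel (\<lambda>x. cmod (f x + g x) powr p)"
      and a: "a = (LINT x|lborel. cmod (f x) powr p) powr (1 / p)"
      and b: "b = (LINT x|lborel. cmod (g x) powr p) powr (1 / p)"
    have ap: "(LINT x|lborel. cmod (f x) powr p) = a powr p"
      using p by (simp add: a powr_powr)
    have bp: "(LINT x|lborel. cmod (g x) powr p) = b powr p"
      using p by (simp add: b powr_powr)
    have le: "cmod (f x + g x) powr p \<le> (a + b) powr p *
       ((1 - t) * (cmod (f x) powr p / a powr p) + t * (cmod (g x) powr p / b powr p))" for x
    proof -
      have eq: "(a + b) * ((1 - t) * (cmod (f x) / a) + t * (cmod (g x) / b)) = cmod (f x) + cmod (g x)"
      proof -
        have "(a + b) * (1 - t) = a" "(a + b) * t = b"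
          unfolding t(3) using ab by (simp_all add: t_def)
        then have "(a + b) * ((1 - t) * u + t * v) = a * u + b * v" for u v
          by (simp add: distrib_left mult.assoc[symmetric])
        from this[of "cmod (f x) / a" "cmod (g x) / b"] show ?thesis
          using ab by simp
      qed
      have "cmod (f x + g x) powr p \<le> ((a + b) * ((1 - t) * (cmod (f x) / a) + t * (cmod (g x) / b))) powr p"
        unfolding eq by (intro powr_mono2) (use p norm_triangle_ineq in auto)
      also have "\<dots> = (a + b) powr p * ((1 - t) * (cmod (f x) / a) + t * (cmod (g x) / b)) powr p"
        by (rule powr_mult)
      also have "\<dots> \<le> (a + b) powr p * ((1 - t) * (cmod (f x) / a) powr p + t * (cmod (g x) / b) powr p)"
        by (intro mult_left_mono powr_convex_comb) (use p ab t in auto)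
      finally show ?thesis by (simp add: powr_divide)
    qed
    have "(LINT x|lborel. cmod (f x + g x) powr p) \<le> (LINT x|lborel. (a + b) powr p *
       ((1 - t) * (cmod (f x) powr p / a powr p) + t * (cmod (g x) powr p / b powr p)))"
      using int le by (intro integral_mono) auto
    also have "\<dots> = (a + b) powr p * ((1 - t) * (a powr p / a powr p) + t * (b powr p / b powr p))"
      using int by (simp add: ap bp)
    also have "\<dots> = (a + b) powr p"
      using ab by simp
    finally have "(LINT x|lborel. cmod (f x + g x) powr p) powr (1 / p) \<le> ((a + b) powr p) powr (1 / p)"
      using p by (intro powr_mono2) auto
    then show "(LINT x|lborel. cmod (f x + g x) powr p) powr (1 / p) \<le> a + b"
      using p ab by (simp add: powr_powr)
  qed
  then show ?thesis
    by (simp add: a_def b_def)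
qed

lemma Lp_metric:
  assumes p: "p \<ge> 1"
  shows "Metric_space (Lp p) (Lp_dist p)"
proof
  fix f g
  show "0 \<le> Lp_dist p f g"
    by (simp add: Lp_dist_def Lp_norm_nonneg)
  show "Lp_dist p f g = Lp_dist p g f"
    unfolding Lp_dist_def by transfer (simp add: norm_minus_commute)
next
  fix f g assume "f \<in> Lp p" "g \<in> Lp p"
  then show "Lp_dist p f g = 0 \<longleftrightarrow> f = g"
    using ae.subspace_diff[OF Lp_subspace[OF p]] Lp_norm_eq_0[of p "f - g"] p
    by (simp add: Lp_dist_def)
next
  fix f g h assume "f \<in> Lp p" "g \<in> Lp p" "h \<in> Lp p"
  then show "Lp_dist p f h \<le> Lp_dist p f g + Lp_dist p g h"
    using Lp_norm_triangle[OF p, of "f - g" "g - h"] ae.subspace_diff[OF Lp_subspace[OF p]]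
    by (simp add: Lp_dist_def)
qed

definition Lp_topology :: "real \<Rightarrow> ae_fun topology" where
  "Lp_topology p = Metric_space.mtopology (Lp p) (Lp_dist p)"


section \<open>Bounded operators and the strong operator topology\<close>

text \<open>
  An operator on \<open>L\<^sup>p(\<real>)\<close> is an extensional function on the carrier (equal to \<open>undefined\<close> off
  \<open>Lp p\<close>), so that equality of HOL functions is equality of operators. Linearity is over the
  complex numbers.
\<close>

definition bounded_ops :: "real \<Rightarrow> (ae_fun \<Rightarrow> ae_fun) set" where
  "bounded_ops p = {T \<in> Lp p \<rightarrow>\<^sub>E Lp p.
     (\<forall>f\<in>Lp p. \<forall>g\<in>Lp p. T (f + g) = T f + T g) \<and>
     (\<forall>c. \<forall>f\<in>Lp p. T (c *\<^sub>a f) = c *\<^sub>a T f) \<and>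
     (\<exists>C. \<forall>f\<in>Lp p. Lp_norm p (T f) \<le> C * Lp_norm p f)}"

definition SOT :: "real \<Rightarrow> (ae_fun \<Rightarrow> ae_fun) topology" where
  "SOT p = subtopology (product_topology (\<lambda>_. Lp_topology p) (Lp p)) (bounded_ops p)"

definition operator_algebra :: "real \<Rightarrow> (ae_fun \<Rightarrow> ae_fun) set \<Rightarrow> bool" where
  "operator_algebra p A \<longleftrightarrow> A \<subseteq> bounded_ops p \<and>
     (\<lambda>f\<in>Lp p. 0) \<in> A \<and>
     (\<forall>S\<in>A. \<forall>T\<in>A. (\<lambda>f\<in>Lp p. S f + T f) \<in> A) \<and>
     (\<forall>c. \<forall>T\<in>A. (\<lambda>f\<in>Lp p. c *\<^sub>a T f) \<in> A) \<and>
     (\<forall>S\<in>A. \<forall>T\<in>A. compose (Lp p) S T \<in> A)"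

definition SOT_closed_algebra_generated :: "real \<Rightarrow> (ae_fun \<Rightarrow> ae_fun) set \<Rightarrow> (ae_fun \<Rightarrow> ae_fun) set"
  where "SOT_closed_algebra_generated p G = (\<lambda>A. operator_algebra p A \<and> closedin (SOT p) A) hull G"


section \<open>The parabolic algebra\<close>

lift_definition modulation :: "real \<Rightarrow> ae_fun \<Rightarrow> ae_fun"
  is "\<lambda>l f x. exp (\<i> * complex_of_real (l * x)) * f x"
  by (auto simp: ae_rel_def)

lift_definition translation :: "real \<Rightarrow> ae_fun \<Rightarrow> ae_fun" is "\<lambda>m f x. f (x - m)"
proof -
  fix m :: real and f g :: "real \<Rightarrow> complex"
  assume "ae_rel f g"
  then have [measurable]: "f \<in> borel_measurable borel" "g \<in> borel_measurable borel"
    and ae: "AE x in lborel. f x = g x"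
    by (auto simp: ae_rel_def)
  have "AE x in lborel. f (- m + 1 * x) = g (- m + 1 * x)"
    by (rule AE_borel_affine[OF _ _ ae]) auto
  then show "ae_rel (\<lambda>x. f (x - m)) (\<lambda>x. g (x - m))"
    by (simp add: ae_rel_def)
qed

definition M_op :: "real \<Rightarrow> real \<Rightarrow> ae_fun \<Rightarrow> ae_fun" where
  "M_op p l = restrict (modulation l) (Lp p)"

definition D_op :: "real \<Rightarrow> real \<Rightarrow> ae_fun \<Rightarrow> ae_fun" where
  "D_op p m = restrict (translation m) (Lp p)"

definition parabolic_algebra :: "real \<Rightarrow> (ae_fun \<Rightarrow> ae_fun) set" where
  "parabolic_algebra p =
     SOT_closed_algebra_generated p ({M_op p l | l. l \<ge> 0} \<union> {D_op p m | m. m \<ge> 0})"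


section \<open>The Fourier binest algebra\<close>

lift_definition vanishes_outside :: "real set \<Rightarrow> ae_fun \<Rightarrow> bool"
  is "\<lambda>E f. AE x in lborel. x \<notin> E \<longrightarrow> f x = 0"
  by (auto simp: ae_rel_def elim: AE_mp)

definition Lp_half_line :: "real \<Rightarrow> real \<Rightarrow> ae_fun set" where
  "Lp_half_line p t = {f \<in> Lp p. vanishes_outside {t..} f}"

definition Hardy_upper :: "real \<Rightarrow> (complex \<Rightarrow> complex) set" where
  "Hardy_upper p = {F. F holomorphic_on {z. Im z > 0} \<and>
     (SUP y\<in>{0<..}. \<integral>\<^sup>+x. ennreal (cmod (F (Complex x y)) powr p) \<partial>lborel) < \<infinity>}"

lift_definition is_boundary_value :: "(complex \<Rightarrow> complex) \<Rightarrow> ae_fun \<Rightarrow> bool"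
  is "\<lambda>F f. AE x in lborel. ((\<lambda>y. F (Complex x y)) \<longlongrightarrow> f x) (at_right 0)"
  by (auto simp: ae_rel_def elim: AE_mp)

definition Hardy :: "real \<Rightarrow> ae_fun set" where
  "Hardy p = {f \<in> Lp p. \<exists>F\<in>Hardy_upper p. is_boundary_value F f}"

definition Fourier_binest :: "real \<Rightarrow> ae_fun set set" where
  "Fourier_binest p = {{0}} \<union> {Lp_half_line p t | t. True} \<union>
     {modulation l ` Hardy p | l. True} \<union> {Lp p}"

definition Fourier_binest_algebra :: "real \<Rightarrow> (ae_fun \<Rightarrow> ae_fun) set" where
  "Fourier_binest_algebra p = {T \<in> bounded_ops p. \<forall>K\<in>Fourier_binest p. T ` K \<subseteq> K}"

end

theory Submission
  imports Defs "HOL-Probability.Probability"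
begin

text \<open>
  A function \<open>f \<in> L\<^sup>p\<close> is the boundary value of a Hardy function iff it is annihilated by all products
  \<open>1 / ((x - w) (x - w'))\<close> with \<open>Im w, Im w' < 0\<close>: one direction is Cauchy's theorem, for the other the
  Poisson integral of \<open>f\<close> is then holomorphic and converges to \<open>f\<close> almost everywhere by the maximal
  theorem. Hence the binest consists of annihilators of bounded integrable functions, so its algebra is SOT-closed.

  Given \<open>T\<close> in the binest algebra, multiplying it on both sides with convolutions by bumps supported in
  \<open>[0, \<infinity>)\<close> and with powers of the bounded analytic functions \<open>\<rho>\<^sub>N(x) = 1 / (1 - i x / (N + 1))\<close> gives an
  operator with a continuous kernel, which vanishes for \<open>x < y\<close> since \<open>T\<close> preserves \<open>L\<^sup>p[y, \<infinity>)\<close>. Along the diagonal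
  \<open>x - y = t\<close> the kernel is a function \<open>G\<^sub>t(y)\<close>. Since \<open>T\<close> preserves \<open>exp (-i \<xi> x) H\<^sup>p\<close> for every
  \<open>\<xi>\<close>, the Fourier transform in \<open>t\<close> of \<open>\<integral> G\<^sub>t(s) / (s - w) ds\<close> vanishes when \<open>Im w < 0\<close>, so each
  \<open>G\<^sub>t\<close> is analytic: its Poisson integral at height \<open>e\<close> equals the Cauchy integral
  \<open>(1 / (2 \<pi> i)) \<integral> G\<^sub>t(s) / (s - y - i e) ds\<close>. For fixed \<open>s\<close> the kernel \<open>G\<^sub>x\<^sub>-\<^sub>y(s) / (s - y - i e)\<close> is a
  resolvent multiplication followed by a convolution with a function supported in \<open>[0, \<infinity>)\<close>, both in
  the parabolic algebra. Riemann sums in \<open>s\<close>, then \<open>e \<rightarrow> 0\<close>, then removal of the regularisation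
  stay inside the algebra, as it is SOT-closed.
\<close>

text \<open>A bounded operator on \<open>L\<^sup>p\<close> need not be an integral operator, and for
  \<open>p\<close> other than 2 there is no Hilbert-Schmidt class to approximate in. Smoothing on
  both sides creates a kernel, and all later kernels are dominated by a convolution kernel
  \<open>m (x - y)\<close>, so that pointwise convergence under a common \<open>m\<close> implies
  strong convergence.

  Analyticity of the diagonals matters because the Poisson integral recovers \<open>G N t\<close> as
  \<open>e \<rightarrow> 0\<close>, but at fixed \<open>s\<close> the Poisson kernel, as a function
  of \<open>y\<close>, has poles on both sides of the line, so multiplication by it does not respect
  the Hardy spaces. The Cauchy kernel \<open>1 / (s - y - i e)\<close> has its only pole at
  \<open>s - i e\<close>, below the line, and is a resolvent. Analyticity lets the second replace
  the first.

  The powers \<open>rho N x ^ 2\<close> and \<open>rho N y ^ 4\<close> arise as follows: two factors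
  on the left form a resolvent product that tests Hardy membership, one on the right completes
  \<open>1 / (y - w)\<close> to an element of \<open>H\<^sup>p\<close>, and three remain as an
  integrable multiplier. Jointly they make \<open>G N t s\<close> decay in both \<open>t\<close> and
  \<open>s\<close>.\<close>

section \<open>Convexity inequalities for powers\<close>

lemma powr_add_le:
  fixes a b p :: real
  assumes "p \<ge> 1" "a \<ge> 0" "b \<ge> 0"
  shows "(a + b) powr p \<le> 2 powr p * (a powr p + b powr p)"
proof -
  have "(a + b) powr p \<le> (2 * max a b) powr p"
    using assms by (intro powr_mono2) auto
  also have "\<dots> = 2 powr p * (max a b) powr p"
    by (rule powr_mult)
  also have "\<dots> \<le> 2 powr p * (a powr p + b powr p)"
    by (intro mult_left_mono) (auto simp: max_def)
  finally show ?thesis .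
qed

lemma le_one_add_powr:
  fixes w p :: real
  assumes "p \<ge> 1" "w \<ge> 0"
  shows "w \<le> 1 + w powr p"
proof (cases "w \<le> 1")
  case False
  then have "w powr 1 \<le> w powr p"
    using assms by (intro powr_mono) auto
  then show ?thesis using False by simp
qed (use assms in \<open>auto intro: order_trans\<close>)

text \<open>Convexity: the graph of \<open>w powr p\<close> lies above its tangent at
  \<open>a\<close>. Since the bound is linear in \<open>w\<close>, it can be integrated against a
  weight.\<close>

lemma powr_tangent:
  fixes a w p :: real
  assumes p: "p > 1" and "w \<ge> 0" "a \<ge> 0"
  shows "p * a powr (p - 1) * w \<le> w powr p + (p - 1) * a powr p"
proof -
  define q where "q = p / (p - 1)"
  have q: "q > 1" "1/p + 1/q = 1" "(p - 1) * q = p"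
    using p by (auto simp: q_def field_simps)
  have "w * a powr (p - 1) \<le> w powr p / p + (a powr (p - 1)) powr q / q"
    using assms q by (intro Youngs_inequality) auto
  then have "p * (w * a powr (p - 1)) \<le> p * (w powr p / p + (a powr (p - 1)) powr q / q)"
    using p by (intro mult_left_mono) auto
  also have "\<dots> = w powr p + (p / q) * a powr p"
    using p q(3) by (simp add: powr_powr distrib_left)
  also have "p / q = p - 1"
    using p by (simp add: q_def)
  finally show ?thesis by (simp add: algebra_simps)
qed

text \<open>Jensen's inequality for the finite measure with density \<open>m\<close>; the factor
  with exponent \<open>p - 1\<close> is the cost of not normalising \<open>m\<close>. It plays the
  part of Hoelder's inequality in all later estimates.\<close>

lemma integral_powr_le:
  fixes m w :: "'a \<Rightarrow> real"
  assumes p: "p > 1" and m: "integrable M m" "\<And>x. m x \<ge> 0"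
    and w: "w \<in> borel_measurable M" "\<And>x. w x \<ge> 0"
    and mw: "integrable M (\<lambda>x. m x * w x powr p)"
  shows "integrable M (\<lambda>x. m x * w x)"
    and "(\<integral>x. m x * w x \<partial>M) powr p \<le> (\<integral>x. m x \<partial>M) powr (p - 1) * (\<integral>x. m x * w x powr p \<partial>M)"
proof -
  have [measurable]: "m \<in> borel_measurable M" "w \<in> borel_measurable M"
    using m w by auto
  show int: "integrable M (\<lambda>x. m x * w x)"
  proof (rule Bochner_Integration.integrable_bound)
    show "integrable M (\<lambda>x. m x + m x * w x powr p)"
      using m mw by auto
    have "m x * w x \<le> m x + m x * w x powr p" for x
      using mult_left_mono[OF le_one_add_powr[of p "w x"] m(2)[of x]] p w by (simp add: algebra_simps)
    then show "AE x in M. norm (m x * w x) \<le> norm (m x + m x * w x powr p)"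
      using m w by (intro AE_I2) (auto intro: order_trans[OF _ abs_ge_self])
  qed auto
  define I where "I = (\<integral>x. m x \<partial>M)"
  show "(\<integral>x. m x * w x \<partial>M) powr p \<le> I powr (p - 1) * (\<integral>x. m x * w x powr p \<partial>M)"
  proof (cases "I = 0")
    case True
    then have "AE x in M. m x = 0"
      using m by (subst (asm) I_def, subst (asm) integral_nonneg_eq_0_iff_AE) auto
    then have "(\<integral>x. m x * w x \<partial>M) = (\<integral>x. 0 \<partial>M)"
      by (intro integral_cong_AE) auto
    then show ?thesis using True by simp
  next
    case False
    have I: "I > 0"
      using False m by (auto simp: I_def less_le)
    \<comment> \<open>The weighted mean of \<open>w\<close>. At this point the linear term of the
      tangent inequality integrates to a multiple of \<open>a powr p * I\<close>, and what remains
      is Jensen's inequality.\<close>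
    define a where "a = (\<integral>x. m x * w x \<partial>M) / I"
    have a: "a \<ge> 0" "(\<integral>x. m x * w x \<partial>M) = a * I"
      using m w I by (auto simp: a_def intro!: divide_nonneg_pos integral_nonneg)
    have "p * a powr (p - 1) * (\<integral>x. m x * w x \<partial>M) = (\<integral>x. p * a powr (p - 1) * (m x * w x) \<partial>M)"
      by (rule integral_mult_right_zero[symmetric])
    also have "\<dots> \<le> (\<integral>x. m x * w x powr p + (p - 1) * a powr p * m x \<partial>M)"
    proof (intro integral_mono)
      fix x
      show "p * a powr (p - 1) * (m x * w x) \<le> m x * w x powr p + (p - 1) * a powr p * m x"
        using mult_left_mono[OF powr_tangent[OF p w(2)[of x] a(1)] m(2)[of x]] by (simp add: algebra_simps)
    qed (use int mw m in auto)
    also have "\<dots> = (\<integral>x. m x * w x powr p \<partial>M) + (p - 1) * a powr p * I"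
      using int mw m by (simp add: I_def)
    finally have "p * (a powr (p - 1) * a) * I \<le> (\<integral>x. m x * w x powr p \<partial>M) + (p - 1) * a powr p * I"
      unfolding a(2) by (simp add: algebra_simps)
    moreover have "a powr (p - 1) * a = a powr p"
      using a(1) p powr_mult_base[of a "p - 1"] by (simp add: mult.commute)
    ultimately have "p * a powr p * I \<le> (\<integral>x. m x * w x powr p \<partial>M) + (p - 1) * a powr p * I"
      by simp
    then have le: "a powr p * I \<le> (\<integral>x. m x * w x powr p \<partial>M)"
      by (simp add: algebra_simps)
    have "(a * I) powr p = I powr (p - 1) * (a powr p * I)"
      using I p powr_mult_base[of I "p - 1"] by (simp add: powr_mult algebra_simps)
    also have "\<dots> \<le> I powr (p - 1) * (\<integral>x. m x * w x powr p \<partial>M)"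
      by (intro mult_left_mono le) auto
    finally show ?thesis by (simp add: a(2))
  qed
qed

section \<open>The \<open>p\<close>-integrable functions before passing to classes\<close>

definition LpF :: "real \<Rightarrow> (real \<Rightarrow> complex) \<Rightarrow> bool" where
  "LpF p f \<longleftrightarrow> f \<in> borel_measurable borel \<and> integrable lborel (\<lambda>x. cmod (f x) powr p)"

text \<open>The \<open>p\<close>-th power of the norm. Working with it avoids roots; the price is
  the factor \<open>2 powr p\<close> in place of the triangle inequality, which is harmless for
  convergence to 0.\<close>

definition Np :: "real \<Rightarrow> (real \<Rightarrow> complex) \<Rightarrow> real" where
  "Np p f = (LINT x|lborel. cmod (f x) powr p)"

lemma LpF_measurable [measurable_dest]: "LpF p f \<Longrightarrow> f \<in> borel_measurable borel"
  by (simp add: LpF_def)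

lemma Np_nonneg [simp]: "Np p f \<ge> 0"
  by (simp add: Np_def)

lemma Np_cong: "(\<And>x. cmod (f x) = cmod (g x)) \<Longrightarrow> Np p f = Np p g"
  by (simp add: Np_def)

lemma LpF_bound:
  assumes "p \<ge> 1" and f: "LpF p f" and g: "g \<in> borel_measurable borel"
    and le: "\<And>x. cmod (g x) \<le> C * cmod (f x)" and C: "C \<ge> 0"
  shows "LpF p g" "Np p g \<le> C powr p * Np p f"
proof -
  have [measurable]: "f \<in> borel_measurable borel" "g \<in> borel_measurable borel"
    using f g by (auto simp: LpF_def)
  have 1: "cmod (g x) powr p \<le> C powr p * cmod (f x) powr p" for x
    using powr_mono2[OF _ _ le, of p x] assms by (simp add: powr_mult)
  have 2: "integrable lborel (\<lambda>x. C powr p * cmod (f x) powr p)"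
    using f by (simp add: LpF_def)
  have 3: "integrable lborel (\<lambda>x. cmod (g x) powr p)"
    by (rule Bochner_Integration.integrable_bound[OF 2]) (use 1 in auto)
  then show "LpF p g" by (simp add: LpF_def)
  show "Np p g \<le> C powr p * Np p f"
    using integral_mono[OF 3 2 1] by (simp add: Np_def)
qed

lemma LpF_0 [simp]: "LpF p (\<lambda>_. 0)"
  by (simp add: LpF_def)

lemma Np_0 [simp]: "Np p (\<lambda>_. 0) = 0"
  by (simp add: Np_def)

lemma LpF_add:
  assumes "p \<ge> 1" and f: "LpF p f" and g: "LpF p g"
  shows "LpF p (\<lambda>x. f x + g x)" "Np p (\<lambda>x. f x + g x) \<le> 2 powr p * (Np p f + Np p g)"
proof -
  have [measurable]: "f \<in> borel_measurable borel" "g \<in> borel_measurable borel"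
    using f g by (auto simp: LpF_def)
  have 1: "cmod (f x + g x) powr p \<le> 2 powr p * (cmod (f x) powr p + cmod (g x) powr p)" for x
    using order_trans[OF powr_mono2[OF _ norm_ge_zero norm_triangle_ineq[of "f x" "g x"]] powr_add_le[of p]] assms by simp
  have 2: "integrable lborel (\<lambda>x. 2 powr p * (cmod (f x) powr p + cmod (g x) powr p))"
    using f g by (simp add: LpF_def)
  have 3: "integrable lborel (\<lambda>x. cmod (f x + g x) powr p)"
    by (rule Bochner_Integration.integrable_bound[OF 2]) (use 1 in auto)
  then show "LpF p (\<lambda>x. f x + g x)" by (simp add: LpF_def)
  show "Np p (\<lambda>x. f x + g x) \<le> 2 powr p * (Np p f + Np p g)"
    using integral_mono[OF 3 2 1] f g by (simp add: Np_def LpF_def)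
qed

lemma LpF_cmult:
  assumes "LpF p f"
  shows "LpF p (\<lambda>x. c * f x)" "Np p (\<lambda>x. c * f x) = cmod c powr p * Np p f"
  using assms by (auto simp: LpF_def Np_def norm_mult powr_mult)

lemma LpF_mult_bounded:
  assumes "p \<ge> 1" "LpF p f" "h \<in> borel_measurable borel" "\<And>x. cmod (h x) \<le> C"
  shows "LpF p (\<lambda>x. h x * f x)" "Np p (\<lambda>x. h x * f x) \<le> C powr p * Np p f"
proof -
  have [measurable]: "f \<in> borel_measurable borel" "h \<in> borel_measurable borel"
    using assms by (auto simp: LpF_def)
  have "0 \<le> C" using assms(4)[of 0] norm_ge_zero[of "h 0"] by linarith
  moreover have "cmod (h x * f x) \<le> C * cmod (f x)" for x
    unfolding norm_mult by (intro mult_right_mono assms) auto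
  moreover have "(\<lambda>x. h x * f x) \<in> borel_measurable borel" by measurable
  ultimately show "LpF p (\<lambda>x. h x * f x)" "Np p (\<lambda>x. h x * f x) \<le> C powr p * Np p f"
    using LpF_bound[of p f "\<lambda>x. h x * f x" C] assms by blast+
qed

lemma LpF_diff:
  assumes "p \<ge> 1" and f: "LpF p f" and g: "LpF p g"
  shows "LpF p (\<lambda>x. f x - g x)" "Np p (\<lambda>x. f x - g x) \<le> 2 powr p * (Np p f + Np p g)"
  using LpF_add[OF assms(1) f LpF_cmult(1)[OF g, of "-1"]] LpF_cmult(2)[OF g, of "-1"] by simp_all

lemma LpF_shift:
  assumes "LpF p f"
  shows "LpF p (\<lambda>x. f (x - a))" "Np p (\<lambda>x. f (x - a)) = Np p f"
proof -
  have [measurable]: "f \<in> borel_measurable borel"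
    using assms by (auto simp: LpF_def)
  have "integrable lborel (\<lambda>x. cmod (f (- a + 1 * x)) powr p)"
    using assms by (intro lborel_integrable_real_affine) (auto simp: LpF_def)
  then show "LpF p (\<lambda>x. f (x - a))" by (simp add: LpF_def)
  show "Np p (\<lambda>x. f (x - a)) = Np p f"
    using lborel_integral_real_affine[of 1 "\<lambda>x. cmod (f x) powr p" "-a"] by (simp add: Np_def)
qed

text \<open>The difference is at most \<open>2 * w x\<close>, so dominated convergence for integrals
  applies to its \<open>p\<close>-th power. Most strong limits below are reduced to this.\<close>

lemma LpF_dominated:
  assumes p: "p \<ge> 1" and m: "\<And>n. f n \<in> borel_measurable borel" "g \<in> borel_measurable borel"
    and w: "integrable lborel (\<lambda>x. w x powr p)" "w \<in> borel_measurable borel"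
    and b: "\<And>n. AE x in lborel. cmod (f n x) \<le> w x"
    and l: "AE x in lborel. (\<lambda>n. f n x) \<longlonglongrightarrow> g x"
  shows "\<And>n. LpF p (f n)" "LpF p g" "(\<lambda>n. Np p (\<lambda>x. f n x - g x)) \<longlonglongrightarrow> 0"
proof -
  note [measurable] = m w(2)
  have gb: "AE x in lborel. cmod (g x) \<le> w x"
  proof -
    have "AE x in lborel. \<forall>n. cmod (f n x) \<le> w x" using b by (simp add: AE_all_countable)
    with l show ?thesis
      by eventually_elim (rule LIMSEQ_le_const2[OF tendsto_norm], auto)
  qed
  have bnd: "LpF p h" if [measurable]: "h \<in> borel_measurable borel" and "AE x in lborel. cmod (h x) \<le> w x" for h
    unfolding LpF_def
  proof (intro conjI that Bochner_Integration.integrable_bound[OF w(1)])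
    show "AE x in lborel. norm (cmod (h x) powr p) \<le> norm (w x powr p)"
      using that(2) by eventually_elim (use p in \<open>auto intro!: powr_mono2\<close>)
  qed measurable
  show f: "LpF p (f n)" for n by (rule bnd[OF m(1) b])
  show g: "LpF p g" by (rule bnd[OF m(2) gb])
  have "(\<lambda>n. (LINT x|lborel. cmod (f n x - g x) powr p)) \<longlonglongrightarrow> (LINT x::real|lborel. 0)"
  proof (rule integral_dominated_convergence[where w="\<lambda>x. 2 powr p * w x powr p"])
    show "integrable lborel (\<lambda>x. 2 powr p * w x powr p)" using w by simp
    show "AE x in lborel. (\<lambda>n. cmod (f n x - g x) powr p) \<longlonglongrightarrow> 0"
      using l
    proof eventually_elim
      case (elim x)
      then have "(\<lambda>n. cmod (f n x - g x)) \<longlonglongrightarrow> 0"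
        by (simp add: LIM_zero tendsto_norm_zero)
      then show ?case
        using tendsto_powr2[of "\<lambda>n. cmod (f n x - g x)" 0 sequentially "\<lambda>_. p" p] p by simp
    qed
    show "AE x in lborel. norm (cmod (f n x - g x) powr p) \<le> 2 powr p * w x powr p" for n
      using gb b[of n]
    proof eventually_elim
      case (elim x)
      have "cmod (f n x - g x) powr p \<le> (2 * w x) powr p"
        using elim norm_triangle_ineq4[of "f n x" "g x"] p by (intro powr_mono2) auto
      then show ?case by (simp add: powr_mult)
    qed
  qed measurable
  then show "(\<lambda>n. Np p (\<lambda>x. f n x - g x)) \<longlonglongrightarrow> 0" by (simp add: Np_def)
qed

lemma Np_tendsto_add:
  assumes p: "p \<ge> 1" and f: "\<And>n. LpF p (f n)" "\<And>n. LpF p (g n)"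
    and lim: "(\<lambda>n. Np p (f n)) \<longlonglongrightarrow> 0" "(\<lambda>n. Np p (g n)) \<longlonglongrightarrow> 0"
  shows "(\<lambda>n. Np p (\<lambda>x. f n x + g n x)) \<longlonglongrightarrow> 0"
proof -
  have 1: "(\<lambda>n. 2 powr p * (Np p (f n) + Np p (g n))) \<longlonglongrightarrow> 0"
    using tendsto_mult_left[OF tendsto_add[OF lim], of "2 powr p"] by simp
  show ?thesis
    by (rule tendsto_sandwich[OF _ _ tendsto_const 1]) (use LpF_add(2)[OF p f] in auto)
qed

text \<open>Truncate \<open>f\<close> in space and in modulus. The truncation is an almost
  everywhere limit of continuous functions by \<open>measurable_on\<close>; cutting these off and
  clipping them keeps the limit and supplies a dominating function.\<close>

lemma LpF_approx_continuous:
  assumes p: "p \<ge> 1" and f: "LpF p f"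
  obtains g where "\<And>n. continuous_on UNIV (g n)" "\<And>n. \<exists>R. \<forall>x. \<bar>x\<bar> > R \<longrightarrow> g n x = 0"
    "\<And>n. LpF p (g n)" "(\<lambda>n. Np p (\<lambda>x. g n x - f x)) \<longlonglongrightarrow> 0"
proof -
  have [measurable]: "f \<in> borel_measurable borel" using f by (simp add: LpF_def)
  have 1: "\<exists>g. continuous_on UNIV g \<and> (\<exists>R. \<forall>x. \<bar>x\<bar> > R \<longrightarrow> g x = 0) \<and> LpF p g \<and> Np p (\<lambda>x. g x - f x) < e"
    if "e > 0" for e
  proof -
    define fN where "fN N x = (if cmod (f x) \<le> real N \<and> \<bar>x\<bar> \<le> real N then f x else 0)" for N x
    have [measurable]: "fN N \<in> borel_measurable borel" for N unfolding fN_def by measurable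
    have N: "(\<lambda>N. Np p (\<lambda>x. fN N x - f x)) \<longlonglongrightarrow> 0" "\<And>N. LpF p (fN N)"
    proof -
      have "(\<lambda>n. fN n x) \<longlonglongrightarrow> f x" for x
      proof (rule tendsto_eventually)
        show "\<forall>\<^sub>F n in sequentially. fN n x = f x"
          using eventually_ge_at_top[of "nat \<lceil>max (cmod (f x)) \<bar>x\<bar>\<rceil>"]
          by eventually_elim (auto simp: fN_def)
      qed
      then have l: "AE x in lborel. (\<lambda>n. fN n x) \<longlonglongrightarrow> f x" by simp
      have b: "AE x in lborel. cmod (fN n x) \<le> cmod (f x)" for n by (simp add: fN_def)
      have w: "integrable lborel (\<lambda>x. cmod (f x) powr p)" using f by (simp add: LpF_def)
      show "(\<lambda>N. Np p (\<lambda>x. fN N x - f x)) \<longlonglongrightarrow> 0" "\<And>N. LpF p (fN N)"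
        by (rule LpF_dominated[OF p _ _ w _ b l]; measurable)+
    qed
    have e: "0 < e / (2 * 2 powr p)" using that by simp
    obtain N where N1: "Np p (\<lambda>x. fN N x - f x) < e / (2 * 2 powr p)"
      using LIMSEQ_D[OF N(1) e] by force
    have "fN N measurable_on UNIV"
      by (intro lebesgue_measurable_imp_measurable_on measurable_completion) simp_all
    then obtain S h where S: "negligible S" "\<And>n. continuous_on UNIV (h n)"
      "\<And>x. x \<notin> S \<Longrightarrow> (\<lambda>n. h n x) \<longlonglongrightarrow> fN N x"
      unfolding measurable_on_def by auto
    \<comment> \<open>The first factor is a continuous cut-off, equal to 1 where \<open>fN N\<close>
      can be nonzero. The second pulls the values radially into the disc of radius
      \<open>N + 1\<close> and does not move values of modulus at most \<open>N\<close>. The radius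
      \<open>N + 1\<close> instead of \<open>N\<close> keeps the denominator positive for
      \<open>N = 0\<close>.\<close>
    define g where "g n x = (of_real (max 0 (min 1 (real N + 1 - \<bar>x\<bar>)) * ((real N + 1) / max (real N + 1) (cmod (h n x)))) * h n x :: complex)" for n x
    have gc: "continuous_on UNIV (g n)" for n
      unfolding g_def by (intro continuous_intros S) (auto simp: max_def)
    have g0: "g n x = 0" if "\<bar>x\<bar> > real N + 1" for n x
      using that by (auto simp: g_def)
    have [measurable]: "g n \<in> borel_measurable borel" for n
      using gc by (intro borel_measurable_continuous_onI)
    have gb: "cmod (g n x) \<le> (real N + 1) * indicator {-(real N + 1)..real N + 1} x" for n x
    proof (cases "\<bar>x\<bar> > real N + 1")
      case False
      have "cmod (g n x) = max 0 (min 1 (real N + 1 - \<bar>x\<bar>)) * ((real N + 1) / max (real N + 1) (cmod (h n x)) * cmod (h n x))"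
        unfolding g_def norm_mult norm_of_real by (auto simp: abs_mult max_def)
      also have "\<dots> \<le> 1 * (real N + 1)"
      proof (intro mult_mono)
        have "(real N + 1) * cmod (h n x) \<le> (real N + 1) * max (real N + 1) (cmod (h n x))"
          by (intro mult_left_mono) auto
        then show "(real N + 1) / max (real N + 1) (cmod (h n x)) * cmod (h n x) \<le> real N + 1"
          by (simp add: pos_divide_le_eq max.strict_coboundedI1)
      qed auto
      finally show ?thesis using False by (auto simp: indicator_def)
    qed (use g0 in auto)
    have lim: "AE x in lborel. (\<lambda>n. g n x) \<longlonglongrightarrow> fN N x"
    proof -
      have "AE x in lebesgue. x \<notin> S" using S(1) negligible_iff_null_sets AE_not_in by blast
      then have "AE x in lborel. x \<notin> S"
        by (simp add: AE_completion_iff)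
      then show ?thesis
      proof eventually_elim
        case (elim x)
        have "(\<lambda>n. g n x) \<longlonglongrightarrow> of_real (max 0 (min 1 (real N + 1 - \<bar>x\<bar>)) * ((real N + 1) / max (real N + 1) (cmod (fN N x)))) * fN N x"
          unfolding g_def by (intro tendsto_intros S(3) elim) (auto simp: max_def)
        moreover have "of_real (max 0 (min 1 (real N + 1 - \<bar>x\<bar>)) * ((real N + 1) / max (real N + 1) (cmod (fN N x)))) * fN N x = fN N x"
          using of_nat_neq_0[of N, where 'a=complex] by (auto simp: fN_def max_def add.commute)
        ultimately show ?case by (simp only:)
      qed
    qed
    have w: "integrable lborel (\<lambda>x. ((real N + 1) * indicator {-(real N + 1)..real N + 1} x) powr p :: real)"
    proof -
      have "(\<lambda>x. ((real N + 1) * indicator {-(real N + 1)..real N + 1} x) powr p :: real) = (\<lambda>x. (real N + 1) powr p * indicator {-(real N + 1)..real N + 1} x)"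
        by (auto simp: indicator_def)
      then show ?thesis by simp
    qed
    have g: "LpF p (g n)" "(\<lambda>n. Np p (\<lambda>x. g n x - fN N x)) \<longlonglongrightarrow> 0" for n
      by (rule LpF_dominated[OF p _ _ w _ AE_I2[OF gb] lim]; measurable)+
    obtain n where n: "Np p (\<lambda>x. g n x - fN N x) < e / (2 * 2 powr p)"
      using LIMSEQ_D[OF g(2) e] by force
    have "Np p (\<lambda>x. (g n x - fN N x) + (fN N x - f x)) \<le> 2 powr p * (Np p (\<lambda>x. g n x - fN N x) + Np p (\<lambda>x. fN N x - f x))"
      using p g N f by (intro LpF_add LpF_diff) auto
    also have "\<dots> < 2 powr p * (e / (2 * 2 powr p) + e / (2 * 2 powr p))"
      using n N1 by (intro mult_strict_left_mono add_strict_mono) auto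
    also have "\<dots> = e" by (simp add: field_simps)
    finally have "Np p (\<lambda>x. g n x - f x) < e" by simp
    then show ?thesis using gc g0 g by blast
  qed
  have "\<forall>n. \<exists>g. continuous_on UNIV g \<and> (\<exists>R. \<forall>x. \<bar>x\<bar> > R \<longrightarrow> g x = 0) \<and> LpF p g \<and> Np p (\<lambda>x. g x - f x) < inverse (real (Suc n))"
    by (intro allI 1) simp
  from choice[OF this] obtain g where g: "continuous_on UNIV (g n) \<and> (\<exists>R. \<forall>x. \<bar>x\<bar> > R \<longrightarrow> g n x = 0) \<and> LpF p (g n) \<and> Np p (\<lambda>x. g n x - f x) < inverse (real (Suc n))" for n
    by blast
  show ?thesis
  proof (rule that[of g])
    show "(\<lambda>n. Np p (\<lambda>x. g n x - f x)) \<longlonglongrightarrow> 0"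
      by (rule tendsto_sandwich[OF _ _ tendsto_const LIMSEQ_inverse_real_of_nat]) (use g in \<open>auto intro!: always_eventually less_imp_le simp del: of_nat_Suc\<close>)
  qed (use g in auto)
qed

section \<open>Operators on representatives\<close>

abbreviation mk :: "(real \<Rightarrow> complex) \<Rightarrow> ae_fun" where "mk \<equiv> abs_ae_fun"
abbreviation fn :: "ae_fun \<Rightarrow> real \<Rightarrow> complex" where "fn \<equiv> rep_ae_fun"

lemma ae_rel_refl_iff: "ae_rel f f \<longleftrightarrow> f \<in> borel_measurable borel"
  by (auto simp: ae_rel_def)

lemma fn_measurable [measurable]: "fn F \<in> borel_measurable borel"
  using Quotient3_rep_reflp[OF Quotient3_ae_fun, of F] by (simp add: ae_rel_refl_iff)

lemma mk_fn [simp]: "mk (fn F) = F"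
  by (rule Quotient3_abs_rep[OF Quotient3_ae_fun])

lemma mk_eqI:
  assumes "f \<in> borel_measurable borel" "g \<in> borel_measurable borel" "AE x in lborel. f x = g x"
  shows "mk f = mk g"
  using Quotient3_rel_abs[OF Quotient3_ae_fun, of f g] assms by (simp add: ae_rel_def)

lemma fn_mk:
  assumes "f \<in> borel_measurable borel"
  shows "AE x in lborel. fn (mk f) x = f x"
  using Quotient3_rep_abs[OF Quotient3_ae_fun, of f] assms by (simp add: ae_rel_def)

lemma mk_plus:
  assumes "f \<in> borel_measurable borel" "g \<in> borel_measurable borel"
  shows "mk f + mk g = mk (\<lambda>x. f x + g x)"
  using assms by (simp add: plus_ae_fun.abs_eq ae_rel_refl_iff)

lemma mk_minus:
  assumes "f \<in> borel_measurable borel" "g \<in> borel_measurable borel"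
  shows "mk f - mk g = mk (\<lambda>x. f x - g x)"
  using assms by (simp add: minus_ae_fun.abs_eq ae_rel_refl_iff)

lemma mk_scale: "f \<in> borel_measurable borel \<Longrightarrow> c *\<^sub>a mk f = mk (\<lambda>x. c * f x)"
  by (simp add: scale_ae.abs_eq ae_rel_refl_iff)

lemma mk_0: "mk (\<lambda>_. 0) = 0"
  by (simp add: zero_ae_fun_def)

lemma mk_in_Lp: "f \<in> borel_measurable borel \<Longrightarrow> mk f \<in> Lp p \<longleftrightarrow> LpF p f"
  by (simp add: Lp_def LpF_def p_integrable.abs_eq ae_rel_refl_iff)

lemma mk_Lp: "LpF p f \<Longrightarrow> mk f \<in> Lp p"
  using mk_in_Lp LpF_measurable by blast

lemma Lp_norm_mk: "f \<in> borel_measurable borel \<Longrightarrow> Lp_norm p (mk f) = Np p f powr (1 / p)"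
  by (simp add: Lp_norm.abs_eq ae_rel_refl_iff Np_def)

lemma LpF_fn: "F \<in> Lp p \<Longrightarrow> LpF p (fn F)"
  using mk_in_Lp[of "fn F" p] by simp

lemma LpE:
  assumes "F \<in> Lp p"
  obtains f where "LpF p f" "F = mk f"
  using LpF_fn[OF assms] by (metis mk_fn)

lemma modulation_mk:
  "f \<in> borel_measurable borel \<Longrightarrow> modulation l (mk f) = mk (\<lambda>x. exp (\<i> * complex_of_real (l * x)) * f x)"
  by (simp add: modulation.abs_eq ae_rel_refl_iff)

lemma translation_mk:
  "f \<in> borel_measurable borel \<Longrightarrow> translation m (mk f) = mk (\<lambda>x. f (x - m))"
  by (simp add: translation.abs_eq ae_rel_refl_iff)

lemma Np_AE_cong:
  assumes "f \<in> borel_measurable borel" "g \<in> borel_measurable borel" "AE x in lborel. f x = g x"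
  shows "Np p f = Np p g"
  unfolding Np_def using assms by (intro integral_cong_AE) auto

lemma LpF_fn_mk: "LpF p f \<Longrightarrow> LpF p (fn (mk f))"
  using LpF_fn mk_Lp by blast

lemma Np_eq_0:
  assumes "LpF p f" "Np p f = 0"
  shows "AE x in lborel. f x = 0"
  using assms unfolding LpF_def Np_def by (subst (asm) integral_nonneg_eq_0_iff_AE) auto

text \<open>A map on representatives that induces a bounded operator. Linearity holds only almost
  everywhere, and \<open>C\<close> bounds \<open>p\<close>-th powers, so the operator norm is at
  most \<open>C powr (1 / p)\<close>. Compatibility with almost everywhere equality follows from
  linearity and the bound, see \<open>bop_cong\<close>.\<close>

definition bop :: "real \<Rightarrow> real \<Rightarrow> ((real \<Rightarrow> complex) \<Rightarrow> real \<Rightarrow> complex) \<Rightarrow> bool" where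
  "bop p C \<Phi> \<longleftrightarrow> C \<ge> 0 \<and> (\<forall>f. LpF p f \<longrightarrow> LpF p (\<Phi> f) \<and> Np p (\<Phi> f) \<le> C * Np p f) \<and>
     (\<forall>f g. LpF p f \<longrightarrow> LpF p g \<longrightarrow> (AE x in lborel. \<Phi> (\<lambda>x. f x + g x) x = \<Phi> f x + \<Phi> g x)) \<and>
     (\<forall>c f. LpF p f \<longrightarrow> (AE x in lborel. \<Phi> (\<lambda>x. c * f x) x = c * \<Phi> f x))"

lemma bopD:
  assumes "bop p C \<Phi>"
  shows "C \<ge> 0" "LpF p f \<Longrightarrow> LpF p (\<Phi> f)" "LpF p f \<Longrightarrow> Np p (\<Phi> f) \<le> C * Np p f"
    "LpF p f \<Longrightarrow> LpF p g \<Longrightarrow> AE x in lborel. \<Phi> (\<lambda>x. f x + g x) x = \<Phi> f x + \<Phi> g x"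
    "LpF p f \<Longrightarrow> AE x in lborel. \<Phi> (\<lambda>x. c * f x) x = c * \<Phi> f x"
  using assms unfolding bop_def by auto

lemma bopI:
  assumes "C \<ge> 0" "\<And>f. LpF p f \<Longrightarrow> LpF p (\<Phi> f)" "\<And>f. LpF p f \<Longrightarrow> Np p (\<Phi> f) \<le> C * Np p f"
    "\<And>f g. LpF p f \<Longrightarrow> LpF p g \<Longrightarrow> AE x in lborel. \<Phi> (\<lambda>x. f x + g x) x = \<Phi> f x + \<Phi> g x"
    "\<And>c f. LpF p f \<Longrightarrow> AE x in lborel. \<Phi> (\<lambda>x. c * f x) x = c * \<Phi> f x"
  shows "bop p C \<Phi>"
  using assms unfolding bop_def by auto

lemma bop_diff:
  assumes "p \<ge> 1" "bop p C \<Phi>" "LpF p f" "LpF p g"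
  shows "AE x in lborel. \<Phi> (\<lambda>x. f x - g x) x = \<Phi> f x - \<Phi> g x"
  using bopD(4)[OF assms(2,3) LpF_cmult(1)[OF assms(4), of "-1"]] bopD(5)[OF assms(2,4), of "-1"]
  by eventually_elim auto

lemma bop_diff_Np:
  assumes "p \<ge> 1" "bop p C \<Phi>" "LpF p f" "LpF p g"
  shows "Np p (\<lambda>x. \<Phi> f x - \<Phi> g x) \<le> C * Np p (\<lambda>x. f x - g x)"
proof -
  have "Np p (\<lambda>x. \<Phi> f x - \<Phi> g x) = Np p (\<Phi> (\<lambda>x. f x - g x))"
    using bop_diff[OF assms] LpF_measurable[OF bopD(2)[OF assms(2)]] assms LpF_diff(1)[OF assms(1,3,4)]
    by (intro Np_AE_cong) (auto elim: AE_mp)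
  then show ?thesis using bopD(3)[OF assms(2) LpF_diff(1)[OF assms(1,3,4)]] by simp
qed

lemma bop_cong:
  assumes "p \<ge> 1" "bop p C \<Phi>" "LpF p f" "LpF p g" "AE x in lborel. f x = g x"
  shows "AE x in lborel. \<Phi> f x = \<Phi> g x"
proof -
  have "Np p (\<lambda>x. f x - g x) = Np p (\<lambda>_. 0)"
    using assms by (intro Np_AE_cong) (auto simp: LpF_def elim: AE_mp)
  then have "Np p (\<lambda>x. \<Phi> f x - \<Phi> g x) = 0"
    using bop_diff_Np[OF assms(1-4)] Np_nonneg[of p "\<lambda>x. \<Phi> f x - \<Phi> g x"] by simp
  then have "AE x in lborel. \<Phi> f x - \<Phi> g x = 0"
    using assms bopD(2) by (intro Np_eq_0 LpF_diff) auto
  then show ?thesis by simp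
qed

definition op :: "real \<Rightarrow> ((real \<Rightarrow> complex) \<Rightarrow> real \<Rightarrow> complex) \<Rightarrow> ae_fun \<Rightarrow> ae_fun" where
  "op p \<Phi> = (\<lambda>F\<in>Lp p. mk (\<Phi> (fn F)))"

lemma op_mk:
  assumes "p \<ge> 1" "bop p C \<Phi>" "LpF p f"
  shows "op p \<Phi> (mk f) = mk (\<Phi> f)"
proof -
  have "op p \<Phi> (mk f) = mk (\<Phi> (fn (mk f)))"
    using assms by (simp add: op_def mk_Lp)
  also have "\<dots> = mk (\<Phi> f)"
  proof (rule mk_eqI)
    show "AE x in lborel. \<Phi> (fn (mk f)) x = \<Phi> f x"
      using assms by (intro bop_cong[OF assms(1,2)] LpF_fn_mk fn_mk) (auto simp: LpF_def)
  qed (use assms bopD(2)[OF assms(2)] LpF_fn_mk LpF_measurable in blast)+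
  finally show ?thesis .
qed

lemma Np_le_iff_norm:
  assumes "p > 0" "C \<ge> 0" "f \<in> borel_measurable borel" "g \<in> borel_measurable borel"
  shows "Lp_norm p (mk f) \<le> C * Lp_norm p (mk g) \<longleftrightarrow> Np p f \<le> C powr p * Np p g"
proof -
  have "Lp_norm p (mk f) \<le> C * Lp_norm p (mk g) \<longleftrightarrow> Np p f powr (1/p) \<le> (C powr p * Np p g) powr (1/p)"
    using assms by (simp add: Lp_norm_mk powr_mult powr_powr)
  also have "\<dots> \<longleftrightarrow> Np p f \<le> C powr p * Np p g"
    using assms powr_mono2[of "1/p"] powr_less_mono2[of "1/p" "C powr p * Np p g" "Np p f"]
    by (smt (verit) Np_nonneg divide_pos_pos mult_nonneg_nonneg powr_ge_zero)
  finally show ?thesis .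
qed

lemma op_bounded:
  assumes p: "p \<ge> 1" and b: "bop p C \<Phi>"
  shows "op p \<Phi> \<in> bounded_ops p"
  unfolding bounded_ops_def mem_Collect_eq
proof (intro conjI ballI allI)
  show "op p \<Phi> \<in> Lp p \<rightarrow>\<^sub>E Lp p"
    unfolding op_def using bopD(2)[OF b] by (auto intro!: mk_Lp LpF_fn)
next
  fix F G assume "F \<in> Lp p" "G \<in> Lp p"
  then obtain f g where fg: "LpF p f" "F = mk f" "LpF p g" "G = mk g" by (metis LpE)
  note m = LpF_measurable[OF fg(1)] LpF_measurable[OF fg(3)] LpF_measurable[OF bopD(2)[OF b fg(1)]]
    LpF_measurable[OF bopD(2)[OF b fg(3)]] LpF_measurable[OF bopD(2)[OF b LpF_add(1)[OF p fg(1,3)]]]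
  show "op p \<Phi> (F + G) = op p \<Phi> F + op p \<Phi> G"
    unfolding fg mk_plus[OF m(1,2)] op_mk[OF p b fg(1)] op_mk[OF p b fg(3)] op_mk[OF p b LpF_add(1)[OF p fg(1,3)]] mk_plus[OF m(3,4)]
    by (rule mk_eqI[OF m(5) _ bopD(4)[OF b fg(1,3)]]) (use m in measurable)
next
  fix c F assume "F \<in> Lp p"
  then obtain f where f: "LpF p f" "F = mk f" by (metis LpE)
  note m = LpF_measurable[OF f(1)] LpF_measurable[OF bopD(2)[OF b f(1)]]
    LpF_measurable[OF bopD(2)[OF b LpF_cmult(1)[OF f(1)]]]
  show "op p \<Phi> (c *\<^sub>a F) = c *\<^sub>a op p \<Phi> F"
    unfolding f mk_scale[OF m(1)] op_mk[OF p b f(1)] op_mk[OF p b LpF_cmult(1)[OF f(1)]] mk_scale[OF m(2)]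
    by (rule mk_eqI[OF m(3) _ bopD(5)[OF b f(1)]]) (use m in measurable)
next
  show "\<exists>D. \<forall>F\<in>Lp p. Lp_norm p (op p \<Phi> F) \<le> D * Lp_norm p F"
  proof (intro exI ballI)
    fix F assume "F \<in> Lp p"
    then obtain f where f: "LpF p f" "F = mk f" by (metis LpE)
    note m = LpF_measurable[OF f(1)] LpF_measurable[OF bopD(2)[OF b f(1)]]
    have "Np p (\<Phi> f) \<le> (C powr (1/p)) powr p * Np p f"
      using bopD(3)[OF b f(1)] bopD(1)[OF b] p by (simp add: powr_powr)
    then show "Lp_norm p (op p \<Phi> F) \<le> C powr (1/p) * Lp_norm p F"
      unfolding f op_mk[OF p b f(1)] using Np_le_iff_norm[OF _ _ m(2,1), of p "C powr (1/p)"] p by simp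
  qed
qed

lemma op_eqI:
  assumes "p \<ge> 1" "bop p C \<Phi>" "bop p D \<Psi>" "\<And>f. LpF p f \<Longrightarrow> AE x in lborel. \<Phi> f x = \<Psi> f x"
  shows "op p \<Phi> = op p \<Psi>"
  unfolding op_def
proof (rule restrict_ext)
  fix F assume "F \<in> Lp p"
  then have "LpF p (fn F)" by (rule LpF_fn)
  then show "mk (\<Phi> (fn F)) = mk (\<Psi> (fn F))"
    using assms bopD(2) LpF_measurable by (intro mk_eqI) blast+
qed

lemma bop_compose:
  assumes p: "p \<ge> 1" and b: "bop p C \<Phi>" "bop p D \<Psi>"
  shows "bop p (C * D) (\<lambda>f. \<Phi> (\<Psi> f))" "op p (\<lambda>f. \<Phi> (\<Psi> f)) = compose (Lp p) (op p \<Phi>) (op p \<Psi>)"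
proof -
  note 1 = bopD[OF b(1)] and 2 = bopD[OF b(2)]
  show "bop p (C * D) (\<lambda>f. \<Phi> (\<Psi> f))"
  proof (rule bopI)
    fix f g assume f: "LpF p f"
    show "Np p (\<Phi> (\<Psi> f)) \<le> C * D * Np p f"
      using order_trans[OF 1(3)[OF 2(2)[OF f]] mult_left_mono[OF 2(3)[OF f] 1(1)]] by (simp add: mult.assoc)
    show "AE x in lborel. \<Phi> (\<Psi> (\<lambda>x. c * f x)) x = c * \<Phi> (\<Psi> f) x" for c
      using bop_cong[OF p b(1) 2(2)[OF LpF_cmult(1)[OF f] ] LpF_cmult(1)[OF 2(2)[OF f]] 2(5)[OF f, of c]] 1(5)[OF 2(2)[OF f], of c]
      by eventually_elim simp
    assume g: "LpF p g"
    show "AE x in lborel. \<Phi> (\<Psi> (\<lambda>x. f x + g x)) x = \<Phi> (\<Psi> f) x + \<Phi> (\<Psi> g) x"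
      using bop_cong[OF p b(1) 2(2)[OF LpF_add(1)[OF p f g]] LpF_add(1)[OF p 2(2)[OF f] 2(2)[OF g]] 2(4)[OF f g]]
        1(4)[OF 2(2)[OF f] 2(2)[OF g]]
      by eventually_elim simp
  qed (use 1(1,2) 2(1,2) in auto)
  show "op p (\<lambda>f. \<Phi> (\<Psi> f)) = compose (Lp p) (op p \<Phi>) (op p \<Psi>)"
    unfolding op_def compose_def
  proof (rule restrict_ext)
    fix F assume F: "F \<in> Lp p"
    have "op p \<Phi> (mk (\<Psi> (fn F))) = mk (\<Phi> (\<Psi> (fn F)))"
      by (rule op_mk[OF p b(1) 2(2)[OF LpF_fn[OF F]]])
    then show "mk (\<Phi> (\<Psi> (fn F))) = (\<lambda>F\<in>Lp p. mk (\<Phi> (fn F))) ((\<lambda>F\<in>Lp p. mk (\<Psi> (fn F))) F)"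
      using F by (simp add: op_def)
  qed
qed

lemma bop_add:
  assumes p: "p \<ge> 1" and b: "bop p C \<Phi>" "bop p D \<Psi>"
  shows "bop p (2 powr p * (C + D)) (\<lambda>f x. \<Phi> f x + \<Psi> f x)"
    "op p (\<lambda>f x. \<Phi> f x + \<Psi> f x) = (\<lambda>F\<in>Lp p. op p \<Phi> F + op p \<Psi> F)"
proof -
  note 1 = bopD[OF b(1)] and 2 = bopD[OF b(2)]
  show "bop p (2 powr p * (C + D)) (\<lambda>f x. \<Phi> f x + \<Psi> f x)"
  proof (rule bopI)
    fix f g assume f: "LpF p f"
    show "LpF p (\<lambda>x. \<Phi> f x + \<Psi> f x)"
      by (rule LpF_add[OF p 1(2)[OF f] 2(2)[OF f]])
    have "Np p (\<lambda>x. \<Phi> f x + \<Psi> f x) \<le> 2 powr p * (Np p (\<Phi> f) + Np p (\<Psi> f))"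
      by (rule LpF_add[OF p 1(2)[OF f] 2(2)[OF f]])
    also have "\<dots> \<le> 2 powr p * (C * Np p f + D * Np p f)"
      by (intro mult_left_mono add_mono 1(3) 2(3) f) auto
    finally show "Np p (\<lambda>x. \<Phi> f x + \<Psi> f x) \<le> 2 powr p * (C + D) * Np p f"
      by (simp add: algebra_simps)
    show "AE x in lborel. \<Phi> (\<lambda>x. c * f x) x + \<Psi> (\<lambda>x. c * f x) x = c * (\<Phi> f x + \<Psi> f x)" for c
      using 1(5)[OF f, of c] 2(5)[OF f, of c] by eventually_elim (simp add: algebra_simps)
    assume g: "LpF p g"
    show "AE x in lborel. \<Phi> (\<lambda>x. f x + g x) x + \<Psi> (\<lambda>x. f x + g x) x = \<Phi> f x + \<Psi> f x + (\<Phi> g x + \<Psi> g x)"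
      using 1(4)[OF f g] 2(4)[OF f g] by eventually_elim (simp add: algebra_simps)
  qed (use 1(1) 2(1) in auto)
  show "op p (\<lambda>f x. \<Phi> f x + \<Psi> f x) = (\<lambda>F\<in>Lp p. op p \<Phi> F + op p \<Psi> F)"
    unfolding op_def
    by (rule restrict_ext) (simp add: mk_plus LpF_fn 1(2) 2(2) LpF_measurable[of p])
qed

lemma bop_scale:
  assumes p: "p \<ge> 1" and b: "bop p C \<Phi>"
  shows "bop p (cmod c powr p * C) (\<lambda>f x. c * \<Phi> f x)"
    "op p (\<lambda>f x. c * \<Phi> f x) = (\<lambda>F\<in>Lp p. c *\<^sub>a op p \<Phi> F)"
proof -
  note 1 = bopD[OF b]
  show "bop p (cmod c powr p * C) (\<lambda>f x. c * \<Phi> f x)"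
  proof (rule bopI)
    fix f g assume f: "LpF p f"
    show "LpF p (\<lambda>x. c * \<Phi> f x)"
      by (rule LpF_cmult[OF 1(2)[OF f]])
    show "Np p (\<lambda>x. c * \<Phi> f x) \<le> cmod c powr p * C * Np p f"
      using LpF_cmult(2)[OF 1(2)[OF f], of c] mult_left_mono[OF 1(3)[OF f], of "cmod c powr p"] by (simp add: mult.assoc)
    show "AE x in lborel. c * \<Phi> (\<lambda>x. d * f x) x = d * (c * \<Phi> f x)" for d
      using 1(5)[OF f, of d] by eventually_elim (simp add: algebra_simps)
    assume g: "LpF p g"
    show "AE x in lborel. c * \<Phi> (\<lambda>x. f x + g x) x = c * \<Phi> f x + c * \<Phi> g x"
      using 1(4)[OF f g] by eventually_elim (simp add: algebra_simps)
  qed (use 1(1) in auto)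
  show "op p (\<lambda>f x. c * \<Phi> f x) = (\<lambda>F\<in>Lp p. c *\<^sub>a op p \<Phi> F)"
    unfolding op_def
    by (rule restrict_ext) (simp add: mk_scale LpF_fn 1(2) LpF_measurable[of p])
qed

lemma bounded_op_representation:
  assumes p: "p \<ge> 1" and T: "T \<in> bounded_ops p"
  obtains C where "bop p C (\<lambda>f. fn (T (mk f)))" "op p (\<lambda>f. fn (T (mk f))) = T"
proof -
  from T obtain C where T: "T \<in> Lp p \<rightarrow>\<^sub>E Lp p" "\<And>F G. F \<in> Lp p \<Longrightarrow> G \<in> Lp p \<Longrightarrow> T (F + G) = T F + T G"
    "\<And>c F. F \<in> Lp p \<Longrightarrow> T (c *\<^sub>a F) = c *\<^sub>a T F" "\<And>F. F \<in> Lp p \<Longrightarrow> Lp_norm p (T F) \<le> C * Lp_norm p F"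
    unfolding bounded_ops_def by blast
  \<comment> \<open>The constant in \<open>bounded_ops\<close> may be negative, while
    \<open>Np_le_iff_norm\<close> asks for a nonnegative one.\<close>
  have "bop p (max C 0 powr p) (\<lambda>f. fn (T (mk f)))"
  proof (rule bopI)
    fix f g assume f: "LpF p f"
    note m = mk_Lp[OF f] LpF_measurable[OF f]
    show "LpF p (fn (T (mk f)))"
      by (rule LpF_fn) (use T(1) m in auto)
    have "Lp_norm p (T (mk f)) \<le> max C 0 * Lp_norm p (mk f)"
      by (rule order_trans[OF T(4)[OF m(1)]]) (auto intro!: mult_right_mono Lp_norm_nonneg)
    then show "Np p (fn (T (mk f))) \<le> max C 0 powr p * Np p f"
      using Np_le_iff_norm[of p "max C 0" "fn (T (mk f))" f] p m by simp
    show "AE x in lborel. fn (T (mk (\<lambda>x. c * f x))) x = c * fn (T (mk f)) x" for c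
    proof -
      have "T (mk (\<lambda>x. c * f x)) = mk (\<lambda>x. c * fn (T (mk f)) x)"
        using T(3)[OF m(1), of c] m by (simp add: mk_scale flip: mk_scale[of "fn (T (mk f))"])
      then show ?thesis by (simp add: fn_mk)
    qed
    assume g: "LpF p g"
    note n = mk_Lp[OF g] LpF_measurable[OF g]
    have "T (mk (\<lambda>x. f x + g x)) = mk (\<lambda>x. fn (T (mk f)) x + fn (T (mk g)) x)"
      using T(2)[OF m(1) n(1)] m n by (simp add: mk_plus flip: mk_plus[of "fn (T (mk f))" "fn (T (mk g))"])
    then show "AE x in lborel. fn (T (mk (\<lambda>x. f x + g x))) x = fn (T (mk f)) x + fn (T (mk g)) x"
      by (simp add: fn_mk)
  qed auto
  moreover have "op p (\<lambda>f. fn (T (mk f))) = T"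
    using T(1) by (auto simp: op_def PiE_def extensional_restrict restrict_def fun_eq_iff extensional_def)
  ultimately show thesis by (rule that)
qed

section \<open>Limits in the strong operator topology\<close>

lemma Lp_dist_mk:
  "f \<in> borel_measurable borel \<Longrightarrow> g \<in> borel_measurable borel \<Longrightarrow>
    Lp_dist p (mk f) (mk g) = Np p (\<lambda>x. f x - g x) powr (1 / p)"
  by (simp add: Lp_dist_def mk_minus Lp_norm_mk)

lemma topspace_Lp: "p \<ge> 1 \<Longrightarrow> topspace (Lp_topology p) = Lp p"
  unfolding Lp_topology_def by (intro Metric_space.topspace_mtopology Lp_metric)

text \<open>In every topology a closed set contains the limits of its sequences, so approximations
  indexed by natural numbers suffice for all membership proofs.\<close>

lemma SOT_limit:
  assumes p: "p \<ge> 1" and A: "closedin (SOT p) A" and T: "\<And>n::nat. T n \<in> A" "S \<in> bounded_ops p"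
    and lim: "\<And>F. F \<in> Lp p \<Longrightarrow> (\<lambda>n. Lp_dist p (T n F) (S F)) \<longlonglongrightarrow> 0"
  shows "S \<in> A"
proof -
  interpret Metric_space "Lp p" "Lp_dist p" by (rule Lp_metric[OF p])
  have sub: "A \<subseteq> bounded_ops p" using closedin_subset[OF A] by (auto simp: SOT_def)
  have Tb: "T n \<in> Lp p \<rightarrow>\<^sub>E Lp p" for n using T(1)[of n] sub by (auto simp: bounded_ops_def)
  have Sb: "S \<in> Lp p \<rightarrow>\<^sub>E Lp p" using T(2) by (auto simp: bounded_ops_def)
  have "limitin (SOT p) T S sequentially"
    unfolding SOT_def limitin_subtopology limitin_componentwise
  proof (intro conjI ballI)
    show "S \<in> bounded_ops p" by fact
    show "\<forall>\<^sub>F a in sequentially. T a \<in> bounded_ops p" by (intro always_eventually allI subsetD[OF sub] T(1))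
    show "S \<in> extensional (Lp p)" using Sb by (simp add: PiE_def)
    show "\<forall>\<^sub>F a in sequentially. T a \<in> topspace (product_topology (\<lambda>_. Lp_topology p) (Lp p))"
      using Tb by (simp add: topspace_Lp[OF p])
    fix F assume F: "F \<in> Lp p"
    show "limitin (Lp_topology p) (\<lambda>n. T n F) (S F) sequentially"
      unfolding Lp_topology_def limitin_metric_dist_null
      using lim[OF F] Tb Sb F by (auto intro!: always_eventually)
  qed
  then show ?thesis
    by (rule limitin_closedin[OF _ A]) (use T in auto)
qed

lemma SOT_limit_op:
  assumes p: "p \<ge> 1" and A: "closedin (SOT p) A" and b: "\<And>n::nat. bop p (C n) (\<Phi> n)" "bop p D \<Psi>"
    and mem: "\<And>n. op p (\<Phi> n) \<in> A"
    and lim: "\<And>f. LpF p f \<Longrightarrow> (\<lambda>n. Np p (\<lambda>x. \<Phi> n f x - \<Psi> f x)) \<longlonglongrightarrow> 0"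
  shows "op p \<Psi> \<in> A"
proof (rule SOT_limit[OF p A mem op_bounded[OF p b(2)]])
  fix F assume "F \<in> Lp p"
  then obtain f where f: "LpF p f" "F = mk f" by (metis LpE)
  have "Lp_dist p (op p (\<Phi> n) F) (op p \<Psi> F) = Np p (\<lambda>x. \<Phi> n f x - \<Psi> f x) powr (1/p)" for n
    unfolding f op_mk[OF p b(1) f(1)] op_mk[OF p b(2) f(1)]
    by (intro Lp_dist_mk LpF_measurable[of p] bopD(2)[OF b(1)] bopD(2)[OF b(2)] f)
  moreover have "(\<lambda>n. Np p (\<lambda>x. \<Phi> n f x - \<Psi> f x) powr (1/p)) \<longlonglongrightarrow> 0 powr (1/p)"
    using p by (intro tendsto_powr2 lim f tendsto_const) auto
  ultimately show "(\<lambda>n. Lp_dist p (op p (\<Phi> n) F) (op p \<Psi> F)) \<longlonglongrightarrow> 0"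
    using p by simp
qed

text \<open>The common bound \<open>C\<close> transfers convergence from the dense set of continuous
  functions with compact support to all of \<open>L\<^sup>p\<close>, where no dominating function is
  available.\<close>

lemma bop_limit_dense:
  assumes p: "p \<ge> 1" and b: "\<And>n::nat. bop p C (\<Phi> n)" "bop p C \<Psi>"
    and lim: "\<And>f R. continuous_on UNIV f \<Longrightarrow> (\<And>x. \<bar>x\<bar> > R \<Longrightarrow> f x = 0) \<Longrightarrow> LpF p f \<Longrightarrow>
      (\<lambda>n. Np p (\<lambda>x. \<Phi> n f x - \<Psi> f x)) \<longlonglongrightarrow> 0"
    and f: "LpF p f"
  shows "(\<lambda>n. Np p (\<lambda>x. \<Phi> n f x - \<Psi> f x)) \<longlonglongrightarrow> 0"
proof (rule tendstoI)
  fix e :: real assume e: "e > 0"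
  \<comment> \<open>The constant produced by splitting into three parts: two nested uses of
    \<open>LpF_add\<close> give \<open>4 powr p\<close>, two of the parts carry the operator bound
    \<open>C\<close>, and the middle one carries 1.\<close>
  define K where "K = 4 powr p * (2 * C + 1)"
  have C: "C \<ge> 0" using bopD(1)[OF b(2)] .
  have K: "K > 0" using C by (simp add: K_def)
  obtain g where g: "\<And>n. continuous_on UNIV (g n)" "\<And>n. \<exists>R. \<forall>x. \<bar>x\<bar> > R \<longrightarrow> g n x = 0"
    "\<And>n. LpF p (g n)" "(\<lambda>n. Np p (\<lambda>x. g n x - f x)) \<longlonglongrightarrow> 0"
    by (rule LpF_approx_continuous[OF p f]) blast
  obtain m where m: "Np p (\<lambda>x. g m x - f x) < e / K"
    using LIMSEQ_D[OF g(4), of "e / K"] e K by force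
  obtain R where R: "\<And>x. \<bar>x\<bar> > R \<Longrightarrow> g m x = 0" using g(2)[of m] by blast
  have ev: "\<forall>\<^sub>F n in sequentially. Np p (\<lambda>x. \<Phi> n (g m) x - \<Psi> (g m) x) < e / K"
    by (rule order_tendstoD(2)[OF lim[OF g(1) R g(3)]]) (use e K in auto)
  have sw: "Np p (\<lambda>x. f x - g m x) = Np p (\<lambda>x. g m x - f x)"
    by (rule Np_cong) (rule norm_minus_commute)
  show "\<forall>\<^sub>F n in sequentially. dist (Np p (\<lambda>x. \<Phi> n f x - \<Psi> f x)) 0 < e"
    using ev
  proof eventually_elim
    case (elim n)
    note d = LpF_diff(1)[OF p]
    note F = bopD(2)[OF b(1)[of n] f] bopD(2)[OF b(1)[of n] g(3)[of m]] bopD(2)[OF b(2) f] bopD(2)[OF b(2) g(3)[of m]]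
    have "Np p (\<lambda>x. \<Phi> n f x - \<Psi> f x) = Np p (\<lambda>x. ((\<Phi> n f x - \<Phi> n (g m) x) + (\<Phi> n (g m) x - \<Psi> (g m) x)) + (\<Psi> (g m) x - \<Psi> f x))"
      by simp
    also have "\<dots> \<le> 2 powr p * (2 powr p * (Np p (\<lambda>x. \<Phi> n f x - \<Phi> n (g m) x) + Np p (\<lambda>x. \<Phi> n (g m) x - \<Psi> (g m) x)) + Np p (\<lambda>x. \<Psi> (g m) x - \<Psi> f x))"
      by (rule order_trans[OF LpF_add(2)[OF p LpF_add(1)[OF p d[OF F(1,2)] d[OF F(2,4)]] d[OF F(4,3)]]])
        (intro mult_left_mono add_mono LpF_add(2)[OF p d[OF F(1,2)] d[OF F(2,4)]] order_refl, auto)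
    also have "\<dots> \<le> 2 powr p * (2 powr p * (C * Np p (\<lambda>x. g m x - f x) + Np p (\<lambda>x. \<Phi> n (g m) x - \<Psi> (g m) x)) + C * Np p (\<lambda>x. g m x - f x))"
      using bop_diff_Np[OF p b(1) f g(3)[of m], of n] bop_diff_Np[OF p b(2) g(3)[of m] f] sw
      by (intro mult_left_mono add_mono order_refl) auto
    also have "\<dots> < 2 powr p * (2 powr p * (C * (e / K) + e / K) + 2 powr p * (C * (e / K)))"
    proof -
      have "1 * (C * Np p (\<lambda>x. g m x - f x)) \<le> 2 powr p * (C * (e / K))"
        using m C p e K by (intro mult_mono mult_left_mono) (auto simp: ge_one_powr_ge_zero)
      moreover have "C * Np p (\<lambda>x. g m x - f x) \<le> C * (e / K)"
        using m C by (intro mult_left_mono) auto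
      ultimately show ?thesis
        using elim by (intro mult_strict_left_mono add_less_le_mono add_le_less_mono) auto
    qed
    also have "\<dots> = 4 powr p * (2 * C + 1) * (e / K)"
      using powr_mult[of 2 2 p] by (simp add: algebra_simps)
    also have "\<dots> = e" using K unfolding K_def[symmetric] by simp
    finally show ?case by simp
  qed
qed

section \<open>Integral operators dominated by a convolution\<close>

lemma integrable_bounded_mult:
  fixes g f :: "real \<Rightarrow> 'a::{real_normed_algebra, second_countable_topology, banach}"
  assumes "integrable lborel f" "g \<in> borel_measurable borel" "\<And>x. norm (g x) \<le> B"
  shows "integrable lborel (\<lambda>x. g x * f x)"
proof (rule Bochner_Integration.integrable_bound)
  show "integrable lborel (\<lambda>x. B * norm (f x))" using assms by auto
  have [measurable]: "f \<in> borel_measurable borel" using assms by auto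
  show "(\<lambda>x. g x * f x) \<in> borel_measurable lborel" using assms by measurable
  have "norm (g x * f x) \<le> B * norm (f x)" for x
    by (rule order_trans[OF norm_mult_ineq]) (intro mult_right_mono assms, auto)
  then show "AE x in lborel. norm (g x * f x) \<le> norm (B * norm (f x))"
    by (intro AE_I2) (auto intro: order_trans[OF _ abs_ge_self])
qed

lemma integrable_reflect:
  fixes m :: "real \<Rightarrow> 'a::{banach, second_countable_topology}"
  assumes "integrable lborel m"
  shows "integrable lborel (\<lambda>y. m (x - y))" "(LINT y|lborel. m (x - y)) = (LINT y|lborel. m y)"
    "integrable lborel (\<lambda>y. m (y - x))" "(LINT y|lborel. m (y - x)) = (LINT y|lborel. m y)"
    "integrable lborel (\<lambda>y. m (y + x))" "(LINT y|lborel. m (y + x)) = (LINT y|lborel. m y)"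
  using lborel_integrable_real_affine[OF assms, of "-1" x] lborel_integral_real_affine[of "-1" m x]
    lborel_integrable_real_affine[OF assms, of "1" "-x"] lborel_integral_real_affine[of "1" m "-x"]
    lborel_integrable_real_affine[OF assms, of "1" "x"] lborel_integral_real_affine[of "1" m "x"]
  by (simp_all add: add.commute)

lemma integral_convolution:
  fixes m h :: "real \<Rightarrow> real"
  assumes m: "integrable lborel m" "\<And>x. m x \<ge> 0" and h: "integrable lborel h" "\<And>x. h x \<ge> 0"
  shows "integrable lborel (\<lambda>x. LINT y|lborel. m (x - y) * h y)"
    "(LINT x|lborel. (LINT y|lborel. m (x - y) * h y)) = (LINT x|lborel. m x) * (LINT x|lborel. h x)"
proof -
  have [measurable]: "m \<in> borel_measurable borel" "h \<in> borel_measurable borel"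
    using m h by auto
  have pair: "integrable (lborel \<Otimes>\<^sub>M lborel) (\<lambda>(y, x). m (x - y) * h y)"
  proof (rule lborel_pair.Fubini_integrable)
    have "(\<lambda>y. LINT x|lborel. norm (m (x - y) * h y)) = (\<lambda>y. (LINT x|lborel. m x) * h y)"
      using m h by (simp add: abs_mult integrable_reflect)
    then show "integrable lborel (\<lambda>y. LINT x|lborel. norm (case (y, x) of (y, x) \<Rightarrow> m (x - y) * h y))"
      using h by simp
    show "AE y in lborel. integrable lborel (\<lambda>x. case (y, x) of (y, x) \<Rightarrow> m (x - y) * h y)"
      using m by (auto intro!: integrable_reflect)
  qed measurable
  from lborel_pair.integrable_snd[OF pair]
  show "integrable lborel (\<lambda>x. LINT y|lborel. m (x - y) * h y)" by simp
  have "(LINT x|lborel. (LINT y|lborel. m (x - y) * h y)) = (LINT y|lborel. (LINT x|lborel. m (x - y) * h y))"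
    using lborel_pair.Fubini_integral[OF pair] by simp
  also have "\<dots> = (LINT y|lborel. (LINT x|lborel. m x) * h y)"
    using m by (simp add: integrable_reflect)
  finally show "(LINT x|lborel. (LINT y|lborel. m (x - y) * h y)) = (LINT x|lborel. m x) * (LINT x|lborel. h x)"
    by simp
qed

text \<open>Integrating against bounded integrable functions instead of all of \<open>L\<^sup>q\<close> spares the
  dual exponent.\<close>

definition majorant :: "(real \<Rightarrow> real) \<Rightarrow> bool" where
  "majorant m \<longleftrightarrow> integrable lborel m \<and> (\<forall>x. 0 \<le> m x) \<and> (\<exists>B. \<forall>x. m x \<le> B)"

lemma majorantD:
  assumes "majorant m"
  shows "integrable lborel m" "0 \<le> m x" "m \<in> borel_measurable borel"
  using assms by (auto simp: majorant_def)

lemma majorant_mult_LpF: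
  assumes p: "p > 1" and m: "majorant m" and f: "LpF p f"
  shows "integrable lborel (\<lambda>y. m y * cmod (f y) powr p)"
    "integrable lborel (\<lambda>y. m y * cmod (f y))"
    "(LINT y|lborel. m y * cmod (f y)) powr p \<le> (LINT y|lborel. m y) powr (p - 1) * (LINT y|lborel. m y * cmod (f y) powr p)"
proof -
  obtain B where "\<And>x. m x \<le> B" using m by (auto simp: majorant_def)
  moreover have "integrable lborel (\<lambda>y. cmod (f y) powr p)" using f by (simp add: LpF_def)
  ultimately show 1: "integrable lborel (\<lambda>y. m y * cmod (f y) powr p)"
    using m by (intro integrable_bounded_mult[where B=B]) (auto simp: majorantD)
  show "integrable lborel (\<lambda>y. m y * cmod (f y))"
    "(LINT y|lborel. m y * cmod (f y)) powr p \<le> (LINT y|lborel. m y) powr (p - 1) * (LINT y|lborel. m y * cmod (f y) powr p)"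
    using integral_powr_le[OF p majorantD(1,2)[OF m] _ _ 1] LpF_measurable[OF f] by auto
qed

lemma majorant_shift: "majorant m \<Longrightarrow> majorant (\<lambda>y. m (x - y))"
  by (auto simp: majorant_def integrable_reflect)

lemma dominated_mult_LpF:
  assumes p: "p > 1" and m: "majorant m" and f: "LpF p f"
    and g: "g \<in> borel_measurable borel" "\<And>y. cmod (g y) \<le> m y"
  shows "integrable lborel (\<lambda>y. g y * f y)"
    "cmod (LINT y|lborel. g y * f y) \<le> (LINT y|lborel. m y * cmod (f y))"
    "cmod (LINT y|lborel. g y * f y) powr p \<le> (LINT y|lborel. m y) powr (p - 1) * (LINT y|lborel. m y * cmod (f y) powr p)"
proof -
  note M = majorant_mult_LpF[OF p m f]
  have [measurable]: "f \<in> borel_measurable borel" "g \<in> borel_measurable borel" using f g by (auto simp: LpF_def)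
  have le: "cmod (g y * f y) \<le> m y * cmod (f y)" for y
    unfolding norm_mult by (intro mult_right_mono g) auto
  show int: "integrable lborel (\<lambda>y. g y * f y)"
    by (rule Bochner_Integration.integrable_bound[OF M(2)])
      (use le in \<open>auto intro!: AE_I2 order_trans[OF _ abs_ge_self]\<close>)
  show 1: "cmod (LINT y|lborel. g y * f y) \<le> (LINT y|lborel. m y * cmod (f y))"
    by (rule order_trans[OF integral_norm_bound]) (intro integral_mono integrable_norm int M(2) le)
  show "cmod (LINT y|lborel. g y * f y) powr p \<le> (LINT y|lborel. m y) powr (p - 1) * (LINT y|lborel. m y * cmod (f y) powr p)"
    by (rule order_trans[OF powr_mono2[OF _ _ 1] M(3)]) (use p in auto)
qed

definition kop :: "(real \<Rightarrow> real \<Rightarrow> complex) \<Rightarrow> (real \<Rightarrow> complex) \<Rightarrow> real \<Rightarrow> complex" where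
  "kop K f = (\<lambda>x. LINT y|lborel. K x y * f y)"

text \<open>Domination by a convolution kernel gives Young's inequality: the operator has norm at
  most the integral of \<open>m\<close>, for every \<open>p\<close> at once. A common
  \<open>m\<close> for a sequence of kernels is what makes strong limits possible.\<close>

definition dominated_kernel :: "(real \<Rightarrow> real) \<Rightarrow> (real \<Rightarrow> real \<Rightarrow> complex) \<Rightarrow> bool" where
  "dominated_kernel m K \<longleftrightarrow> majorant m \<and> (\<lambda>(x, y). K x y) \<in> borel_measurable (borel \<Otimes>\<^sub>M borel) \<and>
     (\<forall>x y. cmod (K x y) \<le> m (x - y))"

lemma dominated_kernelD:
  assumes "dominated_kernel m K"
  shows "majorant m" "(\<lambda>(x, y). K x y) \<in> borel_measurable (borel \<Otimes>\<^sub>M borel)"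
    "cmod (K x y) \<le> m (x - y)" "K x \<in> borel_measurable borel"
proof -
  show 1: "majorant m" "(\<lambda>(x, y). K x y) \<in> borel_measurable (borel \<Otimes>\<^sub>M borel)"
    "cmod (K x y) \<le> m (x - y)" using assms by (auto simp: dominated_kernel_def)
  have "(\<lambda>y. (\<lambda>(x, y). K x y) (x, y)) \<in> borel_measurable borel"
    by (rule measurable_compose[OF _ 1(2)]) simp
  then show "K x \<in> borel_measurable borel" by simp
qed

lemma kop_dominated:
  assumes p: "p > 1" and K: "dominated_kernel m K" and f: "LpF p f"
  shows "integrable lborel (\<lambda>y. K x y * f y)"
    "cmod (kop K f x) \<le> (LINT y|lborel. m (x - y) * cmod (f y))"
    "kop K f \<in> borel_measurable borel"
    "integrable lborel (\<lambda>x. (LINT y|lborel. m (x - y) * cmod (f y)) powr p)"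
    "(LINT x|lborel. (LINT y|lborel. m (x - y) * cmod (f y)) powr p) \<le> (LINT y|lborel. m y) powr p * Np p f"
    "(\<lambda>x. (LINT y|lborel. m (x - y) * cmod (f y))) \<in> borel_measurable borel"
proof -
  have [measurable]: "f \<in> borel_measurable borel" "m \<in> borel_measurable borel"
    "(\<lambda>(x, y). K x y) \<in> borel_measurable (borel \<Otimes>\<^sub>M borel)"
    using f K by (auto simp: LpF_def dest: dominated_kernelD majorantD)
  note m = dominated_kernelD(1)[OF K] and ms = majorant_shift[OF dominated_kernelD(1)[OF K]]
  show "integrable lborel (\<lambda>y. K x y * f y)"
    "cmod (kop K f x) \<le> (LINT y|lborel. m (x - y) * cmod (f y))"
    unfolding kop_def
    by (rule dominated_mult_LpF[OF p ms[of x] f dominated_kernelD(4)[OF K] dominated_kernelD(3)[OF K]])+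
  show "kop K f \<in> borel_measurable borel" unfolding kop_def by measurable
  show mm [measurable]: "(\<lambda>x. (LINT y|lborel. m (x - y) * cmod (f y))) \<in> borel_measurable borel" by measurable
  let ?I = "LINT y|lborel. m y"
  have le: "(LINT y|lborel. m (x - y) * cmod (f y)) powr p \<le> ?I powr (p - 1) * (LINT y|lborel. m (x - y) * cmod (f y) powr p)" for x
    using majorant_mult_LpF(3)[OF p ms f, of x] m by (simp add: integrable_reflect majorantD)
  have fi: "integrable lborel (\<lambda>y. cmod (f y) powr p)" using f by (simp add: LpF_def)
  note C = integral_convolution[OF majorantD(1,2)[OF m] fi]
  have i2: "integrable lborel (\<lambda>x. ?I powr (p - 1) * (LINT y|lborel. m (x - y) * cmod (f y) powr p))"
    using C(1) by simp
  show i1: "integrable lborel (\<lambda>x. (LINT y|lborel. m (x - y) * cmod (f y)) powr p)"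
    by (rule Bochner_Integration.integrable_bound[OF i2]) (use le in \<open>auto intro!: AE_I2 order_trans[OF _ abs_ge_self]\<close>)
  have "(LINT x|lborel. (LINT y|lborel. m (x - y) * cmod (f y)) powr p) \<le> (LINT x|lborel. ?I powr (p - 1) * (LINT y|lborel. m (x - y) * cmod (f y) powr p))"
    by (intro integral_mono i1 i2 le)
  also have "\<dots> = ?I powr (p - 1) * (?I * Np p f)"
    using C(2) by (simp add: Np_def)
  also have "\<dots> = ?I powr p * Np p f"
    using powr_mult_base[of ?I "p - 1"] m by (simp add: majorantD mult.assoc[symmetric] mult.commute)
  finally show "(LINT x|lborel. (LINT y|lborel. m (x - y) * cmod (f y)) powr p) \<le> ?I powr p * Np p f" .
qed

lemma kop_bop:
  assumes p: "p > 1" and K: "dominated_kernel m K"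
  shows "bop p ((LINT y|lborel. m y) powr p) (kop K)"
proof (rule bopI)
  fix f g assume f: "LpF p f"
  note k = kop_dominated[OF p K f]
  have [measurable]: "kop K f \<in> borel_measurable borel" by (rule k(3))
  have le: "cmod (kop K f x) powr p \<le> (LINT y|lborel. m (x - y) * cmod (f y)) powr p" for x
    by (rule powr_mono2[OF _ _ k(2)]) (use p in auto)
  have int: "integrable lborel (\<lambda>x. cmod (kop K f x) powr p)"
    by (rule Bochner_Integration.integrable_bound[OF k(4)]) (use le in auto)
  then show "LpF p (kop K f)" using k(3) by (simp add: LpF_def)
  show "Np p (kop K f) \<le> (LINT y|lborel. m y) powr p * Np p f"
    unfolding Np_def[of p "kop K f"] by (rule order_trans[OF integral_mono[OF int k(4) le] k(5)])
  show "AE x in lborel. kop K (\<lambda>x. c * f x) x = c * kop K f x" for c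
    unfolding kop_def by (simp add: mult.left_commute)
  assume g: "LpF p g"
  show "AE x in lborel. kop K (\<lambda>x. f x + g x) x = kop K f x + kop K g x"
    unfolding kop_def
    by (simp add: distrib_left kop_dominated(1)[OF p K f] kop_dominated(1)[OF p K g])
qed simp

text \<open>The convolution of \<open>m\<close> with \<open>cmod f\<close> lies in
  \<open>L\<^sup>p\<close> and dominates all \<open>kop (K n) f\<close>. Dominated convergence is
  therefore used twice: in \<open>y\<close> for each fixed \<open>x\<close>, then in
  \<open>x\<close>.\<close>

lemma kop_limit:
  assumes p: "p > 1" and K: "\<And>n. dominated_kernel m (K n)" "dominated_kernel m L"
    and lim: "\<And>x y. (\<lambda>n. K n x y) \<longlonglongrightarrow> L x y" and f: "LpF p f"
  shows "(\<lambda>n. Np p (\<lambda>x. kop (K n) f x - kop L f x)) \<longlonglongrightarrow> 0"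
proof (rule LpF_dominated(3)[where f="\<lambda>n. kop (K n) f" and g="kop L f"])
  note k = kop_dominated[OF p K(1) f] and l = kop_dominated[OF p K(2) f]
  show "integrable lborel (\<lambda>x. (LINT y|lborel. m (x - y) * cmod (f y)) powr p)" by (rule l)
  show "AE x in lborel. (\<lambda>n. kop (K n) f x) \<longlonglongrightarrow> kop L f x"
  proof (rule AE_I2)
    fix x
    show "(\<lambda>n. kop (K n) f x) \<longlonglongrightarrow> kop L f x"
      unfolding kop_def
    proof (rule integral_dominated_convergence[where w="\<lambda>y. m (x - y) * cmod (f y)"])
      show "(\<lambda>y. L x y * f y) \<in> borel_measurable lborel" using l(1) by auto
      show "(\<lambda>y. K n x y * f y) \<in> borel_measurable lborel" for n using k(1) by auto
      show "integrable lborel (\<lambda>y. m (x - y) * cmod (f y))"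
        by (rule majorant_mult_LpF(2)[OF p majorant_shift[OF dominated_kernelD(1)[OF K(2)]] f])
      show "AE y in lborel. (\<lambda>n. K n x y * f y) \<longlonglongrightarrow> L x y * f y"
        by (intro AE_I2 tendsto_mult lim tendsto_const)
      show "AE y in lborel. norm (K n x y * f y) \<le> m (x - y) * cmod (f y)" for n
        unfolding norm_mult by (intro AE_I2 mult_right_mono dominated_kernelD(3)[OF K(1)]) auto
    qed
  qed
qed (use p kop_dominated[OF p K(1) f] kop_dominated[OF p K(2) f] in auto)

section \<open>Bounded multipliers and translations\<close>

definition mop :: "(real \<Rightarrow> complex) \<Rightarrow> (real \<Rightarrow> complex) \<Rightarrow> real \<Rightarrow> complex" where
  "mop h f = (\<lambda>x. h x * f x)"

lemma mop_bop:
  assumes p: "p \<ge> 1" and h: "h \<in> borel_measurable borel" "\<And>x. cmod (h x) \<le> B"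
  shows "bop p (B powr p) (mop h)"
  unfolding mop_def
  by (rule bopI) (use LpF_mult_bounded[OF p _ h] in \<open>auto simp: algebra_simps\<close>)

lemma mop_limit:
  assumes p: "p \<ge> 1" and h: "\<And>n. h n \<in> borel_measurable borel" "g \<in> borel_measurable borel"
    "\<And>n x. cmod (h n x) \<le> B" and lim: "\<And>x. (\<lambda>n. h n x) \<longlonglongrightarrow> g x" and f: "LpF p f"
  shows "(\<lambda>n. Np p (\<lambda>x. mop (h n) f x - mop g f x)) \<longlonglongrightarrow> 0"
  unfolding mop_def
proof (rule LpF_dominated(3)[where w="\<lambda>x. cmod (of_real B * f x)" and f="\<lambda>n x. h n x * f x" and g="\<lambda>x. g x * f x"])
  have [measurable]: "f \<in> borel_measurable borel" using f by (simp add: LpF_def)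
  show "integrable lborel (\<lambda>x. cmod (of_real B * f x) powr p)"
    using LpF_cmult(1)[OF f, of "of_real B"] by (simp add: LpF_def)
  show "AE x in lborel. cmod (h n x * f x) \<le> cmod (of_real B * f x)" for n
    unfolding norm_mult norm_of_real
    by (intro AE_I2 mult_right_mono order_trans[OF h(3) abs_ge_self]) auto
  show "AE x in lborel. (\<lambda>n. h n x * f x) \<longlonglongrightarrow> g x * f x"
    by (intro AE_I2 tendsto_mult lim tendsto_const)
  show "(\<lambda>x. h n x * f x) \<in> borel_measurable borel" "(\<lambda>x. g x * f x) \<in> borel_measurable borel" for n
    using h by measurable
qed (use p f in \<open>auto simp: LpF_def\<close>)

lemma shift_bop: "bop p 1 (\<lambda>f x. f (x - a))"
  by (rule bopI) (use LpF_shift in auto)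

lemma M_op_eq: "p \<ge> 1 \<Longrightarrow> M_op p l = op p (mop (\<lambda>x. exp (\<i> * complex_of_real (l * x))))"
  unfolding M_op_def op_def mop_def
  by (rule restrict_ext) (metis modulation_mk fn_measurable mk_fn)

lemma D_op_eq: "p \<ge> 1 \<Longrightarrow> D_op p a = op p (\<lambda>f x. f (x - a))"
  unfolding D_op_def op_def
  by (rule restrict_ext) (metis translation_mk fn_measurable mk_fn)

section \<open>Multiplication and convolution operators in a closed algebra\<close>

lemma mop_eq: "mop h = (\<lambda>f x. h x * f x)"
  by (simp add: mop_def fun_eq_iff)

text \<open>The sums are integrals of step functions \<open>st N\<close> that sample
  \<open>g\<close> at left end points. On a bounded interval these are uniformly bounded and
  converge pointwise. Every integral over a parameter that has to be realised inside the algebra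
  goes through such sums.\<close>

lemma riemann_sum_limit:
  fixes g :: "real \<Rightarrow> complex"
  assumes g: "continuous_on UNIV g"
  shows "(\<lambda>N. \<Sum>j<Suc N * M. (1 / real (Suc N)) *\<^sub>R g (real j / real (Suc N))) \<longlonglongrightarrow>
    (LINT t|lborel. indicator {0..<real M} t *\<^sub>R g t)"
proof -
  define st where "st N t = (\<Sum>j<Suc N * M. indicator {real j / real (Suc N)..<real (Suc j) / real (Suc N)} t *\<^sub>R g (real j / real (Suc N)))" for N t
  have [measurable]: "g \<in> borel_measurable borel" using g by (rule borel_measurable_continuous_onI)
  \<comment> \<open>At most one summand is nonzero at \<open>t\<close>, namely the one with index
    the floor of \<open>t * real (Suc N)\<close>; this index lies in the range of summation exactly
    when \<open>t\<close> is in \<open>{0..<real M}\<close>.\<close>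
  have st_eq: "st N t = indicator {0..<real M} t *\<^sub>R g (real_of_int \<lfloor>t * real (Suc N)\<rfloor> / real (Suc N))" for N t
  proof -
    have iff: "t \<in> {real j / real (Suc N)..<real (Suc j) / real (Suc N)} \<longleftrightarrow> int j = \<lfloor>t * real (Suc N)\<rfloor>" for j
    proof -
      have "t \<in> {real j / real (Suc N)..<real (Suc j) / real (Suc N)} \<longleftrightarrow> real j \<le> t * real (Suc N) \<and> t * real (Suc N) < real j + 1"
        by (simp add: pos_divide_le_eq pos_less_divide_eq add.commute del: of_nat_Suc) (simp add: add.commute)
      also have "\<dots> \<longleftrightarrow> \<lfloor>t * real (Suc N)\<rfloor> = int j"
        by (simp only: floor_eq_iff of_int_of_nat_eq)
      finally show ?thesis by auto
    qed
    have "st N t = (\<Sum>j<Suc N * M. if int j = \<lfloor>t * real (Suc N)\<rfloor> then g (real j / real (Suc N)) else 0)"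
      unfolding st_def indicator_def iff by (intro sum.cong refl) (simp add: of_bool_def)
    also have "\<dots> = indicator {0..<real M} t *\<^sub>R g (real_of_int \<lfloor>t * real (Suc N)\<rfloor> / real (Suc N))"
    proof (cases "t \<in> {0..<real M}")
      case True
      define i where "i = nat \<lfloor>t * real (Suc N)\<rfloor>"
      have i: "int i = \<lfloor>t * real (Suc N)\<rfloor>" using True unfolding i_def by (intro nat_0_le) (simp add: zero_le_mult_iff)
      have "t * real (Suc N) < real M * real (Suc N)" using True by (intro mult_strict_right_mono) auto
      moreover have "real_of_int (int (Suc N * M)) = real M * real (Suc N)" by (simp add: algebra_simps)
      ultimately have "int i < int (Suc N * M)" by (simp only: i floor_less_iff)
      then have "i < Suc N * M" by linarith
      moreover have "(\<Sum>j<Suc N * M. if int j = \<lfloor>t * real (Suc N)\<rfloor> then g (real j / real (Suc N)) else 0) = (\<Sum>j<Suc N * M. if j = i then g (real j / real (Suc N)) else 0)"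
        unfolding i[symmetric] by simp
      ultimately show ?thesis using True by (simp add: i[symmetric] del: of_nat_Suc mult_Suc)
    next
      case False
      have "int j \<noteq> \<lfloor>t * real (Suc N)\<rfloor>" if "j < Suc N * M" for j
      proof
        assume j: "int j = \<lfloor>t * real (Suc N)\<rfloor>"
        then have "0 \<le> \<lfloor>t * real (Suc N)\<rfloor>" by (metis of_nat_0_le_iff)
        then have "0 \<le> t * real (Suc N)" by (rule iffD1[OF zero_le_floor])
        then have "0 \<le> t" by (simp add: zero_le_mult_iff)
        then have "real M \<le> t" using False by auto
        then have "real (Suc N * M) \<le> t * real (Suc N)"
          unfolding of_nat_mult by (subst mult.commute) (rule mult_right_mono, simp_all)
        then have "int (Suc N * M) \<le> \<lfloor>t * real (Suc N)\<rfloor>" by (simp only: le_floor_iff of_int_of_nat_eq)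
        then show False using j that by linarith
      qed
      then show ?thesis using False by (simp add: sum.neutral del: of_nat_Suc mult_Suc)
    qed
    finally show ?thesis .
  qed
  obtain B where B: "\<And>t. t \<in> {0..real M} \<Longrightarrow> cmod (g t) \<le> B"
  proof -
    have "compact (g ` {0..real M})"
      by (intro compact_continuous_image continuous_on_subset[OF g]) auto
    then have "bounded (g ` {0..real M})" by (rule compact_imp_bounded)
    then obtain a where a: "\<And>t. t \<in> {0..real M} \<Longrightarrow> cmod (g t) \<le> a" unfolding bounded_iff by blast
    show ?thesis by (rule that[OF a])
  qed
  have fl: "real_of_int \<lfloor>t * real (Suc N)\<rfloor> / real (Suc N) \<le> t" "t - 1 / real (Suc N) \<le> real_of_int \<lfloor>t * real (Suc N)\<rfloor> / real (Suc N)" for t N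
  proof -
    show "real_of_int \<lfloor>t * real (Suc N)\<rfloor> / real (Suc N) \<le> t"
      using of_int_floor_le[of "t * real (Suc N)"] by (simp only: pos_divide_le_eq of_nat_0_less_iff zero_less_Suc)
    have "t * real (Suc N) - 1 \<le> real_of_int \<lfloor>t * real (Suc N)\<rfloor>" by linarith
    then show "t - 1 / real (Suc N) \<le> real_of_int \<lfloor>t * real (Suc N)\<rfloor> / real (Suc N)"
      by (simp add: pos_le_divide_eq left_diff_distrib del: of_nat_Suc)
  qed
  have "(\<lambda>N. LINT t|lborel. st N t) \<longlonglongrightarrow> (LINT t|lborel. indicator {0..<real M} t *\<^sub>R g t)"
  proof (rule integral_dominated_convergence[where w="\<lambda>t. max B 0 * indicator {0..<real M} t"])
    show "(\<lambda>t. indicator {0..<real M} t *\<^sub>R g t) \<in> borel_measurable lborel" by measurable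
    show "st N \<in> borel_measurable lborel" for N unfolding st_def by measurable
    show "integrable lborel (\<lambda>t. max B 0 * indicator {0..<real M} t :: real)" by simp
    show "AE t in lborel. (\<lambda>N. st N t) \<longlonglongrightarrow> indicator {0..<real M} t *\<^sub>R g t"
    proof (rule AE_I2)
      fix t
      have "(\<lambda>N. real_of_int \<lfloor>t * real (Suc N)\<rfloor> / real (Suc N)) \<longlonglongrightarrow> t"
      proof (rule tendsto_sandwich[OF _ _ _ tendsto_const])
        show "(\<lambda>N. t - 1 / real (Suc N)) \<longlonglongrightarrow> t"
          using tendsto_diff[OF tendsto_const[of t] LIMSEQ_inverse_real_of_nat] by (simp add: inverse_eq_divide)
      qed (use fl[of t] in \<open>simp_all del: of_nat_Suc\<close>)
      moreover have "isCont g t" using g by (simp add: continuous_on_eq_continuous_at)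
      ultimately have "(\<lambda>N. g (real_of_int \<lfloor>t * real (Suc N)\<rfloor> / real (Suc N))) \<longlonglongrightarrow> g t"
        using isCont_tendsto_compose by blast
      then show "(\<lambda>N. st N t) \<longlonglongrightarrow> indicator {0..<real M} t *\<^sub>R g t"
        unfolding st_eq by (intro tendsto_scaleR tendsto_const)
    qed
    show "AE t in lborel. norm (st N t) \<le> max B 0 * indicator {0..<real M} t" for N
    proof (rule AE_I2)
      fix t
      have "cmod (g (real_of_int \<lfloor>t * real (Suc N)\<rfloor> / real (Suc N))) \<le> max B 0" if "t \<in> {0..<real M}"
      proof -
        have "0 \<le> real_of_int \<lfloor>t * real (Suc N)\<rfloor> / real (Suc N)" using that by (simp del: of_nat_Suc)
        then show ?thesis using fl(1)[of t N] that by (intro order_trans[OF B]) auto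
      qed
      then show "norm (st N t) \<le> max B 0 * indicator {0..<real M} t"
        unfolding st_eq by (auto simp: indicator_def)
    qed
  qed
  moreover have "(LINT t|lborel. st N t) = (\<Sum>j<Suc N * M. (1 / real (Suc N)) *\<^sub>R g (real j / real (Suc N)))" for N
    unfolding st_def by (subst Bochner_Integration.integral_sum) (auto simp: field_simps divide_right_mono)
  ultimately show ?thesis by simp
qed

lemma sum_powr_le:
  fixes a w :: "nat \<Rightarrow> real"
  assumes p: "p > 1" and "\<And>j. j < n \<Longrightarrow> a j \<ge> 0" "\<And>j. j < n \<Longrightarrow> w j \<ge> 0"
  shows "(\<Sum>j<n. a j * w j) powr p \<le> (\<Sum>j<n. a j) powr (p - 1) * (\<Sum>j<n. a j * w j powr p)"
  using integral_powr_le(2)[of p "count_space {..<n}" "\<lambda>j. if j < n then a j else 0" "\<lambda>j. if j < n then w j else 0"] assms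
  by (simp add: lebesgue_integral_count_space_finite integrable_count_space)

section \<open>The calculus of a closed algebra that contains the generators\<close>

definition inA :: "real \<Rightarrow> (ae_fun \<Rightarrow> ae_fun) set \<Rightarrow> ((real \<Rightarrow> complex) \<Rightarrow> real \<Rightarrow> complex) \<Rightarrow> bool" where
  "inA p A \<Phi> \<longleftrightarrow> (\<exists>C. bop p C \<Phi>) \<and> op p \<Phi> \<in> A"

text \<open>An arbitrary closed algebra above the generators rather than the smallest one, because
  the closure properties are used for two of them: for an arbitrary member of the family defining
  the hull, and for the binest algebra itself in
  \<open>modulated_resolvent_annihilated\<close>.\<close>

locale closed_algebra =
  fixes p :: real and A :: "(ae_fun \<Rightarrow> ae_fun) set"
  assumes p: "p > 1" and alg: "operator_algebra p A" and clo: "closedin (SOT p) A"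
    and gen: "{M_op p l | l. l \<ge> 0} \<union> {D_op p m | m. m \<ge> 0} \<subseteq> A"
begin

lemma p1: "p \<ge> 1" using p by simp

lemma inA_zero: "inA p A (\<lambda>f x. 0)"
proof -
  have "bop p 0 (\<lambda>f x. 0)" by (rule bopI) auto
  moreover have "op p (\<lambda>f x. 0) = (\<lambda>f\<in>Lp p. 0)" by (simp add: op_def mk_0)
  ultimately show ?thesis using alg by (auto simp: inA_def operator_algebra_def)
qed

lemma inA_add:
  assumes "inA p A \<Phi>" "inA p A \<Psi>"
  shows "inA p A (\<lambda>f x. \<Phi> f x + \<Psi> f x)"
proof -
  from assms obtain C D where b: "bop p C \<Phi>" "bop p D \<Psi>" and m: "op p \<Phi> \<in> A" "op p \<Psi> \<in> A"
    unfolding inA_def by blast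
  show ?thesis
    unfolding inA_def bop_add(2)[OF p1 b]
    using bop_add(1)[OF p1 b] alg m unfolding operator_algebra_def by blast
qed

lemma inA_scale:
  assumes "inA p A \<Phi>"
  shows "inA p A (\<lambda>f x. c * \<Phi> f x)"
proof -
  from assms obtain C where b: "bop p C \<Phi>" and m: "op p \<Phi> \<in> A"
    unfolding inA_def by blast
  show ?thesis
    unfolding inA_def bop_scale(2)[OF p1 b]
    using bop_scale(1)[OF p1 b] alg m unfolding operator_algebra_def by blast
qed

lemma inA_compose:
  assumes "inA p A \<Phi>" "inA p A \<Psi>"
  shows "inA p A (\<lambda>f. \<Phi> (\<Psi> f))"
proof -
  from assms obtain C D where b: "bop p C \<Phi>" "bop p D \<Psi>" and m: "op p \<Phi> \<in> A" "op p \<Psi> \<in> A"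
    unfolding inA_def by blast
  show ?thesis
    unfolding inA_def bop_compose(2)[OF p1 b]
    using bop_compose(1)[OF p1 b] alg m unfolding operator_algebra_def by blast
qed

lemma inA_sum:
  fixes \<Phi> :: "nat \<Rightarrow> _"
  assumes "\<And>j. j < n \<Longrightarrow> inA p A (\<Phi> j)"
  shows "inA p A (\<lambda>f x. \<Sum>j<n. \<Phi> j f x)"
  using assms
proof (induction n)
  case 0
  then show ?case using inA_zero by simp
next
  case (Suc n)
  then show ?case using inA_add[of "\<lambda>f x. \<Sum>j<n. \<Phi> j f x" "\<Phi> n"] by simp
qed

lemma inA_limit:
  assumes "\<And>n::nat. inA p A (\<Phi> n)" "bop p D \<Psi>"
    "\<And>f. LpF p f \<Longrightarrow> (\<lambda>n. Np p (\<lambda>x. \<Phi> n f x - \<Psi> f x)) \<longlonglongrightarrow> 0"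
  shows "inA p A \<Psi>"
proof -
  from assms(1) have "\<forall>n. \<exists>C. bop p C (\<Phi> n)" by (simp add: inA_def)
  from choice[OF this] obtain C where "\<And>n. bop p (C n) (\<Phi> n)" by blast
  then show ?thesis
    using SOT_limit_op[OF p1 clo, of C \<Phi> D \<Psi>] assms unfolding inA_def by blast
qed

lemma inA_cong:
  assumes "inA p A \<Phi>" "bop p D \<Psi>" "\<And>f. LpF p f \<Longrightarrow> AE x in lborel. \<Phi> f x = \<Psi> f x"
  shows "inA p A \<Psi>"
proof -
  from assms(1) obtain C where b: "bop p C \<Phi>" and m: "op p \<Phi> \<in> A"
    unfolding inA_def by blast
  show ?thesis
    using op_eqI[OF p1 b assms(2,3)] m assms(2) unfolding inA_def by auto
qed

lemma inA_kop_limit: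
  assumes "\<And>n::nat. inA p A (kop (K n))" "\<And>n. dominated_kernel m (K n)" "dominated_kernel m L"
    "\<And>x y. (\<lambda>n. K n x y) \<longlonglongrightarrow> L x y"
  shows "inA p A (kop L)"
  by (rule inA_limit[OF assms(1) kop_bop[OF p assms(3)] kop_limit[OF p assms(2,3,4)]])

lemma inA_mop_limit:
  assumes "\<And>n::nat. inA p A (mop (h n))" "\<And>n. h n \<in> borel_measurable borel" "g \<in> borel_measurable borel"
    "\<And>n x. cmod (h n x) \<le> B" "\<And>x. (\<lambda>n. h n x) \<longlonglongrightarrow> g x"
  shows "inA p A (mop g)"
proof (rule inA_limit[OF assms(1)])
  have "cmod (g x) \<le> B" for x
    by (rule LIMSEQ_le_const2[OF tendsto_norm[OF assms(5)]]) (use assms(4) in auto)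
  then show "bop p (B powr p) (mop g)" by (intro mop_bop p1 assms)
  show "(\<lambda>n. Np p (\<lambda>x. mop (h n) f x - mop g f x)) \<longlonglongrightarrow> 0" if "LpF p f" for f
    by (rule mop_limit[OF p1 assms(2-5) that])
qed

lemma inA_M: "l \<ge> 0 \<Longrightarrow> inA p A (mop (\<lambda>x. exp (\<i> * complex_of_real (l * x))))"
  using gen M_op_eq[OF p1, of l] mop_bop[OF p1, of "\<lambda>x. exp (\<i> * complex_of_real (l * x))" 1]
  unfolding inA_def by auto

lemma inA_D: "a \<ge> 0 \<Longrightarrow> inA p A (\<lambda>f x. f (x - a))"
  using gen D_op_eq[OF p1, of a] shift_bop unfolding inA_def by auto

lemma inA_mop_scale:
  assumes "inA p A (mop h)"
  shows "inA p A (mop (\<lambda>x. c * h x))"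
  using inA_scale[OF assms, of c] by (simp add: mop_eq mult.assoc)

lemma inA_mop_mult:
  assumes "inA p A (mop h)" "inA p A (mop g)"
  shows "inA p A (mop (\<lambda>x. h x * g x))"
  using inA_compose[OF assms] by (simp add: mop_eq mult.assoc)

text \<open>Resolvents of the modulation group, obtained from geometric series that approximate
  the Laplace integral of \<open>exp (i l (x - w))\<close> over \<open>l \<ge> 0\<close>.\<close>

lemma inA_resolvent:
  assumes w: "Im w < 0"
  shows "inA p A (mop (\<lambda>x. 1 / (complex_of_real x - w)))"
proof -
  define z where "z d x = exp (\<i> * complex_of_real d * (complex_of_real x - w))" for d x :: real
  have nz: "cmod (z d x) = exp (d * Im w)" for d x
    by (simp add: z_def)
  have mz [measurable]: "z d \<in> borel_measurable borel" for d unfolding z_def by measurable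
  have geo: "inA p A (mop (\<lambda>x. of_real d / (1 - z d x)))" if d: "d > 0" for d
  proof -
    let ?q = "exp (d * Im w)"
    have q: "0 < ?q" "?q < 1" using w d by (auto simp: mult_pos_neg)
    have lim: "(\<lambda>N. of_real d * (\<Sum>k<N. z d x ^ k)) \<longlonglongrightarrow> of_real d / (1 - z d x)" for x
    proof -
      have "(\<lambda>k. z d x ^ k) sums (1 / (1 - z d x))"
        by (rule geometric_sums) (use nz q in simp)
      then show ?thesis
        unfolding sums_def using tendsto_mult_left[of _ "1 / (1 - z d x)" sequentially "of_real d"] by simp
    qed
    have bd: "cmod (of_real d * (\<Sum>k<N. z d x ^ k)) \<le> d / (1 - ?q)" for N x
    proof -
      have "cmod (\<Sum>k<N. z d x ^ k) \<le> (\<Sum>k<N. ?q ^ k)"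
        by (rule order_trans[OF norm_sum]) (simp add: norm_power nz)
      also have "\<dots> \<le> (\<Sum>k. ?q ^ k)"
        using q by (intro sum_le_suminf summable_geometric) auto
      also have "\<dots> = 1 / (1 - ?q)" using q by (intro suminf_geometric) auto
      finally show ?thesis
        using d mult_left_mono[of "cmod (\<Sum>k<N. z d x ^ k)" "1 / (1 - ?q)" d] by (simp add: norm_mult)
    qed
    have fin: "inA p A (mop (\<lambda>x. of_real d * (\<Sum>k<N. z d x ^ k)))" for N
    proof -
      have "inA p A (mop (\<lambda>x. z d x ^ k))" for k
      proof -
        have "z d x ^ k = exp (- \<i> * of_real (real k * d) * w) * exp (\<i> * complex_of_real (real k * d * x))" for x
          unfolding z_def exp_of_nat_mult[symmetric] exp_add[symmetric]
          by (rule arg_cong[where f=exp]) (simp add: algebra_simps)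
        then show ?thesis
          using inA_mop_scale[OF inA_M[of "real k * d"], of "exp (- \<i> * of_real (real k * d) * w)"] d by simp
      qed
      from inA_scale[OF inA_sum[of N "\<lambda>k. mop (\<lambda>x. z d x ^ k)", OF this], of "of_real d"]
      show ?thesis by (simp add: mop_eq sum_distrib_right mult.assoc)
    qed
    show ?thesis
      by (rule inA_mop_limit[OF fin _ _ bd lim]) measurable
  qed
  let ?d = "\<lambda>n. 1 / real (Suc n)"
  \<comment> \<open>As \<open>z d x = exp (d * ?u)\<close>, the quotient is minus the reciprocal of
    the difference quotient of \<open>exp (h * ?u)\<close> at 0, hence tends to
    \<open>- 1 / ?u\<close>.\<close>
  have l: "(\<lambda>n. of_real (?d n) / (1 - z (?d n) x)) \<longlonglongrightarrow> \<i> / (complex_of_real x - w)" for x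
  proof -
    let ?u = "\<i> * (complex_of_real x - w)"
    have u: "?u \<noteq> 0" using w by auto
    have "((\<lambda>h. exp (h * ?u)) has_field_derivative ?u) (at 0)"
      by (auto intro!: derivative_eq_intros)
    then have "((\<lambda>h. (exp (h * ?u) - 1) / h) \<longlongrightarrow> ?u) (at 0)"
      by (simp add: has_field_derivative_iff)
    moreover have "filterlim (\<lambda>n. complex_of_real (?d n)) (at 0) sequentially"
      unfolding filterlim_at
    proof
      show "\<forall>\<^sub>F n in sequentially. complex_of_real (?d n) \<in> UNIV \<and> complex_of_real (?d n) \<noteq> 0"
        by (simp del: of_nat_Suc)
      show "(\<lambda>n. complex_of_real (?d n)) \<longlonglongrightarrow> 0"
        using tendsto_of_real[OF LIMSEQ_inverse_real_of_nat, where 'a=complex] by (simp add: inverse_eq_divide del: of_nat_Suc)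
    qed
    ultimately have "(\<lambda>n. (exp (complex_of_real (?d n) * ?u) - 1) / complex_of_real (?d n)) \<longlonglongrightarrow> ?u"
      by (rule filterlim_compose)
    from tendsto_divide[OF tendsto_const[of "- 1"] this u]
    have "(\<lambda>n. - 1 / ((exp (complex_of_real (?d n) * ?u) - 1) / complex_of_real (?d n))) \<longlonglongrightarrow> - 1 / ?u" .
    moreover have "- 1 / ((exp (complex_of_real (?d n) * ?u) - 1) / complex_of_real (?d n)) = of_real (?d n) / (1 - z (?d n) x)" for n
    proof -
      have "exp (complex_of_real (?d n) * ?u) = z (?d n) x"
        unfolding z_def by (rule arg_cong[where f=exp]) (simp only: mult.left_commute mult.assoc mult.commute)
      then show ?thesis
        by (metis (no_types, lifting) divide_divide_eq_right minus_diff_eq minus_divide_left minus_divide_right mult_minus_left mult_1)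
    qed
    moreover have "- 1 / ?u = \<i> / (complex_of_real x - w)"
      by (simp add: divide_simps)
    ultimately show ?thesis by simp
  qed
  \<comment> \<open>Uniform in \<open>n\<close> and \<open>x\<close>: with
    \<open>?t = ?d n * (- Im w)\<close>, the estimate \<open>1 + ?t \<le> exp ?t\<close> gives
    \<open>1 - cmod (z (?d n) x) \<ge> ?t / (1 + ?t)\<close>, and the factor \<open>?d n\<close>
    cancels.\<close>
  have b: "cmod (of_real (?d n) / (1 - z (?d n) x)) \<le> (1 - Im w) / (- Im w)" for n x
  proof -
    let ?t = "?d n * (- Im w)"
    have t: "?t > 0" using w by (intro mult_pos_pos) auto
    have "1 - cmod (z (?d n) x) \<le> cmod (1 - z (?d n) x)"
      using norm_triangle_ineq2[of 1 "z (?d n) x"] by simp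
    moreover have "cmod (z (?d n) x) \<le> 1 / (1 + ?t)"
    proof -
      have "1 + ?t \<le> exp ?t" by (rule exp_ge_add_one_self)
      then have "inverse (exp ?t) \<le> inverse (1 + ?t)" by (rule le_imp_inverse_le[OF _ add_pos_pos[OF zero_less_one t]])
      moreover have "exp (?d n * Im w) = inverse (exp ?t)" by (simp only: exp_minus[symmetric]) simp
      ultimately show ?thesis unfolding nz by (simp only: inverse_eq_divide)
    qed
    moreover have "?t / (1 + ?t) = 1 - 1 / (1 + ?t)"
    proof -
      have "s / (1 + s) = 1 - 1 / (1 + s)" if "s > 0" for s :: real
        using that by (simp add: field_simps)
      from this[OF t] show ?thesis .
    qed
    ultimately have le: "?t / (1 + ?t) \<le> cmod (1 - z (?d n) x)" by linarith
    have "0 < ?t / (1 + ?t)"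
      by (rule divide_pos_pos[OF t add_pos_pos[OF zero_less_one t]])
    then have "?d n / cmod (1 - z (?d n) x) \<le> ?d n / (?t / (1 + ?t))"
      using le by (intro divide_left_mono mult_pos_pos) auto
    also have "\<dots> = (1 + ?t) / (- Im w)"
    proof -
      have "d / (d * a / (1 + d * a)) = (1 + d * a) / a" if "d > 0" "a > 0" for d a :: real
        using that add_pos_pos[OF zero_less_one mult_pos_pos[OF that]] by (simp add: divide_simps)
      from this[of "?d n" "- Im w"] show ?thesis using w by simp
    qed
    also have "\<dots> \<le> (1 - Im w) / (- Im w)"
      using w mult_right_mono[of "?d n" 1 "- Im w"] by (intro divide_right_mono) auto
    finally show ?thesis by (simp only: norm_divide norm_of_real) simp
  qed
  have "inA p A (mop (\<lambda>x. \<i> / (complex_of_real x - w)))"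
    by (rule inA_mop_limit[OF geo _ _ b l]) (simp, measurable)
  from inA_mop_scale[OF this, of "- \<i>"] show ?thesis by simp
qed

end

lemma bop_mono: "bop p C \<Phi> \<Longrightarrow> C \<le> D \<Longrightarrow> bop p D \<Phi>"
  unfolding bop_def by (meson Np_nonneg mult_right_mono order_trans)

lemma compact_support_bound:
  fixes f :: "real \<Rightarrow> complex"
  assumes "continuous_on UNIV f" "\<And>x. \<bar>x\<bar> > R \<Longrightarrow> f x = 0"
  obtains B where "\<And>x. cmod (f x) \<le> B" "B \<ge> 0"
proof -
  have "compact (f ` {-\<bar>R\<bar>..\<bar>R\<bar>})"
    by (intro compact_continuous_image continuous_on_subset[OF assms(1)]) auto
  then have "bounded (f ` {-\<bar>R\<bar>..\<bar>R\<bar>})" by (rule compact_imp_bounded)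
  then obtain a where a: "\<And>t. t \<in> {-\<bar>R\<bar>..\<bar>R\<bar>} \<Longrightarrow> cmod (f t) \<le> a" unfolding bounded_iff by blast
  have "cmod (f x) \<le> max a 0" for x
  proof (cases "\<bar>x\<bar> > R")
    case False
    then have "cmod (f x) \<le> a" by (intro a) auto
    then show ?thesis by simp
  qed (simp add: assms(2))
  then show ?thesis by (rule that) simp
qed

lemma integrable_box_powr: "integrable lborel (\<lambda>x::real. (K * indicator {a..b} x) powr q :: real)"
proof -
  have "(\<lambda>x::real. (K * indicator {a..b} x) powr q :: real) = (\<lambda>x. K powr q * indicator {a..b} x)"
    by (auto simp: indicator_def)
  moreover have "integrable lborel (indicator {a..b} :: real \<Rightarrow> real)"
    by (intro integrable_real_indicator) (auto simp: emeasure_lborel_Icc_eq)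
  ultimately show ?thesis by simp
qed

lemma dominated_convolution:
  assumes "majorant m" "c \<in> borel_measurable borel" "\<And>t. cmod (c t) \<le> m t"
  shows "dominated_kernel m (\<lambda>x y. c (x - y))"
  unfolding dominated_kernel_def using assms by (auto simp: split_def)

context closed_algebra
begin

text \<open>Convolution is a limit of combinations of translations by nonnegative amounts. The
  weights of each Riemann sum total \<open>B * real M\<close>, whatever the mesh, so the sums are
  uniformly bounded operators and it suffices to check convergence on continuous \<open>f\<close> of
  compact support.\<close>

lemma inA_conv_compact:
  assumes c: "continuous_on UNIV c" "\<And>t. t < 0 \<Longrightarrow> c t = 0" "\<And>t. t \<ge> real M \<Longrightarrow> c t = 0"
    and m: "majorant m" "\<And>t. cmod (c t) \<le> m t"
  shows "inA p A (kop (\<lambda>x y. c (x - y)))"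
proof -
  have [measurable]: "c \<in> borel_measurable borel" using c(1) by (rule borel_measurable_continuous_onI)
  obtain B where B: "\<And>t. m t \<le> B" using m(1) by (auto simp: majorant_def)
  have B0: "B \<ge> 0" using B[of 0] majorantD(2)[OF m(1), of 0] by simp
  have cB: "cmod (c t) \<le> B" for t using m(2)[of t] B[of t] by simp
  define \<Phi> where "\<Phi> N f x = (\<Sum>j<Suc N * M. (of_real (1 / real (Suc N)) * c (real j / real (Suc N))) * f (x - real j / real (Suc N)))" for N f x
  have dk: "dominated_kernel m (\<lambda>x y. c (x - y))"
    using m by (intro dominated_convolution) auto
  have mem: "inA p A (\<Phi> N)" for N
    unfolding \<Phi>_def by (intro inA_sum inA_scale inA_D) simp
  have le: "cmod (\<Phi> N f x) \<le> (\<Sum>j<Suc N * M. B / real (Suc N) * cmod (f (x - real j / real (Suc N))))" for N f x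
    unfolding \<Phi>_def
  proof (rule sum_norm_le)
    fix j
    have "cmod (of_real (1 / real (Suc N)) * c (real j / real (Suc N))) \<le> B / real (Suc N)"
      unfolding norm_mult norm_of_real using cB[of "real j / real (Suc N)"] by (simp add: divide_right_mono)
    then show "cmod (of_real (1 / real (Suc N)) * c (real j / real (Suc N)) * f (x - real j / real (Suc N))) \<le> B / real (Suc N) * cmod (f (x - real j / real (Suc N)))"
      unfolding norm_mult[of _ "f _"] by (rule mult_right_mono) simp
  qed
  have sumB: "(\<Sum>j<Suc N * M. B / real (Suc N)) = B * real M" for N
    by (simp add: algebra_simps divide_simps del: of_nat_Suc) (simp add: algebra_simps)
  have b: "bop p ((B * real M) powr p) (\<Phi> N)" for N
  proof (rule bopI)
    fix f g assume f: "LpF p f"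
    have [measurable]: "f \<in> borel_measurable borel" using f by (simp add: LpF_def)
    let ?a = "\<lambda>j::nat. B / real (Suc N)" and ?w = "\<lambda>j x. cmod (f (x - real j / real (Suc N)))"
    have le2: "cmod (\<Phi> N f x) powr p \<le> (B * real M) powr (p - 1) * (\<Sum>j<Suc N * M. ?a j * ?w j x powr p)" for x
      using order_trans[OF powr_mono2[OF _ _ le[of N f x]] sum_powr_le[OF p, of "Suc N * M" ?a "\<lambda>j. ?w j x"]] p B0
      unfolding sumB by auto
    have i1: "integrable lborel (\<lambda>x. ?w j x powr p)" for j
      using LpF_shift(1)[OF f, of "real j / real (Suc N)"] by (simp add: LpF_def)
    then have i2: "integrable lborel (\<lambda>x. (B * real M) powr (p - 1) * (\<Sum>j<Suc N * M. ?a j * ?w j x powr p))"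
      by (intro integrable_mult_right Bochner_Integration.integrable_sum) auto
    have me: "\<Phi> N f \<in> borel_measurable borel" unfolding \<Phi>_def by measurable
    have i3: "integrable lborel (\<lambda>x. cmod (\<Phi> N f x) powr p)"
      by (rule Bochner_Integration.integrable_bound[OF i2]) (use le2 me in \<open>auto intro!: AE_I2 order_trans[OF _ abs_ge_self]\<close>)
    then show "LpF p (\<Phi> N f)" using me by (simp add: LpF_def)
    have "Np p (\<Phi> N f) \<le> (LINT x|lborel. (B * real M) powr (p - 1) * (\<Sum>j<Suc N * M. ?a j * ?w j x powr p))"
      unfolding Np_def by (rule integral_mono[OF i3 i2 le2])
    also have "\<dots> = (B * real M) powr (p - 1) * (\<Sum>j<Suc N * M. ?a j * Np p f)"
    proof -
      have "(LINT x|lborel. ?w j x powr p) = Np p f" for j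
        using LpF_shift(2)[OF f, of "real j / real (Suc N)"] by (simp add: Np_def)
      moreover have "(LINT x|lborel. (\<Sum>j<Suc N * M. ?a j * ?w j x powr p)) = (\<Sum>j<Suc N * M. ?a j * (LINT x|lborel. ?w j x powr p))"
        using i1 by (subst Bochner_Integration.integral_sum) auto
      ultimately show ?thesis by simp
    qed
    also have "\<dots> = (B * real M) powr (p - 1) * (B * real M) * Np p f"
      unfolding sum_distrib_right[symmetric] sumB by simp
    also have "(B * real M) powr (p - 1) * (B * real M) = (B * real M) powr p"
      using powr_mult_base[of "B * real M" "p - 1"] B0 by (simp add: mult.commute)
    finally show "Np p (\<Phi> N f) \<le> (B * real M) powr p * Np p f" .
    show "AE x in lborel. \<Phi> N (\<lambda>x. d * f x) x = d * \<Phi> N f x" for d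
      unfolding \<Phi>_def by (simp add: sum_distrib_left mult.left_commute)
    show "AE x in lborel. \<Phi> N (\<lambda>x. f x + g x) x = \<Phi> N f x + \<Phi> N g x"
      unfolding \<Phi>_def by (simp add: sum.distrib distrib_left)
  qed simp
  define C where "C = max ((B * real M) powr p) ((LINT y|lborel. m y) powr p)"
  have b1: "bop p C (\<Phi> N)" for N by (rule bop_mono[OF b]) (simp add: C_def)
  have b2: "bop p C (kop (\<lambda>x y. c (x - y)))" by (rule bop_mono[OF kop_bop[OF p dk]]) (simp add: C_def)
  show ?thesis
  proof (rule inA_limit[OF mem b2])
    fix f assume "LpF p f"
    then show "(\<lambda>N. Np p (\<lambda>x. \<Phi> N f x - kop (\<lambda>x y. c (x - y)) f x)) \<longlonglongrightarrow> 0"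
    proof (rule bop_limit_dense[OF p1 b1 b2, rotated])
      fix f :: "real \<Rightarrow> complex" and R
      assume f: "continuous_on UNIV f" "\<And>x. R < \<bar>x\<bar> \<Longrightarrow> f x = 0" "LpF p f"
      obtain D where D: "\<And>x. cmod (f x) \<le> D" "D \<ge> 0" using compact_support_bound[OF f(1,2)] by blast
      have [measurable]: "f \<in> borel_measurable borel" using f by (simp add: LpF_def)
      let ?w = "\<lambda>x. (B * D * real M) * indicator {-(R + real M)..R + real M} x"
      show "(\<lambda>N. Np p (\<lambda>x. \<Phi> N f x - kop (\<lambda>x y. c (x - y)) f x)) \<longlonglongrightarrow> 0"
      proof (rule LpF_dominated(3)[where w="?w" and f="\<lambda>N. \<Phi> N f" and g="kop (\<lambda>x y. c (x - y)) f"])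
        show "\<Phi> N f \<in> borel_measurable borel" for N unfolding \<Phi>_def by measurable
        show "kop (\<lambda>x y. c (x - y)) f \<in> borel_measurable borel" by (rule kop_dominated(3)[OF p dk f(3)])
        show "AE x in lborel. cmod (\<Phi> N f x) \<le> ?w x" for N
        proof (rule AE_I2)
          fix x
          show "cmod (\<Phi> N f x) \<le> ?w x"
          proof (cases "x \<in> {-(R + real M)..R + real M}")
            case True
            have "cmod (\<Phi> N f x) \<le> (\<Sum>j<Suc N * M. B / real (Suc N) * D)"
              using B0 D by (intro order_trans[OF le] sum_mono mult_left_mono) auto
            also have "\<dots> = B * real M * D" unfolding sum_distrib_right[symmetric] sumB ..
            finally show ?thesis using True by (simp add: mult.commute mult.left_commute)
          next
            case False
            have "f (x - real j / real (Suc N)) = 0" if "j < Suc N * M" for j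
            proof (rule f(2))
              have "real j / real (Suc N) \<le> real M"
              proof -
                have "real j \<le> real (Suc N * M)" using that by linarith
                then show ?thesis by (simp add: pos_divide_le_eq mult.commute del: of_nat_Suc mult_Suc mult_Suc_right)
              qed
              moreover have "0 \<le> real j / real (Suc N)" by simp
              ultimately show "R < \<bar>x - real j / real (Suc N)\<bar>" using False unfolding atLeastAtMost_iff by linarith
            qed
            then have "\<Phi> N f x = 0" unfolding \<Phi>_def by (intro sum.neutral) auto
            then show ?thesis using B0 D(2) by simp
          qed
        qed
        show "AE x in lborel. (\<lambda>N. \<Phi> N f x) \<longlonglongrightarrow> kop (\<lambda>x y. c (x - y)) f x"
        proof (rule AE_I2)
          fix x
          have "continuous_on UNIV (\<lambda>t. f (x - t))"
            by (rule continuous_on_compose2[OF f(1)]) (auto intro!: continuous_intros)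
          then have "continuous_on UNIV (\<lambda>t. c t * f (x - t))"
            by (intro continuous_intros c)
          from riemann_sum_limit[OF this, of M]
          have "(\<lambda>N. \<Phi> N f x) \<longlonglongrightarrow> (LINT t|lborel. indicator {0..<real M} t *\<^sub>R (c t * f (x - t)))"
            unfolding \<Phi>_def by (simp add: scaleR_conv_of_real mult.assoc)
          also have "(\<lambda>t. indicator {0..<real M} t *\<^sub>R (c t * f (x - t))) = (\<lambda>t. c t * f (x - t))"
            using c(2,3) by (auto simp: indicator_def fun_eq_iff not_less)
          also have "(LINT t|lborel. c t * f (x - t)) = kop (\<lambda>x y. c (x - y)) f x"
            unfolding kop_def using lborel_integral_real_affine[of "-1" "\<lambda>t. c t * f (x - t)" x] by simp
          finally show "(\<lambda>N. \<Phi> N f x) \<longlonglongrightarrow> kop (\<lambda>x y. c (x - y)) f x" .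
        qed
      qed (use integrable_box_powr p in auto)
    qed
  qed
qed

lemma inA_conv:
  assumes c: "continuous_on UNIV c" "\<And>t. t < 0 \<Longrightarrow> c t = 0"
    and m: "majorant m" "\<And>t. cmod (c t) \<le> m t"
  shows "inA p A (kop (\<lambda>x y. c (x - y)))"
proof -
  define cut where "cut n t = max 0 (min 1 (real n + 1 - t))" for n :: nat and t
  have [measurable]: "c \<in> borel_measurable borel" using c(1) by (rule borel_measurable_continuous_onI)
  have b: "cmod (of_real (cut n t) * c t) \<le> m t" for n t
  proof -
    have "cmod (of_real (cut n t) * c t) \<le> 1 * cmod (c t)"
      unfolding norm_mult by (intro mult_right_mono) (auto simp: cut_def)
    then show ?thesis using m(2)[of t] by simp
  qed
  have cc: "continuous_on UNIV (\<lambda>t. of_real (cut n t) * c t)" for n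
    unfolding cut_def by (intro continuous_intros c)
  show ?thesis
  proof (rule inA_kop_limit[where K="\<lambda>n x y. of_real (cut n (x - y)) * c (x - y)"])
    show "inA p A (kop (\<lambda>x y. of_real (cut n (x - y)) * c (x - y)))" for n
      by (rule inA_conv_compact[where c="\<lambda>t. of_real (cut n t) * c t" and M="Suc n", OF cc _ _ m(1) b])
        (auto simp: c cut_def)
    show "dominated_kernel m (\<lambda>x y. of_real (cut n (x - y)) * c (x - y))" for n
      by (rule dominated_convolution[where c="\<lambda>t. of_real (cut n t) * c t", OF m(1) _ b])
        (use cc in \<open>auto intro: borel_measurable_continuous_onI\<close>)
    show "dominated_kernel m (\<lambda>x y. c (x - y))"
      by (rule dominated_convolution[OF m(1) _ m(2)]) measurable
    show "(\<lambda>n. of_real (cut n (x - y)) * c (x - y)) \<longlonglongrightarrow> c (x - y)" for x y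
    proof (rule tendsto_eventually)
      show "\<forall>\<^sub>F n in sequentially. of_real (cut n (x - y)) * c (x - y) = c (x - y)"
        using eventually_ge_at_top[of "nat \<lceil>x - y\<rceil>"]
      proof eventually_elim
        case (elim n)
        then have "cut n (x - y) = 1" unfolding cut_def by linarith
        then show ?case by simp
      qed
    qed
  qed
qed

end

section \<open>Approximate identities: one-sided bumps and the multipliers
  \<open>rho\<close>\<close>

definition tent :: "real \<Rightarrow> real" where
  "tent t = max 0 (1 - \<bar>t - 1\<bar>)"

text \<open>The support is contained in \<open>[0, 2 / (n + 1)]\<close>, on the right of the origin,
  because only translations to the right are among the generators. Dividing by the integral of
  \<open>tent\<close> gives total mass 1.\<close>

definition bump :: "nat \<Rightarrow> real \<Rightarrow> real" where
  "bump n t = real (Suc n) * tent (real (Suc n) * t) / (LINT t|lborel. tent t)"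

lemma tent_props: "0 \<le> tent t" "tent t \<le> 1" "t < 0 \<Longrightarrow> tent t = 0" "t > 2 \<Longrightarrow> tent t = 0" "continuous_on S tent"
  by (auto simp: tent_def intro!: continuous_intros)

lemma tent_measurable [measurable]: "tent \<in> borel_measurable borel"
  by (intro borel_measurable_continuous_onI tent_props)

lemma tent_integrable: "integrable lborel tent"
proof (rule Bochner_Integration.integrable_bound)
  show "integrable lborel (indicator {0..2} :: real \<Rightarrow> real)" by simp
  show "AE x in lborel. norm (tent x) \<le> norm (indicator {0..2} x :: real)"
    using tent_props by (intro AE_I2) (force simp: indicator_def not_le)
qed simp

lemma tent_integral_pos: "0 < (LINT t|lborel. tent t)"
proof -
  have "(LINT t::real|lborel. 1/2 * indicator {1/2..3/2} t) \<le> (LINT t|lborel. tent t)"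
  proof (intro integral_mono tent_integrable)
    show "integrable lborel (\<lambda>t::real. 1/2 * indicator {1/2..3/2} t :: real)"
      by (intro integrable_mult_right integrable_real_indicator) auto
    show "1/2 * indicator {1/2..3/2} t \<le> tent t" for t :: real
    proof (cases "t \<in> {1/2..3/2}")
      case True
      then have "\<bar>t - 1\<bar> \<le> 1/2" unfolding atLeastAtMost_iff by linarith
      then show ?thesis using True by (simp add: tent_def)
    qed (simp add: tent_props)
  qed
  then show ?thesis by simp
qed

lemma bump_props:
  shows "0 \<le> bump n t" "t < 0 \<Longrightarrow> bump n t = 0" "t > 2 \<Longrightarrow> bump n t = 0" "continuous_on S (bump n)"
    "majorant (bump n)" "(LINT t|lborel. bump n t) = 1"
proof -
  have bm [measurable]: "bump n \<in> borel_measurable borel" unfolding bump_def by measurable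
  show 0: "0 \<le> bump n t" for t
    unfolding bump_def using tent_integral_pos tent_props by (intro divide_nonneg_nonneg mult_nonneg_nonneg) auto
  show "t < 0 \<Longrightarrow> bump n t = 0"
    unfolding bump_def by (subst tent_props(3)) (auto simp: mult_pos_neg simp del: of_nat_Suc)
  show "bump n t = 0" if "t > 2"
  proof -
    have "1 * 2 < real (Suc n) * t" by (rule mult_le_less_imp_less) (use that in auto)
    then show ?thesis unfolding bump_def by (subst tent_props(4)) auto
  qed
  show "continuous_on S (bump n)"
    unfolding bump_def using tent_integral_pos
    by (intro continuous_intros continuous_on_compose2[OF tent_props(5)[of UNIV]]) auto
  have i: "integrable lborel (\<lambda>t. tent (real (Suc n) * t))"
    using lborel_integrable_real_affine[OF tent_integrable, of "real (Suc n)" 0] by simp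
  then have bi: "integrable lborel (bump n)" unfolding bump_def by simp
  have "bump n t \<le> real (Suc n) * 1 / (LINT t|lborel. tent t)" for t
    unfolding bump_def using tent_integral_pos tent_props by (intro divide_right_mono mult_left_mono) auto
  then show "majorant (bump n)" using 0 bi by (auto simp: majorant_def)
  have I: "real (Suc n) * (LINT t|lborel. tent (real (Suc n) * t)) = (LINT t|lborel. tent t)"
    using lborel_integral_real_affine[of "real (Suc n)" tent 0] by simp
  show "(LINT t|lborel. bump n t) = 1"
    unfolding bump_def integral_divide_zero integral_mult_right_zero I
    using tent_integral_pos by simp
qed

lemma bump_measurable [measurable]: "bump n \<in> borel_measurable borel"
  by (intro borel_measurable_continuous_onI bump_props)

definition bump_op :: "nat \<Rightarrow> (real \<Rightarrow> complex) \<Rightarrow> real \<Rightarrow> complex" where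
  "bump_op n = kop (\<lambda>x y. complex_of_real (bump n (x - y)))"

lemma bump_dominated: "dominated_kernel (bump n) (\<lambda>x y. complex_of_real (bump n (x - y)))"
  by (rule dominated_convolution) (auto simp: bump_props)

lemma bump_op_bop: "p > 1 \<Longrightarrow> bop p 1 (bump_op n)"
  using kop_bop[OF _ bump_dominated[of n], of p] by (simp add: bump_op_def bump_props)

lemma bump_op_limit:
  assumes p: "p > 1" and "LpF p f"
  shows "(\<lambda>n. Np p (\<lambda>x. bump_op n f x - f x)) \<longlonglongrightarrow> 0"
proof (rule bop_limit_dense[where \<Psi>="\<lambda>f. f" and C=1])
  show "bop p 1 (\<lambda>f. f)" by (rule bopI) auto
  fix f :: "real \<Rightarrow> complex" and R
  assume f: "continuous_on UNIV f" "\<And>x. R < \<bar>x\<bar> \<Longrightarrow> f x = 0" "LpF p f"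
  obtain D where D: "\<And>x. cmod (f x) \<le> D" "D \<ge> 0" using compact_support_bound[OF f(1,2)] by blast
  have [measurable]: "f \<in> borel_measurable borel" using f by (simp add: LpF_def)
  let ?I = "LINT t|lborel. tent t"
  \<comment> \<open>Rescaling moves \<open>n\<close> from the weight into the argument of
    \<open>f\<close>, so continuity of \<open>f\<close> yields the pointwise limit by dominated
    convergence.\<close>
  have eq: "bump_op n f x = (LINT u|lborel. complex_of_real (tent u / ?I) * f (x - u / real (Suc n)))" for n x
  proof -
    have "bump_op n f x = (LINT s|lborel. complex_of_real (bump n s) * f (x - s))"
      unfolding bump_op_def kop_def using lborel_integral_real_affine[of "-1" "\<lambda>t. complex_of_real (bump n t) * f (x - t)" x] by simp
    also have "\<dots> = (1 / real (Suc n)) *\<^sub>R (LINT u|lborel. complex_of_real (bump n (u / real (Suc n))) * f (x - u / real (Suc n)))"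
      using lborel_integral_real_affine[of "1 / real (Suc n)" "\<lambda>t. complex_of_real (bump n t) * f (x - t)" 0] by simp
    also have "\<dots> = (LINT u|lborel. (1 / real (Suc n)) *\<^sub>R (complex_of_real (bump n (u / real (Suc n))) * f (x - u / real (Suc n))))"
      by simp
    also have "\<dots> = (LINT u|lborel. complex_of_real (tent u / ?I) * f (x - u / real (Suc n)))"
      by (intro Bochner_Integration.integral_cong refl) (simp add: bump_def scaleR_conv_of_real del: of_nat_Suc)
    finally show ?thesis .
  qed
  show "(\<lambda>n. Np p (\<lambda>x. bump_op n f x - f x)) \<longlonglongrightarrow> 0"
  proof (rule LpF_dominated(3)[where w="\<lambda>x. D * indicator {-(R + 2)..R + 2} x" and f="\<lambda>n. bump_op n f"])
    show "bump_op n f \<in> borel_measurable borel" for n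
      using kop_dominated(3)[OF p bump_dominated f(3)] by (simp add: bump_op_def)
    show "AE x in lborel. cmod (bump_op n f x) \<le> D * indicator {-(R + 2)..R + 2} x" for n
    proof (rule AE_I2)
      fix x
      show "cmod (bump_op n f x) \<le> D * indicator {-(R + 2)..R + 2} x"
      proof (cases "x \<in> {-(R + 2)..R + 2}")
        case True
        have "cmod (bump_op n f x) \<le> (LINT y|lborel. bump n (x - y) * cmod (f y))"
          using kop_dominated(2)[OF p bump_dominated f(3)] by (simp add: bump_op_def)
        also have "\<dots> \<le> (LINT y|lborel. bump n (x - y) * D)"
          by (intro integral_mono majorant_mult_LpF(2)[OF p majorant_shift[OF bump_props(5)] f(3)] mult_left_mono D bump_props)
            (simp add: integrable_reflect majorantD bump_props)
        also have "\<dots> = D" by (simp add: integrable_reflect(2) majorantD bump_props)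
        finally show ?thesis using True by simp
      next
        case False
        have "complex_of_real (bump n (x - y)) * f y = 0" for y
        proof (cases "x - y < 0 \<or> x - y > 2")
          case out: False
          then have "R < \<bar>y\<bar>" using False unfolding atLeastAtMost_iff by linarith
          then show ?thesis by (simp add: f(2))
        qed (use bump_props(2,3)[of "x - y" n] in auto)
        then have "bump_op n f x = 0" unfolding bump_op_def kop_def by (simp only: integral_zero)
        then show ?thesis using D(2) by simp
      qed
    qed
    show "AE x in lborel. (\<lambda>n. bump_op n f x) \<longlonglongrightarrow> f x"
    proof (rule AE_I2)
      fix x
      have "(\<lambda>n. bump_op n f x) \<longlonglongrightarrow> (LINT u|lborel. complex_of_real (tent u / ?I) * f x)"
        unfolding eq
      proof (rule integral_dominated_convergence[where w="\<lambda>u. tent u / ?I * D"])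
        show "integrable lborel (\<lambda>u. tent u / ?I * D)" using tent_integrable by simp
        show "AE u in lborel. (\<lambda>n. complex_of_real (tent u / ?I) * f (x - u / real (Suc n))) \<longlonglongrightarrow> complex_of_real (tent u / ?I) * f x"
        proof (intro AE_I2 tendsto_mult tendsto_const)
          fix u
          have "(\<lambda>n. x - u * inverse (real (Suc n))) \<longlonglongrightarrow> x - u * 0"
            by (intro tendsto_intros LIMSEQ_inverse_real_of_nat)
          then have "(\<lambda>n. x - u / real (Suc n)) \<longlonglongrightarrow> x" by (simp add: divide_inverse)
          then show "(\<lambda>n. f (x - u / real (Suc n))) \<longlonglongrightarrow> f x"
            using f(1) by (intro isCont_tendsto_compose[of x f]) (auto simp: continuous_on_eq_continuous_at)
        qed
        show "AE u in lborel. norm (complex_of_real (tent u / ?I) * f (x - u / real (Suc n))) \<le> tent u / ?I * D" for n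
          unfolding norm_mult norm_of_real
          using tent_props(1) tent_integral_pos D by (intro AE_I2 mult_mono) auto
      qed measurable
      then show "(\<lambda>n. bump_op n f x) \<longlonglongrightarrow> f x" using tent_integral_pos by simp
    qed
  qed (use p f(3) integrable_box_powr in \<open>auto simp: LpF_def\<close>)
qed (use assms bump_op_bop in auto)

text \<open>A multiple of the resolvent with pole \<open>- \<i> * (n + 1)\<close>. Each power
  contributes decay of order \<open>1 / \<bar>x\<bar>\<close>, and the pointwise limit 1 makes the
  regularisation removable.\<close>

definition rho :: "nat \<Rightarrow> real \<Rightarrow> complex" where
  "rho n x = 1 / (1 - \<i> * complex_of_real (x / real (Suc n)))"

lemma rho_denominator: "1 + \<bar>u\<bar> \<le> 2 * cmod (1 - \<i> * complex_of_real u)" "1 \<le> cmod (1 - \<i> * complex_of_real u)"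
proof -
  have "\<bar>Re (1 - \<i> * complex_of_real u)\<bar> \<le> cmod (1 - \<i> * complex_of_real u)"
    "\<bar>Im (1 - \<i> * complex_of_real u)\<bar> \<le> cmod (1 - \<i> * complex_of_real u)"
    by (rule abs_Re_le_cmod abs_Im_le_cmod)+
  then show "1 + \<bar>u\<bar> \<le> 2 * cmod (1 - \<i> * complex_of_real u)" "1 \<le> cmod (1 - \<i> * complex_of_real u)" by simp_all
qed

lemma rho_measurable [measurable]: "rho n \<in> borel_measurable borel"
  unfolding rho_def by measurable

lemma rho_le_1: "cmod (rho n x) \<le> 1"
  using rho_denominator(2)[of "x / real (Suc n)"] by (simp only: rho_def norm_divide norm_one) simp

lemma rho_limit: "(\<lambda>n. rho n x) \<longlonglongrightarrow> 1"
proof -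
  have "(\<lambda>n. 1 / (1 - \<i> * complex_of_real (x * inverse (real (Suc n))))) \<longlonglongrightarrow> 1 / (1 - \<i> * complex_of_real (x * 0))"
    by (intro tendsto_intros LIMSEQ_inverse_real_of_nat) auto
  then show ?thesis by (simp add: rho_def divide_inverse)
qed

lemma rho_resolvent: "rho n x = (\<i> * complex_of_real (real (Suc n))) * (1 / (complex_of_real x - (- \<i> * complex_of_real (real (Suc n)))))"
proof -
  define N where "N = real (Suc n)"
  have N: "N > 0" by (simp add: N_def)
  have "1 - \<i> * complex_of_real (x / N) \<noteq> 0" using rho_denominator(2)[of "x / N"] by auto
  moreover have "complex_of_real x - (- \<i> * complex_of_real N) \<noteq> 0" using N by (auto simp: complex_eq_iff)
  ultimately show ?thesis
    unfolding rho_def N_def[symmetric] using N by (simp add: field_simps)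
qed

lemma (in closed_algebra) inA_rho: "inA p A (mop (rho n))"
  unfolding rho_resolvent by (rule inA_mop_scale[OF inA_resolvent]) simp

section \<open>Boundary values of Hardy functions are annihilated by resolvent products\<close>

lemma integral_inverse_square:
  "integrable lborel (\<lambda>x::real. 1 / (1 + x\<^sup>2))" "(LINT x::real|lborel. 1 / (1 + x\<^sup>2)) = pi"
proof -
  have A: "((arctan \<circ> real_of_ereal) \<longlongrightarrow> - (pi / 2)) (at_right (-\<infinity>))"
    unfolding ereal_tendsto_simps by (rule tendsto_arctan_at_bot)
  have B: "((arctan \<circ> real_of_ereal) \<longlongrightarrow> pi / 2) (at_left \<infinity>)"
    unfolding ereal_tendsto_simps by (rule tendsto_arctan_at_top)
  have nz: "1 + x\<^sup>2 \<noteq> 0" for x :: real by (metis add_pos_nonneg zero_less_one zero_le_power2 less_irrefl)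
  have "set_integrable lborel (einterval (-\<infinity>) \<infinity>) (\<lambda>x::real. 1 / (1 + x\<^sup>2))"
    "(LBINT x=-\<infinity>..\<infinity>. 1 / (1 + x\<^sup>2)) = pi / 2 - (- (pi / 2))"
    by (rule interval_integral_FTC_nonneg[OF _ _ _ _ A B];
        auto intro!: derivative_eq_intros continuous_intros simp: nz inverse_eq_divide)+
  then show "integrable lborel (\<lambda>x::real. 1 / (1 + x\<^sup>2))" "(LINT x::real|lborel. 1 / (1 + x\<^sup>2)) = pi"
    by (simp_all add: set_integrable_def interval_lebesgue_integral_def set_lebesgue_integral_def)
qed

text \<open>Two lower bounds are combined: \<open>\<bar>Im w\<bar>\<close> for bounded
  \<open>x\<close> and \<open>\<bar>x\<bar> - cmod w\<close> far out. The constant is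
  \<open>\<bar>Im w\<bar> / (\<bar>Im w\<bar> + 1 + cmod w)\<close>.\<close>

lemma resolvent_lower_bound:
  assumes "Im w \<noteq> 0"
  obtains c where "c > 0" "\<And>x. c * (1 + \<bar>x\<bar>) \<le> cmod (complex_of_real x - w)"
proof -
  let ?D = "\<bar>Im w\<bar> + 1 + cmod w"
  have D: "?D > 0" using assms by (intro add_pos_nonneg) auto
  have "\<bar>Im w\<bar> / ?D * (1 + \<bar>x\<bar>) \<le> cmod (complex_of_real x - w)" for x
  proof -
    have 1: "\<bar>Im w\<bar> \<le> cmod (complex_of_real x - w)"
      using abs_Im_le_cmod[of "complex_of_real x - w"] by simp
    have 2: "\<bar>x\<bar> \<le> cmod (complex_of_real x - w) + cmod w"
      using norm_triangle_ineq[of "complex_of_real x - w" w] by simp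
    have "\<bar>Im w\<bar> * (1 + \<bar>x\<bar>) \<le> \<bar>Im w\<bar> * (cmod (complex_of_real x - w) + (cmod w + 1))"
      using 2 by (intro mult_left_mono) auto
    also have "\<dots> = \<bar>Im w\<bar> * cmod (complex_of_real x - w) + \<bar>Im w\<bar> * (cmod w + 1)"
      by (rule distrib_left)
    also have "\<dots> \<le> \<bar>Im w\<bar> * cmod (complex_of_real x - w) + cmod (complex_of_real x - w) * (cmod w + 1)"
      using 1 by (intro add_left_mono mult_right_mono) auto
    also have "\<dots> = cmod (complex_of_real x - w) * ?D" by (simp add: algebra_simps)
    finally show ?thesis using D by (simp add: pos_divide_le_eq)
  qed
  then show ?thesis using assms D by (intro that[of "\<bar>Im w\<bar> / ?D"]) auto
qed

text \<open>A single resolvent decays like \<open>1 / \<bar>x\<bar>\<close> and is not integrable;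
  two of them decay like \<open>1 / (1 + x\<^sup>2)\<close>. This is why Hardy functions are tested
  against products of two.\<close>

lemma resolvent_product_majorant:
  assumes "Im w \<noteq> 0" "Im w' \<noteq> 0"
  shows "majorant (\<lambda>x. cmod (1 / ((complex_of_real x - w) * (complex_of_real x - w'))))"
proof -
  obtain c where c: "c > 0" "\<And>x. c * (1 + \<bar>x\<bar>) \<le> cmod (complex_of_real x - w)"
    using resolvent_lower_bound[OF assms(1)] by blast
  obtain d where d: "d > 0" "\<And>x. d * (1 + \<bar>x\<bar>) \<le> cmod (complex_of_real x - w')"
    using resolvent_lower_bound[OF assms(2)] by blast
  have le: "cmod (1 / ((complex_of_real x - w) * (complex_of_real x - w'))) \<le> 1 / (c * d) * (1 / (1 + x\<^sup>2))" for x
  proof -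
    have "(c * d) * (1 + x\<^sup>2) \<le> (c * d) * ((1 + \<bar>x\<bar>) * (1 + \<bar>x\<bar>))"
      using c d by (intro mult_left_mono) (auto simp: algebra_simps power2_eq_square)
    also have "\<dots> = (c * (1 + \<bar>x\<bar>)) * (d * (1 + \<bar>x\<bar>))" by simp
    also have "\<dots> \<le> cmod (complex_of_real x - w) * cmod (complex_of_real x - w')"
      using c d by (intro mult_mono) auto
    finally have le: "(c * d) * (1 + x\<^sup>2) \<le> cmod (complex_of_real x - w) * cmod (complex_of_real x - w')" .
    have "0 < (c * d) * (1 + x\<^sup>2)" using c d by (intro mult_pos_pos add_pos_nonneg) auto
    with le have "1 / (cmod (complex_of_real x - w) * cmod (complex_of_real x - w')) \<le> 1 / ((c * d) * (1 + x\<^sup>2))"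
      by (intro divide_left_mono) (auto intro: mult_pos_pos)
    then show ?thesis by (simp add: norm_divide norm_mult)
  qed
  have le2: "1 / (c * d) * (1 / (1 + x\<^sup>2)) \<le> 1 / (c * d)" for x :: real
  proof -
    have "1 / (1 + x\<^sup>2) \<le> 1" by (simp add: add_pos_nonneg divide_le_eq_1)
    then show ?thesis using c d mult_left_mono[of "1 / (1 + x\<^sup>2)" 1 "1 / (c * d)"] by simp
  qed
  show ?thesis
    unfolding majorant_def
  proof (intro conjI allI exI)
    show "integrable lborel (\<lambda>x. cmod (1 / ((complex_of_real x - w) * (complex_of_real x - w'))))"
    proof (rule Bochner_Integration.integrable_bound)
      show "integrable lborel (\<lambda>x::real. 1 / (c * d) * (1 / (1 + x\<^sup>2)))"
        by (intro integrable_mult_right integral_inverse_square)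
      show "AE x in lborel. norm (cmod (1 / ((complex_of_real x - w) * (complex_of_real x - w')))) \<le> norm (1 / (c * d) * (1 / (1 + x\<^sup>2)))"
        by (intro AE_I2) (simp only: real_norm_def abs_norm_cancel, rule order_trans[OF le abs_ge_self])
    qed measurable
    show "cmod (1 / ((complex_of_real x - w) * (complex_of_real x - w'))) \<le> 1 / (c * d)" for x
      by (rule order_trans[OF le le2])
  qed auto
qed

lemma measurable_holomorphic_upper:
  assumes "h holomorphic_on {z. Im z > 0}"
  shows "(\<lambda>(x, y). if y > 0 then h (Complex x y) else 0) \<in> borel_measurable (borel \<Otimes>\<^sub>M borel)"
proof -
  have op: "open {z. Im z > 0}" by (rule open_halfspace_Im_gt)
  have [measurable]: "(\<lambda>z. indicator {z. Im z > 0} z *\<^sub>R h z) \<in> borel_measurable borel"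
    using op by (intro borel_measurable_continuous_on_indicator holomorphic_on_imp_continuous_on assms) auto
  have "(\<lambda>(x, y). (\<lambda>z. indicator {z. Im z > 0} z *\<^sub>R h z) (complex_of_real x + \<i> * complex_of_real y)) \<in> borel_measurable (borel \<Otimes>\<^sub>M borel)"
    by measurable
  also have "(\<lambda>(x, y). (\<lambda>z. indicator {z. Im z > 0} z *\<^sub>R h z) (complex_of_real x + \<i> * complex_of_real y)) =
    (\<lambda>(x, y). if y > 0 then h (Complex x y) else 0)"
    by (auto simp: fun_eq_iff Complex_eq)
  finally show ?thesis .
qed

lemma measurable_horizontal:
  assumes "h holomorphic_on {z. Im z > 0}" "y > 0"
  shows "(\<lambda>x. h (Complex x y)) \<in> borel_measurable borel"
proof -
  have "(\<lambda>x. (\<lambda>(x, y). if y > 0 then h (Complex x y) else 0) (x, y)) \<in> borel_measurable borel"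
    by (rule measurable_compose[OF _ measurable_holomorphic_upper[OF assms(1)]]) measurable
  then show ?thesis using assms(2) by simp
qed

text \<open>Cauchy's theorem on long rectangles: the contributions of the vertical sides are
  integrable in the position of the side, so they cannot stay away from 0.\<close>

lemma strip_integral_eq:
  assumes hol: "h holomorphic_on {z. Im z > 0}" and e: "0 < e" "e \<le> Y"
    and int: "\<And>y. e \<le> y \<Longrightarrow> y \<le> Y \<Longrightarrow> integrable lborel (\<lambda>x. h (Complex x y))"
    and K: "\<And>y. e \<le> y \<Longrightarrow> y \<le> Y \<Longrightarrow> (LINT x|lborel. cmod (h (Complex x y))) \<le> K"
  shows "(LINT x|lborel. h (Complex x e)) = (LINT x|lborel. h (Complex x Y))"
proof -
  let ?S = "{z. Im z > 0}"
  have S: "convex ?S" "open ?S" by (rule convex_halfspace_Im_gt open_halfspace_Im_gt)+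
  have Y: "Y > 0" using e by simp
  \<comment> \<open>On the convex half plane a primitive does the work of Cauchy's theorem: each
    side of a rectangle contributes a difference of two values of \<open>G\<close>.\<close>
  obtain G where G: "\<And>z. z \<in> ?S \<Longrightarrow> (G has_field_derivative h z) (at z)"
    using holomorphic_convex_primitive'[OF S(1,2) hol] S(2) by (auto simp: at_within_open[OF _ S(2)])
  have cont: "continuous_on ?S h" using hol by (rule holomorphic_on_imp_continuous_on)
  define hm where "hm = (\<lambda>(x, y). if y > 0 then h (Complex x y) else 0)"
  have [measurable]: "hm \<in> borel_measurable (borel \<Otimes>\<^sub>M borel)"
    unfolding hm_def by (rule measurable_holomorphic_upper[OF hol])
  define V where "V R = (LINT y|lborel. indicator {e..Y} y * cmod (hm (R, y)))" for R
  have horiz: "(LINT x|lborel. indicator {-R..R} x *\<^sub>R h (Complex x y)) = G (Complex R y) - G (Complex (-R) y)"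
    if "R \<ge> 0" "y > 0" for R y
  proof -
    have "has_bochner_integral lborel (\<lambda>x. indicator {-R..R} x *\<^sub>R h (Complex x y)) (G (Complex R y) - G (Complex (-R) y))"
    proof (rule has_bochner_integral_FTC_Icc)
      show "- R \<le> R" using that by simp
      show "((\<lambda>x. G (Complex x y)) has_vector_derivative h (Complex x y)) (at x within {- R..R})" for x
      proof -
        have "((\<lambda>x. complex_of_real x + \<i> * complex_of_real y) has_vector_derivative 1) (at x within {- R..R})"
          by (auto intro!: derivative_eq_intros)
        then have "((\<lambda>x. Complex x y) has_vector_derivative 1) (at x within {- R..R})"
          by (simp add: Complex_eq)
        from field_vector_diff_chain_within[OF this, of G "h (Complex x y)"] G[of "Complex x y"] that
        show ?thesis by (auto simp: o_def has_field_derivative_at_within)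
      qed
      show "continuous_on {- R..R} (\<lambda>x. h (Complex x y))"
        using that by (intro continuous_on_compose2[OF cont]) (auto simp: Complex_eq intro!: continuous_intros)
    qed
    then show ?thesis by (rule has_bochner_integral_integral_eq)
  qed
  have vert: "cmod (G (Complex R Y) - G (Complex R e)) \<le> V R" for R
  proof -
    have "has_bochner_integral lborel (\<lambda>y. indicator {e..Y} y *\<^sub>R (\<i> * h (Complex R y))) (G (Complex R Y) - G (Complex R e))"
    proof (rule has_bochner_integral_FTC_Icc[where F="\<lambda>y. G (Complex R y)"])
      show "((\<lambda>y. G (Complex R y)) has_vector_derivative \<i> * h (Complex R y)) (at y within {e..Y})" if "e \<le> y" for y
      proof -
        have "((\<lambda>y. complex_of_real R + \<i> * complex_of_real y) has_vector_derivative \<i>) (at y within {e..Y})"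
          by (auto intro!: derivative_eq_intros simp: has_vector_derivative_of_real)
        then have "((\<lambda>y. Complex R y) has_vector_derivative \<i>) (at y within {e..Y})"
          by (simp add: Complex_eq)
        from field_vector_diff_chain_within[OF this, of G "h (Complex R y)"] G[of "Complex R y"] that e
        show ?thesis by (auto simp: o_def has_field_derivative_at_within)
      qed
      show "continuous_on {e..Y} (\<lambda>y. \<i> * h (Complex R y))"
        using e by (intro continuous_intros continuous_on_compose2[OF cont]) (auto simp: Complex_eq intro!: continuous_intros)
    qed (use e in auto)
    then have "G (Complex R Y) - G (Complex R e) = (LINT y|lborel. indicator {e..Y} y *\<^sub>R (\<i> * h (Complex R y)))"
      by (simp add: has_bochner_integral_integral_eq)
    also have "cmod \<dots> \<le> (LINT y|lborel. norm (indicator {e..Y} y *\<^sub>R (\<i> * h (Complex R y))))"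
      by (rule integral_norm_bound)
    also have "\<dots> = V R" unfolding V_def
      by (intro Bochner_Integration.integral_cong refl) (use e in \<open>auto simp: hm_def norm_mult indicator_def\<close>)
    finally show ?thesis .
  qed
  have Vint: "integrable lborel V"
  proof -
    have pair: "integrable (lborel \<Otimes>\<^sub>M lborel) (\<lambda>(y, x). indicator {e..Y} y * cmod (hm (x, y)))"
    proof (rule lborel_pair.Fubini_integrable)
      have eq: "(LINT x|lborel. norm (indicator {e..Y} y * cmod (hm (x, y)))) = indicator {e..Y} y * (LINT x|lborel. cmod (h (Complex x y)))" for y
        using e by (auto simp: hm_def indicator_def)
      have "integrable lborel (\<lambda>y. LINT x|lborel. norm (indicator {e..Y} y * cmod (hm (x, y))))"
      proof (rule Bochner_Integration.integrable_bound)
        show "integrable lborel (\<lambda>y. K * indicator {e..Y} y :: real)" using e by simp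
        show "AE y in lborel. norm (LINT x|lborel. norm (indicator {e..Y} y * cmod (hm (x, y)))) \<le> norm (K * indicator {e..Y} y)"
        proof (rule AE_I2)
          fix y
          show "norm (LINT x|lborel. norm (indicator {e..Y} y * cmod (hm (x, y)))) \<le> norm (K * indicator {e..Y} y)"
            unfolding eq using K[of y] by (auto simp: indicator_def)
        qed
      qed measurable
      then show "integrable lborel (\<lambda>y. LINT x|lborel. norm (case (y, x) of (y, x) \<Rightarrow> indicator {e..Y} y * cmod (hm (x, y))))" by simp
      have "integrable lborel (\<lambda>x. indicator {e..Y} y * cmod (hm (x, y)))" for y
      proof (cases "y \<in> {e..Y}")
        case True
        then have "(\<lambda>x. indicator {e..Y} y * cmod (hm (x, y))) = (\<lambda>x. cmod (h (Complex x y)))"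
          using e by (auto simp: hm_def)
        then show ?thesis using int[of y] True by simp
      qed simp
      then show "AE y in lborel. integrable lborel (\<lambda>x. case (y, x) of (y, x) \<Rightarrow> indicator {e..Y} y * cmod (hm (x, y)))" by simp
    qed measurable
    from lborel_pair.integrable_snd[OF pair] show ?thesis unfolding V_def by simp
  qed
  define W where "W R = V R + V (- R)" for R
  have Wint: "integrable lborel W"
    unfolding W_def using Vint integrable_reflect(1)[OF Vint, of 0] by simp
  have W0: "W R \<ge> 0" for R unfolding W_def V_def by (intro add_nonneg_nonneg integral_nonneg) auto
  define L where "L = (LINT x|lborel. h (Complex x e)) - (LINT x|lborel. h (Complex x Y))"
  define LR where "LR n = (LINT x|lborel. indicator {-real n..real n} x *\<^sub>R h (Complex x e)) - (LINT x|lborel. indicator {-real n..real n} x *\<^sub>R h (Complex x Y))" for n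
  have lim1: "((\<lambda>R. LINT x|lborel. indicator {-R..R} x *\<^sub>R h (Complex x y)) \<longlongrightarrow> (LINT x|lborel. h (Complex x y))) at_top"
    if "e \<le> y" "y \<le> Y" for y
  proof (rule integral_dominated_convergence_at_top)
    have m: "(\<lambda>x. h (Complex x y)) \<in> borel_measurable borel" using int[OF that] by auto
    show "(\<lambda>x. h (Complex x y)) \<in> borel_measurable lborel" using m by simp
    show "(\<lambda>x. indicator {- R..R} x *\<^sub>R h (Complex x y)) \<in> borel_measurable lborel" for R using m by measurable
    show "integrable lborel (\<lambda>x. cmod (h (Complex x y)))" using int[OF that] by simp
    show "\<forall>\<^sub>F R in at_top. AE x in lborel. norm (indicator {- R..R} x *\<^sub>R h (Complex x y)) \<le> cmod (h (Complex x y))"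
      by (auto simp: indicator_def)
    show "AE x in lborel. ((\<lambda>R. indicator {- R..R} x *\<^sub>R h (Complex x y)) \<longlongrightarrow> h (Complex x y)) at_top"
    proof (intro AE_I2 tendsto_eventually)
      fix x
      show "\<forall>\<^sub>F R in at_top. indicator {- R..R} x *\<^sub>R h (Complex x y) = h (Complex x y)"
        using eventually_ge_at_top[of "\<bar>x\<bar>"] by eventually_elim (auto simp: indicator_def)
    qed
  qed
  have lim: "((\<lambda>R. (LINT x|lborel. indicator {-R..R} x *\<^sub>R h (Complex x e)) - (LINT x|lborel. indicator {-R..R} x *\<^sub>R h (Complex x Y))) \<longlongrightarrow> L) at_top"
    unfolding L_def by (intro tendsto_diff lim1) (use e in auto)
  \<comment> \<open>Otherwise \<open>cmod L / 2 \<le> W R\<close> from some \<open>R0\<close> on,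
    and the integral of \<open>W\<close> over \<open>{R0..R0 + real n}\<close> would exceed every
    bound, although \<open>W\<close> is integrable.\<close>
  have "L = 0"
  proof (rule ccontr)
    assume "L \<noteq> 0"
    then have pos: "cmod L / 2 > 0" by simp
    have "\<forall>\<^sub>F R in at_top. cmod L / 2 \<le> W R"
      using tendstoD[OF lim pos] eventually_ge_at_top[of 0]
    proof eventually_elim
      case (elim R)
      have "(LINT x|lborel. indicator {-R..R} x *\<^sub>R h (Complex x e)) - (LINT x|lborel. indicator {-R..R} x *\<^sub>R h (Complex x Y)) =
        (G (Complex (-R) Y) - G (Complex (-R) e)) - (G (Complex R Y) - G (Complex R e))"
        using horiz[OF elim(2) e(1)] horiz[OF elim(2) Y] by simp
      then have "cmod ((LINT x|lborel. indicator {-R..R} x *\<^sub>R h (Complex x e)) - (LINT x|lborel. indicator {-R..R} x *\<^sub>R h (Complex x Y))) \<le> W R"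
        using norm_triangle_ineq4[of "G (Complex (-R) Y) - G (Complex (-R) e)" "G (Complex R Y) - G (Complex R e)"] vert[of R] vert[of "-R"]
        unfolding W_def by simp
      moreover have "cmod L - cmod ((LINT x|lborel. indicator {-R..R} x *\<^sub>R h (Complex x e)) - (LINT x|lborel. indicator {-R..R} x *\<^sub>R h (Complex x Y))) < cmod L / 2"
        using elim(1) norm_triangle_ineq2[of L "(LINT x|lborel. indicator {-R..R} x *\<^sub>R h (Complex x e)) - (LINT x|lborel. indicator {-R..R} x *\<^sub>R h (Complex x Y))"]
        by (simp add: dist_norm norm_minus_commute)
      ultimately show ?case by linarith
    qed
    then obtain R0 where R0: "\<And>R. R \<ge> R0 \<Longrightarrow> cmod L / 2 \<le> W R" by (auto simp: eventually_at_top_linorder)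
    obtain n :: nat where n: "(LINT R|lborel. W R) < real n * (cmod L / 2)"
      using reals_Archimedean3[OF pos] by blast
    have "(LINT R|lborel. cmod L / 2 * indicator {R0..R0 + real n} R) \<le> (LINT R|lborel. W R)"
    proof (intro integral_mono Wint)
      show "integrable lborel (\<lambda>R. cmod L / 2 * indicator {R0..R0 + real n} R)" by simp
      show "cmod L / 2 * indicator {R0..R0 + real n} R \<le> W R" for R
        using R0[of R] W0[of R] by (auto simp: indicator_def)
    qed
    then show False using n by (simp add: mult.commute)
  qed
  then show ?thesis by (simp add: L_def)
qed

lemma Hardy_upper_LpF:
  assumes p: "p > 1" and F: "F \<in> Hardy_upper p"
  obtains C where "\<And>y. y > 0 \<Longrightarrow> LpF p (\<lambda>x. F (Complex x y))" "\<And>y. y > 0 \<Longrightarrow> Np p (\<lambda>x. F (Complex x y)) \<le> C"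
proof -
  let ?N = "\<lambda>y. \<integral>\<^sup>+x. ennreal (cmod (F (Complex x y)) powr p) \<partial>lborel"
  have hol: "F holomorphic_on {z. Im z > 0}" and fin: "(SUP y\<in>{0<..}. ?N y) < \<infinity>"
    using F by (auto simp: Hardy_upper_def)
  obtain C where C: "(SUP y\<in>{0<..}. ?N y) = ennreal C" "C \<ge> 0"
    using fin by (cases "SUP y\<in>{0<..}. ?N y") auto
  have le: "?N y \<le> ennreal C" if "y > 0" for y
    unfolding C(1)[symmetric] using that by (intro SUP_upper) auto
  have L: "LpF p (\<lambda>x. F (Complex x y))" if "y > 0" for y
    unfolding LpF_def
  proof
    show m: "(\<lambda>x. F (Complex x y)) \<in> borel_measurable borel" by (rule measurable_horizontal[OF hol that])
    have "?N y < \<infinity>" using le[OF that] by (simp add: order.strict_trans1)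
    then show "integrable lborel (\<lambda>x. cmod (F (Complex x y)) powr p)"
      using m by (intro integrableI_nonneg) auto
  qed
  have "Np p (\<lambda>x. F (Complex x y)) \<le> C" if "y > 0" for y
  proof -
    have "ennreal (Np p (\<lambda>x. F (Complex x y))) = ?N y"
      unfolding Np_def using L[OF that] by (intro nn_integral_eq_integral[symmetric]) (auto simp: LpF_def)
    then have "ennreal (Np p (\<lambda>x. F (Complex x y))) \<le> ennreal C" using le[OF that] by simp
    then show ?thesis using C(2) by (simp only: ennreal_le_iff)
  qed
  with L show ?thesis by (rule that)
qed

text \<open>Bounded \<open>p\<close>-th powers give uniform integrability when \<open>p > 1\<close>:
  the part of the difference above the level \<open>R\<close> is at most
  \<open>R powr (1 - p)\<close> times its \<open>p\<close>-th power, which is small uniformly in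
  \<open>n\<close>. The part below \<open>R\<close> is treated by dominated convergence. No common
  majorant of the \<open>f n\<close> enters.\<close>

lemma weak_limit_LpF:
  assumes p: "p > 1" and f: "\<And>n. LpF p (f n)" "LpF p g" and C: "\<And>n. Np p (f n) \<le> C"
    and lim: "AE x in lborel. (\<lambda>n. f n x) \<longlonglongrightarrow> g x"
    and m: "majorant m" and u: "u \<in> borel_measurable borel" "\<And>x. cmod (u x) \<le> m x"
  shows "(\<lambda>n. LINT x|lborel. u x * f n x) \<longlonglongrightarrow> (LINT x|lborel. u x * g x)"
proof (rule Lim_null[THEN iffD2], rule tendstoI)
  fix e :: real assume e: "e > 0"
  have [measurable]: "g \<in> borel_measurable borel" "f n \<in> borel_measurable borel" "m \<in> borel_measurable borel" for n
    using f m by (auto simp: LpF_def majorantD)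
  obtain B where B: "\<And>x. m x \<le> B" using m by (auto simp: majorant_def)
  have B0: "B \<ge> 0" using B[of 0] majorantD(2)[OF m, of 0] by simp
  define E where "E = B * (2 powr p * (C + Np p g))"
  have C0: "C \<ge> 0" using C[of 0] Np_nonneg[of p "f 0"] by linarith
  have E0: "E \<ge> 0" unfolding E_def using B0 C0 by (intro mult_nonneg_nonneg add_nonneg_nonneg) auto
  define d where "d n x = f n x - g x" for n x
  have d: "LpF p (d n)" "Np p (d n) \<le> 2 powr p * (C + Np p g)" for n
  proof -
    show "LpF p (d n)" unfolding d_def using p by (intro LpF_diff f) auto
    show "Np p (d n) \<le> 2 powr p * (C + Np p g)"
      unfolding d_def using p C[of n]
      by (intro order_trans[OF LpF_diff(2)[OF _ f]] mult_left_mono add_right_mono) auto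
  qed
  have [measurable]: "d n \<in> borel_measurable borel" for n using d by (simp add: LpF_def)
  have "((\<lambda>R. R powr (1 - p) * E) \<longlongrightarrow> 0 * E) at_top"
    using p by (intro tendsto_intros tendsto_neg_powr filterlim_ident) auto
  then have "\<forall>\<^sub>F R in at_top. R powr (1 - p) * E < e / 2"
    using e by (intro order_tendstoD) auto
  then have "\<forall>\<^sub>F R in at_top. R powr (1 - p) * E < e / 2 \<and> R > 0"
    using eventually_gt_at_top[of 0] by (rule eventually_conj)
  then obtain R where R: "R powr (1 - p) * E < e / 2" "R > 0"
    using eventually_happens'[of "at_top::real filter"] by force
  have key: "t \<le> min t R + R powr (1 - p) * t powr p" if "t \<ge> 0" for t
  proof (cases "t \<le> R")
    case False
    have "t = t powr (1 - p) * t powr p" using False R by (simp flip: powr_add)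
    also have "\<dots> \<le> R powr (1 - p) * t powr p"
      using False R p by (intro mult_right_mono powr_mono2') auto
    finally show ?thesis using False R by simp
  qed auto
  have ev: "(\<lambda>n. LINT x|lborel. m x * min (cmod (d n x)) R) \<longlonglongrightarrow> (LINT x::real|lborel. 0)"
  proof (rule integral_dominated_convergence[where w="\<lambda>x. m x * R"])
    show "integrable lborel (\<lambda>x. m x * R)" using m by (simp add: majorantD)
    show "AE x in lborel. (\<lambda>n. m x * min (cmod (d n x)) R) \<longlonglongrightarrow> 0"
      using lim
    proof eventually_elim
      case (elim x)
      then have "(\<lambda>n. d n x) \<longlonglongrightarrow> 0" unfolding d_def by (rule LIM_zero)
      then have "(\<lambda>n. m x * min (cmod (d n x)) R) \<longlonglongrightarrow> m x * min (cmod 0) R"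
        by (intro tendsto_intros)
      then show ?case using R by simp
    qed
    show "AE x in lborel. norm (m x * min (cmod (d n x)) R) \<le> m x * R" for n
      using R m by (intro AE_I2) (auto simp: abs_mult majorantD intro!: mult_left_mono)
  qed measurable
  then have "\<forall>\<^sub>F n in sequentially. (LINT x|lborel. m x * min (cmod (d n x)) R) < e / 2"
    using e by (intro order_tendstoD) auto
  then show "\<forall>\<^sub>F n in sequentially. dist ((LINT x|lborel. u x * f n x) - (LINT x|lborel. u x * g x)) 0 < e"
  proof eventually_elim
    case (elim n)
    have i1: "integrable lborel (\<lambda>x. m x * min (cmod (d n x)) R)"
      by (rule Bochner_Integration.integrable_bound[where f="\<lambda>x. m x * R"])
        (use R m in \<open>auto simp: abs_mult majorantD intro!: mult_left_mono\<close>)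
    note i2 = majorant_mult_LpF(1)[OF p m d(1)[of n]]
    have "(LINT x|lborel. u x * f n x) - (LINT x|lborel. u x * g x) = (LINT x|lborel. u x * d n x)"
      unfolding d_def by (simp add: right_diff_distrib dominated_mult_LpF(1)[OF p m f(1) u] dominated_mult_LpF(1)[OF p m f(2) u])
    also have "cmod \<dots> \<le> (LINT x|lborel. m x * cmod (d n x))"
      by (rule dominated_mult_LpF(2)[OF p m d(1) u])
    also have "\<dots> \<le> (LINT x|lborel. m x * min (cmod (d n x)) R + R powr (1 - p) * (m x * cmod (d n x) powr p))"
    proof (intro integral_mono)
      show "integrable lborel (\<lambda>x. m x * cmod (d n x))" by (rule majorant_mult_LpF(2)[OF p m d(1)])
      show "m x * cmod (d n x) \<le> m x * min (cmod (d n x)) R + R powr (1 - p) * (m x * cmod (d n x) powr p)" for x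
        using mult_left_mono[OF key[of "cmod (d n x)"], of "m x"] m by (simp add: majorantD algebra_simps)
    qed (use i1 i2 in auto)
    also have "\<dots> = (LINT x|lborel. m x * min (cmod (d n x)) R) + R powr (1 - p) * (LINT x|lborel. m x * cmod (d n x) powr p)"
      using i1 i2 by simp
    also have "(LINT x|lborel. m x * cmod (d n x) powr p) \<le> E"
    proof -
      have "(LINT x|lborel. m x * cmod (d n x) powr p) \<le> (LINT x|lborel. B * cmod (d n x) powr p)"
        using i2 d(1)[of n] B by (intro integral_mono mult_right_mono) (auto simp: LpF_def)
      also have "\<dots> = B * Np p (d n)" by (simp add: Np_def)
      also have "\<dots> \<le> E" unfolding E_def using d(2) B0 by (intro mult_left_mono) auto
      finally show ?thesis .
    qed
    finally have "cmod ((LINT x|lborel. u x * f n x) - (LINT x|lborel. u x * g x)) \<le> (LINT x|lborel. m x * min (cmod (d n x)) R) + R powr (1 - p) * E"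
      by (simp add: mult_left_mono)
    then show ?case using elim R by simp
  qed
qed

text \<open>With \<open>g\<close> the resolvent product, the integral of \<open>g * F\<close> over a
  horizontal line does not depend on the height. Far up it tends to 0, as \<open>g\<close> is at
  most \<open>1 / y\<^sup>2\<close> and the \<open>L\<^sup>p\<close> norms of \<open>F\<close> stay
  bounded; towards the real line it tends to the integral in question.\<close>

lemma Hardy_annihilated:
  assumes p: "p > 1" and F: "F \<in> Hardy_upper p" and f: "LpF p f"
    and bv: "AE x in lborel. ((\<lambda>y. F (Complex x y)) \<longlongrightarrow> f x) (at_right 0)"
    and w: "Im w < 0" "Im w' < 0"
  shows "(LINT x|lborel. 1 / ((complex_of_real x - w) * (complex_of_real x - w')) * f x) = 0"
proof -
  obtain C where C: "\<And>y. y > 0 \<Longrightarrow> LpF p (\<lambda>x. F (Complex x y))" "\<And>y. y > 0 \<Longrightarrow> Np p (\<lambda>x. F (Complex x y)) \<le> C"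
    using Hardy_upper_LpF[OF p F] by blast
  have hol: "F holomorphic_on {z. Im z > 0}" using F by (simp add: Hardy_upper_def)
  define g where "g z = 1 / ((z - w) * (z - w'))" for z
  define m where "m x = cmod (g (complex_of_real x))" for x
  have m: "majorant m" unfolding m_def g_def using w by (intro resolvent_product_majorant) auto
  obtain B where B: "\<And>x. m x \<le> B" using m by (auto simp: majorant_def)
  have nz: "z - w \<noteq> 0" "z - w' \<noteq> 0" if "Im z \<ge> 0" for z using that w by auto
  have ghol: "g holomorphic_on {z. Im z > 0}"
    unfolding g_def using nz by (auto intro!: holomorphic_intros simp: less_imp_le)
  have up: "cmod (complex_of_real x - a) \<le> cmod (Complex x y - a)" "cmod (complex_of_real x - a) > 0" "y \<le> cmod (Complex x y - a)" if "Im a < 0" "y \<ge> 0" for x y a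
  proof -
    have "(Im a)\<^sup>2 \<le> (y - Im a)\<^sup>2" using that power_mono[of "- Im a" "y - Im a" 2] by simp
    then show "cmod (complex_of_real x - a) \<le> cmod (Complex x y - a)" by (simp add: cmod_def)
    show "cmod (complex_of_real x - a) > 0" using that by (auto simp: complex_eq_iff)
    show "y \<le> cmod (Complex x y - a)" using abs_Im_le_cmod[of "Complex x y - a"] that by simp
  qed
  have gm: "cmod (g (Complex x y)) \<le> m x" if "y \<ge> 0" for x y
    unfolding m_def g_def norm_divide norm_mult norm_one using up[OF w(1) that, of x] up[OF w(2) that, of x]
    by (intro divide_left_mono mult_mono mult_pos_pos) (auto intro: order.strict_trans2)
  have gY: "cmod (g (Complex x y)) \<le> 1 / (y * y)" if "y > 0" for x y
  proof -
    have "y * y \<le> cmod (Complex x y - w) * cmod (Complex x y - w')"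
      using up(3)[OF w(1), of y x] up(3)[OF w(2), of y x] that by (intro mult_mono) auto
    moreover have "0 < y * y" using that by simp
    ultimately show ?thesis unfolding g_def norm_divide norm_mult norm_one
      by (intro divide_left_mono) (auto intro: mult_pos_pos)
  qed
  have gmeas: "(\<lambda>x. g (Complex x y)) \<in> borel_measurable borel" if "y \<ge> 0" for y
    unfolding g_def Complex_eq by measurable
  have gint: "integrable lborel (\<lambda>x. cmod (g (Complex x y)))" if "y \<ge> 0" for y
  proof (rule Bochner_Integration.integrable_bound[OF majorantD(1)[OF m]])
    show "(\<lambda>x. cmod (g (Complex x y))) \<in> borel_measurable lborel" using gmeas[OF that] by simp
    show "AE x in lborel. norm (cmod (g (Complex x y))) \<le> norm (m x)"
      by (intro AE_I2) (simp only: real_norm_def abs_norm_cancel, rule order_trans[OF gm[OF that] abs_ge_self])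
  qed
  define h where "h z = g z * F z" for z
  have hhol: "h holomorphic_on {z. Im z > 0}" unfolding h_def by (intro holomorphic_intros ghol hol)
  have hi: "integrable lborel (\<lambda>x. h (Complex x y))" if "y > 0" for y
    unfolding h_def using that by (intro dominated_mult_LpF(1)[OF p m C(1)] gmeas gm) auto
  have hb: "(LINT x|lborel. cmod (h (Complex x y))) \<le> (LINT x|lborel. cmod (g (Complex x y))) + b * C"
    if "y > 0" "\<And>x. cmod (g (Complex x y)) \<le> b" for y b
  proof -
    have [measurable]: "(\<lambda>x. g (Complex x y)) \<in> borel_measurable borel" using gmeas that by simp
    have gi: "integrable lborel (\<lambda>x. cmod (g (Complex x y)))" by (rule gint) (use that in simp)
    have Fi: "integrable lborel (\<lambda>x. cmod (F (Complex x y)) powr p)" using C(1)[OF that(1)] by (simp add: LpF_def)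
    have b0: "b \<ge> 0" by (rule order_trans[OF norm_ge_zero that(2)[of 0]])
    have "(LINT x|lborel. cmod (h (Complex x y))) \<le> (LINT x|lborel. cmod (g (Complex x y)) + b * cmod (F (Complex x y)) powr p)"
    proof (intro integral_mono)
      show "cmod (h (Complex x y)) \<le> cmod (g (Complex x y)) + b * cmod (F (Complex x y)) powr p" for x
      proof -
        have "cmod (h (Complex x y)) \<le> cmod (g (Complex x y)) * (1 + cmod (F (Complex x y)) powr p)"
          unfolding h_def norm_mult using p by (intro mult_left_mono le_one_add_powr) auto
        also have "\<dots> \<le> cmod (g (Complex x y)) + b * cmod (F (Complex x y)) powr p"
          using mult_right_mono[OF that(2)[of x], of "cmod (F (Complex x y)) powr p"] by (simp add: algebra_simps)
        finally show ?thesis .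
      qed
    qed (use hi that gi Fi in auto)
    also have "\<dots> = (LINT x|lborel. cmod (g (Complex x y))) + b * Np p (\<lambda>x. F (Complex x y))"
      using gi Fi by (simp add: Np_def)
    also have "\<dots> \<le> (LINT x|lborel. cmod (g (Complex x y))) + b * C"
      using C(2)[OF that(1)] b0 by (intro add_left_mono mult_left_mono)
    finally show ?thesis .
  qed
  have hK: "(LINT x|lborel. cmod (h (Complex x y))) \<le> (LINT x|lborel. m x) + B * C" if "y > 0" for y
  proof -
    have 1: "(LINT x|lborel. cmod (g (Complex x y))) \<le> (LINT x|lborel. m x)"
      by (intro integral_mono gint majorantD(1)[OF m] gm) (use that in simp_all)
    have 2: "cmod (g (Complex x y)) \<le> B" for x using gm[of y x] B[of x] that by simp
    show ?thesis using hb[OF that 2] 1 by linarith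
  qed
  have zero: "(LINT x|lborel. h (Complex x e)) = 0" if e: "e > 0" for e
  proof -
    let ?Y = "\<lambda>n. e + real n"
    have eq: "(LINT x|lborel. h (Complex x e)) = (LINT x|lborel. h (Complex x (?Y n)))" for n
      by (rule strip_integral_eq[OF hhol e _ hi hK]) (use e in auto)
    have lim0: "(\<lambda>n. 1 / (?Y n * ?Y n)) \<longlonglongrightarrow> 0" using e by real_asymp
    have "(\<lambda>n. LINT x|lborel. cmod (g (Complex x (?Y n)))) \<longlonglongrightarrow> (LINT x::real|lborel. 0)"
    proof (rule integral_dominated_convergence[where w=m])
      show "(\<lambda>x. cmod (g (Complex x (?Y n)))) \<in> borel_measurable lborel" for n using gmeas[of "?Y n"] e by simp
      show "AE x in lborel. (\<lambda>n. cmod (g (Complex x (?Y n)))) \<longlonglongrightarrow> 0"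
        using gY e by (intro AE_I2 tendsto_sandwich[OF _ _ tendsto_const lim0]) auto
      show "AE x in lborel. norm (cmod (g (Complex x (?Y n)))) \<le> m x" for n using gm[of "?Y n"] e by simp
    qed (use m in \<open>auto simp: majorantD\<close>)
    then have lim1: "(\<lambda>n. (LINT x|lborel. cmod (g (Complex x (?Y n)))) + 1 / (?Y n * ?Y n) * C) \<longlonglongrightarrow> 0 + 0 * C"
      by (intro tendsto_add tendsto_mult lim0 tendsto_const) simp
    have "cmod (LINT x|lborel. h (Complex x e)) \<le> (LINT x|lborel. cmod (g (Complex x (?Y n)))) + 1 / (?Y n * ?Y n) * C" for n
      unfolding eq[of n] using e gY[of "?Y n"] by (intro order_trans[OF integral_norm_bound hb]) auto
    then have "cmod (LINT x|lborel. h (Complex x e)) \<le> 0 + 0 * C"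
      by (intro LIMSEQ_le_const[OF lim1]) auto
    then show ?thesis by simp
  qed
  let ?e = "\<lambda>n. 1 / real (Suc n)"
  \<comment> \<open>\<open>weak_limit_LpF\<close> wants one fixed test function. The bounded
    quotient \<open>q\<close> moves the dependence of \<open>g\<close> on the height over to
    \<open>F\<close>, and it tends to 1.\<close>
  define q where "q n x = g (Complex x (?e n)) / g (complex_of_real x)" for n x
  have g0: "g (complex_of_real x) \<noteq> 0" for x unfolding g_def using nz[of "complex_of_real x"] by simp
  have q1: "cmod (q n x) \<le> 1" for n x
    unfolding q_def norm_divide using gm[of "?e n" x] g0[of x] by (simp add: m_def divide_le_eq_1)
  have qm [measurable]: "q n \<in> borel_measurable borel" for n
    unfolding q_def g_def Complex_eq by measurable
  have gr [measurable]: "(\<lambda>x. g (complex_of_real x)) \<in> borel_measurable borel" unfolding g_def by measurable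
  have ee: "filterlim ?e (at_right 0) sequentially"
    unfolding filterlim_at using LIMSEQ_inverse_real_of_nat by (auto simp: inverse_eq_divide simp del: of_nat_Suc intro!: always_eventually)
  have "(\<lambda>n. LINT x|lborel. g (complex_of_real x) * (q n x * F (Complex x (?e n)))) \<longlonglongrightarrow> (LINT x|lborel. g (complex_of_real x) * f x)"
  proof (rule weak_limit_LpF[OF p _ f _ _ m gr])
    show "LpF p (\<lambda>x. q n x * F (Complex x (?e n)))" for n
      using p q1 by (intro LpF_mult_bounded(1)[where C=1] C(1) qm) auto
    show "Np p (\<lambda>x. q n x * F (Complex x (?e n))) \<le> C" for n
      using p q1 C(2)[of "?e n"] by (intro order_trans[OF LpF_mult_bounded(2)[where C=1]] C(1) qm) auto
    show "cmod (g (complex_of_real x)) \<le> m x" for x by (simp add: m_def)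
    show "AE x in lborel. (\<lambda>n. q n x * F (Complex x (?e n))) \<longlonglongrightarrow> f x"
      using bv
    proof eventually_elim
      case (elim x)
      have "(\<lambda>n. F (Complex x (?e n))) \<longlonglongrightarrow> f x" by (rule filterlim_compose[OF elim ee])
      moreover have "(\<lambda>n. q n x) \<longlonglongrightarrow> 1"
      proof -
        have "(\<lambda>n. Complex x (?e n)) \<longlonglongrightarrow> complex_of_real x"
        proof -
          have "(\<lambda>n. complex_of_real x + \<i> * complex_of_real (inverse (real (Suc n)))) \<longlonglongrightarrow> complex_of_real x + \<i> * complex_of_real 0"
            by (intro tendsto_intros LIMSEQ_inverse_real_of_nat)
          then show ?thesis by (simp add: Complex_eq inverse_eq_divide)
        qed
        moreover have "isCont g (complex_of_real x)"
          unfolding g_def using nz[of "complex_of_real x"] by (intro continuous_intros) auto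
        ultimately have "(\<lambda>n. g (Complex x (?e n))) \<longlonglongrightarrow> g (complex_of_real x)"
          by (rule isCont_tendsto_compose[rotated])
        then have "(\<lambda>n. q n x) \<longlonglongrightarrow> g (complex_of_real x) / g (complex_of_real x)"
          unfolding q_def by (intro tendsto_intros g0)
        then show ?thesis using g0 by simp
      qed
      ultimately show ?case using tendsto_mult[of "\<lambda>n. q n x" 1] by fastforce
    qed
  qed
  moreover have "(LINT x|lborel. g (complex_of_real x) * (q n x * F (Complex x (?e n)))) = 0" for n
  proof -
    have "g (complex_of_real x) * (q n x * F (Complex x (?e n))) = h (Complex x (?e n))" for x
      unfolding q_def h_def using g0[of x] by simp
    then show ?thesis using zero[of "?e n"] by simp
  qed
  ultimately show ?thesis unfolding g_def by (simp add: LIMSEQ_const_iff)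
qed

section \<open>The Poisson kernel and almost everywhere convergence\<close>

definition poisson :: "real \<Rightarrow> real \<Rightarrow> real" where
  "poisson y t = y / (pi * (t\<^sup>2 + y\<^sup>2))"

definition PI :: "real \<Rightarrow> (real \<Rightarrow> complex) \<Rightarrow> real \<Rightarrow> complex" where
  "PI y = kop (\<lambda>x t. complex_of_real (poisson y (x - t)))"

lemma poisson_scale:
  assumes "y > 0"
  shows "poisson y (y * u) = 1 / y * (1 / pi * (1 / (1 + u\<^sup>2)))"
proof -
  have "(y * u)\<^sup>2 + y\<^sup>2 = y * y * (1 + u\<^sup>2)" by (simp add: power2_eq_square algebra_simps)
  moreover have "1 + u\<^sup>2 > 0" by (simp add: add_pos_nonneg)
  ultimately show ?thesis using assms by (simp add: poisson_def)
qed

lemma poisson_nonneg: "y > 0 \<Longrightarrow> 0 \<le> poisson y t"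
  by (simp add: poisson_def)

lemma poisson_measurable [measurable]: "poisson y \<in> borel_measurable borel"
  unfolding poisson_def by measurable

lemma poisson_integral:
  assumes "y > 0"
  shows "integrable lborel (poisson y)" "(LINT t|lborel. poisson y t) = 1"
proof -
  have "integrable lborel (\<lambda>u. poisson y (0 + y * u))"
    unfolding add_0 poisson_scale[OF assms] by (intro integrable_mult_right integral_inverse_square)
  then show "integrable lborel (poisson y)"
    using lborel_integrable_real_affine_iff[of y "poisson y" 0] assms by simp
  have "(LINT t|lborel. poisson y t) = y * (LINT u|lborel. poisson y (y * u))"
    using lborel_integral_real_affine[of y "poisson y" 0] assms by simp
  also have "\<dots> = 1"
    unfolding poisson_scale[OF assms] integral_mult_right_zero integral_inverse_square(2) using assms by simp
  finally show "(LINT t|lborel. poisson y t) = 1" .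
qed

lemma poisson_majorant:
  assumes "y > 0"
  shows "majorant (poisson y)"
  unfolding majorant_def
proof (intro conjI allI exI)
  show "poisson y t \<le> y / (pi * y\<^sup>2)" for t
    unfolding poisson_def using assms by (intro divide_left_mono mult_left_mono mult_pos_pos add_nonneg_pos) auto
qed (use assms poisson_integral poisson_nonneg in auto)

lemma poisson_dominated: "y > 0 \<Longrightarrow> dominated_kernel (poisson y) (\<lambda>x t. complex_of_real (poisson y (x - t)))"
  by (rule dominated_convolution) (auto simp: poisson_majorant poisson_nonneg)

text \<open>The weight is minus the radial derivative of the kernel, so the kernel is a
  superposition of indicators of centred intervals; exchanging the integrals gives the formula. For
  negative \<open>r\<close> the weight is negative and \<open>ennreal\<close> sends it to 0.\<close>

lemma poisson_layer_cake:
  assumes y: "y > 0" and u [measurable]: "u \<in> borel_measurable borel"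
  shows "(\<integral>\<^sup>+s. ennreal (poisson y (x - s)) * u s \<partial>lborel) =
    (\<integral>\<^sup>+r. ennreal (2 * y * r / (pi * (r\<^sup>2 + y\<^sup>2)\<^sup>2)) * (\<integral>\<^sup>+s. indicator (cball x r) s * u s \<partial>lborel) \<partial>lborel)"
proof -
  let ?q = "\<lambda>r. 2 * y * r / (pi * (r\<^sup>2 + y\<^sup>2)\<^sup>2)"
  have ft: "(\<integral>\<^sup>+r. ennreal (?q r) * indicator {a..} r \<partial>lborel) = ennreal (poisson y a)" if a: "a \<ge> 0" for a
  proof -
    have "(\<integral>\<^sup>+r. ennreal (?q r) * indicator {a..} r \<partial>lborel) = 0 - (- poisson y a)"
    proof (rule nn_integral_FTC_atLeast)
      show "?q \<in> borel_measurable borel" by measurable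
      fix r assume "a \<le> r"
      then show "0 \<le> ?q r" using y a by simp
      have nz: "r\<^sup>2 + y\<^sup>2 > 0" using y by (simp add: add_nonneg_pos)
      have "((\<lambda>r. - (y / (pi * (r\<^sup>2 + y\<^sup>2)))) has_real_derivative - ((0 * (pi * (r\<^sup>2 + y\<^sup>2)) - y * (pi * (2 * r))) / (pi * (r\<^sup>2 + y\<^sup>2) * (pi * (r\<^sup>2 + y\<^sup>2))))) (at r)"
        using nz by (auto intro!: derivative_eq_intros)
      also have "- ((0 * (pi * (r\<^sup>2 + y\<^sup>2)) - y * (pi * (2 * r))) / (pi * (r\<^sup>2 + y\<^sup>2) * (pi * (r\<^sup>2 + y\<^sup>2)))) = ?q r"
        using nz by (simp add: power2_eq_square mult_ac)
      finally show "((\<lambda>r. - poisson y r) has_real_derivative ?q r) (at r)" by (simp add: poisson_def)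
    next
      show "((\<lambda>r. - poisson y r) \<longlongrightarrow> 0) at_top" unfolding poisson_def using y by real_asymp
    qed
    then show ?thesis by simp
  qed
  have sw: "indicator {\<bar>x - s\<bar>..} r = (indicator (cball x r) s :: ennreal)" for s r
    by (auto simp: indicator_def dist_real_def)
  have me: "(\<lambda>(s, r). ennreal (?q r) * indicator {\<bar>x - s\<bar>..} r * u s) \<in> borel_measurable (lborel \<Otimes>\<^sub>M lborel)"
  proof -
    have "(\<lambda>(s, r). ennreal (?q r) * (if \<bar>x - s\<bar> \<le> r then 1 else 0) * u s) \<in> borel_measurable (lborel \<Otimes>\<^sub>M lborel)"
      by measurable
    then show ?thesis by (simp add: indicator_def of_bool_def)
  qed
  have "(\<integral>\<^sup>+s. ennreal (poisson y (x - s)) * u s \<partial>lborel) = (\<integral>\<^sup>+s. (\<integral>\<^sup>+r. ennreal (?q r) * indicator {\<bar>x - s\<bar>..} r \<partial>lborel) * u s \<partial>lborel)"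
    by (intro nn_integral_cong) (simp add: ft, simp add: poisson_def)
  also have "\<dots> = (\<integral>\<^sup>+s. (\<integral>\<^sup>+r. ennreal (?q r) * indicator {\<bar>x - s\<bar>..} r * u s \<partial>lborel) \<partial>lborel)"
    by (intro nn_integral_cong nn_integral_multc[symmetric]) measurable
  also have "\<dots> = (\<integral>\<^sup>+r. (\<integral>\<^sup>+s. ennreal (?q r) * indicator {\<bar>x - s\<bar>..} r * u s \<partial>lborel) \<partial>lborel)"
    using lborel_pair.Fubini'[OF me] by simp
  also have "\<dots> = (\<integral>\<^sup>+r. ennreal (?q r) * (\<integral>\<^sup>+s. indicator (cball x r) s * u s \<partial>lborel) \<partial>lborel)"
  proof -
    have [measurable]: "(\<lambda>s. indicator (cball x r) s * u s) \<in> borel_measurable lborel" for r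
      using borel_measurable_indicator[of "cball x r" borel, where 'b=ennreal] u by simp
    show ?thesis unfolding sw mult.assoc by (intro nn_integral_cong nn_integral_cmult) measurable
  qed
  finally show ?thesis .
qed

text \<open>In layer cake form the Poisson integral of \<open>w\<close> is compared interval by
  interval with that of the constant \<open>l\<close>, and the latter equals \<open>l\<close>
  because the kernel has mass 1.\<close>

lemma poisson_le_maximal:
  assumes y: "y > 0" and w: "integrable lborel w" "\<And>x. w x \<ge> 0" and l: "l \<ge> 0"
    and avg: "\<And>r. r > 0 \<Longrightarrow> (LINT s|lborel. indicator (cball x r) s * w s) \<le> l * (2 * r)"
  shows "(LINT s|lborel. poisson y (x - s) * w s) \<le> l"
proof -
  have [measurable]: "w \<in> borel_measurable borel" using w by auto
  have cb: "(\<integral>\<^sup>+s. indicator (cball x r) s * ennreal (w s) \<partial>lborel) \<le> (\<integral>\<^sup>+s. indicator (cball x r) s * ennreal l \<partial>lborel)" if "r \<noteq> 0" for r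
  proof (cases "r > 0")
    case True
    have i: "integrable lborel (\<lambda>s. indicator (cball x r) s * w s)"
      using w by (intro integrable_bounded_mult[where B=1]) (auto simp: indicator_def)
    have "(\<integral>\<^sup>+s. indicator (cball x r) s * ennreal (w s) \<partial>lborel) = (\<integral>\<^sup>+s. ennreal (indicator (cball x r) s * w s) \<partial>lborel)"
      by (intro nn_integral_cong) (auto simp: indicator_def)
    also have "\<dots> = ennreal (LINT s|lborel. indicator (cball x r) s * w s)"
      using i w by (intro nn_integral_eq_integral) auto
    also have "\<dots> \<le> ennreal (l * (2 * r))" by (rule ennreal_leI[OF avg[OF True]])
    also have "\<dots> = (\<integral>\<^sup>+s. indicator (cball x r) s * ennreal l \<partial>lborel)"
      using True l by (subst nn_integral_multc) (simp_all add: cball_eq_atLeastAtMost ennreal_mult[symmetric] mult.commute)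
    finally show ?thesis .
  next
    case False
    then have "cball x r = {}" using that by simp
    then show ?thesis by simp
  qed
  have i: "integrable lborel (\<lambda>s. poisson y (x - s) * w s)"
  proof -
    obtain B where "\<And>t. poisson y t \<le> B" using poisson_majorant[OF y] by (auto simp: majorant_def)
    then show ?thesis using w y by (intro integrable_bounded_mult[where B=B]) (auto simp: poisson_nonneg)
  qed
  have "ennreal (LINT s|lborel. poisson y (x - s) * w s) = (\<integral>\<^sup>+s. ennreal (poisson y (x - s) * w s) \<partial>lborel)"
    using i w y by (intro nn_integral_eq_integral[symmetric]) (auto simp: poisson_nonneg)
  also have "\<dots> = (\<integral>\<^sup>+s. ennreal (poisson y (x - s)) * ennreal (w s) \<partial>lborel)"
    using y w by (simp add: ennreal_mult poisson_nonneg)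
  also have "\<dots> \<le> (\<integral>\<^sup>+s. ennreal (poisson y (x - s)) * ennreal l \<partial>lborel)"
  proof -
    have "AE r in lborel. r \<noteq> (0::real)" by (rule AE_lborel_singleton)
    then have "AE r in lborel. ennreal (2 * y * r / (pi * (r\<^sup>2 + y\<^sup>2)\<^sup>2)) * (\<integral>\<^sup>+s. indicator (cball x r) s * ennreal (w s) \<partial>lborel) \<le>
        ennreal (2 * y * r / (pi * (r\<^sup>2 + y\<^sup>2)\<^sup>2)) * (\<integral>\<^sup>+s. indicator (cball x r) s * ennreal l \<partial>lborel)"
      by eventually_elim (intro mult_left_mono cb, auto)
    then show ?thesis
      unfolding poisson_layer_cake[OF y, of "\<lambda>s. ennreal (w s)", simplified] poisson_layer_cake[OF y, of "\<lambda>s. ennreal l", simplified]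
      by (rule nn_integral_mono_AE)
  qed
  also have "\<dots> = (\<integral>\<^sup>+s. ennreal (poisson y (x - s)) \<partial>lborel) * ennreal l"
    by (rule nn_integral_multc) measurable
  also have "(\<integral>\<^sup>+s. ennreal (poisson y (x - s)) \<partial>lborel) = ennreal (LINT s|lborel. poisson y (x - s))"
    using y by (intro nn_integral_eq_integral) (auto simp: poisson_nonneg intro: integrable_reflect(1) poisson_integral(1))
  also have "(LINT s|lborel. poisson y (x - s)) = 1"
    using integrable_reflect(2)[OF poisson_integral(1)[OF y], of x] poisson_integral(2)[OF y] by simp
  finally show ?thesis using l by simp
qed

text \<open>The Hardy-Littlewood estimate by Vitali covering. The exceptional set is enlarged to a
  countable union of fivefold intervals, which makes it measurable. A fivefold interval has length
  \<open>10 * r\<close>, while the disjoint originals satisfy \<open>l * (2 * r) \<le> ?W i\<close>;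
  hence the constant \<open>5 / l\<close>.\<close>

lemma maximal_covering:
  fixes w :: "real \<Rightarrow> real"
  assumes w: "integrable lborel w" "\<And>x. w x \<ge> 0" and l: "l > 0"
  obtains G where "G \<in> sets borel" "emeasure lborel G \<le> ennreal (5 / l * (LINT s|lborel. w s))"
    "\<And>x r. x \<notin> G \<Longrightarrow> r > 0 \<Longrightarrow> (LINT s|lborel. indicator (cball x r) s * w s) \<le> l * (2 * r)"
proof -
  let ?I = "LINT s|lborel. w s"
  let ?W = "\<lambda>i::real \<times> real. LINT s|lborel. indicator (cball (fst i) (snd i)) s * w s"
  have [measurable]: "w \<in> borel_measurable borel" using w by auto
  have Wi: "integrable lborel (\<lambda>s. indicator (cball (fst i) (snd i)) s * w s)" for i :: "real \<times> real"
    using w by (intro integrable_bounded_mult[where B=1]) (auto simp: indicator_def)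
  have WI: "?W i \<le> ?I" for i
    by (intro integral_mono Wi w) (use w in \<open>auto simp: indicator_def\<close>)
  define K where "K = {i :: real \<times> real. snd i > 0 \<and> ?W i > l * (2 * snd i)}"
  \<comment> \<open>The covering lemma requires bounded radii: an interval on which the average of
    \<open>w\<close> exceeds \<open>l\<close> cannot be longer than the total mass divided by
    \<open>l\<close>.\<close>
  have Kr: "0 < snd i \<and> snd i \<le> ?I / (2 * l)" if "i \<in> K" for i
  proof -
    have "l * (2 * snd i) < ?I" using that WI[of i] unfolding K_def by auto
    then show ?thesis using that l unfolding K_def by (auto simp: pos_le_divide_eq algebra_simps)
  qed
  obtain C where C: "countable C" "C \<subseteq> K"
    "pairwise (\<lambda>i j. disjnt (cball (fst i) (snd i)) (cball (fst j) (snd j))) C"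
    "(\<Union>i\<in>K. cball (fst i) (snd i)) \<subseteq> (\<Union>i\<in>C. cball (fst i) (5 * snd i))"
    by (rule Vitali_covering_lemma_cballs[OF subset_refl Kr]) blast+
  define G where "G = (\<Union>i\<in>C. cball (fst i) (5 * snd i))"
  have Gm: "G \<in> sets borel" unfolding G_def using C(1) by (intro sets.countable_UN' ) auto
  have fin: "emeasure lborel (\<Union>i\<in>D. cball (fst i) (5 * snd i)) \<le> ennreal (5 / l * ?I)" if D: "finite D" "D \<subseteq> C" for D
  proof -
    have "emeasure lborel (\<Union>i\<in>D. cball (fst i) (5 * snd i)) \<le> (\<Sum>i\<in>D. emeasure lborel (cball (fst i) (5 * snd i)))"
      using D by (intro emeasure_subadditive_finite) auto
    also have "\<dots> = (\<Sum>i\<in>D. ennreal (10 * snd i))"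
    proof (intro sum.cong refl)
      fix i assume "i \<in> D"
      then have "snd i > 0" using D C Kr by blast
      then show "emeasure lborel (cball (fst i) (5 * snd i)) = ennreal (10 * snd i)"
        by (simp add: cball_eq_atLeastAtMost)
    qed
    also have "\<dots> = ennreal (\<Sum>i\<in>D. 10 * snd i)"
    proof (intro sum_ennreal)
      show "0 \<le> 10 * snd i" if "i \<in> D" for i using Kr[of i] D(2) C(2) that by auto
    qed
    also have "\<dots> \<le> ennreal (5 / l * ?I)"
    proof (rule ennreal_leI)
      have "(\<Sum>i\<in>D. 10 * snd i) \<le> (\<Sum>i\<in>D. 5 / l * ?W i)"
      proof (rule sum_mono)
        fix i assume "i \<in> D"
        then have "l * (2 * snd i) \<le> ?W i" using D C(2) by (auto simp: K_def)
        from mult_left_mono[OF this, of "5 / l"] show "10 * snd i \<le> 5 / l * ?W i" using l by simp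
      qed
      also have "\<dots> = 5 / l * (LINT s|lborel. (\<Sum>i\<in>D. indicator (cball (fst i) (snd i)) s * w s))"
        using Wi by (simp add: Bochner_Integration.integral_sum sum_distrib_left)
      also have "\<dots> \<le> 5 / l * ?I"
      proof (intro mult_left_mono integral_mono w Bochner_Integration.integrable_sum Wi)
        fix s
        have dj: "disjoint_family_on (\<lambda>i. cball (fst i) (snd i)) D"
          using C(3) D(2) unfolding disjoint_family_on_def pairwise_def disjnt_def by blast
        have "(\<Sum>i\<in>D. indicator (cball (fst i) (snd i)) s * w s) = indicator (\<Union>i\<in>D. cball (fst i) (snd i)) s * w s"
          unfolding indicator_UN_disjoint[OF D(1) dj] sum_distrib_right ..
        also have "\<dots> \<le> w s" using w(2)[of s] by (auto simp: indicator_def)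
        finally show "(\<Sum>i\<in>D. indicator (cball (fst i) (snd i)) s * w s) \<le> w s" .
      qed (use l in auto)
      finally show "(\<Sum>i\<in>D. 10 * snd i) \<le> 5 / l * ?I" .
    qed
    finally show ?thesis .
  qed
  have Gle: "emeasure lborel G \<le> ennreal (5 / l * ?I)"
  proof (cases "C = {}")
    case False
    let ?X = "\<lambda>n. \<Union>i\<in>from_nat_into C ` {..<n}. cball (fst i) (5 * snd i)"
    have "G = (\<Union>n. ?X n)"
    proof -
      have "C = from_nat_into C ` (\<Union>n. {..<n})"
        using range_from_nat_into[OF False C(1)] by (metis UN_lessThan_UNIV)
      then show ?thesis unfolding G_def by blast
    qed
    moreover have "(SUP n. emeasure lborel (?X n)) = emeasure lborel (\<Union>n. ?X n)"
    proof (rule SUP_emeasure_incseq)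
      show "incseq ?X"
      proof (rule incseq_SucI)
        show "?X n \<subseteq> ?X (Suc n)" for n by (intro UN_mono image_mono) auto
      qed
    qed auto
    moreover have "(SUP n. emeasure lborel (?X n)) \<le> ennreal (5 / l * ?I)"
      using False by (intro SUP_least fin) (auto intro: from_nat_into)
    ultimately show ?thesis by simp
  qed (simp add: G_def)
  show ?thesis
  proof (rule that[OF Gm Gle])
    fix x r assume "x \<notin> G" and r: "(r::real) > 0"
    then have "x \<notin> (\<Union>i\<in>K. cball (fst i) (snd i))" using C(4) unfolding G_def by blast
    then have "(x, r) \<notin> K" using r by force
    then show "(LINT s|lborel. indicator (cball x r) s * w s) \<le> l * (2 * r)" using r by (simp add: K_def not_less)
  qed
qed

lemma PI_continuous_limit:
  assumes p: "p > 1" and f: "continuous_on UNIV f" "\<And>x. cmod (f x) \<le> D"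
    and X: "\<And>n. X n > 0" "X \<longlonglongrightarrow> 0"
  shows "(\<lambda>n. PI (X n) f x) \<longlonglongrightarrow> f x"
proof -
  have [measurable]: "f \<in> borel_measurable borel" using f by (intro borel_measurable_continuous_onI)
  let ?k = "\<lambda>u::real. 1 / pi * (1 / (1 + u\<^sup>2))"
  \<comment> \<open>As for the bumps, scaling by the height leaves a fixed integrable weight and
    puts \<open>y\<close> into the argument of \<open>f\<close>.\<close>
  have eq: "PI y f x = (LINT u|lborel. complex_of_real (?k u) * f (x - y * u))" if y: "y > 0" for y
  proof -
    have "PI y f x = (LINT s|lborel. complex_of_real (poisson y s) * f (x - s))"
      unfolding PI_def kop_def using lborel_integral_real_affine[of "-1" "\<lambda>t. complex_of_real (poisson y t) * f (x - t)" x] by simp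
    also have "\<dots> = (LINT u|lborel. y *\<^sub>R (complex_of_real (poisson y (y * u)) * f (x - y * u)))"
      using lborel_integral_real_affine[of y "\<lambda>t. complex_of_real (poisson y t) * f (x - t)" 0] y by simp
    also have "\<dots> = (LINT u|lborel. complex_of_real (?k u) * f (x - y * u))"
      using y by (intro Bochner_Integration.integral_cong refl) (simp add: poisson_scale scaleR_conv_of_real)
    finally show ?thesis .
  qed
  have ki: "integrable lborel ?k" by (intro integrable_mult_right integral_inverse_square)
  have "(\<lambda>n. LINT u|lborel. complex_of_real (?k u) * f (x - X n * u)) \<longlonglongrightarrow> (LINT u|lborel. complex_of_real (?k u) * f x)"
  proof (rule integral_dominated_convergence[where w="\<lambda>u. ?k u * D"])
    show "integrable lborel (\<lambda>u. ?k u * D)" using ki by (rule integrable_mult_left)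
    show "AE u in lborel. (\<lambda>n. complex_of_real (?k u) * f (x - X n * u)) \<longlonglongrightarrow> complex_of_real (?k u) * f x"
    proof (intro AE_I2 tendsto_mult tendsto_const)
      fix u
      have "(\<lambda>n. x - X n * u) \<longlonglongrightarrow> x - 0 * u" by (intro tendsto_intros X)
      then show "(\<lambda>n. f (x - X n * u)) \<longlonglongrightarrow> f x"
        using f(1) by (intro isCont_tendsto_compose[of x f]) (auto simp: continuous_on_eq_continuous_at)
    qed
    show "AE u in lborel. norm (complex_of_real (?k u) * f (x - X n * u)) \<le> ?k u * D" for n
      unfolding norm_mult norm_of_real using f(2) by (intro AE_I2 mult_mono) (auto simp: add_nonneg_nonneg)
  qed measurable
  moreover have "(LINT u|lborel. complex_of_real (?k u) * f x) = f x"
  proof -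
    have "(LINT u|lborel. complex_of_real (?k u)) = complex_of_real (LINT u|lborel. ?k u)"
      by (rule integral_complex_of_real)
    also have "(LINT u|lborel. ?k u) = 1"
      unfolding integral_mult_right_zero integral_inverse_square(2) by simp
    finally show ?thesis unfolding integral_mult_left_zero by simp
  qed
  ultimately show ?thesis using eq[OF X(1)] by simp
qed

text \<open>Continuous approximants \<open>g n\<close> converge everywhere, and off a small set both
  \<open>g n - f\<close> and all its Poisson integrals are small by the maximal theorem. The
  measures of these sets are summable, so by Borel-Cantelli almost every point avoids all but
  finitely many of them.\<close>

theorem PI_AE_limit:
  assumes p: "p > 1" and f: "LpF p f"
  shows "AE x in lborel. ((\<lambda>y. PI y f x) \<longlongrightarrow> f x) (at_right 0)"
proof -
  have p1: "p \<ge> 1" using p by simp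
  obtain g0 where g0: "\<And>n. continuous_on UNIV (g0 n)" "\<And>n. \<exists>R. \<forall>x. \<bar>x\<bar> > R \<longrightarrow> g0 n x = 0"
    "\<And>n. LpF p (g0 n)" "(\<lambda>n. Np p (\<lambda>x. g0 n x - f x)) \<longlonglongrightarrow> 0"
    by (rule LpF_approx_continuous[OF p1 f]) blast
  have "\<exists>g. (\<forall>n. Np p (\<lambda>x. g n x - f x) \<le> (1/4) ^ n \<and> LpF p (g n) \<and> continuous_on UNIV (g n) \<and> (\<exists>D. \<forall>x. cmod (g n x) \<le> D))"
  proof (intro choice allI)
    fix n :: nat
    obtain N where N: "Np p (\<lambda>x. g0 N x - f x) < (1/4) ^ n"
      using LIMSEQ_D[OF g0(4), of "(1/4) ^ n"] by force
    obtain R where R: "\<And>x. \<bar>x\<bar> > R \<Longrightarrow> g0 N x = 0" using g0(2)[of N] by blast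
    obtain D where "\<And>x. cmod (g0 N x) \<le> D" using compact_support_bound[OF g0(1) R] by blast
    then show "\<exists>g. Np p (\<lambda>x. g x - f x) \<le> (1/4) ^ n \<and> LpF p g \<and> continuous_on UNIV g \<and> (\<exists>D. \<forall>x. cmod (g x) \<le> D)"
      using N g0(1,3) by (intro exI[of _ "g0 N"]) auto
  qed
  then obtain g where g: "\<And>n. Np p (\<lambda>x. g n x - f x) \<le> (1/4) ^ n" "\<And>n. LpF p (g n)" "\<And>n. continuous_on UNIV (g n)"
    "\<And>n. \<exists>D. \<forall>x. cmod (g n x) \<le> D" by blast
  have dL: "LpF p (\<lambda>x. g n x - f x)" for n by (rule LpF_diff(1)[OF p1 g(2) f])
  \<comment> \<open>The maximal theorem is applied to this integrable \<open>p\<close>-th power;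
    Jensen's inequality for the Poisson kernel, of mass 1, brings the estimate back to
    \<open>g n - f\<close>.\<close>
  define w where "w = (\<lambda>n x. cmod (g n x - f x) powr p)"
  have wi: "integrable lborel (w n)" "w n x \<ge> 0" "(LINT x|lborel. w n x) \<le> (1/4) ^ n" for n x
    using dL[of n] g(1)[of n] by (auto simp: w_def LpF_def Np_def)
  have wm [measurable]: "w n \<in> borel_measurable borel" for n using wi(1)[of n] by auto
  have "\<exists>G. \<forall>n. G n \<in> sets borel \<and> emeasure lborel (G n) \<le> ennreal (5 / (1/2) ^ n * (LINT x|lborel. w n x)) \<and>
      (\<forall>x r. x \<notin> G n \<longrightarrow> r > 0 \<longrightarrow> (LINT s|lborel. indicator (cball x r) s * w n s) \<le> (1/2) ^ n * (2 * r))"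
  proof (intro choice allI)
    fix n :: nat
    have "(0::real) < (1/2) ^ n" by simp
    from maximal_covering[OF wi(1,2)[of n] this] show "\<exists>G. G \<in> sets borel \<and> emeasure lborel G \<le> ennreal (5 / (1/2) ^ n * (LINT x|lborel. w n x)) \<and>
      (\<forall>x r. x \<notin> G \<longrightarrow> r > 0 \<longrightarrow> (LINT s|lborel. indicator (cball x r) s * w n s) \<le> (1/2) ^ n * (2 * r))" by metis
  qed
  then obtain G where G: "\<And>n. G n \<in> sets borel" "\<And>n. emeasure lborel (G n) \<le> ennreal (5 / (1/2) ^ n * (LINT x|lborel. w n x))"
    "\<And>n x r. x \<notin> G n \<Longrightarrow> r > 0 \<Longrightarrow> (LINT s|lborel. indicator (cball x r) s * w n s) \<le> (1/2) ^ n * (2 * r)" by blast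
  define H where "H n = {x. w n x \<ge> (1/2) ^ n}" for n
  have Hm: "H n \<in> sets borel" for n unfolding H_def by measurable
  have half: "c / (1/2) ^ n * (1/4) ^ n = c * (1/2) ^ n" for c :: real and n
    by (simp add: power_divide power_mult_distrib[symmetric] field_simps)
  \<comment> \<open>At level \<open>(1/2) ^ n\<close> against mass \<open>(1/4) ^ n\<close>, the
    covering lemma contributes the factor 5 and Markov's inequality for \<open>H n\<close> the
    factor 1.\<close>
  have em: "emeasure lborel (G n \<union> H n) \<le> ennreal (6 * (1/2) ^ n)" for n
  proof -
    have "5 / (1/2) ^ n * (LINT x|lborel. w n x) \<le> 5 / (1/2) ^ n * (1/4) ^ n"
      using wi(3)[of n] by (intro mult_left_mono) auto
    then have 1: "emeasure lborel (G n) \<le> ennreal (5 * (1/2) ^ n)"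
      using order_trans[OF G(2)[of n] ennreal_leI] half[of 5 n] by simp
    have "1 / (1/2) ^ n * (LINT x|lborel. w n x) \<le> 1 / (1/2) ^ n * (1/4) ^ n"
      using wi(3)[of n] by (intro mult_left_mono) auto
    moreover have "emeasure lborel {x \<in> space lborel. w n x \<ge> (1/2) ^ n} \<le> ennreal (1 / (1/2) ^ n * (LINT x|lborel. w n x))"
      using integral_Markov_inequality[OF wi(1)[of n] _ , of "(1/2)^n"] wi(2) by simp
    ultimately have 2: "emeasure lborel (H n) \<le> ennreal (1 * (1/2) ^ n)"
      using half[of 1 n] unfolding H_def by (simp add: order_trans[OF _ ennreal_leI])
    have "emeasure lborel (G n \<union> H n) \<le> emeasure lborel (G n) + emeasure lborel (H n)"
      using G(1) Hm by (intro emeasure_subadditive) auto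
    also have "\<dots> \<le> ennreal (5 * (1/2) ^ n) + ennreal (1 * (1/2) ^ n)" by (rule add_mono[OF 1 2])
    also have "\<dots> = ennreal (6 * (1/2) ^ n)" by (subst ennreal_plus[symmetric]) auto
    finally show ?thesis .
  qed
  have "AE x in lborel. eventually (\<lambda>n. x \<in> space lborel - (G n \<union> H n)) sequentially"
  proof (rule borel_cantelli_AE1)
    show "G n \<union> H n \<in> sets lborel" for n using G(1) Hm by auto
    show "emeasure lborel (G n \<union> H n) < \<infinity>" for n by (rule order.strict_trans1[OF em]) simp
    have "measure lborel (G n \<union> H n) \<le> 6 * (1/2) ^ n" for n
      using em[of n] unfolding measure_def by (simp add: enn2real_leI)
    then show "summable (\<lambda>n. measure lborel (G n \<union> H n))"
      by (intro summable_comparison_test[OF _ summable_mult[OF summable_geometric[of "1/2::real"], of 6]]) auto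
  qed
  then show ?thesis
  proof eventually_elim
    case (elim x)
    show ?case
      unfolding tendsto_at_iff_sequentially
    proof (intro allI impI)
      fix X :: "nat \<Rightarrow> real" assume X: "\<forall>i. X i \<in> {0<..} - {0}" "X \<longlonglongrightarrow> 0"
      have X0: "X n > 0" for n using X(1) by auto
      have "(\<lambda>k. PI (X k) f x) \<longlonglongrightarrow> f x"
      proof (rule tendstoI)
        fix e :: real assume e: "e > 0"
        have "(\<lambda>n. ((1/2::real) ^ n) powr (1/p)) \<longlonglongrightarrow> 0 powr (1/p)"
          using p by (intro tendsto_powr2 LIMSEQ_realpow_zero tendsto_const) auto
        then have "(\<lambda>n. ((1/2::real) ^ n) powr (1/p)) \<longlonglongrightarrow> 0" using p by simp
        then have "\<forall>\<^sub>F n in sequentially. ((1/2::real) ^ n) powr (1/p) < e / 3"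
          using e by (intro order_tendstoD) auto
        with elim have "\<forall>\<^sub>F n in sequentially. x \<in> space lborel - (G n \<union> H n) \<and> ((1/2::real) ^ n) powr (1/p) < e / 3"
          by (rule eventually_conj)
        then obtain n where n: "x \<notin> G n" "x \<notin> H n" "((1/2::real) ^ n) powr (1/p) < e / 3"
          using eventually_happens'[OF sequentially_bot] by auto
        let ?l = "(1/2::real) ^ n"
        have root: "t \<le> ?l powr (1/p)" if "t \<ge> 0" "t powr p \<le> ?l" for t
          using powr_mono2[OF _ _ that(2), of "1/p"] that(1) p by (simp add: powr_powr)
        have b1: "cmod (PI y (\<lambda>x. g n x - f x) x) \<le> ?l powr (1/p)" if y: "y > 0" for y
        proof (rule root)
          note ms = majorant_shift[OF poisson_majorant[OF y], of x]
          have "cmod (PI y (\<lambda>x. g n x - f x) x) powr p \<le> (LINT t|lborel. poisson y (x - t)) powr (p - 1) * (LINT t|lborel. poisson y (x - t) * w n t)"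
            unfolding PI_def kop_def w_def by (rule dominated_mult_LpF(3)[OF p ms dL]) (use y in \<open>auto simp: poisson_nonneg\<close>)
          also have "(LINT t|lborel. poisson y (x - t)) = 1"
            using integrable_reflect(2)[OF poisson_integral(1)[OF y], of x] poisson_integral(2)[OF y] by simp
          also have "(LINT t|lborel. poisson y (x - t) * w n t) \<le> ?l"
            by (rule poisson_le_maximal[OF y wi(1,2) _ G(3)[OF n(1)]]) auto
          finally show "cmod (PI y (\<lambda>x. g n x - f x) x) powr p \<le> ?l" by simp
        qed simp
        have b2: "cmod (g n x - f x) \<le> ?l powr (1/p)"
          using n(2) by (intro root) (auto simp: H_def w_def)
        obtain D where D: "\<And>x. cmod (g n x) \<le> D" using g(4)[of n] by blast
        have lin: "PI y (\<lambda>x. g n x - f x) x = PI y (g n) x - PI y f x" if y: "y > 0" for y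
          unfolding PI_def kop_def
          using kop_dominated(1)[OF p poisson_dominated[OF y] g(2)[of n], of x] kop_dominated(1)[OF p poisson_dominated[OF y] f, of x]
          by (simp add: right_diff_distrib)
        from tendstoD[OF PI_continuous_limit[OF p g(3) D X0 X(2), of x], of "e/3"] e
        have "\<forall>\<^sub>F k in sequentially. dist (PI (X k) (g n) x) (g n x) < e / 3" by simp
        then show "\<forall>\<^sub>F k in sequentially. dist (PI (X k) f x) (f x) < e"
        proof eventually_elim
          case (elim k)
          have "PI (X k) f x - f x = (PI (X k) (g n) x - g n x) - PI (X k) (\<lambda>x. g n x - f x) x + (g n x - f x)"
            using lin[OF X0[of k]] by simp
          then have "cmod (PI (X k) f x - f x) \<le> cmod (PI (X k) (g n) x - g n x) + cmod (PI (X k) (\<lambda>x. g n x - f x) x) + cmod (g n x - f x)"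
            by (metis (no_types, lifting) add_right_mono norm_triangle_ineq norm_triangle_ineq4 order_trans)
          then show ?case using elim b1[OF X0[of k]] b2 n(3) by (simp add: dist_norm)
        qed
      qed
      then show "((\<lambda>y. PI y f x) \<circ> X) \<longlonglongrightarrow> f x" by (simp add: o_def)
    qed
  qed
qed

section \<open>Functions annihilated by resolvent products are Hardy boundary values\<close>

text \<open>The Poisson kernel is a difference of Cauchy kernels at \<open>z\<close> and at its
  conjugate. The hypothesis removes the second term, so the Poisson integral of \<open>f\<close> is
  the analytic function \<open>F\<close>; its norms are bounded by Young's inequality, and its
  boundary values come from \<open>PI_AE_limit\<close>.\<close>

lemma annihilated_imp_Hardy:
  assumes p: "p > 1" and f: "LpF p f"
    and ann: "\<And>w w'. Im w < 0 \<Longrightarrow> Im w' < 0 \<Longrightarrow> (LINT t|lborel. 1 / ((complex_of_real t - w) * (complex_of_real t - w')) * f t) = 0"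
  obtains F where "F \<in> Hardy_upper p" "AE x in lborel. ((\<lambda>y. F (Complex x y)) \<longlongrightarrow> f x) (at_right 0)"
proof -
  \<comment> \<open>Together with the prefactor \<open>z + \<i>\<close> of \<open>F\<close> this is
    the Cauchy kernel normalised to \<open>1 / (t - z) - 1 / (t + \<i>)\<close>, which is a multiple
    of a product of two resolvents and hence an admissible test.\<close>
  define J where "J z = (LINT t|lborel. 1 / ((complex_of_real t - z) * (complex_of_real t - (- \<i>))) * f t)" for z
  define F where "F z = (z + \<i>) / (2 * pi * \<i>) * J z" for z
  have [measurable]: "f \<in> borel_measurable borel" using f by (simp add: LpF_def)
  have int: "integrable lborel (\<lambda>t. 1 / ((complex_of_real t - z) * (complex_of_real t - (- \<i>))) * f t)" if "Im z \<noteq> 0" for z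
    by (rule dominated_mult_LpF(1)[OF p resolvent_product_majorant[OF that, of "- \<i>"] f]) auto
  have tz: "complex_of_real t - z \<noteq> 0" if "Im z \<noteq> 0" for t z using that by auto
  have der: "(J has_field_derivative (LINT t|lborel. 1 / ((complex_of_real t - z) * (complex_of_real t - z)) * (1 / (complex_of_real t - (- \<i>))) * f t)) (at z)"
    if z: "Im z > 0" for z
    unfolding has_field_derivative_iff tendsto_at_iff_sequentially
  proof (intro allI impI)
    fix Z :: "nat \<Rightarrow> complex" assume Z: "\<forall>i. Z i \<in> UNIV - {z}" "Z \<longlonglongrightarrow> z"
    let ?k = "\<lambda>t. 1 / ((complex_of_real t - z) * (complex_of_real t - z)) * (1 / (complex_of_real t - (- \<i>))) * f t"
    let ?q = "\<lambda>n t. 1 / ((complex_of_real t - Z n) * (complex_of_real t - z)) * (1 / (complex_of_real t - (- \<i>))) * f t"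
    \<comment> \<open>For \<open>Z n\<close> within half the height of \<open>z\<close>, the
      distances of \<open>t\<close> to \<open>Z n\<close> and to \<open>z\<close> are comparable up
      to the factor 2, which dominates the difference quotients.\<close>
    have "Im z / 2 > 0" using z by simp
    then obtain N where N: "\<And>n. n \<ge> N \<Longrightarrow> cmod (Z n - z) < Im z / 2"
      using LIMSEQ_D[OF Z(2)] by blast
    have low: "cmod (complex_of_real t - z) \<le> 2 * cmod (complex_of_real t - Z n)" "Im (Z n) > 0" if "n \<ge> N" for n t
    proof -
      have 1: "Im z \<le> cmod (complex_of_real t - z)" using abs_Im_le_cmod[of "complex_of_real t - z"] z by simp
      have "cmod (complex_of_real t - z) \<le> cmod (complex_of_real t - Z n) + cmod (Z n - z)"
        using norm_triangle_ineq[of "complex_of_real t - Z n" "Z n - z"] by simp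
      then show "cmod (complex_of_real t - z) \<le> 2 * cmod (complex_of_real t - Z n)" using N[OF that] 1 by linarith
      show "Im (Z n) > 0" using N[OF that] abs_Im_le_cmod[of "Z n - z"] by auto
    qed
    define m where "m t = cmod (1 / ((complex_of_real t - z) * (complex_of_real t - z)))" for t
    have mj: "majorant m" unfolding m_def by (rule resolvent_product_majorant) (use z in auto)
    have one: "1 \<le> cmod (complex_of_real t - (- \<i>))" for t
      using abs_Im_le_cmod[of "complex_of_real t - (- \<i>)"] by simp
    have lim: "(\<lambda>n. LINT t|lborel. ?q (n + N) t) \<longlonglongrightarrow> (LINT t|lborel. ?k t)"
    proof (rule integral_dominated_convergence[where w="\<lambda>t. 2 * (m t * cmod (f t))"])
      show "integrable lborel (\<lambda>t. 2 * (m t * cmod (f t)))"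
        by (intro integrable_mult_right majorant_mult_LpF(2)[OF p mj f])
      show "AE t in lborel. (\<lambda>n. ?q (n + N) t) \<longlonglongrightarrow> ?k t"
        by (intro AE_I2 tendsto_intros LIMSEQ_ignore_initial_segment[OF Z(2)]) (use z tz[of z] in auto)
      show "AE t in lborel. norm (?q (n + N) t) \<le> 2 * (m t * cmod (f t))" for n
      proof (rule AE_I2)
        fix t
        have a: "0 < cmod (complex_of_real t - z)" using tz[of z t] z by simp
        have "cmod (1 / ((complex_of_real t - Z (n + N)) * (complex_of_real t - z))) \<le> 2 * m t"
        proof -
          have "1 / cmod (complex_of_real t - Z (n + N)) \<le> 2 / cmod (complex_of_real t - z)"
            using low(1)[of "n + N" t] a by (simp add: divide_simps)
          then have "1 / cmod (complex_of_real t - Z (n + N)) * (1 / cmod (complex_of_real t - z)) \<le> 2 / cmod (complex_of_real t - z) * (1 / cmod (complex_of_real t - z))"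
            by (rule mult_right_mono) simp
          then show ?thesis by (simp add: m_def norm_divide norm_mult)
        qed
        moreover have "cmod (1 / (complex_of_real t - (- \<i>))) \<le> 1"
          using one[of t] by (simp only: norm_divide norm_one divide_le_eq_1) auto
        ultimately have "cmod (1 / ((complex_of_real t - Z (n + N)) * (complex_of_real t - z)) * (1 / (complex_of_real t - (- \<i>)))) \<le> 2 * m t * 1"
          unfolding norm_mult[of "1 / ((complex_of_real t - Z (n + N)) * (complex_of_real t - z))"]
          by (intro mult_mono) (auto simp: m_def)
        then show "norm (?q (n + N) t) \<le> 2 * (m t * cmod (f t))"
          unfolding norm_mult[of _ "f t"] using mult_right_mono[of _ "2 * m t * 1" "cmod (f t)"] by fastforce
      qed
    qed measurable
    have quot: "(J (Z n) - J z) / (Z n - z) = (LINT t|lborel. ?q n t)" if "n \<ge> N" for n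
    proof -
      have ne: "Z n - z \<noteq> 0" using Z(1) by auto
      have d: "J (Z n) - J z = (LINT t|lborel. (Z n - z) * ?q n t)"
        unfolding J_def using int[of "Z n"] int[of z] low(2)[OF that] z
      proof (subst Bochner_Integration.integral_diff[symmetric])
        show "(LINT t|lborel. 1 / ((complex_of_real t - Z n) * (complex_of_real t - (- \<i>))) * f t - 1 / ((complex_of_real t - z) * (complex_of_real t - (- \<i>))) * f t) = (LINT t|lborel. (Z n - z) * ?q n t)"
        proof (intro Bochner_Integration.integral_cong refl)
          fix t
          have "a \<noteq> 0 \<Longrightarrow> b \<noteq> 0 \<Longrightarrow> c \<noteq> 0 \<Longrightarrow> 1 / (a * c) * v - 1 / (b * c) * v = (b - a) * (1 / (a * b) * (1 / c) * v)" for a b c v :: complex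
            by (simp add: field_simps)
          from this[of "complex_of_real t - Z n" "complex_of_real t - z" "complex_of_real t - (- \<i>)" "f t"]
          show "1 / ((complex_of_real t - Z n) * (complex_of_real t - (- \<i>))) * f t - 1 / ((complex_of_real t - z) * (complex_of_real t - (- \<i>))) * f t = (Z n - z) * ?q n t"
            using tz[of "Z n" t] tz[of z t] tz[of "- \<i>" t] z low(2)[OF that] by auto
        qed
      qed auto
      show ?thesis unfolding d integral_mult_right_zero using ne by (rule nonzero_mult_div_cancel_left)
    qed
    have "(\<lambda>n. (J (Z (n + N)) - J z) / (Z (n + N) - z)) \<longlonglongrightarrow> (LINT t|lborel. ?k t)"
      using lim quot by simp
    then have "(\<lambda>n. (J (Z n) - J z) / (Z n - z)) \<longlonglongrightarrow> (LINT t|lborel. ?k t)"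
      by (rule LIMSEQ_offset)
    then show "((\<lambda>y. (J y - J z) / (y - z)) \<circ> Z) \<longlonglongrightarrow> (LINT t|lborel. ?k t)"
      by (simp add: o_def)
  qed
  have "J holomorphic_on {z. Im z > 0}"
    unfolding holomorphic_on_def field_differentiable_def
    using der by (auto intro: has_field_derivative_at_within)
  then have hol: "F holomorphic_on {z. Im z > 0}"
    unfolding F_def by (intro holomorphic_intros) auto
  have FP: "F (Complex x y) = PI y f x" if y: "y > 0" for x y
  proof -
    let ?z = "Complex x y" and ?zc = "Complex x (- y)"
    \<comment> \<open>The conjugate point lies below the line. Subtracting this zero term cancels
      \<open>1 / (t + \<i>)\<close> and leaves the Poisson kernel.\<close>
    have "J ?zc = 0" unfolding J_def using y by (intro ann) auto
    then have "(?z + \<i>) * J ?z = (?z + \<i>) * J ?z - (?zc + \<i>) * J ?zc" by simp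
    also have "\<dots> = (LINT t|lborel. (?z + \<i>) * (1 / ((complex_of_real t - ?z) * (complex_of_real t - (- \<i>))) * f t) - (?zc + \<i>) * (1 / ((complex_of_real t - ?zc) * (complex_of_real t - (- \<i>))) * f t))"
      unfolding J_def integral_mult_right_zero[symmetric]
      by (rule Bochner_Integration.integral_diff[symmetric]; intro integrable_mult_right int) (use y in auto)
    also have "\<dots> = (LINT t|lborel. 2 * pi * \<i> * (complex_of_real (poisson y (x - t)) * f t))"
    proof (intro Bochner_Integration.integral_cong refl)
      fix t
      define a b c where "a = complex_of_real t - ?z" and "b = complex_of_real t - ?zc" and "c = complex_of_real t - (- \<i>)"
      have nz: "a \<noteq> 0" "b \<noteq> 0" "c \<noteq> 0" unfolding a_def b_def c_def using y by (auto simp: complex_eq_iff)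
      have "(?z + \<i>) * (1 / (a * c) * f t) - (?zc + \<i>) * (1 / (b * c) * f t) = ((c - a) / (a * c) - (c - b) / (b * c)) * f t"
        by (simp add: a_def b_def c_def algebra_simps)
      also have "(c - a) / (a * c) - (c - b) / (b * c) = (b - a) / (a * b)"
        using nz by (simp add: field_simps)
      also have "b - a = 2 * \<i> * complex_of_real y"
        by (simp add: a_def b_def complex_eq_iff)
      also have "a * b = complex_of_real ((x - t)\<^sup>2 + y\<^sup>2)"
        by (simp add: a_def b_def complex_eq_iff power2_eq_square algebra_simps)
      finally show "(?z + \<i>) * (1 / ((complex_of_real t - ?z) * (complex_of_real t - (- \<i>))) * f t) - (?zc + \<i>) * (1 / ((complex_of_real t - ?zc) * (complex_of_real t - (- \<i>))) * f t) = 2 * pi * \<i> * (complex_of_real (poisson y (x - t)) * f t)"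
        unfolding a_def b_def c_def by (simp add: poisson_def)
    qed
    also have "\<dots> = 2 * pi * \<i> * PI y f x" unfolding PI_def kop_def by simp
    finally have "(?z + \<i>) * J ?z = 2 * pi * \<i> * PI y f x" .
    then show ?thesis unfolding F_def by simp
  qed
  have bd: "(\<integral>\<^sup>+x. ennreal (cmod (F (Complex x y)) powr p) \<partial>lborel) \<le> ennreal (Np p f)" if y: "y > 0" for y
  proof -
    note b = kop_bop[OF p poisson_dominated[OF y], folded PI_def]
    have "(\<integral>\<^sup>+x. ennreal (cmod (F (Complex x y)) powr p) \<partial>lborel) = ennreal (Np p (PI y f))"
      unfolding FP[OF y] Np_def using bopD(2)[OF b f] by (intro nn_integral_eq_integral) (auto simp: LpF_def)
    also have "\<dots> \<le> ennreal (Np p f)"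
      using bopD(3)[OF b f] poisson_integral(2)[OF y] by (intro ennreal_leI) simp
    finally show ?thesis .
  qed
  have "(SUP y\<in>{0<..}. \<integral>\<^sup>+x. ennreal (cmod (F (Complex x y)) powr p) \<partial>lborel) \<le> ennreal (Np p f)"
    by (rule SUP_least) (use bd in auto)
  then have "F \<in> Hardy_upper p"
    using hol unfolding Hardy_upper_def by (simp add: order.strict_trans1)
  moreover have "AE x in lborel. ((\<lambda>y. F (Complex x y)) \<longlongrightarrow> f x) (at_right 0)"
    using PI_AE_limit[OF p f]
  proof eventually_elim
    case (elim x)
    show ?case
    proof (rule Lim_transform_eventually[OF elim])
      show "\<forall>\<^sub>F y in at_right 0. PI y f x = F (Complex x y)"
        unfolding eventually_at_right_field using FP by (intro exI[of _ 1]) auto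
    qed
  qed
  ultimately show ?thesis by (rule that)
qed

section \<open>The Fourier binest algebra is a closed algebra containing the generators\<close>

definition test_fun :: "(real \<Rightarrow> complex) \<Rightarrow> bool" where
  "test_fun u \<longleftrightarrow> u \<in> borel_measurable borel \<and> (\<exists>m. majorant m \<and> (\<forall>x. cmod (u x) \<le> m x))"

text \<open>A uniform description of all members of the binest: linearity and closedness need to be
  proved only once, for annihilators of test functions.\<close>

definition ann :: "real \<Rightarrow> (real \<Rightarrow> complex) set \<Rightarrow> ae_fun set" where
  "ann p U = {F \<in> Lp p. \<forall>u\<in>U. (LINT x|lborel. u x * fn F x) = 0}"

lemma mk_in_ann:
  assumes f: "LpF p f" and U: "\<And>u. u \<in> U \<Longrightarrow> test_fun u"
  shows "mk f \<in> ann p U \<longleftrightarrow> (\<forall>u\<in>U. (LINT x|lborel. u x * f x) = 0)"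
proof -
  have [measurable]: "f \<in> borel_measurable borel" using f by (simp add: LpF_def)
  have "(LINT x|lborel. u x * fn (mk f) x) = (LINT x|lborel. u x * f x)" if "u \<in> U" for u
  proof (rule integral_cong_AE)
    have [measurable]: "u \<in> borel_measurable borel" using U[OF that] by (simp add: test_fun_def)
    show "(\<lambda>x. u x * fn (mk f) x) \<in> borel_measurable lborel" "(\<lambda>x. u x * f x) \<in> borel_measurable lborel" by measurable
    show "AE x in lborel. u x * fn (mk f) x = u x * f x"
      using fn_mk[of f, simplified] by eventually_elim simp
  qed
  then show ?thesis using mk_Lp[OF f] by (auto simp: ann_def)
qed

lemma Lp_set_eqI:
  assumes "K \<subseteq> Lp p" "L \<subseteq> Lp p" and iff: "\<And>f. LpF p f \<Longrightarrow> mk f \<in> K \<longleftrightarrow> mk f \<in> L"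
  shows "K = L"
proof (rule set_eqI)
  fix F
  show "F \<in> K \<longleftrightarrow> F \<in> L"
  proof (cases "F \<in> Lp p")
    case True
    then obtain f where "LpF p f" "F = mk f" by (rule LpE)
    then show ?thesis using iff by simp
  qed (use assms in blast)
qed

lemma test_fun_pairing:
  assumes p: "p > 1" and u: "test_fun u"
  obtains K where "K \<ge> 0" "\<And>f. LpF p f \<Longrightarrow> integrable lborel (\<lambda>x. u x * f x)"
    "\<And>f. LpF p f \<Longrightarrow> cmod (LINT x|lborel. u x * f x) powr p \<le> K * Np p f"
proof -
  obtain m where m: "majorant m" "u \<in> borel_measurable borel" "\<And>x. cmod (u x) \<le> m x"
    using u by (auto simp: test_fun_def)
  obtain B where B: "\<And>x. m x \<le> B" using m(1) by (auto simp: majorant_def)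
  have B0: "B \<ge> 0" using B[of 0] majorantD(2)[OF m(1), of 0] by simp
  let ?I = "(LINT x|lborel. m x) powr (p - 1)"
  show thesis
  proof (rule that[of "?I * B"])
    show "?I * B \<ge> 0" using B0 by simp
    fix f assume f: "LpF p f"
    note D = dominated_mult_LpF[OF p m(1) f m(2,3)]
    show "integrable lborel (\<lambda>x. u x * f x)" by (rule D)
    have "(LINT x|lborel. m x * cmod (f x) powr p) \<le> (LINT x|lborel. B * cmod (f x) powr p)"
      using f B by (intro integral_mono majorant_mult_LpF(1)[OF p m(1) f] mult_right_mono) (auto simp: LpF_def)
    also have "\<dots> = B * Np p f" by (simp add: Np_def)
    finally have "?I * (LINT x|lborel. m x * cmod (f x) powr p) \<le> ?I * (B * Np p f)"
      by (intro mult_left_mono) auto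
    then show "cmod (LINT x|lborel. u x * f x) powr p \<le> ?I * B * Np p f"
      using D(3) by (simp add: mult.assoc)
  qed
qed

lemma ann_subset: "ann p U \<subseteq> Lp p"
  by (auto simp: ann_def)

lemma ann_zero: "0 \<in> ann p U" if "\<And>u. u \<in> U \<Longrightarrow> test_fun u"
  using mk_in_ann[OF LpF_0 that, of U p] by (simp add: mk_0)

lemma ann_add:
  assumes p: "p > 1" and U: "\<And>u. u \<in> U \<Longrightarrow> test_fun u" and F: "F \<in> ann p U" "G \<in> ann p U"
  shows "F + G \<in> ann p U"
proof -
  have "F \<in> Lp p" "G \<in> Lp p" using F ann_subset by blast+
  then obtain f g where f: "LpF p f" "F = mk f" and g: "LpF p g" "G = mk g" by (metis LpE)
  have p1: "p \<ge> 1" using p by simp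
  have "(LINT x|lborel. u x * (f x + g x)) = 0" if u: "u \<in> U" for u
  proof -
    obtain K where "\<And>f. LpF p f \<Longrightarrow> integrable lborel (\<lambda>x. u x * f x)"
      using test_fun_pairing[OF p U[OF u]] by metis
    then show ?thesis using F u f g mk_in_ann[OF f(1) U, of U] mk_in_ann[OF g(1) U, of U]
      by (simp add: distrib_left)
  qed
  then have "mk (\<lambda>x. f x + g x) \<in> ann p U"
    using mk_in_ann[OF LpF_add(1)[OF p1 f(1) g(1)] U, of U] by blast
  then show ?thesis using f g by (simp add: mk_plus LpF_measurable[of p])
qed

lemma ann_scale:
  assumes U: "\<And>u. u \<in> U \<Longrightarrow> test_fun u" and F: "F \<in> ann p U"
  shows "c *\<^sub>a F \<in> ann p U"
proof -
  have "F \<in> Lp p" using F ann_subset by blast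
  then obtain f where f: "LpF p f" "F = mk f" by (metis LpE)
  have "(LINT x|lborel. u x * (c * f x)) = 0" if u: "u \<in> U" for u
  proof -
    have "(LINT x|lborel. u x * (c * f x)) = (LINT x|lborel. c * (u x * f x))"
      by (simp add: mult.left_commute)
    also have "\<dots> = 0" unfolding integral_mult_right_zero
      using F u f mk_in_ann[OF f(1) U, of U] by simp
    finally show ?thesis .
  qed
  then have "mk (\<lambda>x. c * f x) \<in> ann p U"
    using mk_in_ann[OF LpF_cmult(1)[OF f(1)] U, of U] by blast
  then show ?thesis using f by (simp add: mk_scale LpF_measurable[of p])
qed

lemma ann_closed:
  assumes p: "p > 1" and U: "\<And>u. u \<in> U \<Longrightarrow> test_fun u"
  shows "closedin (Lp_topology p) (ann p U)"
proof -
  have p1: "p \<ge> 1" using p by simp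
  interpret Metric_space "Lp p" "Lp_dist p" by (rule Lp_metric[OF p1])
  show ?thesis
    unfolding Lp_topology_def metric_closedin_iff_sequentially_closed
  proof (intro conjI allI impI ann_subset)
    fix \<sigma> F assume "range \<sigma> \<subseteq> ann p U \<and> limitin mtopology \<sigma> F sequentially"
    then have s: "\<And>n. \<sigma> n \<in> ann p U" and F: "F \<in> Lp p" and l: "(\<lambda>n. Lp_dist p (\<sigma> n) F) \<longlonglongrightarrow> 0"
      by (auto simp: limitin_metric_dist_null)
    have sL: "LpF p (fn (\<sigma> n))" for n using s[of n] ann_subset LpF_fn by blast
    have FL: "LpF p (fn F)" using F by (rule LpF_fn)
    have d: "(\<lambda>n. Np p (\<lambda>x. fn (\<sigma> n) x - fn F x)) \<longlonglongrightarrow> 0"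
    proof -
      have "Lp_dist p (\<sigma> n) F powr p = Np p (\<lambda>x. fn (\<sigma> n) x - fn F x)" for n
        using Lp_dist_mk[of "fn (\<sigma> n)" "fn F" p] p by (simp add: powr_powr)
      moreover have "(\<lambda>n. Lp_dist p (\<sigma> n) F powr p) \<longlonglongrightarrow> 0 powr p"
        using p by (intro tendsto_powr2 l tendsto_const) (auto simp: Lp_dist_def Lp_norm_nonneg)
      ultimately show ?thesis using p by simp
    qed
    have "(LINT x|lborel. u x * fn F x) = 0" if u: "u \<in> U" for u
    proof -
      obtain K where K: "K \<ge> 0" "\<And>f. LpF p f \<Longrightarrow> integrable lborel (\<lambda>x. u x * f x)"
        "\<And>f. LpF p f \<Longrightarrow> cmod (LINT x|lborel. u x * f x) powr p \<le> K * Np p f"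
        using test_fun_pairing[OF p U[OF u]] by metis
      have "cmod (LINT x|lborel. u x * fn F x) powr p \<le> K * Np p (\<lambda>x. fn (\<sigma> n) x - fn F x)" for n
      proof -
        have "(LINT x|lborel. u x * (fn (\<sigma> n) x - fn F x)) = - (LINT x|lborel. u x * fn F x)"
          using s[of n] u by (simp add: right_diff_distrib K(2)[OF sL] K(2)[OF FL] ann_def)
        then show ?thesis using K(3)[OF LpF_diff(1)[OF p1 sL FL], of n] by simp
      qed
      then have "cmod (LINT x|lborel. u x * fn F x) powr p \<le> K * 0"
        by (intro LIMSEQ_le_const[OF tendsto_mult[OF tendsto_const d]]) auto
      then show ?thesis by simp
    qed
    then show "F \<in> ann p U" using F by (simp add: ann_def)
  qed
qed

lemma test_fun_resolvents:
  assumes "Im w < 0" "Im w' < 0"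
  shows "test_fun (\<lambda>x. exp (\<i> * complex_of_real (l * x)) * (1 / ((complex_of_real x - w) * (complex_of_real x - w'))))"
proof -
  have "majorant (\<lambda>x. cmod (1 / ((complex_of_real x - w) * (complex_of_real x - w'))))"
    using assms by (intro resolvent_product_majorant) auto
  moreover have "cmod (exp (\<i> * complex_of_real (l * x)) * (1 / ((complex_of_real x - w) * (complex_of_real x - w')))) \<le> cmod (1 / ((complex_of_real x - w) * (complex_of_real x - w')))" for x
    unfolding norm_mult[of "exp _"] by simp
  ultimately show ?thesis unfolding test_fun_def by (intro conjI exI) auto
qed

text \<open>Turns the existence of an analytic extension into linear equations on the boundary
  function, which pass to limits in \<open>L\<^sup>p\<close>.\<close>

lemma mk_in_Hardy:
  assumes p: "p > 1" and f: "LpF p f"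
  shows "mk f \<in> Hardy p \<longleftrightarrow> (\<forall>w w'. Im w < 0 \<longrightarrow> Im w' < 0 \<longrightarrow>
    (LINT t|lborel. 1 / ((complex_of_real t - w) * (complex_of_real t - w')) * f t) = 0)"
proof -
  have "is_boundary_value F (mk f) \<longleftrightarrow> (AE x in lborel. ((\<lambda>y. F (Complex x y)) \<longlongrightarrow> f x) (at_right 0))" for F
    using LpF_measurable[OF f] by (simp add: is_boundary_value.abs_eq ae_rel_refl_iff)
  then have iff: "mk f \<in> Hardy p \<longleftrightarrow> (\<exists>F\<in>Hardy_upper p. AE x in lborel. ((\<lambda>y. F (Complex x y)) \<longlongrightarrow> f x) (at_right 0))"
    using mk_Lp[OF f] unfolding Hardy_def by simp
  show ?thesis
  proof
    assume "mk f \<in> Hardy p"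
    then obtain F where F: "F \<in> Hardy_upper p" "AE x in lborel. ((\<lambda>y. F (Complex x y)) \<longlongrightarrow> f x) (at_right 0)"
      unfolding iff by blast
    show "\<forall>w w'. Im w < 0 \<longrightarrow> Im w' < 0 \<longrightarrow> (LINT t|lborel. 1 / ((complex_of_real t - w) * (complex_of_real t - w')) * f t) = 0"
      by (intro allI impI Hardy_annihilated[OF p F(1) f F(2)])
  next
    assume ann: "\<forall>w w'. Im w < 0 \<longrightarrow> Im w' < 0 \<longrightarrow> (LINT t|lborel. 1 / ((complex_of_real t - w) * (complex_of_real t - w')) * f t) = 0"
    obtain F where "F \<in> Hardy_upper p" "AE x in lborel. ((\<lambda>y. F (Complex x y)) \<longlongrightarrow> f x) (at_right 0)"
      by (rule annihilated_imp_Hardy[OF p f]) (use ann in auto)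
    then show "mk f \<in> Hardy p" unfolding iff by blast
  qed
qed

section \<open>The members of the binest as annihilators\<close>

definition hardy_tests :: "real \<Rightarrow> (real \<Rightarrow> complex) set" where
  "hardy_tests l = {\<lambda>x. exp (\<i> * complex_of_real (- l * x)) * (1 / ((complex_of_real x - w) * (complex_of_real x - w'))) | w w'. Im w < 0 \<and> Im w' < 0}"

lemma hardy_tests: "u \<in> hardy_tests l \<Longrightarrow> test_fun u"
  unfolding hardy_tests_def mem_Collect_eq by (elim exE conjE) (simp only: test_fun_resolvents)

lemma LpF_modulate: "p \<ge> 1 \<Longrightarrow> LpF p f \<Longrightarrow> LpF p (\<lambda>x. exp (\<i> * complex_of_real (l * x)) * f x)"
  by (rule LpF_mult_bounded(1)[where C=1]) auto

lemma exp_cancel: "exp (\<i> * complex_of_real (- l * x)) * (exp (\<i> * complex_of_real (l * x)) * z) = z"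
  "exp (\<i> * complex_of_real (l * x)) * (exp (\<i> * complex_of_real (- l * x)) * z) = z"
  by (simp_all add: mult.assoc[symmetric] exp_add[symmetric])

lemma mk_in_modulated_Hardy:
  assumes p: "p > 1" and f: "LpF p f"
  shows "mk f \<in> modulation l ` Hardy p \<longleftrightarrow> mk (\<lambda>x. exp (\<i> * complex_of_real (- l * x)) * f x) \<in> Hardy p"
proof
  assume "mk f \<in> modulation l ` Hardy p"
  then obtain G where G: "G \<in> Hardy p" "mk f = modulation l G" by blast
  then obtain g where g: "LpF p g" "G = mk g" using LpE[of G p] by (auto simp: Hardy_def)
  have m: "f \<in> borel_measurable borel" "g \<in> borel_measurable borel" "(\<lambda>x. exp (\<i> * complex_of_real (l * x)) * g x) \<in> borel_measurable borel"
    using LpF_measurable[OF f] LpF_measurable[OF g(1)] by measurable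
  have "modulation (- l) (mk f) = modulation (- l) (modulation l (mk g))" using G g by simp
  then have "mk (\<lambda>x. exp (\<i> * complex_of_real (- l * x)) * f x) = mk g"
    unfolding modulation_mk[OF m(1)] modulation_mk[OF m(2)] modulation_mk[OF m(3)] exp_cancel by simp
  then show "mk (\<lambda>x. exp (\<i> * complex_of_real (- l * x)) * f x) \<in> Hardy p" using G(1) g by (simp only:)
next
  assume h: "mk (\<lambda>x. exp (\<i> * complex_of_real (- l * x)) * f x) \<in> Hardy p"
  have "modulation l (mk (\<lambda>x. exp (\<i> * complex_of_real (- l * x)) * f x)) = mk f"
  proof -
    have m: "(\<lambda>x. exp (\<i> * complex_of_real (- l * x)) * f x) \<in> borel_measurable borel"
      using LpF_measurable[OF f] by measurable
    show ?thesis unfolding modulation_mk[OF m] exp_cancel by (rule refl)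
  qed
  then show "mk f \<in> modulation l ` Hardy p" by (rule image_eqI[OF sym h])
qed

lemma modulated_Hardy_ann:
  assumes p: "p > 1"
  shows "modulation l ` Hardy p = ann p (hardy_tests l)"
proof -
  have p1: "p \<ge> 1" using p by simp
  have sub: "modulation l ` Hardy p \<subseteq> Lp p"
  proof
    fix F assume "F \<in> modulation l ` Hardy p"
    then obtain G where G: "G \<in> Hardy p" "F = modulation l G" by blast
    then obtain g where g: "LpF p g" "G = mk g" using LpE[of G p] by (auto simp: Hardy_def)
    show "F \<in> Lp p" unfolding G g using mk_Lp[OF LpF_modulate[OF p1 g(1), of l]] LpF_measurable[OF g(1)]
      by (simp add: modulation_mk)
  qed
  have iff: "mk f \<in> modulation l ` Hardy p \<longleftrightarrow> mk f \<in> ann p (hardy_tests l)" if f: "LpF p f" for f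
  proof -
    have 1: "1 / ((complex_of_real t - w) * (complex_of_real t - w')) * (exp (\<i> * complex_of_real (- l * t)) * f t) =
      exp (\<i> * complex_of_real (- l * t)) * (1 / ((complex_of_real t - w) * (complex_of_real t - w'))) * f t" for t w w'
      by (simp only: mult_ac)
    have 2: "mk f \<in> ann p (hardy_tests l) \<longleftrightarrow> (\<forall>u\<in>hardy_tests l. (LINT x|lborel. u x * f x) = 0)"
      by (rule mk_in_ann[OF f hardy_tests])
    show ?thesis
      unfolding mk_in_modulated_Hardy[OF p f] mk_in_Hardy[OF p LpF_modulate[OF p1 f]] 1 2
    proof (intro iffI ballI allI impI)
      fix u assume all: "\<forall>w w'. Im w < 0 \<longrightarrow> Im w' < 0 \<longrightarrow> (LINT t|lborel. exp (\<i> * complex_of_real (- l * t)) * (1 / ((complex_of_real t - w) * (complex_of_real t - w'))) * f t) = 0"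
        and "u \<in> hardy_tests l"
      then obtain w w' where w: "Im w < 0" "Im w' < 0" and u: "u = (\<lambda>x. exp (\<i> * complex_of_real (- l * x)) * (1 / ((complex_of_real x - w) * (complex_of_real x - w'))))"
        unfolding hardy_tests_def mem_Collect_eq by (elim exE conjE) (rule that)
      show "(LINT x|lborel. u x * f x) = 0" unfolding u by (rule all[rule_format, OF w])
    next
      fix w w' assume all: "\<forall>u\<in>hardy_tests l. (LINT x|lborel. u x * f x) = 0" and w: "Im w < 0" "Im w' < 0"
      have "(\<lambda>x. exp (\<i> * complex_of_real (- l * x)) * (1 / ((complex_of_real x - w) * (complex_of_real x - w')))) \<in> hardy_tests l"
        unfolding hardy_tests_def mem_Collect_eq by (rule exI[of _ w], rule exI[of _ w'], intro conjI refl w)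
      from bspec[OF all this] show "(LINT t|lborel. exp (\<i> * complex_of_real (- l * t)) * (1 / ((complex_of_real t - w) * (complex_of_real t - w'))) * f t) = 0" .
    qed
  qed
  show ?thesis
    by (rule Lp_set_eqI[OF sub ann_subset iff])
qed

definition vanishing_tests :: "real set \<Rightarrow> (real \<Rightarrow> complex) set" where
  "vanishing_tests S = {u. test_fun u \<and> (\<forall>x\<in>S. u x = 0)}"

lemma mk_in_ann_vanishing:
  assumes p: "p > 1" and f: "LpF p f" and S: "S \<in> sets borel"
  shows "mk f \<in> ann p (vanishing_tests S) \<longleftrightarrow> (AE x in lborel. x \<notin> S \<longrightarrow> f x = 0)"
proof -
  have [measurable]: "f \<in> borel_measurable borel" using f by (simp add: LpF_def)
  note S [measurable]
  have t: "u \<in> vanishing_tests S \<Longrightarrow> test_fun u" for u by (simp add: vanishing_tests_def)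
  have m: "majorant (\<lambda>x::real. 1 / (1 + x\<^sup>2))"
    unfolding majorant_def using integral_inverse_square
    by (auto intro!: exI[of _ 1] simp: add_pos_nonneg divide_le_eq_1 add_nonneg_nonneg)
  have eq: "mk f \<in> ann p (vanishing_tests S) \<longleftrightarrow> (\<forall>u\<in>vanishing_tests S. (LINT x|lborel. u x * f x) = 0)"
    by (rule mk_in_ann[OF f t])
  show ?thesis
    unfolding eq
  proof
    assume all: "\<forall>u\<in>vanishing_tests S. (LINT x|lborel. u x * f x) = 0"
    \<comment> \<open>The conjugate phase of \<open>f\<close> off \<open>S\<close>, with an
      integrable weight; pairing it with \<open>f\<close> gives the integral of
      \<open>cmod (f x) / (1 + x\<^sup>2)\<close> over the complement of \<open>S\<close>. Where
      \<open>f\<close> vanishes, division by zero makes \<open>u\<close> zero.\<close>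
    define u where "u x = indicator (- S) x *\<^sub>R (complex_of_real (cmod (f x)) / f x * complex_of_real (1 / (1 + x\<^sup>2)))" for x
    have "- S \<in> sets borel" using S by auto
    then have um [measurable]: "u \<in> borel_measurable borel" unfolding u_def by measurable
    have pos: "1 / (1 + x\<^sup>2) > 0" for x :: real by (simp add: add_pos_nonneg)
    have ub: "cmod (u x) \<le> 1 / (1 + x\<^sup>2)" for x
    proof -
      have "cmod (complex_of_real (cmod (f x)) / f x * complex_of_real (1 / (1 + x\<^sup>2))) \<le> 1 * (1 / (1 + x\<^sup>2))"
        unfolding norm_mult norm_of_real using pos[of x] by (intro mult_mono) (auto simp: norm_divide)
      then show ?thesis using pos[of x] by (auto simp: u_def indicator_def)
    qed
    have "u \<in> vanishing_tests S"
      unfolding vanishing_tests_def test_fun_def using um ub m by (auto simp: u_def)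
    then have z: "(LINT x|lborel. u x * f x) = 0" using all by blast
    define v where "v = (\<lambda>x. indicator (- S) x * (cmod (f x) * (1 / (1 + x\<^sup>2))) :: real)"
    have uv: "u x * f x = complex_of_real (v x)" for x
      by (cases "f x = 0") (auto simp: u_def v_def scaleR_conv_of_real indicator_def)
    have "integrable lborel (\<lambda>x. u x * f x)" by (rule dominated_mult_LpF(1)[OF p m f um ub])
    then have vi: "integrable lborel v" unfolding uv by (simp add: complex_of_real_integrable_eq)
    moreover have "(LINT x|lborel. v x) = 0"
    proof -
      have "complex_of_real (LINT x|lborel. v x) = (LINT x|lborel. complex_of_real (v x))"
        by (rule integral_complex_of_real[symmetric])
      then show ?thesis using z unfolding uv by simp
    qed
    ultimately have "AE x in lborel. v x = 0"
      using pos by (subst (asm) integral_nonneg_eq_0_iff_AE) (auto simp: v_def less_imp_le)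
    then show "AE x in lborel. x \<notin> S \<longrightarrow> f x = 0"
    proof eventually_elim
      case (elim x)
      then show ?case using pos[of x] by (auto simp: v_def indicator_def)
    qed
  next
    assume ae: "AE x in lborel. x \<notin> S \<longrightarrow> f x = 0"
    show "\<forall>u\<in>vanishing_tests S. (LINT x|lborel. u x * f x) = 0"
    proof
      fix u assume u: "u \<in> vanishing_tests S"
      from ae have "AE x in lborel. u x * f x = 0"
        by eventually_elim (use u in \<open>auto simp: vanishing_tests_def\<close>)
      then show "(LINT x|lborel. u x * f x) = 0" by (rule integral_eq_zero_AE)
    qed
  qed
qed

lemma vanishes_mk: "f \<in> borel_measurable borel \<Longrightarrow> vanishes_outside S (mk f) \<longleftrightarrow> (AE x in lborel. x \<notin> S \<longrightarrow> f x = 0)"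
  by (simp add: vanishes_outside.abs_eq ae_rel_refl_iff)

lemma half_line_ann:
  assumes p: "p > 1"
  shows "Lp_half_line p t = ann p (vanishing_tests {t..})"
proof -
  have "mk f \<in> Lp_half_line p t \<longleftrightarrow> mk f \<in> ann p (vanishing_tests {t..})" if f: "LpF p f" for f
    using mk_Lp[OF f] LpF_measurable[OF f] mk_in_ann_vanishing[OF p f, of "{t..}"]
    by (simp add: Lp_half_line_def vanishes_mk)
  moreover have "Lp_half_line p t \<subseteq> Lp p" by (auto simp: Lp_half_line_def)
  ultimately show ?thesis
    by (intro Lp_set_eqI[OF _ ann_subset]) auto
qed

lemma zero_ann:
  assumes p: "p > 1"
  shows "{0} = ann p (vanishing_tests {})"
proof -
  have "mk f = 0 \<longleftrightarrow> mk f \<in> ann p (vanishing_tests {})" if f: "LpF p f" for f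
  proof -
    have "mk f \<in> ann p (vanishing_tests {}) \<longleftrightarrow> (AE x in lborel. f x = 0)"
      using mk_in_ann_vanishing[OF p f, of "{}"] by simp
    also have "\<dots> \<longleftrightarrow> mk f = mk (\<lambda>_. 0)"
      using Quotient3_rel[OF Quotient3_ae_fun, of f "\<lambda>_. 0"] LpF_measurable[OF f] by (auto simp: ae_rel_def)
    finally show ?thesis by (simp add: mk_0)
  qed
  then show ?thesis
    by (intro Lp_set_eqI[OF _ ann_subset]) (auto simp: Lp_0)
qed

lemma Fourier_binest_ann:
  assumes p: "p > 1" and K: "K \<in> Fourier_binest p"
  obtains U where "\<And>u. u \<in> U \<Longrightarrow> test_fun u" "K = ann p U"
proof -
  have v: "u \<in> vanishing_tests S \<Longrightarrow> test_fun u" for u S by (simp add: vanishing_tests_def)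
  have L: "Lp p = ann p {}" by (simp add: ann_def)
  from K consider "K = {0}" | t where "K = Lp_half_line p t" | l where "K = modulation l ` Hardy p" | "K = Lp p"
    by (auto simp: Fourier_binest_def)
  then show thesis
  proof cases
    case 1
    show thesis by (rule that[of "vanishing_tests {}"]) (use v 1 zero_ann[OF p] in auto)
  next
    case (2 t)
    show thesis by (rule that[of "vanishing_tests {t..}"]) (use v 2 half_line_ann[OF p] in auto)
  next
    case (3 l)
    show thesis by (rule that[of "hardy_tests l"]) (use hardy_tests 3 modulated_Hardy_ann[OF p] in auto)
  next
    case 4
    show thesis by (rule that[of "{}"]) (use L 4 in auto)
  qed
qed

section \<open>Invariance of the binest under the generators\<close>

text \<open>For \<open>l \<ge> 0\<close> the factor \<open>exp (\<i> * l * z)\<close> is bounded by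
  1 above the line. The proof goes through the analytic extension, since the family of resolvent
  products is not stable under modulation.\<close>

lemma Hardy_modulation:
  assumes p: "p > 1" and f: "LpF p f" "mk f \<in> Hardy p" and l: "l \<ge> 0"
  shows "mk (\<lambda>x. exp (\<i> * complex_of_real (l * x)) * f x) \<in> Hardy p"
proof -
  obtain F where F: "F \<in> Hardy_upper p" and bv: "AE x in lborel. ((\<lambda>y. F (Complex x y)) \<longlongrightarrow> f x) (at_right 0)"
    using f LpF_measurable[OF f(1)] by (auto simp: Hardy_def is_boundary_value.abs_eq ae_rel_refl_iff)
  define G where "G z = exp (\<i> * complex_of_real l * z) * F z" for z
  have "G holomorphic_on {z. Im z > 0}"
    using F unfolding G_def Hardy_upper_def by (auto intro!: holomorphic_intros)
  moreover have "(SUP y\<in>{0<..}. \<integral>\<^sup>+x. ennreal (cmod (G (Complex x y)) powr p) \<partial>lborel) \<le> (SUP y\<in>{0<..}. \<integral>\<^sup>+x. ennreal (cmod (F (Complex x y)) powr p) \<partial>lborel)"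
  proof (intro SUP_mono bexI nn_integral_mono ennreal_leI powr_mono2)
    fix y :: real and x assume y: "y \<in> {0<..}"
    have "cmod (exp (\<i> * complex_of_real l * Complex x y)) \<le> 1" using y l by simp
    then show "cmod (G (Complex x y)) \<le> cmod (F (Complex x y))"
      unfolding G_def norm_mult[of "exp _"] by (simp add: mult_left_le_one_le)
  qed (use p in auto)
  ultimately have "G \<in> Hardy_upper p" using F unfolding Hardy_upper_def by (auto intro: order.strict_trans1)
  moreover have "AE x in lborel. ((\<lambda>y. G (Complex x y)) \<longlongrightarrow> exp (\<i> * complex_of_real (l * x)) * f x) (at_right 0)"
    using bv
  proof eventually_elim
    case (elim x)
    have "((\<lambda>y. exp (\<i> * complex_of_real l * (complex_of_real x + \<i> * complex_of_real y))) \<longlongrightarrow> exp (\<i> * complex_of_real l * (complex_of_real x + \<i> * complex_of_real 0))) (at_right 0)"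
      by (intro tendsto_intros)
    then have "((\<lambda>y. exp (\<i> * complex_of_real l * Complex x y)) \<longlongrightarrow> exp (\<i> * complex_of_real (l * x))) (at_right 0)"
      by (simp add: Complex_eq mult.assoc)
    from tendsto_mult[OF this elim] show ?case by (simp add: G_def)
  qed
  ultimately show ?thesis
    using LpF_modulate[OF _ f(1), of l] p LpF_measurable[OF f(1)]
    by (auto simp: Hardy_def mk_Lp is_boundary_value.abs_eq ae_rel_refl_iff)
qed

text \<open>A real shift moves the poles of the tests horizontally and keeps them below the line, so
  \<open>a\<close> may have either sign.\<close>

lemma Hardy_translation:
  assumes p: "p > 1" and f: "LpF p f" "mk f \<in> Hardy p"
  shows "mk (\<lambda>x. f (x - a)) \<in> Hardy p"
  unfolding mk_in_Hardy[OF p LpF_shift(1)[OF f(1)]]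
proof (intro allI impI)
  fix w w' assume w: "Im w < 0" "Im w' < 0"
  have "(LINT t|lborel. 1 / ((complex_of_real t - w) * (complex_of_real t - w')) * f (t - a)) =
    (LINT t|lborel. 1 / ((complex_of_real t - (w - a)) * (complex_of_real t - (w' - a))) * f t)"
    using lborel_integral_real_affine[of 1 "\<lambda>t. 1 / ((complex_of_real t - w) * (complex_of_real t - w')) * f (t - a)" a]
    by (simp add: algebra_simps)
  also have "\<dots> = 0"
    using f(2) w unfolding mk_in_Hardy[OF p f(1)] by simp
  finally show "(LINT t|lborel. 1 / ((complex_of_real t - w) * (complex_of_real t - w')) * f (t - a)) = 0" .
qed

lemma Hardy_scale:
  assumes p: "p > 1" and F: "F \<in> Hardy p"
  shows "c *\<^sub>a F \<in> Hardy p"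
proof -
  have id: "modulation 0 ` Hardy p = Hardy p"
  proof -
    have "modulation 0 G = G" for G
      using modulation_mk[of "fn G" 0] by simp
    then show ?thesis by auto
  qed
  have "Hardy p = ann p (hardy_tests 0)" using modulated_Hardy_ann[OF p, of 0] id by simp
  with F show ?thesis by (simp only:) (rule ann_scale[OF hardy_tests])
qed

lemma algebra_bounded_ops:
  assumes p: "p \<ge> 1" and S: "S \<in> bounded_ops p" and T: "T \<in> bounded_ops p"
  shows "(\<lambda>f\<in>Lp p. S f + T f) \<in> bounded_ops p" "(\<lambda>f\<in>Lp p. c *\<^sub>a T f) \<in> bounded_ops p"
    "compose (Lp p) S T \<in> bounded_ops p"
proof -
  obtain C where C: "bop p C (\<lambda>f. fn (S (mk f)))" "op p (\<lambda>f. fn (S (mk f))) = S"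
    by (rule bounded_op_representation[OF p S])
  obtain D where D: "bop p D (\<lambda>f. fn (T (mk f)))" "op p (\<lambda>f. fn (T (mk f))) = T"
    by (rule bounded_op_representation[OF p T])
  show "(\<lambda>f\<in>Lp p. S f + T f) \<in> bounded_ops p"
    using op_bounded[OF p bop_add(1)[OF p C(1) D(1)]] bop_add(2)[OF p C(1) D(1)] C(2) D(2) by simp
  show "(\<lambda>f\<in>Lp p. c *\<^sub>a T f) \<in> bounded_ops p"
    using op_bounded[OF p bop_scale(1)[OF p D(1)], of c] bop_scale(2)[OF p D(1), of c] D(2) by simp
  show "compose (Lp p) S T \<in> bounded_ops p"
    using op_bounded[OF p bop_compose(1)[OF p C(1) D(1)]] bop_compose(2)[OF p C(1) D(1)] C(2) D(2) by simp
qed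

lemma Fourier_binest_subset:
  assumes p: "p > 1" and K: "K \<in> Fourier_binest p"
  shows "K \<subseteq> Lp p" "0 \<in> K" "F \<in> K \<Longrightarrow> G \<in> K \<Longrightarrow> F + G \<in> K" "F \<in> K \<Longrightarrow> c *\<^sub>a F \<in> K"
    "closedin (Lp_topology p) K"
proof -
  obtain U where U: "\<And>u. u \<in> U \<Longrightarrow> test_fun u" "K = ann p U"
    by (rule Fourier_binest_ann[OF p K]) blast
  show "K \<subseteq> Lp p" "0 \<in> K" "F \<in> K \<Longrightarrow> G \<in> K \<Longrightarrow> F + G \<in> K" "F \<in> K \<Longrightarrow> c *\<^sub>a F \<in> K"
    "closedin (Lp_topology p) K"
    unfolding U(2) by (rule ann_subset ann_zero[OF U(1)] ann_add[OF p U(1)] ann_scale[OF U(1)] ann_closed[OF p U(1)]; assumption)+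
qed

lemma Fourier_binest_algebra_algebra:
  assumes p: "p > 1"
  shows "operator_algebra p (Fourier_binest_algebra p)"
proof -
  have p1: "p \<ge> 1" using p by simp
  have inv: "T F \<in> K" if "T \<in> Fourier_binest_algebra p" "K \<in> Fourier_binest p" "F \<in> K" for T F K
    using that by (auto simp: Fourier_binest_algebra_def)
  have bd: "T \<in> bounded_ops p" if "T \<in> Fourier_binest_algebra p" for T
    using that by (auto simp: Fourier_binest_algebra_def)
  have mem: "F \<in> Lp p" if "K \<in> Fourier_binest p" "F \<in> K" for K F
    using Fourier_binest_subset(1)[OF p that(1)] that(2) by blast
  show ?thesis
    unfolding operator_algebra_def
  proof (intro conjI ballI allI)
    show "Fourier_binest_algebra p \<subseteq> bounded_ops p" using bd by blast
    have b0: "bop p 0 (\<lambda>f x. 0)" by (rule bopI) auto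
    have "op p (\<lambda>f x. 0) = (\<lambda>f\<in>Lp p. 0)" by (simp add: op_def mk_0)
    then have "(\<lambda>f\<in>Lp p. 0) \<in> bounded_ops p" using op_bounded[OF p1 b0] by simp
    moreover have "0 \<in> K" if "K \<in> Fourier_binest p" for K
      by (rule Fourier_binest_subset(2)[OF p that])
    ultimately show "(\<lambda>f\<in>Lp p. 0) \<in> Fourier_binest_algebra p"
      using mem by (auto simp: Fourier_binest_algebra_def)
  next
    fix S T assume S: "S \<in> Fourier_binest_algebra p" and T: "T \<in> Fourier_binest_algebra p"
    have "F + G \<in> K" if "K \<in> Fourier_binest p" "F \<in> K" "G \<in> K" for K F G
      by (rule Fourier_binest_subset(3)[OF p that])
    then show "(\<lambda>f\<in>Lp p. S f + T f) \<in> Fourier_binest_algebra p"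
      using algebra_bounded_ops(1)[OF p1 bd[OF S] bd[OF T]] inv[OF S] inv[OF T] mem by (auto simp: Fourier_binest_algebra_def)
    show "compose (Lp p) S T \<in> Fourier_binest_algebra p"
      using algebra_bounded_ops(3)[OF p1 bd[OF S] bd[OF T]] inv[OF S] inv[OF T] mem by (auto simp: Fourier_binest_algebra_def compose_def)
  next
    fix c T assume T: "T \<in> Fourier_binest_algebra p"
    have "c *\<^sub>a F \<in> K" if "K \<in> Fourier_binest p" "F \<in> K" for K F
      by (rule Fourier_binest_subset(4)[OF p that])
    then show "(\<lambda>f\<in>Lp p. c *\<^sub>a T f) \<in> Fourier_binest_algebra p"
      using algebra_bounded_ops(2)[OF p1 bd[OF T] bd[OF T]] inv[OF T] mem by (auto simp: Fourier_binest_algebra_def)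
  qed
qed

text \<open>Each condition \<open>T F \<in> K\<close> with \<open>F \<in> K\<close> is the preimage
  of a closed set under a coordinate projection of the product topology; the algebra is the
  intersection of all of them with the bounded operators.\<close>

lemma Fourier_binest_algebra_closed:
  assumes p: "p > 1"
  shows "closedin (SOT p) (Fourier_binest_algebra p)"
proof -
  have p1: "p \<ge> 1" using p by simp
  let ?P = "product_topology (\<lambda>_. Lp_topology p) (Lp p)"
  let ?C = "\<lambda>(K, F). {T \<in> topspace ?P. T F \<in> K}"
  let ?I = "SIGMA K:Fourier_binest p. K"
  have "closedin ?P (\<Inter>(?C ` ?I))"
  proof (rule closedin_Inter)
    have "{0} \<in> Fourier_binest p" by (simp add: Fourier_binest_def)
    then show "?C ` ?I \<noteq> {}" by blast
    fix X assume "X \<in> ?C ` ?I"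
    then obtain K F where K: "K \<in> Fourier_binest p" "F \<in> K" and X: "X = {T \<in> topspace ?P. T F \<in> K}" by auto
    have F: "F \<in> Lp p" using Fourier_binest_subset(1)[OF p K(1)] K(2) by blast
    from Fourier_binest_subset(5)[OF p K(1)] show "closedin ?P X"
      unfolding X by (rule closedin_continuous_map_preimage[OF continuous_map_product_projection[OF F]])
  qed
  moreover have "Fourier_binest_algebra p = \<Inter>(?C ` ?I) \<inter> bounded_ops p"
  proof -
    have "T \<in> topspace ?P" if "T \<in> bounded_ops p" for T
      using that by (auto simp: topspace_Lp[OF p1] bounded_ops_def)
    then show ?thesis unfolding Fourier_binest_algebra_def by blast
  qed
  ultimately show ?thesis unfolding SOT_def closedin_subtopology by blast
qed

lemma generators_in_Fourier_binest_algebra: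
  assumes p: "p > 1"
  shows "{M_op p l | l. l \<ge> 0} \<union> {D_op p m | m. m \<ge> 0} \<subseteq> Fourier_binest_algebra p"
proof -
  have p1: "p \<ge> 1" using p by simp
  have cases: "T \<in> Fourier_binest_algebra p" if T: "T \<in> bounded_ops p" "T 0 = 0"
    "\<And>t f. LpF p f \<Longrightarrow> AE x in lborel. x \<notin> {t..} \<longrightarrow> f x = 0 \<Longrightarrow> T (mk f) \<in> Lp_half_line p t"
    "\<And>a f. LpF p f \<Longrightarrow> mk f \<in> Hardy p \<Longrightarrow> T (modulation a (mk f)) \<in> modulation a ` Hardy p" for T
    unfolding Fourier_binest_algebra_def
  proof (intro CollectI conjI ballI T(1))
    fix K assume "K \<in> Fourier_binest p"
    then consider "K = {0}" | t where "K = Lp_half_line p t" | l where "K = modulation l ` Hardy p" | "K = Lp p"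
      by (auto simp: Fourier_binest_def)
    then show "T ` K \<subseteq> K"
    proof cases
      case 1
      show ?thesis unfolding 1 by (simp add: T(2))
    next
      case (2 t)
      show ?thesis unfolding 2
      proof (rule image_subsetI)
        fix F assume F: "F \<in> Lp_half_line p t"
        then obtain f where f: "LpF p f" "F = mk f" using LpE[of F p] by (auto simp: Lp_half_line_def)
        have "AE x in lborel. x \<notin> {t..} \<longrightarrow> f x = 0"
          using F vanishes_mk[OF LpF_measurable[OF f(1)], of "{t..}"] unfolding f(2) Lp_half_line_def by simp
        then show "T F \<in> Lp_half_line p t" unfolding f(2) by (rule T(3)[OF f(1)])
      qed
    next
      case (3 l)
      show ?thesis unfolding 3
      proof (rule image_subsetI)
        fix F assume "F \<in> modulation l ` Hardy p"
        then obtain G where G: "G \<in> Hardy p" "F = modulation l G" by blast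
        then obtain g where g: "LpF p g" "G = mk g" using LpE[of G p] by (auto simp: Hardy_def)
        have "mk g \<in> Hardy p" using G(1) g(2) by simp
        then show "T F \<in> modulation l ` Hardy p" unfolding G(2) g(2) by (rule T(4)[OF g(1)])
      qed
    next
      case 4
      have "T \<in> Lp p \<rightarrow>\<^sub>E Lp p" using T(1) unfolding bounded_ops_def by blast
      then show ?thesis unfolding 4 by blast
    qed
  qed
  have "M_op p l \<in> Fourier_binest_algebra p" if l: "l \<ge> 0" for l
  proof (rule cases)
    show "M_op p l \<in> bounded_ops p"
      unfolding M_op_eq[OF p1] by (rule op_bounded[OF p1 mop_bop[OF p1, where B=1]]) auto
    show "M_op p l 0 = 0"
      using modulation_mk[of "\<lambda>_. 0" l] by (simp add: M_op_def Lp_0 mk_0)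
    fix f assume f: "LpF p f"
    have M: "M_op p l (mk g) = mk (\<lambda>x. exp (\<i> * complex_of_real (l * x)) * g x)" if "LpF p g" for g
      using mk_Lp[OF that] LpF_measurable[OF that] by (simp add: M_op_def modulation_mk)
    show "M_op p l (mk f) \<in> Lp_half_line p t" if "AE x in lborel. x \<notin> {t..} \<longrightarrow> f x = 0" for t
      unfolding M[OF f] Lp_half_line_def
      using mk_Lp[OF LpF_modulate[OF p1 f, of l]] LpF_measurable[OF LpF_modulate[OF p1 f, of l]] that
      by (auto simp: vanishes_mk)
    show "M_op p l (modulation a (mk f)) \<in> modulation a ` Hardy p" if "mk f \<in> Hardy p" for a
    proof
      show "mk (\<lambda>x. exp (\<i> * complex_of_real (l * x)) * f x) \<in> Hardy p"
        by (rule Hardy_modulation[OF p f that l])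
      show "M_op p l (modulation a (mk f)) = modulation a (mk (\<lambda>x. exp (\<i> * complex_of_real (l * x)) * f x))"
        using M[OF LpF_modulate[OF p1 f, of a]] LpF_measurable[OF f] by (simp add: modulation_mk mult.left_commute)
    qed
  qed
  moreover have "D_op p m \<in> Fourier_binest_algebra p" if m: "m \<ge> 0" for m
  proof (rule cases)
    show "D_op p m \<in> bounded_ops p"
      unfolding D_op_eq[OF p1] by (rule op_bounded[OF p1 shift_bop])
    show "D_op p m 0 = 0"
      using translation_mk[of "\<lambda>_. 0" m] by (simp add: D_op_def Lp_0 mk_0)
    fix f assume f: "LpF p f"
    have D: "D_op p m (mk g) = mk (\<lambda>x. g (x - m))" if "LpF p g" for g
      using mk_Lp[OF that] LpF_measurable[OF that] by (simp add: D_op_def translation_mk)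
    show "D_op p m (mk f) \<in> Lp_half_line p t" if "AE x in lborel. x \<notin> {t..} \<longrightarrow> f x = 0" for t
    proof -
      have [measurable]: "f \<in> borel_measurable borel" using f by (simp add: LpF_def)
      have "AE x in lborel. (\<lambda>x. if x \<notin> {t..} then f x else 0) (- m + 1 * x) = (\<lambda>_. 0) (- m + 1 * x)"
        by (rule AE_borel_affine) (use that in auto)
      then have "AE x in lborel. x \<notin> {t..} \<longrightarrow> f (x - m) = 0"
        by eventually_elim (use m in \<open>auto split: if_splits\<close>)
      then show ?thesis
        unfolding D[OF f] Lp_half_line_def using mk_Lp[OF LpF_shift(1)[OF f, of m]] by (simp add: vanishes_mk)
    qed
    show "D_op p m (modulation a (mk f)) \<in> modulation a ` Hardy p" if "mk f \<in> Hardy p" for a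
    proof
      \<comment> \<open>Translation and modulation commute up to this scalar, which the Hardy space
        absorbs.\<close>
      let ?c = "exp (\<i> * complex_of_real (- a * m))"
      show "?c *\<^sub>a mk (\<lambda>x. f (x - m)) \<in> Hardy p"
        by (intro Hardy_scale Hardy_translation p f that)
      have "D_op p m (modulation a (mk f)) = mk (\<lambda>x. exp (\<i> * complex_of_real (a * (x - m))) * f (x - m))"
        using D[OF LpF_modulate[OF p1 f, of a]] LpF_measurable[OF f] by (simp add: modulation_mk)
      also have "(\<lambda>x. exp (\<i> * complex_of_real (a * (x - m))) * f (x - m)) = (\<lambda>x. exp (\<i> * complex_of_real (a * x)) * (?c * f (x - m)))"
      proof
        fix x
        have "exp (\<i> * complex_of_real (a * (x - m))) = exp (\<i> * complex_of_real (a * x)) * ?c"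
          by (simp add: exp_add[symmetric] algebra_simps)
        then show "exp (\<i> * complex_of_real (a * (x - m))) * f (x - m) = exp (\<i> * complex_of_real (a * x)) * (?c * f (x - m))"
          by simp
      qed
      finally show "D_op p m (modulation a (mk f)) = modulation a (?c *\<^sub>a mk (\<lambda>x. f (x - m)))"
        using LpF_measurable[OF LpF_shift(1)[OF f, of m]] by (simp add: mk_scale modulation_mk)
    qed
  qed
  ultimately show ?thesis by blast
qed

lemma Fourier_binest_closed_algebra: "p > 1 \<Longrightarrow> closed_algebra p (Fourier_binest_algebra p)"
  by (intro closed_algebra.intro Fourier_binest_algebra_algebra Fourier_binest_algebra_closed generators_in_Fourier_binest_algebra)

lemma parabolic_subset_Fourier: "p > 1 \<Longrightarrow> parabolic_algebra p \<subseteq> Fourier_binest_algebra p"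
  unfolding parabolic_algebra_def SOT_closed_algebra_generated_def
  by (intro hull_minimal generators_in_Fourier_binest_algebra conjI Fourier_binest_algebra_algebra Fourier_binest_algebra_closed)

text \<open>Moving up from the real line increases the distance to the poles, so the modulus on
  every horizontal line is at most that on the boundary. These functions later serve as the inputs
  to which the operator is applied.\<close>

lemma resolvent_product_Hardy:
  assumes p: "p > 1" and w: "Im w < 0" "Im w' < 0"
  shows "LpF p (\<lambda>x. 1 / ((complex_of_real x - w) * (complex_of_real x - w')))"
    "mk (\<lambda>x. 1 / ((complex_of_real x - w) * (complex_of_real x - w'))) \<in> Hardy p"
proof -
  define g where "g z = 1 / ((z - w) * (z - w'))" for z
  define m where "m x = cmod (g (complex_of_real x))" for x
  have m: "majorant m" unfolding m_def g_def using w by (intro resolvent_product_majorant) auto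
  obtain B where B: "\<And>x. m x \<le> B" using m by (auto simp: majorant_def)
  have nz: "z - w \<noteq> 0" "z - w' \<noteq> 0" if "Im z \<ge> 0" for z using that w by auto
  have [measurable]: "(\<lambda>x. g (complex_of_real x)) \<in> borel_measurable borel" unfolding g_def by measurable
  have mp: "integrable lborel (\<lambda>x. m x powr p)"
  proof (rule Bochner_Integration.integrable_bound)
    show "integrable lborel (\<lambda>x. B powr (p - 1) * m x)" using m by (simp add: majorantD)
    have "m x powr p \<le> B powr (p - 1) * m x" for x
    proof -
      have "m x powr p = m x powr (p - 1) * m x"
        using powr_mult_base[of "m x" "p - 1"] m by (simp add: majorantD mult.commute)
      also have "\<dots> \<le> B powr (p - 1) * m x"
        using m B p by (intro mult_right_mono powr_mono2) (auto simp: majorantD)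
      finally show ?thesis .
    qed
    then show "AE x in lborel. norm (m x powr p) \<le> norm (B powr (p - 1) * m x)"
      by (intro AE_I2) (auto intro: order_trans[OF _ abs_ge_self])
  qed (unfold m_def, measurable)
  show L: "LpF p (\<lambda>x. 1 / ((complex_of_real x - w) * (complex_of_real x - w')))"
    using mp unfolding LpF_def m_def g_def by simp
  have up: "cmod (complex_of_real x - a) \<le> cmod (Complex x y - a)" "cmod (complex_of_real x - a) > 0" if "Im a < 0" "y \<ge> 0" for x y a
  proof -
    have "(Im a)\<^sup>2 \<le> (y - Im a)\<^sup>2" using that power_mono[of "- Im a" "y - Im a" 2] by simp
    then show "cmod (complex_of_real x - a) \<le> cmod (Complex x y - a)" by (simp add: cmod_def)
    show "cmod (complex_of_real x - a) > 0" using that by (auto simp: complex_eq_iff)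
  qed
  have gm: "cmod (g (Complex x y)) \<le> m x" if "y \<ge> 0" for x y
    unfolding m_def g_def norm_divide norm_mult norm_one using up[OF w(1) that, of x] up[OF w(2) that, of x]
    by (intro divide_left_mono mult_mono mult_pos_pos) (auto intro: order.strict_trans2)
  have "g holomorphic_on {z. Im z > 0}"
    unfolding g_def using nz by (auto intro!: holomorphic_intros simp: less_imp_le)
  moreover have "(SUP y\<in>{0<..}. \<integral>\<^sup>+x. ennreal (cmod (g (Complex x y)) powr p) \<partial>lborel) \<le> (\<integral>\<^sup>+x. ennreal (m x powr p) \<partial>lborel)"
    using gm p by (intro SUP_least nn_integral_mono ennreal_leI powr_mono2) auto
  moreover have "(\<integral>\<^sup>+x. ennreal (m x powr p) \<partial>lborel) < \<infinity>"
    using mp by (simp add: integrable_iff_bounded)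
  ultimately have "g \<in> Hardy_upper p" unfolding Hardy_upper_def by (auto intro: order.strict_trans1)
  moreover have "((\<lambda>y. g (Complex x y)) \<longlongrightarrow> g (complex_of_real x)) (at_right 0)" for x
  proof -
    have "((\<lambda>y. complex_of_real x + \<i> * complex_of_real y) \<longlongrightarrow> complex_of_real x + \<i> * complex_of_real 0) (at_right 0)"
      by (intro tendsto_intros)
    then have "((\<lambda>y. Complex x y) \<longlongrightarrow> complex_of_real x) (at_right 0)" by (simp add: Complex_eq)
    moreover have "isCont g (complex_of_real x)"
      unfolding g_def using nz[of "complex_of_real x"] by (intro continuous_intros) auto
    ultimately show ?thesis by (rule isCont_tendsto_compose[rotated])
  qed
  ultimately show "mk (\<lambda>x. 1 / ((complex_of_real x - w) * (complex_of_real x - w'))) \<in> Hardy p"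
    using mk_Lp[OF L] LpF_measurable[OF L] unfolding Hardy_def
    by (auto simp: is_boundary_value.abs_eq ae_rel_refl_iff g_def[symmetric] intro!: bexI[of _ g])
qed

section \<open>Injectivity of the Fourier transform\<close>

text \<open>The positive and negative parts of \<open>r\<close> have the same Fourier transform, and
  frequency 0 shows that they have the same mass. Normalised by it they are probability densities,
  to which Levy's uniqueness theorem applies.\<close>

lemma Fourier_injective_real:
  fixes r :: "real \<Rightarrow> real"
  assumes r: "integrable lborel r" and F: "\<And>t. (LINT x|lborel. complex_of_real (r x) * iexp (t * x)) = 0"
  shows "AE x in lborel. r x = 0"
proof -
  define a b where "a x = max 0 (r x)" and "b x = max 0 (- r x)" for x
  have [measurable]: "r \<in> borel_measurable borel" using r by auto
  have ab: "r x = a x - b x" "a x \<ge> 0" "b x \<ge> 0" for x by (auto simp: a_def b_def)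
  have ai: "integrable lborel a" "integrable lborel b"
    unfolding a_def b_def using r by (auto intro: Bochner_Integration.integrable_bound[OF r])
  have am [measurable]: "a \<in> borel_measurable borel" "b \<in> borel_measurable borel" using ai by auto
  have ci: "integrable lborel (\<lambda>x. complex_of_real (a x) * iexp (t * x))" "integrable lborel (\<lambda>x. complex_of_real (b x) * iexp (t * x))" for t
    by (rule Bochner_Integration.integrable_bound[OF ai(1)], simp_all add: norm_mult ab)
      (rule Bochner_Integration.integrable_bound[OF ai(2)], simp_all add: norm_mult ab)
  have eq: "(LINT x|lborel. complex_of_real (a x) * iexp (t * x)) = (LINT x|lborel. complex_of_real (b x) * iexp (t * x))" for t
  proof -
    have "0 = (LINT x|lborel. complex_of_real (a x) * iexp (t * x) - complex_of_real (b x) * iexp (t * x))"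
      using F[of t] unfolding ab(1) by (simp add: left_diff_distrib)
    then show ?thesis using ci[of t] by simp
  qed
  define I where "I = (LINT x|lborel. a x)"
  have Ib: "I = (LINT x|lborel. b x)"
    using eq[of 0] unfolding I_def by (simp add: integral_complex_of_real)
  show ?thesis
  proof (cases "I = 0")
    case True
    have "(LINT x|lborel. a x) = 0" "(LINT x|lborel. b x) = 0" using True Ib by (simp_all add: I_def)
    then have "AE x in lborel. a x = 0" "AE x in lborel. b x = 0"
      using integral_nonneg_eq_0_iff_AE[OF ai(1)] integral_nonneg_eq_0_iff_AE[OF ai(2)] ab by simp_all
    then show ?thesis by eventually_elim (simp add: ab)
  next
    case False
    have I: "I > 0" using False ab unfolding I_def by (simp add: less_le)
    have dist: "real_distribution (density lborel (\<lambda>x. ennreal (c x / I)))"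
      if c: "integrable lborel c" "\<And>x. c x \<ge> 0" "(LINT x|lborel. c x) = I" for c :: "real \<Rightarrow> real"
    proof (intro real_distribution.intro real_distribution_axioms.intro)
      have [measurable]: "c \<in> borel_measurable borel" using c by auto
      have "emeasure (density lborel (\<lambda>x. ennreal (c x / I))) (space (density lborel (\<lambda>x. ennreal (c x / I)))) = (\<integral>\<^sup>+x. ennreal (c x / I) \<partial>lborel)"
        by (simp add: emeasure_density)
      also have "\<dots> = ennreal (LINT x|lborel. c x / I)"
        using c I by (intro nn_integral_eq_integral) auto
      also have "\<dots> = 1" using c I by simp
      finally show "prob_space (density lborel (\<lambda>x. ennreal (c x / I)))" by (rule prob_spaceI)
    qed auto
    have ch: "char (density lborel (\<lambda>x. ennreal (c x / I))) t = (LINT x|lborel. complex_of_real (c x) * iexp (t * x)) / I"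
      if c: "integrable lborel c" "\<And>x. c x \<ge> 0" for c :: "real \<Rightarrow> real" and t
    proof -
      have [measurable]: "c \<in> borel_measurable borel" using c by auto
      have "char (density lborel (\<lambda>x. ennreal (c x / I))) t = (LINT x|lborel. (c x / I) *\<^sub>R iexp (t * x))"
        unfolding char_def using c I by (subst integral_density) auto
      also have "\<dots> = (LINT x|lborel. complex_of_real (c x) * iexp (t * x) / I)"
        by (simp add: scaleR_conv_of_real)
      finally show ?thesis by simp
    qed
    have "density lborel (\<lambda>x. ennreal (a x / I)) = density lborel (\<lambda>x. ennreal (b x / I))"
    proof (rule Levy_uniqueness)
      show "real_distribution (density lborel (\<lambda>x. ennreal (a x / I)))" by (rule dist) (use ai ab I_def in auto)
      show "real_distribution (density lborel (\<lambda>x. ennreal (b x / I)))" by (rule dist) (use ai ab Ib in auto)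
      show "char (density lborel (\<lambda>x. ennreal (a x / I))) = char (density lborel (\<lambda>x. ennreal (b x / I)))"
        using ch[OF ai(1)] ch[OF ai(2)] ab eq by (simp add: fun_eq_iff)
    qed
    then have "AE x in lborel. ennreal (a x / I) = ennreal (b x / I)"
      by (subst (asm) sigma_finite_measure.density_unique_iff[OF sigma_finite_lborel]) auto
    then show ?thesis
    proof eventually_elim
      case (elim x)
      then have "a x / I = b x / I" using ab(2,3)[of x] I by (simp add: ennreal_inj)
      then show ?case using I by (simp add: ab(1))
    qed
  qed
qed

text \<open>Since the transform vanishes at all real frequencies, that of \<open>cnj g\<close>
  vanishes too; hence so do the transforms of the real and imaginary parts.\<close>

lemma Fourier_injective:
  fixes g :: "real \<Rightarrow> complex"
  assumes g: "integrable lborel g" and F: "\<And>t. (LINT x|lborel. g x * iexp (t * x)) = 0"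
  shows "AE x in lborel. g x = 0"
proof -
  have [measurable]: "g \<in> borel_measurable borel" using g by auto
  have i: "integrable lborel (\<lambda>x. g x * iexp (t * x))" for t
    by (rule Bochner_Integration.integrable_bound[OF g]) (simp_all add: norm_mult)
  have cF: "(LINT x|lborel. cnj (g x) * iexp (t * x)) = 0" for t
  proof -
    have "(LINT x|lborel. cnj (g x) * iexp (t * x)) = (LINT x|lborel. cnj (g x * iexp ((- t) * x)))"
      by (intro Bochner_Integration.integral_cong refl) (simp add: exp_cnj)
    also have "\<dots> = cnj (LINT x|lborel. g x * iexp ((- t) * x))" by (rule Bochner_Integration.integral_cnj)
    also have "\<dots> = 0" unfolding F by simp
    finally show ?thesis .
  qed
  have ci: "integrable lborel (\<lambda>x. cnj (g x) * iexp (t * x))" for t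
  proof -
    have "cnj (g x) * iexp (t * x) = cnj (g x * iexp ((- t) * x))" for x by (simp add: exp_cnj)
    then show ?thesis using integrable_cnj[OF i[of "- t"]] by (simp only:)
  qed
  have re: "complex_of_real (Re z) * e = (z * e + cnj z * e) / 2" for z e
    by (simp add: distrib_right[symmetric] complex_add_cnj)
  have im: "complex_of_real (Im z) * e = (z * e - cnj z * e) / (2 * \<i>)" for z e
  proof -
    have "z * e - cnj z * e = (2 * \<i>) * (complex_of_real (Im z) * e)"
      by (simp only: left_diff_distrib[symmetric] complex_diff_cnj) simp
    then show ?thesis by simp
  qed
  have "AE x in lborel. Re (g x) = 0"
  proof (rule Fourier_injective_real)
    show "(LINT x|lborel. complex_of_real (Re (g x)) * iexp (t * x)) = 0" for t
      unfolding re using i[of t] ci[of t] F[of t] cF[of t] by simp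
  qed (use g in auto)
  moreover have "AE x in lborel. Im (g x) = 0"
  proof (rule Fourier_injective_real)
    show "(LINT x|lborel. complex_of_real (Im (g x)) * iexp (t * x)) = 0" for t
      unfolding im using i[of t] ci[of t] F[of t] cF[of t] by simp
  qed (use g in auto)
  ultimately show ?thesis by eventually_elim (simp add: complex_eq_iff)
qed

lemma AE_zero_continuous:
  fixes g :: "real \<Rightarrow> complex"
  assumes ae: "AE x in lborel. g x = 0" and g: "continuous_on UNIV g"
  shows "g x = 0"
proof (rule ccontr)
  assume "g x \<noteq> 0"
  have op: "open {y. g y \<noteq> 0}" by (intro open_Collect_neq g continuous_intros)
  have "{y \<in> space lborel. \<not> g y = 0} \<in> null_sets lborel"
    using ae op by (subst (asm) AE_iff_null) auto
  then have "{y. g y \<noteq> 0} \<in> null_sets lebesgue" by (auto intro: null_sets_completionI)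
  then have "negligible {y. g y \<noteq> 0}" by (simp add: negligible_iff_null_sets)
  then show False using open_not_negligible[OF op] \<open>g x \<noteq> 0\<close> by blast
qed

section \<open>The kernel of a regularised operator\<close>

lemma majorant_box: "B \<ge> 0 \<Longrightarrow> majorant (\<lambda>s. B * indicator {a..b} s)"
  unfolding majorant_def
proof (intro conjI allI exI)
  show "integrable lborel (\<lambda>s::real. B * indicator {a..b} s)"
    by (intro integrable_mult_right integrable_real_indicator) (auto simp: emeasure_lborel_Icc_eq)
  show "B \<ge> 0 \<Longrightarrow> B * indicator {a..b} s \<le> B" for s by (auto simp: indicator_def)
qed auto

lemma LpF_box:
  assumes p: "p \<ge> 1" and f: "f \<in> borel_measurable borel" "\<And>x. cmod (f x) \<le> B * indicator {a..b} x"
  shows "LpF p f"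
  by (rule LpF_dominated(1)[OF p f(1) f(1) integrable_box_powr, of B a b]) (use f in auto)

lemma powr_tendsto_zero:
  assumes p: "p > 0" and le: "\<And>n. cmod (a n) powr p \<le> K * N n" and N: "N \<longlonglongrightarrow> 0" "\<And>n. 0 \<le> K * N n"
  shows "a \<longlonglongrightarrow> 0"
proof -
  have "(\<lambda>n. (K * N n) powr (1/p)) \<longlonglongrightarrow> (K * 0) powr (1/p)"
    using p N by (intro tendsto_powr2 tendsto_intros) auto
  then have lim: "(\<lambda>n. (K * N n) powr (1/p)) \<longlonglongrightarrow> 0" using p by simp
  have "cmod (a n) \<le> (K * N n) powr (1/p)" for n
    using powr_mono2[OF _ _ le[of n], of "1/p"] p by (simp add: powr_powr)
  then show ?thesis
    by (intro Lim_null_comparison[OF _ lim]) auto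
qed

text \<open>Both factors vary: the convergence of \<open>g n\<close> in norm is used with the common
  majorant of the \<open>u n\<close>, and the pointwise convergence of \<open>u n\<close> against
  the fixed limit \<open>l\<close>.\<close>

lemma pairing_tendsto:
  assumes p: "p > 1" and g: "\<And>n. LpF p (g n)" "LpF p l" "(\<lambda>n. Np p (\<lambda>x. g n x - l x)) \<longlonglongrightarrow> 0"
    and m: "majorant m" and u: "\<And>n. u n \<in> borel_measurable borel" "v \<in> borel_measurable borel"
    "\<And>n x. cmod (u n x) \<le> m x" "\<And>x. (\<lambda>n. u n x) \<longlonglongrightarrow> v x"
  shows "(\<lambda>n. LINT x|lborel. u n x * g n x) \<longlonglongrightarrow> (LINT x|lborel. v x * l x)"
proof -
  have p1: "p \<ge> 1" using p by simp
  obtain B where B: "\<And>x. m x \<le> B" using m by (auto simp: majorant_def)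
  have B0: "B \<ge> 0" using B[of 0] majorantD(2)[OF m, of 0] by simp
  let ?I = "(LINT x|lborel. m x) powr (p - 1)"
  have dL: "LpF p (\<lambda>x. g n x - l x)" for n by (rule LpF_diff(1)[OF p1 g(1,2)])
  have "(\<lambda>n. LINT x|lborel. u n x * (g n x - l x)) \<longlonglongrightarrow> 0"
  proof (rule powr_tendsto_zero[where K="?I * B" and N="\<lambda>n. Np p (\<lambda>x. g n x - l x)"])
    fix n
    have "(LINT x|lborel. m x * cmod (g n x - l x) powr p) \<le> (LINT x|lborel. B * cmod (g n x - l x) powr p)"
      using dL[of n] B by (intro integral_mono majorant_mult_LpF(1)[OF p m dL] mult_right_mono) (auto simp: LpF_def)
    then have "?I * (LINT x|lborel. m x * cmod (g n x - l x) powr p) \<le> ?I * (B * Np p (\<lambda>x. g n x - l x))"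
      by (intro mult_left_mono) (auto simp: Np_def)
    then show "cmod (LINT x|lborel. u n x * (g n x - l x)) powr p \<le> ?I * B * Np p (\<lambda>x. g n x - l x)"
      using dominated_mult_LpF(3)[OF p m dL[of n] u(1)[of n] u(3)[of n]] by (simp add: mult.assoc)
  qed (use p g B0 in auto)
  moreover have "(\<lambda>n. LINT x|lborel. u n x * l x) \<longlonglongrightarrow> (LINT x|lborel. v x * l x)"
  proof (rule integral_dominated_convergence[where w="\<lambda>x. m x * cmod (l x)"])
    have [measurable]: "l \<in> borel_measurable borel" using g by (simp add: LpF_def)
    show "integrable lborel (\<lambda>x. m x * cmod (l x))" by (rule majorant_mult_LpF(2)[OF p m g(2)])
    show "AE x in lborel. (\<lambda>n. u n x * l x) \<longlonglongrightarrow> v x * l x" by (intro AE_I2 tendsto_intros u)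
    show "AE x in lborel. norm (u n x * l x) \<le> m x * cmod (l x)" for n
      unfolding norm_mult by (intro AE_I2 mult_right_mono u) auto
    show "(\<lambda>x. u n x * l x) \<in> borel_measurable lborel" "(\<lambda>x. v x * l x) \<in> borel_measurable lborel" for n
      using u(1)[of n] u(2) by simp_all
  qed
  ultimately have "(\<lambda>n. (LINT x|lborel. u n x * (g n x - l x)) + (LINT x|lborel. u n x * l x)) \<longlonglongrightarrow> 0 + (LINT x|lborel. v x * l x)"
    by (rule tendsto_add)
  moreover have "(LINT x|lborel. u n x * (g n x - l x)) + (LINT x|lborel. u n x * l x) = (LINT x|lborel. u n x * g n x)" for n
    using dominated_mult_LpF(1)[OF p m g(1) u(1,3), of n] dominated_mult_LpF(1)[OF p m g(2) u(1,3), of n]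
    by (simp add: right_diff_distrib)
  ultimately show ?thesis by simp
qed

text \<open>\<open>n1\<close> and \<open>n2\<close> index the bumps that smooth the output and the
  input of \<open>T\<close>; they stay fixed until the very end, where they are sent to infinity one
  after the other.\<close>

locale binest_kernel =
  fixes p :: real and T :: "ae_fun \<Rightarrow> ae_fun" and n1 n2 :: nat
  assumes p: "p > 1" and T: "T \<in> Fourier_binest_algebra p"
begin

lemma p1: "p \<ge> 1" using p by simp

definition \<Phi> :: "(real \<Rightarrow> complex) \<Rightarrow> real \<Rightarrow> complex" where
  "\<Phi> f = fn (T (mk f))"

definition \<phi> :: "real \<Rightarrow> real \<Rightarrow> complex" where
  "\<phi> y s = complex_of_real (bump n2 (s - y))"

text \<open>The kernel of \<open>bump_op n1\<close> after \<open>\<Phi>\<close> after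
  \<open>bump_op n2\<close>: formally \<open>bump_op n2 f\<close> is the integral of
  \<open>f y\<close> times \<open>\<phi> y\<close>, so \<open>T\<close> is applied to a bump
  starting at \<open>y\<close> and the result is averaged just to the left of
  \<open>x\<close>.\<close>

definition k :: "real \<Rightarrow> real \<Rightarrow> complex" where
  "k x y = (LINT s|lborel. complex_of_real (bump n1 (x - s)) * \<Phi> (\<phi> y) s)"

lemma T_bounded: "T \<in> bounded_ops p"
  using T by (simp add: Fourier_binest_algebra_def)

lemma \<Phi>_bop: obtains C where "bop p C \<Phi>" "op p \<Phi> = T"
  using bounded_op_representation[OF p1 T_bounded] unfolding \<Phi>_def[abs_def] by blast

lemma bump_box: obtains B where "B \<ge> 0" "\<And>t. bump n t \<le> B * indicator {0..2} t"
proof -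
  obtain B where B: "\<And>t. bump n t \<le> B" using bump_props(5)[of n] by (auto simp: majorant_def)
  have "B \<ge> 0" using B[of 0] bump_props(1)[of n 0] by simp
  moreover have "bump n t \<le> B * indicator {0..2} t" for t
    using B[of t] bump_props(2,3)[of t n] by (auto simp: indicator_def not_le)
  ultimately show ?thesis by (rule that)
qed

lemma bump_shift_box:
  assumes B: "B \<ge> 0" "\<And>t. bump n t \<le> B * indicator {0..2} t"
    and t: "0 \<le> t \<Longrightarrow> t \<le> 2 \<Longrightarrow> a \<le> s \<and> s \<le> b"
  shows "cmod (complex_of_real (bump n t)) \<le> B * indicator {a..b} s"
proof (cases "t \<in> {0..2}")
  case True
  then show ?thesis using B(2)[of t] t bump_props(1)[of n t] by simp
next
  case False
  then have "bump n t = 0" using bump_props(2,3)[of t n] by (auto simp: not_le)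
  then show ?thesis using B(1) by simp
qed

lemma \<phi>_measurable [measurable]: "\<phi> y \<in> borel_measurable borel"
  unfolding \<phi>_def[abs_def] by measurable

lemma \<phi>_LpF: "LpF p (\<phi> y)" "Np p (\<phi> y) = Np p (\<phi> 0)"
proof -
  obtain B where B: "B \<ge> 0" "\<And>t. bump n2 t \<le> B * indicator {0..2} t" by (rule bump_box[of n2]) blast
  have 0: "LpF p (\<phi> 0)"
    by (rule LpF_box[OF p1, of _ B 0 2]) (use B(2) bump_props(1) in \<open>auto simp: \<phi>_def\<close>)
  show "LpF p (\<phi> y)" "Np p (\<phi> y) = Np p (\<phi> 0)"
    using LpF_shift[OF 0, of y] by (simp_all add: \<phi>_def[abs_def])
qed

lemma \<phi>_continuous:
  assumes Y: "Y \<longlonglongrightarrow> y"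
  shows "(\<lambda>n. Np p (\<lambda>s. \<phi> (Y n) s - \<phi> y s)) \<longlonglongrightarrow> 0"
proof -
  obtain B where B: "B \<ge> 0" "\<And>t. bump n2 t \<le> B * indicator {0..2} t" by (rule bump_box[of n2]) blast
  obtain R where R: "\<And>n. \<bar>Y n\<bar> \<le> R"
    using convergent_imp_Bseq[OF convergentI[OF Y]] by (auto simp: Bseq_def)
  have b: "cmod (\<phi> (Y n) s) \<le> B * indicator {-R..R + 2} s" for n s
    unfolding \<phi>_def by (rule bump_shift_box[OF B]) (use R[of n] in auto)
  have l: "(\<lambda>n. \<phi> (Y n) s) \<longlonglongrightarrow> \<phi> y s" for s
    unfolding \<phi>_def
    by (intro tendsto_of_real continuous_on_tendsto_compose[OF bump_props(4)[of UNIV n2]] tendsto_intros Y) auto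
  show ?thesis
    by (rule LpF_dominated(3)[OF p1 _ _ integrable_box_powr _ AE_I2[OF b] AE_I2[OF l]]) auto
qed

lemma \<Phi>_\<phi>_continuous:
  assumes Y: "Y \<longlonglongrightarrow> y"
  shows "(\<lambda>n. Np p (\<lambda>s. \<Phi> (\<phi> (Y n)) s - \<Phi> (\<phi> y) s)) \<longlonglongrightarrow> 0"
proof -
  obtain C where C: "bop p C \<Phi>" by (rule \<Phi>_bop)
  have "(\<lambda>n. C * Np p (\<lambda>s. \<phi> (Y n) s - \<phi> y s)) \<longlonglongrightarrow> C * 0"
    by (intro tendsto_intros \<phi>_continuous Y)
  then have "(\<lambda>n. C * Np p (\<lambda>s. \<phi> (Y n) s - \<phi> y s)) \<longlonglongrightarrow> 0" by simp
  from tendsto_sandwich[OF _ _ tendsto_const this]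
  show ?thesis using bop_diff_Np[OF p1 C \<phi>_LpF(1) \<phi>_LpF(1)] by (auto intro!: always_eventually)
qed

lemma \<Phi>_LpF: "LpF p f \<Longrightarrow> LpF p (\<Phi> f)"
  using \<Phi>_bop bopD(2) by metis

lemma k_continuous: "continuous_on UNIV (\<lambda>z. k (fst z) (snd z))"
  unfolding continuous_on_sequentially
proof (intro allI ballI impI)
  fix X :: "nat \<Rightarrow> real \<times> real" and z :: "real \<times> real"
  assume "z \<in> UNIV" "(\<forall>n. X n \<in> UNIV) \<and> X \<longlonglongrightarrow> z"
  then have X: "X \<longlonglongrightarrow> z" by simp
  then have X1: "(\<lambda>n. fst (X n)) \<longlonglongrightarrow> fst z" and X2: "(\<lambda>n. snd (X n)) \<longlonglongrightarrow> snd z"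
    by (auto intro: tendsto_fst tendsto_snd)
  obtain B where B: "B \<ge> 0" "\<And>t. bump n1 t \<le> B * indicator {0..2} t" by (rule bump_box[of n1]) blast
  obtain R where R: "\<And>n. \<bar>fst (X n)\<bar> \<le> R"
    using convergent_imp_Bseq[OF convergentI[OF X1]] by (auto simp: Bseq_def)
  have "(\<lambda>n. LINT s|lborel. complex_of_real (bump n1 (fst (X n) - s)) * \<Phi> (\<phi> (snd (X n))) s) \<longlonglongrightarrow> (LINT s|lborel. complex_of_real (bump n1 (fst z - s)) * \<Phi> (\<phi> (snd z)) s)"
  proof (rule pairing_tendsto[OF p \<Phi>_LpF[OF \<phi>_LpF(1)] \<Phi>_LpF[OF \<phi>_LpF(1)] \<Phi>_\<phi>_continuous[OF X2] majorant_box[OF B(1), of "- R - 2" R]])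
    show "cmod (complex_of_real (bump n1 (fst (X n) - s))) \<le> B * indicator {- R - 2..R} s" for n s
      by (rule bump_shift_box[OF B]) (use R[of n] in auto)
    show "(\<lambda>n. complex_of_real (bump n1 (fst (X n) - s))) \<longlonglongrightarrow> complex_of_real (bump n1 (fst z - s))" for s
      by (intro tendsto_of_real continuous_on_tendsto_compose[OF bump_props(4)[of UNIV n1]] tendsto_intros X1) auto
  qed measurable
  then show "((\<lambda>z. k (fst z) (snd z)) \<circ> X) \<longlonglongrightarrow> k (fst z) (snd z)" by (simp add: k_def o_def)
qed

lemma k_continuous_compose:
  assumes "continuous_on S a" "continuous_on S b"
  shows "continuous_on S (\<lambda>t. k (a t) (b t))"
  using continuous_on_compose2[OF k_continuous continuous_on_Pair[OF assms]] by simp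

lemma k_bounded: obtains \<kappa> where "\<kappa> \<ge> 0" "\<And>x y. cmod (k x y) \<le> \<kappa>"
proof -
  obtain C where C: "bop p C \<Phi>" by (rule \<Phi>_bop)
  obtain B where B: "\<And>t. bump n1 t \<le> B" using bump_props(5)[of n1] by (auto simp: majorant_def)
  have B0: "B \<ge> 0" using B[of 0] bump_props(1)[of n1 0] by simp
  let ?K = "B * (C * Np p (\<phi> 0))"
  have "cmod (k x y) \<le> ?K powr (1/p)" for x y
  proof -
    note ms = majorant_shift[OF bump_props(5)[of n1], of x]
    have "cmod (k x y) powr p \<le> (LINT s|lborel. bump n1 (x - s)) powr (p - 1) * (LINT s|lborel. bump n1 (x - s) * cmod (\<Phi> (\<phi> y) s) powr p)"
      unfolding k_def by (rule dominated_mult_LpF(3)[OF p ms \<Phi>_LpF[OF \<phi>_LpF(1)]]) (auto simp: bump_props)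
    also have "(LINT s|lborel. bump n1 (x - s)) = 1"
      using integrable_reflect(2)[OF majorantD(1)[OF bump_props(5)[of n1]], of x] bump_props(6)[of n1] by simp
    also have "(LINT s|lborel. bump n1 (x - s) * cmod (\<Phi> (\<phi> y) s) powr p) \<le> (LINT s|lborel. B * cmod (\<Phi> (\<phi> y) s) powr p)"
      using \<Phi>_LpF[OF \<phi>_LpF(1)[of y]] B
      by (intro integral_mono majorant_mult_LpF(1)[OF p ms \<Phi>_LpF[OF \<phi>_LpF(1)]] mult_right_mono) (auto simp: LpF_def)
    also have "\<dots> = B * Np p (\<Phi> (\<phi> y))" by (simp add: Np_def)
    also have "\<dots> \<le> B * (C * Np p (\<phi> 0))"
      using bopD(3)[OF C \<phi>_LpF(1)[of y]] \<phi>_LpF(2)[of y] B0 by (intro mult_left_mono) auto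
    finally have "cmod (k x y) powr p \<le> ?K" by simp
    from powr_mono2[OF _ _ this, of "1/p"] show ?thesis using p by (simp add: powr_powr)
  qed
  then show ?thesis by (intro that[of "?K powr (1/p)"]) auto
qed

text \<open>The bump \<open>\<phi> y\<close> lives on \<open>[y, \<infinity>)\<close>, which
  \<open>T\<close> preserves, while the average at \<open>x\<close> only sees points
  \<open>s \<le> x\<close>.\<close>

lemma k_zero:
  assumes "x < y"
  shows "k x y = 0"
proof -
  have "mk (\<phi> y) \<in> Lp_half_line p y"
    using mk_Lp[OF \<phi>_LpF(1)[of y]] bump_props(2)[of _ n2] by (auto simp: Lp_half_line_def vanishes_mk \<phi>_def not_le)
  moreover have "Lp_half_line p y \<in> Fourier_binest p" by (auto simp: Fourier_binest_def)
  ultimately have "T (mk (\<phi> y)) \<in> Lp_half_line p y"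
    using T by (auto simp: Fourier_binest_algebra_def)
  then have "vanishes_outside {y..} (mk (fn (T (mk (\<phi> y)))))" by (simp add: Lp_half_line_def)
  then have "AE s in lborel. s \<notin> {y..} \<longrightarrow> \<Phi> (\<phi> y) s = 0"
    by (simp only: vanishes_mk[OF fn_measurable] \<Phi>_def)
  then have "AE s in lborel. complex_of_real (bump n1 (x - s)) * \<Phi> (\<phi> y) s = 0"
    by eventually_elim (use assms bump_props(2)[of _ n1] in auto)
  then show ?thesis unfolding k_def by (rule integral_eq_zero_AE)
qed

lemma pairing_sum:
  fixes n :: nat
  assumes u: "test_fun u" and g: "\<And>j. LpF p (g j)"
  shows "LpF p (\<lambda>s. \<Sum>j<n. c j * g j s)"
    "(LINT s|lborel. u s * \<Phi> (\<lambda>s. \<Sum>j<n. c j * g j s) s) = (\<Sum>j<n. c j * (LINT s|lborel. u s * \<Phi> (g j) s))"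
proof -
  obtain C where C: "bop p C \<Phi>" by (rule \<Phi>_bop)
  have ui: "integrable lborel (\<lambda>s. u s * \<Phi> f s)" if "LpF p f" for f
    using test_fun_pairing[OF p u] \<Phi>_LpF[OF that] by metis
  have [measurable]: "u \<in> borel_measurable borel" using u by (simp add: test_fun_def)
  have m: "(\<lambda>s. u s * \<Phi> f s) \<in> borel_measurable lborel" if "LpF p f" for f using ui[OF that] by auto
  have "LpF p (\<lambda>s. \<Sum>j<n. c j * g j s) \<and> (LINT s|lborel. u s * \<Phi> (\<lambda>s. \<Sum>j<n. c j * g j s) s) = (\<Sum>j<n. c j * (LINT s|lborel. u s * \<Phi> (g j) s))"
  proof (induction n)
    case 0
    have "AE s in lborel. u s * \<Phi> (\<lambda>s. 0) s = 0"
      using bopD(5)[OF C LpF_0, of 0] by eventually_elim simp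
    then show ?case by (simp add: integral_eq_zero_AE)
  next
    case (Suc n)
    then have L: "LpF p (\<lambda>s. \<Sum>j<n. c j * g j s)" by simp
    note L2 = LpF_cmult(1)[OF g[of n], of "c n"]
    have "(LINT s|lborel. u s * \<Phi> (\<lambda>s. (\<Sum>j<n. c j * g j s) + c n * g n s) s) =
      (LINT s|lborel. u s * \<Phi> (\<lambda>s. \<Sum>j<n. c j * g j s) s + c n * (u s * \<Phi> (g n) s))"
    proof (rule integral_cong_AE)
      show "AE s in lborel. u s * \<Phi> (\<lambda>s. (\<Sum>j<n. c j * g j s) + c n * g n s) s = u s * \<Phi> (\<lambda>s. \<Sum>j<n. c j * g j s) s + c n * (u s * \<Phi> (g n) s)"
        using bopD(4)[OF C L L2] bopD(5)[OF C g[of n], of "c n"] by eventually_elim (simp add: algebra_simps)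
      show "(\<lambda>s. u s * \<Phi> (\<lambda>s. (\<Sum>j<n. c j * g j s) + c n * g n s) s) \<in> borel_measurable lborel"
        by (rule m[OF LpF_add(1)[OF p1 L L2]])
      show "(\<lambda>s. u s * \<Phi> (\<lambda>s. \<Sum>j<n. c j * g j s) s + c n * (u s * \<Phi> (g n) s)) \<in> borel_measurable lborel"
        using m[OF L] m[OF g[of n]] by simp
    qed
    also have "\<dots> = (LINT s|lborel. u s * \<Phi> (\<lambda>s. \<Sum>j<n. c j * g j s) s) + c n * (LINT s|lborel. u s * \<Phi> (g n) s)"
      using ui[OF L] ui[OF g[of n]] by simp
    finally show ?case using Suc LpF_add(1)[OF p1 L L2] by simp
  qed
  then show "LpF p (\<lambda>s. \<Sum>j<n. c j * g j s)"
    "(LINT s|lborel. u s * \<Phi> (\<lambda>s. \<Sum>j<n. c j * g j s) s) = (\<Sum>j<n. c j * (LINT s|lborel. u s * \<Phi> (g j) s))" by auto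
qed

text \<open>\<open>\<Phi>\<close> cannot be moved under an integral directly. The Riemann sums
  \<open>RN\<close> of \<open>bump_op n2 f\<close> converge in \<open>L\<^sup>p\<close>,
  \<open>\<Phi>\<close> passes through the finite sums by linearity and through the limit by
  boundedness, and the resulting numbers are Riemann sums for the integral against
  \<open>k\<close>.\<close>

lemma kernel_formula_compact:
  assumes f: "continuous_on UNIV f" "\<And>x. \<bar>x\<bar> > R \<Longrightarrow> f x = 0"
  shows "bump_op n1 (\<Phi> (bump_op n2 f)) x = (LINT y|lborel. k x y * f y)"
proof -
  obtain C where C: "bop p C \<Phi>" by (rule \<Phi>_bop)
  obtain D where D: "\<And>x. cmod (f x) \<le> D" "D \<ge> 0" using compact_support_bound[OF f] by blast
  have [measurable]: "f \<in> borel_measurable borel" using f(1) by (rule borel_measurable_continuous_onI)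
  have fL: "LpF p f"
    by (rule LpF_box[OF p1, of _ D "-R" R]) (use D f(2) in \<open>auto simp: indicator_def\<close>)
  obtain B where B: "B \<ge> 0" "\<And>t. bump n2 t \<le> B * indicator {0..2} t" by (rule bump_box[of n2]) blast
  \<comment> \<open>Strictly larger than \<open>\<bar>R\<bar>\<close>, so that \<open>f\<close>
    vanishes outside the half-open interval from \<open>- M\<close> to \<open>M\<close>; the shift
    by \<open>M\<close> below moves this interval to one starting at 0, as
    \<open>riemann_sum_limit\<close> requires.\<close>
  define M where "M = nat \<lceil>\<bar>R\<bar>\<rceil> + 1"
  have M: "\<bar>R\<bar> < real M" unfolding M_def by linarith
  have fM: "f y = 0" if "y \<notin> {- real M..<real M}" for y using that M by (intro f(2)) auto
  define y where "y N j = real j / real (Suc N) - real M" for N j :: nat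
  define c where "c N j = of_real (1 / real (Suc N)) * f (y N j)" for N j
  have rs: "(\<lambda>N. \<Sum>j<Suc N * (2 * M). c N j * g (y N j)) \<longlonglongrightarrow> (LINT y|lborel. f y * g y)"
    if g: "continuous_on UNIV g" for g :: "real \<Rightarrow> complex"
  proof -
    have "continuous_on UNIV (\<lambda>t. f (t - real M) * g (t - real M))"
      by (intro continuous_intros continuous_on_compose2[OF f(1)] continuous_on_compose2[OF g]) auto
    from riemann_sum_limit[OF this, of "2 * M"]
    have "(\<lambda>N. \<Sum>j<Suc N * (2 * M). c N j * g (y N j)) \<longlonglongrightarrow> (LINT t|lborel. indicator {0..<real (2 * M)} t *\<^sub>R (f (t - real M) * g (t - real M)))"
      by (simp only: c_def y_def scaleR_conv_of_real mult.assoc)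
    also have "(\<lambda>t. indicator {0..<real (2 * M)} t *\<^sub>R (f (t - real M) * g (t - real M))) = (\<lambda>t. f (t - real M) * g (t - real M))"
    proof
      fix t
      show "indicator {0..<real (2 * M)} t *\<^sub>R (f (t - real M) * g (t - real M)) = f (t - real M) * g (t - real M)"
        using fM[of "t - real M"] by (auto simp: indicator_def)
    qed
    also have "(LINT t|lborel. f (t - real M) * g (t - real M)) = (LINT y|lborel. f y * g y)"
      using lborel_integral_real_affine[of 1 "\<lambda>t. f (t - real M) * g (t - real M)" "real M"] by simp
    finally show ?thesis .
  qed
  define RN where "RN N s = (\<Sum>j<Suc N * (2 * M). c N j * \<phi> (y N j) s)" for N s
  have b2: "bump_op n2 f s = (LINT y|lborel. f y * \<phi> y s)" for s
    unfolding bump_op_def kop_def \<phi>_def by (simp add: mult.commute)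
  have RN_lim: "(\<lambda>N. Np p (\<lambda>s. RN N s - bump_op n2 f s)) \<longlonglongrightarrow> 0"
  proof (rule LpF_dominated(3)[OF p1, where w="\<lambda>s. (2 * real M * D * B) * indicator {- real M..real M + 2} s"])
    show "AE s in lborel. (\<lambda>N. RN N s) \<longlonglongrightarrow> bump_op n2 f s"
    proof (rule AE_I2)
      fix s
      have "continuous_on UNIV (\<lambda>y. \<phi> y s)"
        unfolding \<phi>_def by (intro continuous_intros continuous_on_compose2[OF bump_props(4)[of UNIV n2]]) auto
      from rs[OF this] show "(\<lambda>N. RN N s) \<longlonglongrightarrow> bump_op n2 f s" unfolding RN_def b2 .
    qed
    show "AE s in lborel. cmod (RN N s) \<le> (2 * real M * D * B) * indicator {- real M..real M + 2} s" for N
    proof (rule AE_I2)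
      fix s
      have yb: "- real M \<le> y N j" "y N j \<le> real M" if "j < Suc N * (2 * M)" for j
      proof -
        have "real j \<le> real (Suc N * (2 * M))" using that by linarith
        then have "real j / real (Suc N) \<le> 2 * real M" by (simp add: pos_divide_le_eq mult_ac del: of_nat_Suc mult_Suc mult_Suc_right)
        moreover have "0 \<le> real j / real (Suc N)" by simp
        ultimately show "- real M \<le> y N j" "y N j \<le> real M" unfolding y_def by linarith+
      qed
      have "cmod (RN N s) \<le> (\<Sum>j<Suc N * (2 * M). 1 / real (Suc N) * (D * (B * indicator {- real M..real M + 2} s)))"
        unfolding RN_def
      proof (rule sum_norm_le)
        fix j assume j: "j \<in> {..<Suc N * (2 * M)}"
        have "cmod (\<phi> (y N j) s) \<le> B * indicator {- real M..real M + 2} s"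
          unfolding \<phi>_def by (rule bump_shift_box[OF B]) (use yb[of j] j in auto)
        then have "cmod (f (y N j)) * cmod (\<phi> (y N j) s) \<le> D * (B * indicator {- real M..real M + 2} s)"
          using D by (intro mult_mono) auto
        then have "1 / real (Suc N) * (cmod (f (y N j)) * cmod (\<phi> (y N j) s)) \<le> 1 / real (Suc N) * (D * (B * indicator {- real M..real M + 2} s))"
          by (intro mult_left_mono) auto
        then show "cmod (c N j * \<phi> (y N j) s) \<le> 1 / real (Suc N) * (D * (B * indicator {- real M..real M + 2} s))"
          unfolding c_def norm_mult norm_of_real by (simp add: mult.assoc)
      qed
      also have "\<dots> = real (Suc N * (2 * M)) * (1 / real (Suc N) * (D * (B * indicator {- real M..real M + 2} s)))"
        by (simp only: sum_constant card_lessThan)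
      also have "\<dots> = (2 * real M * D * B) * indicator {- real M..real M + 2} s"
        by (simp only: of_nat_mult) (simp del: of_nat_Suc)
      finally show "cmod (RN N s) \<le> (2 * real M * D * B) * indicator {- real M..real M + 2} s" .
    qed
    show "RN N \<in> borel_measurable borel" for N unfolding RN_def[abs_def] by measurable
    show "bump_op n2 f \<in> borel_measurable borel"
      using kop_dominated(3)[OF p bump_dominated fL] by (simp add: bump_op_def)
  qed (use integrable_box_powr in auto)
  have bL: "LpF p (bump_op n2 f)" by (rule bopD(2)[OF bump_op_bop[OF p] fL])
  define u where "u s = complex_of_real (bump n1 (x - s))" for s
  have um: "u \<in> borel_measurable borel" unfolding u_def[abs_def] by measurable
  have ub: "cmod (u s) \<le> bump n1 (x - s)" for s by (simp add: u_def bump_props)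
  have ut: "test_fun u"
    unfolding test_fun_def using um ub majorant_shift[OF bump_props(5)[of n1], of x] by blast
  note ps = pairing_sum[OF ut \<phi>_LpF(1)]
  have RL: "LpF p (RN N)" for N unfolding RN_def[abs_def] by (rule ps(1))
  have "(\<lambda>N. Np p (\<lambda>s. \<Phi> (RN N) s - \<Phi> (bump_op n2 f) s)) \<longlonglongrightarrow> 0"
  proof (rule tendsto_sandwich[OF _ _ tendsto_const])
    show "(\<lambda>N. C * Np p (\<lambda>s. RN N s - bump_op n2 f s)) \<longlonglongrightarrow> 0"
      using tendsto_mult[OF tendsto_const RN_lim, of C] by simp
  qed (use bop_diff_Np[OF p1 C RL bL] in auto)
  from pairing_tendsto[OF p \<Phi>_LpF[OF RL] \<Phi>_LpF[OF bL] this majorant_shift[OF bump_props(5)[of n1]] um um ub]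
  have 1: "(\<lambda>N. LINT s|lborel. u s * \<Phi> (RN N) s) \<longlonglongrightarrow> (LINT s|lborel. u s * \<Phi> (bump_op n2 f) s)" by simp
  have 2: "(LINT s|lborel. u s * \<Phi> (RN N) s) = (\<Sum>j<Suc N * (2 * M). c N j * k x (y N j))" for N
    unfolding RN_def[abs_def] ps(2) by (simp only: u_def k_def)
  have 3: "(\<lambda>N. \<Sum>j<Suc N * (2 * M). c N j * k x (y N j)) \<longlonglongrightarrow> (LINT y|lborel. f y * k x y)"
    by (rule rs) (intro k_continuous_compose continuous_intros)
  have "(LINT s|lborel. u s * \<Phi> (bump_op n2 f) s) = (LINT y|lborel. f y * k x y)"
    by (rule LIMSEQ_unique[OF 1[unfolded 2] 3])
  then show ?thesis unfolding bump_op_def[of n1] kop_def u_def by (simp add: mult.commute)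
qed

text \<open>\<open>k\<close> is only known to be bounded, so its product with a general
  \<open>f\<close> in \<open>L\<^sup>p\<close> need not be integrable. The multiplier
  \<open>h\<close> turns \<open>k x y * h y\<close> into a test function of \<open>y\<close>, and
  both sides become continuous in \<open>f\<close>.\<close>

lemma kernel_formula:
  assumes h: "continuous_on UNIV h" "majorant m" "\<And>x. cmod (h x) \<le> m x" and f: "LpF p f"
  shows "bump_op n1 (\<Phi> (bump_op n2 (mop h f))) x = (LINT y|lborel. k x y * h y * f y)"
proof -
  obtain C where C: "bop p C \<Phi>" by (rule \<Phi>_bop)
  obtain \<kappa> where \<kappa>: "\<kappa> \<ge> 0" "\<And>x y. cmod (k x y) \<le> \<kappa>" by (rule k_bounded) blast
  obtain B where B: "\<And>x. m x \<le> B" using h(2) by (auto simp: majorant_def)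
  have hm [measurable]: "h \<in> borel_measurable borel" using h(1) by (rule borel_measurable_continuous_onI)
  have hb: "cmod (h x) \<le> B" for x using h(3)[of x] B[of x] by simp
  obtain g where g: "\<And>n. continuous_on UNIV (g n)" "\<And>n. \<exists>R. \<forall>x. \<bar>x\<bar> > R \<longrightarrow> g n x = 0"
    "\<And>n. LpF p (g n)" "(\<lambda>n. Np p (\<lambda>x. g n x - f x)) \<longlonglongrightarrow> 0"
    by (rule LpF_approx_continuous[OF p1 f]) blast
  define \<Psi> where "\<Psi> f = \<Phi> (bump_op n2 (mop h f))" for f
  note b1 = bop_compose(1)[OF p1 C bop_compose(1)[OF p1 bump_op_bop[OF p, of n2] mop_bop[OF p1 hm hb]], folded \<Psi>_def]
  have "(\<lambda>n. Np p (\<lambda>x. \<Psi> (g n) x - \<Psi> f x)) \<longlonglongrightarrow> 0"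
  proof (rule tendsto_sandwich[OF _ _ tendsto_const])
    show "(\<lambda>n. C * (1 * B powr p) * Np p (\<lambda>x. g n x - f x)) \<longlonglongrightarrow> 0"
      using tendsto_mult[OF tendsto_const g(4), of "C * (1 * B powr p)"] by simp
  qed (use bop_diff_Np[OF p1 b1 g(3) f] in auto)
  from pairing_tendsto[OF p bopD(2)[OF b1 g(3)] bopD(2)[OF b1 f] this majorant_shift[OF bump_props(5)[of n1], of x], of "\<lambda>n s. complex_of_real (bump n1 (x - s))" "\<lambda>s. complex_of_real (bump n1 (x - s))"]
  have 1: "(\<lambda>n. bump_op n1 (\<Psi> (g n)) x) \<longlonglongrightarrow> bump_op n1 (\<Psi> f) x"
    unfolding bump_op_def kop_def by (simp add: bump_props)
  have km: "(\<lambda>y. k x y * h y) \<in> borel_measurable borel"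
    by (intro borel_measurable_continuous_onI continuous_intros k_continuous_compose h)
  have mj: "majorant (\<lambda>y. \<kappa> * m y)"
  proof -
    have "\<kappa> * m y \<le> \<kappa> * B" for y using \<kappa>(1) B by (intro mult_left_mono) auto
    then show ?thesis unfolding majorant_def using \<kappa>(1) h(2) by (auto simp: majorantD)
  qed
  have kb: "cmod (k x y * h y) \<le> \<kappa> * m y" for y
    unfolding norm_mult using \<kappa> h(3) by (intro mult_mono) auto
  have 2: "(\<lambda>n. LINT y|lborel. (k x y * h y) * g n y) \<longlonglongrightarrow> (LINT y|lborel. (k x y * h y) * f y)"
    by (rule pairing_tendsto[OF p g(3) f g(4) mj km km kb]) simp
  have "bump_op n1 (\<Psi> (g n)) x = (LINT y|lborel. (k x y * h y) * g n y)" for n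
  proof -
    obtain R where R: "\<And>x. \<bar>x\<bar> > R \<Longrightarrow> g n x = 0" using g(2)[of n] by blast
    have "bump_op n1 (\<Psi> (g n)) x = (LINT y|lborel. k x y * mop h (g n) y)"
      unfolding \<Psi>_def by (rule kernel_formula_compact[where R=R]) (use R in \<open>auto simp: mop_def intro!: continuous_intros h g\<close>)
    then show ?thesis by (simp add: mop_def mult.assoc)
  qed
  with 1 have "(\<lambda>n. LINT y|lborel. (k x y * h y) * g n y) \<longlonglongrightarrow> bump_op n1 (\<Psi> f) x" by simp
  from LIMSEQ_unique[OF this 2] show ?thesis unfolding \<Psi>_def .
qed

end

section \<open>Analyticity of the kernel along the diagonals\<close>

lemma rho_bound: "cmod (rho N x) \<le> 2 * real (Suc N) / (1 + \<bar>x\<bar>)"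
proof -
  define n where "n = real (Suc N)"
  have n: "n \<ge> 1" by (simp add: n_def)
  let ?z = "1 - \<i> * complex_of_real (x / n)"
  have z1: "1 \<le> cmod ?z" by (rule rho_denominator)
  have "1 + \<bar>x\<bar> \<le> n * (1 + \<bar>x / n\<bar>)" using n by (simp add: algebra_simps abs_divide)
  also have "\<dots> \<le> n * (2 * cmod ?z)" using n rho_denominator(1)[of "x / n"] by (intro mult_left_mono) auto
  finally have "1 + \<bar>x\<bar> \<le> 2 * n * cmod ?z" by simp
  then have "1 / cmod ?z \<le> 2 * n / (1 + \<bar>x\<bar>)"
    using z1 by (simp add: divide_simps) (auto simp: mult_ac)
  then show ?thesis by (simp only: rho_def n_def norm_divide norm_one)
qed

lemma rho_continuous: "continuous_on S (rho N)"
proof -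
  have "1 - \<i> * complex_of_real (x / real (Suc N)) \<noteq> 0" for x
    using rho_denominator(2)[of "x / real (Suc N)"] by (metis norm_zero not_one_le_zero)
  then show ?thesis unfolding rho_def[abs_def] by (intro continuous_intros) auto
qed

lemma one_add_square_le: "1 + x\<^sup>2 \<le> (1 + \<bar>x\<bar>)\<^sup>2" for x :: real
  by (simp add: power2_eq_square algebra_simps)

lemma majorant_cauchy: "K \<ge> 0 \<Longrightarrow> majorant (\<lambda>t::real. K * (1 / (1 + t\<^sup>2)))"
proof -
  assume K: "K \<ge> 0"
  have "K * (1 / (1 + t\<^sup>2)) \<le> K * 1" for t :: real
    using K by (intro mult_left_mono) (auto simp: divide_le_eq_1 add_pos_nonneg)
  moreover have "0 \<le> K * (1 / (1 + t\<^sup>2))" for t :: real using K by (simp add: add_nonneg_nonneg)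
  ultimately show ?thesis
    unfolding majorant_def by (intro conjI integrable_mult_right integral_inverse_square(1)) blast+
qed

text \<open>Two factors supply the decay and the others are bounded by 1. Used for the exponents 3
  and 4.\<close>

lemma rho_cube_majorant: "cmod (rho N x ^ (Suc (Suc j))) \<le> (2 * real (Suc N)) ^ 2 * (1 / (1 + x\<^sup>2))"
proof -
  have "cmod (rho N x) ^ Suc (Suc j) = cmod (rho N x) ^ 2 * cmod (rho N x) ^ j" by (simp add: power2_eq_square)
  also have "\<dots> \<le> (2 * real (Suc N) / (1 + \<bar>x\<bar>)) ^ 2 * 1"
    by (intro mult_mono power_mono rho_bound power_le_one rho_le_1) auto
  also have "\<dots> = (2 * real (Suc N)) ^ 2 / (1 + \<bar>x\<bar>)\<^sup>2" by (simp add: power_divide)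
  also have "\<dots> \<le> (2 * real (Suc N)) ^ 2 / (1 + x\<^sup>2)"
    by (intro divide_left_mono one_add_square_le) (auto intro!: mult_pos_pos add_pos_nonneg zero_less_power)
  finally show ?thesis unfolding norm_power by simp
qed

text \<open>Decay in \<open>t\<close> comes from \<open>(1 + \<bar>s + t\<bar>) * (1 +
  \<bar>s\<bar>) \<ge> 1 + \<bar>t\<bar>\<close>. Two factors at \<open>s\<close> are spent on it
  together with the two at \<open>s + t\<close>; the other two at \<open>s\<close> give the decay in
  \<open>s\<close>.\<close>

lemma rho_product_bound:
  "cmod (rho N (s + t) ^ 2 * rho N s ^ 4) \<le> (2 * real (Suc N)) ^ 6 * (1 / (1 + t\<^sup>2)) * (1 / (1 + s\<^sup>2))"
proof -
  define c where "c = 2 * real (Suc N)"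
  have c: "c > 0" by (simp add: c_def)
  let ?r1 = "cmod (rho N (s + t))" and ?r2 = "cmod (rho N s)"
  have "?r1 * ?r2 \<le> c / (1 + \<bar>s + t\<bar>) * (c / (1 + \<bar>s\<bar>))"
    unfolding c_def by (intro mult_mono rho_bound) auto
  also have "\<dots> = c\<^sup>2 / ((1 + \<bar>s + t\<bar>) * (1 + \<bar>s\<bar>))" by (simp add: power2_eq_square)
  also have "\<dots> \<le> c\<^sup>2 / (1 + \<bar>t\<bar>)"
  proof (intro divide_left_mono)
    have "1 + \<bar>t\<bar> \<le> 1 + \<bar>s + t\<bar> + \<bar>s\<bar>" by simp
    also have "\<dots> \<le> (1 + \<bar>s + t\<bar>) * (1 + \<bar>s\<bar>)" by (simp add: algebra_simps)
    finally show "1 + \<bar>t\<bar> \<le> (1 + \<bar>s + t\<bar>) * (1 + \<bar>s\<bar>)" .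
  qed (auto intro!: mult_pos_pos)
  finally have A: "?r1 * ?r2 \<le> c\<^sup>2 / (1 + \<bar>t\<bar>)" .
  have "?r1 ^ 2 * ?r2 ^ 4 = (?r1 * ?r2) ^ 2 * ?r2 ^ 2"
    by (simp add: power_mult_distrib power_add[symmetric] mult.assoc)
  also have "\<dots> \<le> (c\<^sup>2 / (1 + \<bar>t\<bar>)) ^ 2 * (c / (1 + \<bar>s\<bar>)) ^ 2"
    using rho_bound[of N s] unfolding c_def[symmetric] by (intro mult_mono power_mono A) auto
  also have "\<dots> = c ^ 6 * (1 / (1 + \<bar>t\<bar>)\<^sup>2) * (1 / (1 + \<bar>s\<bar>)\<^sup>2)"
    by (simp add: power_divide power_mult_distrib flip: power_mult power_add)
  also have "\<dots> \<le> c ^ 6 * (1 / (1 + t\<^sup>2)) * (1 / (1 + s\<^sup>2))"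
    using c by (intro mult_mono divide_left_mono one_add_square_le mult_nonneg_nonneg)
      (auto intro!: mult_pos_pos add_pos_nonneg zero_less_power add_nonneg_nonneg)
  finally show ?thesis unfolding c_def by (simp add: norm_mult norm_power)
qed

text \<open>The inner majorant may move with \<open>s\<close> as long as its integral is constant;
  this covers the shifted majorant \<open>A (x - s)\<close> after a change of variables.\<close>

lemma integrable_pair_dominated:
  fixes f :: "real \<times> real \<Rightarrow> complex"
  assumes f: "f \<in> borel_measurable (borel \<Otimes>\<^sub>M borel)"
    and b: "integrable lborel b" "\<And>s. b s \<ge> 0"
    and a: "\<And>s. integrable lborel (a s)" "\<And>s. (LINT x|lborel. a s x) = A"
    and le: "\<And>s x. cmod (f (s, x)) \<le> b s * a s x"
  shows "integrable (lborel \<Otimes>\<^sub>M lborel) f"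
proof (rule lborel_pair.Fubini_integrable)
  have fm [measurable]: "f \<in> borel_measurable (lborel \<Otimes>\<^sub>M lborel)" using f by simp
  show "f \<in> borel_measurable (lborel \<Otimes>\<^sub>M lborel)" by (rule fm)
  have fs [measurable]: "(\<lambda>x. f (s, x)) \<in> borel_measurable lborel" for s
    by (rule measurable_compose[OF _ fm]) simp
  have i: "integrable lborel (\<lambda>x. f (s, x))" for s
    by (rule Bochner_Integration.integrable_bound[OF integrable_mult_right[OF a(1)[of s], of "b s"] fs])
      (use le in \<open>auto intro!: AE_I2 order_trans[OF _ abs_ge_self]\<close>)
  then show "AE s in lborel. integrable lborel (\<lambda>x. f (s, x))" by simp
  show "integrable lborel (\<lambda>s. LINT x|lborel. norm (f (s, x)))"
  proof (rule Bochner_Integration.integrable_bound[OF integrable_mult_left[OF b(1), of A]])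
    show "AE s in lborel. norm (LINT x|lborel. norm (f (s, x))) \<le> norm (b s * A)"
    proof (rule AE_I2)
      fix s
      have "(LINT x|lborel. norm (f (s, x))) \<le> (LINT x|lborel. b s * a s x)"
        using i[of s] a(1)[of s] le by (intro integral_mono) auto
      then show "norm (LINT x|lborel. norm (f (s, x))) \<le> norm (b s * A)"
        using a(2)[of s] by (simp add: order_trans[OF _ abs_ge_self])
    qed
  qed measurable
qed

lemma (in closed_algebra) inA_bump: "inA p A (bump_op n)"
  unfolding bump_op_def
  by (rule inA_conv[where m="bump n"])
    (auto simp: bump_props intro!: continuous_intros bump_props(4))

lemma (in closed_algebra) inA_rho_power: "inA p A (mop (\<lambda>x. rho N x ^ Suc j))"
proof (induction j)
  case 0
  then show ?case using inA_rho[of N] by simp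
next
  case (Suc j)
  then show ?case using inA_mop_mult[OF inA_rho[of N] Suc] by simp
qed

context binest_kernel
begin

text \<open>The regularised kernel in the diagonal coordinate \<open>t = x - y\<close>.\<close>

definition G :: "nat \<Rightarrow> real \<Rightarrow> real \<Rightarrow> complex" where
  "G N t s = rho N (s + t) ^ 2 * k (s + t) s * rho N s ^ 4"

lemma G_continuous: "continuous_on UNIV (\<lambda>z. G N (fst z) (snd z))"
  unfolding G_def
  by (intro continuous_intros k_continuous_compose continuous_on_compose2[OF rho_continuous[of UNIV N]]) auto

lemma G_continuous_compose:
  assumes "continuous_on S a" "continuous_on S b"
  shows "continuous_on S (\<lambda>t. G N (a t) (b t))"
  using continuous_on_compose2[OF G_continuous continuous_on_Pair[OF assms]] by simp

lemma G_measurable [measurable]: "(\<lambda>z. G N (fst z) (snd z)) \<in> borel_measurable (borel \<Otimes>\<^sub>M borel)"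
  using borel_measurable_continuous_onI[OF G_continuous] by (simp add: borel_prod)

lemma G_measurable_compose [measurable (raw)]:
  assumes "a \<in> borel_measurable M" "b \<in> borel_measurable M"
  shows "(\<lambda>x. G N (a x) (b x)) \<in> borel_measurable M"
  using measurable_compose[OF measurable_Pair[OF assms] G_measurable] by simp

lemma G_bound: obtains K where "K \<ge> 0" "\<And>t s. cmod (G N t s) \<le> K * (1 / (1 + t\<^sup>2)) * (1 / (1 + s\<^sup>2))"
proof -
  obtain \<kappa> where \<kappa>: "\<kappa> \<ge> 0" "\<And>x y. cmod (k x y) \<le> \<kappa>" by (rule k_bounded) blast
  have "cmod (G N t s) \<le> ((2 * real (Suc N)) ^ 6 * \<kappa>) * (1 / (1 + t\<^sup>2)) * (1 / (1 + s\<^sup>2))" for t s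
  proof -
    have "cmod (G N t s) = cmod (rho N (s + t) ^ 2 * rho N s ^ 4) * cmod (k (s + t) s)"
      by (simp add: G_def norm_mult)
    also have "\<dots> \<le> ((2 * real (Suc N)) ^ 6 * (1 / (1 + t\<^sup>2)) * (1 / (1 + s\<^sup>2))) * \<kappa>"
      by (intro mult_mono rho_product_bound \<kappa>) (auto simp: add_nonneg_nonneg)
    finally show ?thesis by (simp only: mult_ac)
  qed
  then show ?thesis using \<kappa>(1) by (intro that[of "(2 * real (Suc N)) ^ 6 * \<kappa>"]) auto
qed

lemma G_zero: "t < 0 \<Longrightarrow> G N t s = 0"
  by (simp add: G_def k_zero)

text \<open>The input is \<open>exp (-i \<xi> x)\<close> times a resolvent product, so it lies in a
  modulated Hardy space that the smoothed operator preserves. Undoing the modulation gives a Hardy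
  function, and \<open>rho N x ^ 2\<close> is a multiple of a resolvent product. One of the four
  right factors \<open>rho\<close> is inside \<open>f\<close>, the other three form the
  multiplier.\<close>

lemma modulated_resolvent_annihilated:
  fixes N :: nat and \<xi> :: real and w :: complex
  assumes w: "Im w < 0"
  defines "f \<equiv> \<lambda>x. rho N x * (1 / (complex_of_real x - w)) * iexp (- \<xi> * x)"
  shows "LpF p f"
    "(LINT x|lborel. rho N x ^ 2 * (iexp (\<xi> * x) * bump_op n1 (\<Phi> (bump_op n2 (mop (\<lambda>x. rho N x ^ 3) f))) x)) = 0"
proof -
  interpret FB: closed_algebra p "Fourier_binest_algebra p" by (rule Fourier_binest_closed_algebra[OF p])
  define c where "c = \<i> * complex_of_real (real (Suc N))"
  define w1 where "w1 = - \<i> * complex_of_real (real (Suc N))"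
  have w1: "Im w1 < 0" by (simp add: w1_def)
  have rho: "rho N x = c * (1 / (complex_of_real x - w1))" for x
    unfolding c_def w1_def by (rule rho_resolvent)
  define g where "g x = 1 / ((complex_of_real x - w1) * (complex_of_real x - w))" for x
  have g: "LpF p g" "mk g \<in> Hardy p"
    unfolding g_def[abs_def] by (rule resolvent_product_Hardy[OF p w1 w])+
  have feq: "f = (\<lambda>x. exp (\<i> * complex_of_real ((- \<xi>) * x)) * (c * g x))"
    unfolding f_def rho g_def by (simp add: fun_eq_iff mult_ac)
  show fL: "LpF p f" unfolding feq by (rule LpF_modulate[OF p1 LpF_cmult(1)[OF g(1)]])
  have "mk f = modulation (- \<xi>) (c *\<^sub>a mk g)"
    unfolding feq using LpF_measurable[OF g(1)] LpF_measurable[OF LpF_cmult(1)[OF g(1), of c]]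
    by (simp add: mk_scale modulation_mk)
  then have fH: "mk f \<in> modulation (- \<xi>) ` Hardy p" using Hardy_scale[OF p g(2), of c] by blast
  define S where "S f = bump_op n1 (\<Phi> (bump_op n2 (mop (\<lambda>x. rho N x ^ 3) f)))" for f
  have "inA p (Fourier_binest_algebra p) \<Phi>"
    unfolding inA_def using \<Phi>_bop T by metis
  then have "inA p (Fourier_binest_algebra p) S"
    unfolding S_def[abs_def] using FB.inA_rho_power[of N 2]
    by (intro FB.inA_compose[OF FB.inA_bump FB.inA_compose[OF _ FB.inA_compose[OF FB.inA_bump]]]) (simp_all add: numeral_3_eq_3)
  then obtain D where D: "bop p D S" "op p S \<in> Fourier_binest_algebra p" by (auto simp: inA_def)
  have "op p S (mk f) \<in> modulation (- \<xi>) ` Hardy p"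
  proof -
    have "modulation (- \<xi>) ` Hardy p \<in> Fourier_binest p" by (auto simp: Fourier_binest_def)
    moreover have "R F \<in> K" if "R \<in> Fourier_binest_algebra p" "K \<in> Fourier_binest p" "F \<in> K" for R K F
      using that by (auto simp: Fourier_binest_algebra_def)
    ultimately show ?thesis using D(2) fH by blast
  qed
  then have "mk (S f) \<in> modulation (- \<xi>) ` Hardy p" by (simp only: op_mk[OF p1 D(1) fL])
  then have "mk (\<lambda>x. exp (\<i> * complex_of_real (- (- \<xi>) * x)) * S f x) \<in> Hardy p"
    using mk_in_modulated_Hardy[OF p bopD(2)[OF D(1) fL]] by simp
  then have z: "(LINT t|lborel. 1 / ((complex_of_real t - w1) * (complex_of_real t - w1)) * (exp (\<i> * complex_of_real (- (- \<xi>) * t)) * S f t)) = 0"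
    using mk_in_Hardy[OF p LpF_modulate[OF p1 bopD(2)[OF D(1) fL], of "- (- \<xi>)"]] w1 by blast
  have "(LINT x|lborel. rho N x ^ 2 * (iexp (\<xi> * x) * S f x)) =
    (LINT t|lborel. c\<^sup>2 * (1 / ((complex_of_real t - w1) * (complex_of_real t - w1)) * (exp (\<i> * complex_of_real (- (- \<xi>) * t)) * S f t)))"
    by (intro Bochner_Integration.integral_cong refl) (simp add: rho power2_eq_square)
  also have "\<dots> = 0" unfolding integral_mult_right_zero z by simp
  finally show "(LINT x|lborel. rho N x ^ 2 * (iexp (\<xi> * x) * bump_op n1 (\<Phi> (bump_op n2 (mop (\<lambda>x. rho N x ^ 3) f))) x)) = 0"
    unfolding S_def .
qed

text \<open>The Fourier transform in \<open>t\<close> of the Cauchy integral of \<open>G N t\<close> is an integral of a function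
  in the Hardy space against a resolvent product, because the operator leaves \<open>exp (-i \<xi> x) H\<^sup>p\<close> invariant.\<close>

lemma G_annihilated:
  assumes w: "Im w < 0"
  shows "(LINT s|lborel. G N t s * (1 / (complex_of_real s - w))) = 0"
proof -
  obtain K where K: "K \<ge> 0" "\<And>t s. cmod (G N t s) \<le> K * (1 / (1 + t\<^sup>2)) * (1 / (1 + s\<^sup>2))" by (rule G_bound[of N]) blast
  define a where "a = - Im w"
  have a: "a > 0" using w by (simp add: a_def)
  have res: "cmod (1 / (complex_of_real s - w)) \<le> 1 / a" for s
  proof -
    have "a \<le> cmod (complex_of_real s - w)" using abs_Im_le_cmod[of "complex_of_real s - w"] by (simp add: a_def)
    then show ?thesis using a unfolding norm_divide norm_one
      by (intro divide_left_mono mult_pos_pos) (auto intro: order.strict_trans2)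
  qed
  define A where "A t = K / a * (1 / (1 + t\<^sup>2))" for t :: real
  define b where "b s = 1 / (1 + s\<^sup>2)" for s :: real
  have Am: "majorant A" unfolding A_def[abs_def] using K a by (intro majorant_cauchy) auto
  have bm: "majorant b" using majorant_cauchy[of 1] unfolding b_def[abs_def] by simp
  have le: "cmod (G N t s * (1 / (complex_of_real s - w))) \<le> A t * b s" for t s
  proof -
    have "cmod (G N t s * (1 / (complex_of_real s - w))) \<le> (K * (1 / (1 + t\<^sup>2)) * (1 / (1 + s\<^sup>2))) * (1 / a)"
      unfolding norm_mult using K(2) res order_trans[OF norm_ge_zero K(2)] by (intro mult_mono) auto
    then show ?thesis by (simp add: A_def b_def mult_ac)
  qed
  have Ale: "A t \<le> K / a" for t
  proof -
    have "1 / (1 + t\<^sup>2) \<le> 1" by (simp add: divide_le_eq_1 add_pos_nonneg)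
    then show ?thesis unfolding A_def using K a mult_left_mono[of "1 / (1 + t\<^sup>2)" 1 "K / a"] by simp
  qed
  have cw: "continuous_on UNIV (\<lambda>s. 1 / (complex_of_real s - w))"
    using w by (intro continuous_intros) auto
  have mw [measurable]: "(\<lambda>s. 1 / (complex_of_real s - w)) \<in> borel_measurable borel" by measurable
  define Cf where "Cf t = (LINT s|lborel. G N t s * (1 / (complex_of_real s - w)))" for t
  \<comment> \<open>Injectivity of the Fourier transform gives vanishing only for almost every
    \<open>t\<close>; continuity extends it to every \<open>t\<close>.\<close>
  have Cc: "continuous_on UNIV Cf"
    unfolding continuous_on_sequentially
  proof (intro allI ballI impI)
    fix X :: "nat \<Rightarrow> real" and t assume "t \<in> UNIV" "(\<forall>n. X n \<in> UNIV) \<and> X \<longlonglongrightarrow> t"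
    then have X: "X \<longlonglongrightarrow> t" by simp
    have "(\<lambda>n. LINT s|lborel. G N (X n) s * (1 / (complex_of_real s - w))) \<longlonglongrightarrow> (LINT s|lborel. G N t s * (1 / (complex_of_real s - w)))"
    proof (rule integral_dominated_convergence[where w="\<lambda>s. K / a * b s"])
      show "integrable lborel (\<lambda>s. K / a * b s)" using majorantD(1)[OF bm] by simp
      show "AE s in lborel. norm (G N (X n) s * (1 / (complex_of_real s - w))) \<le> K / a * b s" for n
        using Ale[of "X n"] majorantD(2)[OF bm] by (intro AE_I2 order_trans[OF le] mult_right_mono) auto
      show "AE s in lborel. (\<lambda>n. G N (X n) s * (1 / (complex_of_real s - w))) \<longlonglongrightarrow> G N t s * (1 / (complex_of_real s - w))"
      proof (intro AE_I2 tendsto_mult tendsto_const)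
        fix s
        have "continuous_on UNIV (\<lambda>t. G N t s)" by (intro G_continuous_compose continuous_intros)
        then show "(\<lambda>n. G N (X n) s) \<longlonglongrightarrow> G N t s" using X by (intro continuous_on_tendsto_compose[of UNIV "\<lambda>t. G N t s"]) auto
      qed
    qed measurable
    then show "(Cf \<circ> X) \<longlonglongrightarrow> Cf t" by (simp add: Cf_def o_def)
  qed
  have Ci: "integrable lborel Cf"
  proof (rule Bochner_Integration.integrable_bound)
    show "integrable lborel (\<lambda>t. A t * (LINT s|lborel. b s))" using majorantD(1)[OF Am] by simp
    show "Cf \<in> borel_measurable lborel" using Cc by (simp add: borel_measurable_continuous_onI)
    have "cmod (Cf t) \<le> A t * (LINT s|lborel. b s)" for t
    proof -
      have i: "integrable lborel (\<lambda>s. G N t s * (1 / (complex_of_real s - w)))"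
      proof (rule Bochner_Integration.integrable_bound)
        show "integrable lborel (\<lambda>s. A t * b s)" using majorantD(1)[OF bm] by simp
        show "AE s in lborel. norm (G N t s * (1 / (complex_of_real s - w))) \<le> norm (A t * b s)"
          using le by (intro AE_I2) (simp add: order_trans[OF _ abs_ge_self])
      qed measurable
      have "cmod (Cf t) \<le> (LINT s|lborel. A t * b s)"
        unfolding Cf_def using i majorantD(1)[OF bm] le by (intro order_trans[OF integral_norm_bound] integral_mono) auto
      then show ?thesis by simp
    qed
    then show "AE t in lborel. norm (Cf t) \<le> norm (A t * (LINT s|lborel. b s))"
      by (intro AE_I2) (auto intro: order_trans[OF _ abs_ge_self])
  qed
  have "(LINT t|lborel. Cf t * iexp (\<xi> * t)) = 0" for \<xi>
  proof -
    define H where "H t s = G N t s * (1 / (complex_of_real s - w)) * iexp (\<xi> * t)" for t s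
    have Hle: "cmod (H t s) \<le> A t * b s" for t s
      using le[of t s] unfolding H_def norm_mult[of _ "iexp _"] by simp
    define f where "f = (\<lambda>x. rho N x * (1 / (complex_of_real x - w)) * iexp (- \<xi> * x))"
    note fann = modulated_resolvent_annihilated[OF w, of N \<xi>, folded f_def]
    have "(LINT t|lborel. Cf t * iexp (\<xi> * t)) = (LINT t|lborel. (LINT s|lborel. H t s))"
      unfolding Cf_def H_def integral_mult_left_zero ..
    also have "\<dots> = (LINT s|lborel. (LINT t|lborel. H t s))"
    proof -
      have "integrable (lborel \<Otimes>\<^sub>M lborel) (\<lambda>z. H (snd z) (fst z))"
      proof (rule integrable_pair_dominated)
        show "(\<lambda>z. H (snd z) (fst z)) \<in> borel_measurable (borel \<Otimes>\<^sub>M borel)" unfolding H_def by measurable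
        show "cmod (H (snd (s, t)) (fst (s, t))) \<le> b s * A t" for s t using Hle[of t s] by (simp add: mult.commute)
      qed (use bm Am in \<open>auto simp: majorantD\<close>)
      from lborel_pair.Fubini_integral[of "\<lambda>s t. H t s"] this show ?thesis by (simp add: split_def)
    qed
    \<comment> \<open>Substituting \<open>t = x - s\<close> leads from the diagonal coordinate back
      to the kernel variables; after another exchange the inner integral over \<open>s\<close> is
      the operator applied to \<open>f\<close>.\<close>
    also have "\<dots> = (LINT s|lborel. (LINT x|lborel. H (x - s) s))"
    proof (rule Bochner_Integration.integral_cong[OF refl])
      fix s
      show "(LINT t|lborel. H t s) = (LINT x|lborel. H (x - s) s)"
        using lborel_integral_real_affine[of 1 "\<lambda>x. H x s" "- s"] by (simp add: add.commute)
    qed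
    also have "\<dots> = (LINT x|lborel. (LINT s|lborel. H (x - s) s))"
    proof -
      have "integrable (lborel \<Otimes>\<^sub>M lborel) (\<lambda>z. H (snd z - fst z) (fst z))"
      proof (rule integrable_pair_dominated)
        show "(\<lambda>z. H (snd z - fst z) (fst z)) \<in> borel_measurable (borel \<Otimes>\<^sub>M borel)" unfolding H_def by measurable
        show "cmod (H (snd (s, x) - fst (s, x)) (fst (s, x))) \<le> b s * A (x - s)" for s x
          using Hle[of "x - s" s] by (simp add: mult.commute)
        show "integrable lborel (\<lambda>x. A (x - s))" "(LINT x|lborel. A (x - s)) = (LINT x|lborel. A x)" for s
          using majorantD(1)[OF Am] by (simp_all add: integrable_reflect)
      qed (use bm in \<open>auto simp: majorantD\<close>)
      from lborel_pair.Fubini_integral[of "\<lambda>s x. H (x - s) s"] this show ?thesis by (simp add: split_def)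
    qed
    also have "\<dots> = (LINT x|lborel. rho N x ^ 2 * (iexp (\<xi> * x) * bump_op n1 (\<Phi> (bump_op n2 (mop (\<lambda>x. rho N x ^ 3) f))) x))"
    proof (rule Bochner_Integration.integral_cong[OF refl])
      fix x
      have "bump_op n1 (\<Phi> (bump_op n2 (mop (\<lambda>x. rho N x ^ 3) f))) x = (LINT y|lborel. k x y * rho N y ^ 3 * f y)"
      proof (rule kernel_formula[OF _ majorant_cauchy _ fann(1)])
        show "continuous_on UNIV (\<lambda>x. rho N x ^ 3)" by (intro continuous_intros rho_continuous)
        show "cmod (rho N x ^ 3) \<le> (2 * real (Suc N)) ^ 2 * (1 / (1 + x\<^sup>2))" for x
          using rho_cube_majorant[of N x 1] by (simp add: numeral_3_eq_3)
      qed simp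
      then have "rho N x ^ 2 * (iexp (\<xi> * x) * bump_op n1 (\<Phi> (bump_op n2 (mop (\<lambda>x. rho N x ^ 3) f))) x) =
        (LINT y|lborel. rho N x ^ 2 * (iexp (\<xi> * x) * (k x y * rho N y ^ 3 * f y)))"
        by (simp only: integral_mult_right_zero)
      also have "\<dots> = (LINT s|lborel. H (x - s) s)"
      proof (rule Bochner_Integration.integral_cong[OF refl])
        fix s
        \<comment> \<open>The phase in \<open>t\<close> splits into a modulation of the output and
          the opposite modulation contained in \<open>f\<close>.\<close>
        have "iexp (\<xi> * x) * iexp (- \<xi> * s) = iexp (\<xi> * (x - s))"
          by (simp add: exp_add[symmetric] algebra_simps)
        then show "rho N x ^ 2 * (iexp (\<xi> * x) * (k x s * rho N s ^ 3 * f s)) = H (x - s) s"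
          unfolding H_def G_def f_def by (simp add: power4_eq_xxxx power3_eq_cube mult_ac)
      qed
      finally show "(LINT s|lborel. H (x - s) s) = rho N x ^ 2 * (iexp (\<xi> * x) * bump_op n1 (\<Phi> (bump_op n2 (mop (\<lambda>x. rho N x ^ 3) f))) x)" ..
    qed
    also have "\<dots> = 0" by (rule fann(2))
    finally show ?thesis .
  qed
  from AE_zero_continuous[OF Fourier_injective[OF Ci this] Cc] show ?thesis unfolding Cf_def .
qed

end

section \<open>Approximation by the parabolic algebra\<close>

lemma dominated_kernel_limit:
  assumes K: "\<And>n. dominated_kernel m (K n)" and lim: "\<And>x y. (\<lambda>n. K n x y) \<longlonglongrightarrow> L x y"
  shows "dominated_kernel m L"
  unfolding dominated_kernel_def
proof (intro conjI allI)
  show "majorant m" using K by (rule dominated_kernelD)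
  show "(\<lambda>(x, y). L x y) \<in> borel_measurable (borel \<Otimes>\<^sub>M borel)"
    by (rule borel_measurable_LIMSEQ_metric[OF dominated_kernelD(2)[OF K]]) (use lim in auto)
  show "cmod (L x y) \<le> m (x - y)" for x y
    by (rule LIMSEQ_le_const2[OF tendsto_norm[OF lim]]) (use dominated_kernelD(3)[OF K] in auto)
qed

context closed_algebra
begin

lemma inA_kop_pointwise_limit:
  assumes "\<And>n::nat. inA p A (kop (K n))" "\<And>n. dominated_kernel m (K n)" "\<And>x y. (\<lambda>n. K n x y) \<longlonglongrightarrow> L x y"
  shows "inA p A (kop L)" "dominated_kernel m L"
  using dominated_kernel_limit[OF assms(2,3)] inA_kop_limit[OF assms(1,2) _ assms(3)] by auto

lemma inA_kop_sum:
  fixes n :: nat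
  assumes K: "\<And>j. inA p A (kop (K j))" "\<And>j. dominated_kernel m (K j)"
    and d: "dominated_kernel m' (\<lambda>x y. \<Sum>j<n. c j * K j x y)"
  shows "inA p A (kop (\<lambda>x y. \<Sum>j<n. c j * K j x y))"
proof (rule inA_cong[OF inA_sum[of n "\<lambda>j f x. c j * kop (K j) f x"] kop_bop[OF p d]])
  show "inA p A (\<lambda>f x. c j * kop (K j) f x)" for j by (rule inA_scale[OF K(1)])
  fix f assume f: "LpF p f"
  have "kop (\<lambda>x y. \<Sum>j<n. c j * K j x y) f x = (\<Sum>j<n. c j * kop (K j) f x)" for x
  proof -
    have i: "integrable lborel (\<lambda>y. c j * (K j x y * f y))" for j
      by (intro integrable_mult_right kop_dominated(1)[OF p K(2) f])
    have "kop (\<lambda>x y. \<Sum>j<n. c j * K j x y) f x = (LINT y|lborel. (\<Sum>j<n. c j * (K j x y * f y)))"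
      unfolding kop_def by (simp add: sum_distrib_right mult.assoc)
    also have "\<dots> = (\<Sum>j<n. c j * kop (K j) f x)"
      unfolding kop_def integral_mult_right_zero[symmetric] by (rule Bochner_Integration.integral_sum) (rule i)
    finally show ?thesis .
  qed
  then show "AE x in lborel. (\<Sum>j<n. c j * kop (K j) f x) = kop (\<lambda>x y. \<Sum>j<n. c j * K j x y) f x" by simp
qed

end

context binest_kernel
begin

text \<open>The Cauchy integral at the conjugate point vanishes by \<open>G_annihilated\<close>, and
  the difference of the two Cauchy kernels is the Poisson kernel. One resolvent is enough here
  because \<open>G N t\<close> is itself integrable.\<close>

lemma cauchy_eq_PI:
  assumes e: "e > 0"
  shows "(LINT s|lborel. 1 / (2 * complex_of_real pi * \<i>) * (G N t s * (1 / (complex_of_real s - Complex y e)))) = PI e (G N t) y"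
proof -
  obtain K where K: "K \<ge> 0" "\<And>t s. cmod (G N t s) \<le> K * (1 / (1 + t\<^sup>2)) * (1 / (1 + s\<^sup>2))" by (rule G_bound[of N]) blast
  have int: "integrable lborel (\<lambda>s. G N t s * (1 / (complex_of_real s - z)))" if z: "Im z \<noteq> 0" for z
  proof (rule Bochner_Integration.integrable_bound)
    show "integrable lborel (\<lambda>s. K * (1 / (1 + t\<^sup>2)) * (1 / \<bar>Im z\<bar>) * (1 / (1 + s\<^sup>2)))"
      by (intro integrable_mult_right integral_inverse_square)
    have le: "cmod (G N t s * (1 / (complex_of_real s - z))) \<le> K * (1 / (1 + t\<^sup>2)) * (1 / \<bar>Im z\<bar>) * (1 / (1 + s\<^sup>2))" for s
    proof -
      have "\<bar>Im z\<bar> \<le> cmod (complex_of_real s - z)" using abs_Im_le_cmod[of "complex_of_real s - z"] by simp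
      then have "cmod (1 / (complex_of_real s - z)) \<le> 1 / \<bar>Im z\<bar>"
        using z unfolding norm_divide norm_one by (intro divide_left_mono mult_pos_pos) (auto intro: order.strict_trans2)
      then have "cmod (G N t s * (1 / (complex_of_real s - z))) \<le> K * (1 / (1 + t\<^sup>2)) * (1 / (1 + s\<^sup>2)) * (1 / \<bar>Im z\<bar>)"
        unfolding norm_mult using K(2)[of t s] order_trans[OF norm_ge_zero K(2)[of t s]] by (intro mult_mono) auto
      then show ?thesis by (simp only: mult_ac)
    qed
    show "AE s in lborel. norm (G N t s * (1 / (complex_of_real s - z))) \<le> norm (K * (1 / (1 + t\<^sup>2)) * (1 / \<bar>Im z\<bar>) * (1 / (1 + s\<^sup>2)))"
    proof (rule AE_I2)
      fix s
      have "K * (1 / (1 + t\<^sup>2)) * (1 / \<bar>Im z\<bar>) * (1 / (1 + s\<^sup>2)) \<le> norm (K * (1 / (1 + t\<^sup>2)) * (1 / \<bar>Im z\<bar>) * (1 / (1 + s\<^sup>2)))"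
        by (simp only: real_norm_def abs_ge_self)
      with le[of s] show "norm (G N t s * (1 / (complex_of_real s - z))) \<le> norm (K * (1 / (1 + t\<^sup>2)) * (1 / \<bar>Im z\<bar>) * (1 / (1 + s\<^sup>2)))"
        by (rule order_trans)
    qed
  qed measurable
  let ?z = "Complex y e" and ?zc = "Complex y (- e)"
  have zc: "(LINT s|lborel. G N t s * (1 / (complex_of_real s - ?zc))) = 0" by (rule G_annihilated) (use e in simp)
  have "(LINT s|lborel. 1 / (2 * complex_of_real pi * \<i>) * (G N t s * (1 / (complex_of_real s - ?z)))) =
    1 / (2 * complex_of_real pi * \<i>) * ((LINT s|lborel. G N t s * (1 / (complex_of_real s - ?z))) - (LINT s|lborel. G N t s * (1 / (complex_of_real s - ?zc))))"
    unfolding zc integral_mult_right_zero by simp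
  also have "\<dots> = 1 / (2 * complex_of_real pi * \<i>) * (LINT s|lborel. G N t s * (1 / (complex_of_real s - ?z)) - G N t s * (1 / (complex_of_real s - ?zc)))"
    using e by (subst Bochner_Integration.integral_diff[OF int int]) auto
  also have "\<dots> = (LINT s|lborel. 1 / (2 * complex_of_real pi * \<i>) * (G N t s * (1 / (complex_of_real s - ?z)) - G N t s * (1 / (complex_of_real s - ?zc))))"
    by (rule integral_mult_right_zero[symmetric])
  also have "\<dots> = (LINT s|lborel. complex_of_real (poisson e (y - s)) * G N t s)"
  proof (rule Bochner_Integration.integral_cong[OF refl])
    fix s
    define a b where "a = complex_of_real s - ?z" and "b = complex_of_real s - ?zc"
    have nz: "a \<noteq> 0" "b \<noteq> 0" unfolding a_def b_def using e by (auto simp: complex_eq_iff)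
    have "1 / a - 1 / b = (b - a) / (a * b)" using nz by (simp add: field_simps)
    also have "b - a = 2 * \<i> * complex_of_real e" by (simp add: a_def b_def complex_eq_iff)
    also have "a * b = complex_of_real ((y - s)\<^sup>2 + e\<^sup>2)"
      by (simp add: a_def b_def complex_eq_iff power2_eq_square algebra_simps)
    finally have "1 / (2 * complex_of_real pi * \<i>) * (1 / a - 1 / b) = complex_of_real (poisson e (y - s))"
      by (simp add: poisson_def)
    then have "1 / (2 * complex_of_real pi * \<i>) * (1 / a - 1 / b) * G N t s = complex_of_real (poisson e (y - s)) * G N t s" by simp
    then show "1 / (2 * complex_of_real pi * \<i>) * (G N t s * (1 / (complex_of_real s - ?z)) - G N t s * (1 / (complex_of_real s - ?zc))) = complex_of_real (poisson e (y - s)) * G N t s"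
      unfolding a_def b_def by (simp add: algebra_simps)
  qed
  finally show ?thesis unfolding PI_def kop_def .
qed

text \<open>Three limits of kernels in turn: Riemann sums over a bounded range of \<open>s\<close>,
  then the range tending to the whole line, then \<open>e \<rightarrow> 0\<close>. Each needs its
  own majorant, always a multiple of \<open>m\<close>; in the first two the multiple may depend on
  \<open>e\<close>, in the last it must not.\<close>

lemma inA_regularised_kernel:
  assumes "closed_algebra p A"
  shows "inA p A (kop (\<lambda>x y. rho N x ^ 2 * k x y * rho N y ^ 4))"
proof -
  interpret closed_algebra p A by fact
  obtain K where K: "K \<ge> 0" "\<And>t s. cmod (G N t s) \<le> K * (1 / (1 + t\<^sup>2)) * (1 / (1 + s\<^sup>2))" by (rule G_bound[of N]) blast
  define m where "m t = K * (1 / (1 + t\<^sup>2))" for t :: real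
  define b where "b s = 1 / (1 + s\<^sup>2)" for s :: real
  have m: "majorant m" unfolding m_def[abs_def] by (rule majorant_cauchy[OF K(1)])
  have b: "majorant b" using majorant_cauchy[of 1] unfolding b_def[abs_def] by simp
  have m0: "m t \<ge> 0" for t using majorantD(2)[OF m] .
  have Gb: "cmod (G N t s) \<le> m t * b s" for t s using K(2) by (simp add: m_def b_def)
  have b1: "b s \<le> 1" for s by (simp add: b_def divide_le_eq_1 add_pos_nonneg)
  have Gm: "cmod (G N t s) \<le> m t" for t s
    using Gb[of t s] mult_left_mono[OF b1[of s] m0[of t]] by simp
  have mc: "majorant (\<lambda>t. C * m t)" if "C \<ge> 0" for C
    using majorant_cauchy[of "C * K"] that K(1) by (simp add: m_def[abs_def] mult.assoc)
  define Q where "Q e s x y = G N (x - y) s * (1 / (complex_of_real s - Complex y e))" for e s x y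
  have rb: "cmod (1 / (complex_of_real s - Complex y e)) \<le> 1 / e" if "e > 0" for s y e
  proof -
    have "e \<le> cmod (complex_of_real s - Complex y e)" using abs_Im_le_cmod[of "complex_of_real s - Complex y e"] that by simp
    then show ?thesis using that unfolding norm_divide norm_one by (intro divide_left_mono mult_pos_pos) (auto intro: order.strict_trans2)
  qed
  have Qb: "cmod (Q e s x y) \<le> (1 / e) * m (x - y) * b s" if "e > 0" for e s x y
  proof -
    have "cmod (Q e s x y) \<le> (m (x - y) * b s) * (1 / e)"
      unfolding Q_def norm_mult using Gb rb[OF that] m0 majorantD(2)[OF b] that by (intro mult_mono) auto
    then show ?thesis by (simp add: mult_ac)
  qed
  have Qb1: "cmod (Q e s x y) \<le> (1 / e) * m (x - y)" if "e > 0" for e s x y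
  proof (rule order_trans[OF Qb[OF that]])
    show "(1 / e) * m (x - y) * b s \<le> (1 / e) * m (x - y)"
      using mult_left_mono[OF b1[of s], of "(1 / e) * m (x - y)"] m0[of "x - y"] that by simp
  qed
  have Qmeas: "(\<lambda>z. Q e s (fst z) (snd z)) \<in> borel_measurable (borel \<Otimes>\<^sub>M borel)" for e s
    unfolding Q_def Complex_eq by measurable
  have Qd: "dominated_kernel (\<lambda>t. (1 / e) * m t) (Q e s)" if "e > 0" for e s
    unfolding dominated_kernel_def using mc[of "1 / e"] Qb1[OF that] Qmeas[of e s] that by (auto simp: split_def)
  have QA: "inA p A (kop (Q e s))" if e: "e > 0" for e s
  proof -
    have c: "inA p A (kop (\<lambda>x y. G N (x - y) s))"
      by (rule inA_conv[OF _ G_zero m Gm]) (intro G_continuous_compose continuous_intros)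
    have "inA p A (mop (\<lambda>y. - 1 * (1 / (complex_of_real y - (complex_of_real s - \<i> * complex_of_real e)))))"
      by (rule inA_mop_scale[OF inA_resolvent]) (use e in simp)
    also have "(\<lambda>y. - 1 * (1 / (complex_of_real y - (complex_of_real s - \<i> * complex_of_real e)))) = (\<lambda>y. 1 / (complex_of_real s - Complex y e))"
    proof
      fix y
      have "complex_of_real s - Complex y e = - (complex_of_real y - (complex_of_real s - \<i> * complex_of_real e))"
        by (simp add: complex_eq_iff)
      then show "- 1 * (1 / (complex_of_real y - (complex_of_real s - \<i> * complex_of_real e))) = 1 / (complex_of_real s - Complex y e)"
        by (simp only: divide_minus_right) simp
    qed
    finally have r: "inA p A (mop (\<lambda>y. 1 / (complex_of_real s - Complex y e)))" .
    have "(\<lambda>f. kop (\<lambda>x y. G N (x - y) s) (mop (\<lambda>y. 1 / (complex_of_real s - Complex y e)) f)) = kop (Q e s)"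
      unfolding kop_def mop_def Q_def[abs_def] by (simp only: mult.assoc)
    with inA_compose[OF c r] show ?thesis by simp
  qed
  define c0 where "c0 = 1 / (2 * complex_of_real pi * \<i>)"
  have c0: "cmod c0 \<le> 1"
  proof -
    have "1 \<le> 2 * pi" using pi_gt3 by simp
    then show ?thesis by (simp add: c0_def norm_divide norm_mult divide_le_eq_1)
  qed
  define LM where "LM e M x y = (LINT s|lborel. indicator {- real M..<real M} s *\<^sub>R (c0 * Q e s x y))" for e x y and M :: nat
  have Qcont: "continuous_on UNIV (\<lambda>s. Q e s x y)" if "e > 0" for e x y
  proof -
    have "complex_of_real s - Complex y e \<noteq> 0" for s using that by (auto simp: complex_eq_iff)
    then show ?thesis unfolding Q_def by (intro continuous_intros G_continuous_compose) auto
  qed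
  have LMA: "inA p A (kop (LM e M))" "dominated_kernel (\<lambda>t. real (2 * M) * ((1 / e) * m t)) (LM e M)" if e: "e > 0" for e M
  proof -
    define sj where "sj n j = real j / real (Suc n) - real M" for n j
    define cj where "cj n = complex_of_real (1 / real (Suc n)) * c0" for n
    define RS where "RS n x y = (\<Sum>j<Suc n * (2 * M). cj n * Q e (sj n j) x y)" for n x y
    have RSd: "dominated_kernel (\<lambda>t. real (2 * M) * ((1 / e) * m t)) (RS n)" for n
      unfolding dominated_kernel_def
    proof (intro conjI allI)
      show "majorant (\<lambda>t. real (2 * M) * ((1 / e) * m t))"
        using mc[of "real (2 * M) * (1 / e)"] e by (simp add: mult.assoc)
      show "(\<lambda>(x, y). RS n x y) \<in> borel_measurable (borel \<Otimes>\<^sub>M borel)"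
        unfolding RS_def split_def by (intro borel_measurable_sum borel_measurable_times borel_measurable_const Qmeas)
      show "cmod (RS n x y) \<le> real (2 * M) * ((1 / e) * m (x - y))" for x y
      proof -
        have "cmod (RS n x y) \<le> (\<Sum>j<Suc n * (2 * M). 1 / real (Suc n) * ((1 / e) * m (x - y)))"
          unfolding RS_def
        proof (rule sum_norm_le)
          fix j
          have "cmod (cj n) \<le> 1 / real (Suc n) * 1"
            unfolding cj_def norm_mult norm_of_real using c0 by (intro mult_mono) auto
          then show "cmod (cj n * Q e (sj n j) x y) \<le> 1 / real (Suc n) * ((1 / e) * m (x - y))"
            unfolding norm_mult using Qb1[OF e] by (intro mult_mono) auto
        qed
        also have "\<dots> = real (Suc n * (2 * M)) * (1 / real (Suc n) * ((1 / e) * m (x - y)))"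
          by (simp only: sum_constant card_lessThan)
        also have "\<dots> = real (2 * M) * ((1 / e) * m (x - y))"
          by (simp only: of_nat_mult[of "Suc n"]) (simp del: of_nat_Suc of_nat_mult)
        finally show ?thesis .
      qed
    qed
    have RSA: "inA p A (kop (RS n))" for n
      using inA_kop_sum[where K="\<lambda>j. Q e (sj n j)" and c="\<lambda>j. cj n" and n="Suc n * (2 * M)", OF QA[OF e] Qd[OF e]] RSd[of n]
      unfolding RS_def[abs_def] by blast
    have RSl: "(\<lambda>n. RS n x y) \<longlonglongrightarrow> LM e M x y" for x y
    proof -
      let ?g = "\<lambda>t. c0 * Q e (t - real M) x y"
      have "continuous_on UNIV ?g"
        by (intro continuous_intros continuous_on_compose2[OF Qcont[OF e]]) auto
      from riemann_sum_limit[OF this, of "2 * M"]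
      have "(\<lambda>n. RS n x y) \<longlonglongrightarrow> (LINT t|lborel. indicator {0..<real (2 * M)} t *\<^sub>R ?g t)"
        by (simp only: RS_def cj_def sj_def scaleR_conv_of_real mult.assoc)
      also have "(LINT t|lborel. indicator {0..<real (2 * M)} t *\<^sub>R ?g t) = (LINT s|lborel. indicator {0..<real (2 * M)} (real M + s) *\<^sub>R ?g (real M + s))"
        using lborel_integral_real_affine[of 1 "\<lambda>t. indicator {0..<real (2 * M)} t *\<^sub>R ?g t" "real M"] by simp
      also have "\<dots> = LM e M x y"
        unfolding LM_def by (intro Bochner_Integration.integral_cong refl) (auto simp: indicator_def)
      finally show ?thesis .
    qed
    show "inA p A (kop (LM e M))" "dominated_kernel (\<lambda>t. real (2 * M) * ((1 / e) * m t)) (LM e M)"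
      by (rule inA_kop_pointwise_limit[OF RSA RSd RSl])+
  qed
  define L where "L e x y = (LINT s|lborel. c0 * Q e s x y)" for e x y
  have LA: "inA p A (kop (L e))" "dominated_kernel (\<lambda>t. ((1 / e) * pi) * m t) (L e)" if e: "e > 0" for e
  proof -
    have w: "integrable lborel (\<lambda>s. (1 / e) * m (x - y) * b s)" for x y using majorantD(1)[OF b] by simp
    have bI: "(LINT s|lborel. b s) = pi" unfolding b_def by (rule integral_inverse_square)
    have Qc: "cmod (c0 * Q e s x y) \<le> (1 / e) * m (x - y) * b s" for s x y
    proof -
      have "cmod (c0 * Q e s x y) \<le> 1 * cmod (Q e s x y)" unfolding norm_mult by (intro mult_right_mono c0) auto
      then show ?thesis using Qb[OF e, of s x y] by simp
    qed
    have Qs [measurable]: "(\<lambda>s. c0 * Q e s x y) \<in> borel_measurable borel" for x y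
      unfolding Q_def by measurable
    have LMb: "cmod (indicator {- real M..<real M} s *\<^sub>R (c0 * Q e s x y)) \<le> (1 / e) * m (x - y) * b s" for M s x y
      using Qc[of s x y] order_trans[OF norm_ge_zero Qc[of s x y]] by (auto simp: indicator_def)
    \<comment> \<open>The majorant obtained from the Riemann sums grows with \<open>M\<close>.
      Integrating the decay \<open>b s\<close> over the line gives one that does not, at the cost of
      the constant \<open>pi / e\<close>.\<close>
    have LMd: "dominated_kernel (\<lambda>t. ((1 / e) * pi) * m t) (LM e M)" for M
      unfolding dominated_kernel_def
    proof (intro conjI allI)
      show "majorant (\<lambda>t. ((1 / e) * pi) * m t)" using mc[of "(1 / e) * pi"] e by simp
      show "(\<lambda>(x, y). LM e M x y) \<in> borel_measurable (borel \<Otimes>\<^sub>M borel)" by (rule dominated_kernelD(2)[OF LMA(2)[OF e]])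
      show "cmod (LM e M x y) \<le> ((1 / e) * pi) * m (x - y)" for x y
      proof -
        have "integrable lborel (\<lambda>s. indicator {- real M..<real M} s *\<^sub>R (c0 * Q e s x y))"
        proof (rule Bochner_Integration.integrable_bound[OF w[of x y]])
          show "(\<lambda>s. indicator {- real M..<real M} s *\<^sub>R (c0 * Q e s x y)) \<in> borel_measurable lborel" by measurable
          show "AE s in lborel. norm (indicator {- real M..<real M} s *\<^sub>R (c0 * Q e s x y)) \<le> norm ((1 / e) * m (x - y) * b s)"
          proof (rule AE_I2)
            fix s
            have "(1 / e) * m (x - y) * b s \<le> norm ((1 / e) * m (x - y) * b s)" by (simp only: real_norm_def abs_ge_self)
            with LMb[of M s x y] show "norm (indicator {- real M..<real M} s *\<^sub>R (c0 * Q e s x y)) \<le> norm ((1 / e) * m (x - y) * b s)"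
              by (rule order_trans)
          qed
        qed
        then have "cmod (LM e M x y) \<le> (LINT s|lborel. (1 / e) * m (x - y) * b s)"
          unfolding LM_def by (intro order_trans[OF integral_norm_bound] integral_mono integrable_norm w LMb)
        also have "\<dots> = (1 / e) * m (x - y) * pi" unfolding integral_mult_right_zero bI ..
        finally show ?thesis by (simp add: mult_ac)
      qed
    qed
    have LMl: "(\<lambda>M. LM e M x y) \<longlonglongrightarrow> L e x y" for x y
      unfolding LM_def L_def
    proof (rule integral_dominated_convergence[OF _ _ w])
      show "AE s in lborel. norm (indicator {- real M..<real M} s *\<^sub>R (c0 * Q e s x y)) \<le> (1 / e) * m (x - y) * b s" for M
        using LMb by simp
      show "AE s in lborel. (\<lambda>M. indicator {- real M..<real M} s *\<^sub>R (c0 * Q e s x y)) \<longlonglongrightarrow> c0 * Q e s x y"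
      proof (intro AE_I2 tendsto_eventually)
        fix s
        show "\<forall>\<^sub>F M in sequentially. indicator {- real M..<real M} s *\<^sub>R (c0 * Q e s x y) = c0 * Q e s x y"
          using eventually_gt_at_top[of "nat \<lceil>\<bar>s\<bar>\<rceil>"]
        proof eventually_elim
          case (elim M)
          then have "\<bar>s\<bar> < real M" by linarith
          then show ?case by (auto simp: indicator_def)
        qed
      qed
    qed measurable
    show "inA p A (kop (L e))" "dominated_kernel (\<lambda>t. ((1 / e) * pi) * m t) (L e)"
      by (rule inA_kop_pointwise_limit[OF LMA(1)[OF e] LMd LMl])+
  qed
  have LPI: "L e x y = PI e (G N (x - y)) y" if "e > 0" for e x y
    unfolding L_def Q_def c0_def by (rule cauchy_eq_PI[OF that])
  let ?e = "\<lambda>n. inverse (real (Suc n))"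
  have e: "?e n > 0" for n by simp
  \<comment> \<open>The Cauchy form bounds the kernel only by a multiple of \<open>m / e\<close>. In
    Poisson form the positive kernel of mass 1 yields a bound uniform in \<open>e\<close>.\<close>
  have PIb: "cmod (PI e (G N t) y) \<le> m t" if "e > 0" for e t y
  proof -
    have i1: "integrable lborel (\<lambda>s. poisson e (y - s) * m t)"
      using integrable_reflect(1)[OF poisson_integral(1)[OF that]] by simp
    have le: "cmod (complex_of_real (poisson e (y - s)) * G N t s) \<le> poisson e (y - s) * m t" for s
      unfolding norm_mult norm_of_real using poisson_nonneg[OF that] Gm by (intro mult_mono) auto
    have i2: "integrable lborel (\<lambda>s. complex_of_real (poisson e (y - s)) * G N t s)"
    proof (rule Bochner_Integration.integrable_bound[OF i1])
      show "(\<lambda>s. complex_of_real (poisson e (y - s)) * G N t s) \<in> borel_measurable lborel" by measurable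
      show "AE s in lborel. norm (complex_of_real (poisson e (y - s)) * G N t s) \<le> norm (poisson e (y - s) * m t)"
        using le by (auto intro!: AE_I2 order_trans[OF _ abs_ge_self])
    qed
    have "cmod (PI e (G N t) y) \<le> (LINT s|lborel. poisson e (y - s) * m t)"
      unfolding PI_def kop_def by (intro order_trans[OF integral_norm_bound] integral_mono integrable_norm i1 i2 le)
    also have "\<dots> = m t"
      unfolding integral_mult_left_zero integrable_reflect(2)[OF poisson_integral(1)[OF that]] poisson_integral(2)[OF that] by simp
    finally show ?thesis .
  qed
  have "inA p A (kop (\<lambda>x y. G N (x - y) y))"
  proof (rule inA_kop_pointwise_limit(1)[OF LA(1)[OF e]])
    show "dominated_kernel m (L (?e n))" for n
      unfolding dominated_kernel_def LPI[OF e]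
    proof (intro conjI allI m PIb e)
      show "(\<lambda>(x, y). PI (?e n) (G N (x - y)) y) \<in> borel_measurable (borel \<Otimes>\<^sub>M borel)"
        using dominated_kernelD(2)[OF LA(2)[OF e[of n]]] by (simp only: LPI[OF e])
    qed
    show "(\<lambda>n. L (?e n) x y) \<longlonglongrightarrow> G N (x - y) y" for x y
      unfolding LPI[OF e]
      by (rule PI_continuous_limit[OF p _ Gm e LIMSEQ_inverse_real_of_nat]) (intro G_continuous_compose continuous_intros)
  qed
  then show ?thesis by (simp add: G_def)
qed

lemma inA_regularised:
  assumes "closed_algebra p A"
  shows "inA p A (\<lambda>f. bump_op n1 (\<Phi> (bump_op n2 f)))"
proof -
  interpret closed_algebra p A by fact
  obtain C where C: "bop p C \<Phi>" by (rule \<Phi>_bop)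
  define \<Psi> where "\<Psi> f = bump_op n1 (\<Phi> (bump_op n2 f))" for f
  obtain D where D: "bop p D \<Psi>"
    unfolding \<Psi>_def[abs_def] using bop_compose(1)[OF p1 bump_op_bop[OF p] bop_compose(1)[OF p1 C bump_op_bop[OF p]]] by blast
  have m2: "(\<lambda>x. rho N x ^ j) \<in> borel_measurable borel" "cmod (rho N x ^ j) \<le> 1" for N j x
    by (measurable, simp add: norm_power power_le_one rho_le_1)
  have hm: "bop p 1 (mop (\<lambda>x. rho N x ^ j))" for N j
    using mop_bop[OF p1 m2, of N j] by simp
  have reg: "inA p A (\<lambda>f. mop (\<lambda>x. rho N x ^ 2) (\<Psi> (mop (\<lambda>x. rho N x ^ 4) f)))" for N
  proof (rule inA_cong[OF inA_regularised_kernel[OF assms, of N] bop_compose(1)[OF p1 hm bop_compose(1)[OF p1 D hm]]])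
    fix f assume f: "LpF p f"
    have "\<Psi> (mop (\<lambda>x. rho N x ^ 4) f) x = (LINT y|lborel. k x y * rho N y ^ 4 * f y)" for x
      unfolding \<Psi>_def
    proof (rule kernel_formula[OF _ majorant_cauchy _ f])
      show "continuous_on UNIV (\<lambda>x. rho N x ^ 4)" by (intro continuous_intros rho_continuous)
      show "cmod (rho N x ^ 4) \<le> (2 * real (Suc N)) ^ 2 * (1 / (1 + x\<^sup>2))" for x
        using rho_cube_majorant[of N x 2] by (simp add: numeral_eq_Suc)
    qed simp
    then have "kop (\<lambda>x y. rho N x ^ 2 * k x y * rho N y ^ 4) f x = mop (\<lambda>x. rho N x ^ 2) (\<Psi> (mop (\<lambda>x. rho N x ^ 4) f)) x" for x
      unfolding kop_def mop_def by (simp only: integral_mult_right_zero[symmetric] mult.assoc)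
    then show "AE x in lborel. kop (\<lambda>x y. rho N x ^ 2 * k x y * rho N y ^ 4) f x = mop (\<lambda>x. rho N x ^ 2) (\<Psi> (mop (\<lambda>x. rho N x ^ 4) f)) x" by simp
  qed
  have "inA p A \<Psi>"
  proof (rule inA_limit[OF reg D])
    fix f assume f: "LpF p f"
    have one: "(\<lambda>N. Np p (\<lambda>x. mop (\<lambda>x. rho N x ^ j) g x - mop (\<lambda>x. 1) g x)) \<longlonglongrightarrow> 0" if "LpF p g" for g j
    proof (rule mop_limit[OF p1 m2(1) _ m2(2) _ that])
      show "(\<lambda>N. rho N x ^ j) \<longlonglongrightarrow> 1" for x
        using tendsto_power[OF rho_limit[of x], of j] by simp
    qed simp
    have hL: "LpF p (mop (\<lambda>x. rho N x ^ 4) f)" for N by (rule bopD(2)[OF hm f])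
    have L1: "LpF p (\<lambda>x. \<Psi> (mop (\<lambda>x. rho N x ^ 4) f) x - \<Psi> f x)" for N
      by (rule LpF_diff(1)[OF p1 bopD(2)[OF D hL] bopD(2)[OF D f]])
    \<comment> \<open>Both outer and inner multipliers depend on \<open>N\<close>. The error splits
      into the outer multiplier applied to the inner error, controlled by the bound of
      \<open>\<Psi>\<close>, and the outer error on the fixed function
      \<open>\<Psi> f\<close>.\<close>
    have "(\<lambda>N. Np p (\<lambda>x. mop (\<lambda>x. rho N x ^ 2) (\<lambda>x. \<Psi> (mop (\<lambda>x. rho N x ^ 4) f) x - \<Psi> f x) x + (mop (\<lambda>x. rho N x ^ 2) (\<Psi> f) x - \<Psi> f x))) \<longlonglongrightarrow> 0"
    proof (rule Np_tendsto_add[OF p1])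
      show "LpF p (mop (\<lambda>x. rho N x ^ 2) (\<lambda>x. \<Psi> (mop (\<lambda>x. rho N x ^ 4) f) x - \<Psi> f x))" for N
        by (rule bopD(2)[OF hm L1])
      show "LpF p (\<lambda>x. mop (\<lambda>x. rho N x ^ 2) (\<Psi> f) x - \<Psi> f x)" for N
        by (rule LpF_diff(1)[OF p1 bopD(2)[OF hm bopD(2)[OF D f]] bopD(2)[OF D f]])
      show "(\<lambda>N. Np p (\<lambda>x. mop (\<lambda>x. rho N x ^ 2) (\<Psi> f) x - \<Psi> f x)) \<longlonglongrightarrow> 0"
        using one[OF bopD(2)[OF D f], of 2] by (simp add: mop_def)
      show "(\<lambda>N. Np p (mop (\<lambda>x. rho N x ^ 2) (\<lambda>x. \<Psi> (mop (\<lambda>x. rho N x ^ 4) f) x - \<Psi> f x))) \<longlonglongrightarrow> 0"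
      proof (rule tendsto_sandwich[OF _ _ tendsto_const])
        have "Np p (mop (\<lambda>x. rho N x ^ 2) (\<lambda>x. \<Psi> (mop (\<lambda>x. rho N x ^ 4) f) x - \<Psi> f x)) \<le> D * Np p (\<lambda>x. mop (\<lambda>x. rho N x ^ 4) f x - f x)" for N
          using order_trans[OF bopD(3)[OF hm L1, of N 2 N]] bop_diff_Np[OF p1 D hL f, of N] by simp
        then show "\<forall>\<^sub>F N in sequentially. Np p (mop (\<lambda>x. rho N x ^ 2) (\<lambda>x. \<Psi> (mop (\<lambda>x. rho N x ^ 4) f) x - \<Psi> f x)) \<le> D * Np p (\<lambda>x. mop (\<lambda>x. rho N x ^ 4) f x - f x)"
          by simp
        have "(\<lambda>N. D * Np p (\<lambda>x. mop (\<lambda>x. rho N x ^ 4) f x - mop (\<lambda>x. 1) f x)) \<longlonglongrightarrow> D * 0"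
          by (intro tendsto_mult tendsto_const one f)
        then show "(\<lambda>N. D * Np p (\<lambda>x. mop (\<lambda>x. rho N x ^ 4) f x - f x)) \<longlonglongrightarrow> 0"
          by (simp add: mop_def)
      qed simp
    qed
    moreover have "mop (\<lambda>x. rho N x ^ 2) (\<lambda>x. \<Psi> (mop (\<lambda>x. rho N x ^ 4) f) x - \<Psi> f x) x + (mop (\<lambda>x. rho N x ^ 2) (\<Psi> f) x - \<Psi> f x) = mop (\<lambda>x. rho N x ^ 2) (\<Psi> (mop (\<lambda>x. rho N x ^ 4) f)) x - \<Psi> f x" for N x
      unfolding mop_def by (simp add: right_diff_distrib)
    ultimately show "(\<lambda>N. Np p (\<lambda>x. mop (\<lambda>x. rho N x ^ 2) (\<Psi> (mop (\<lambda>x. rho N x ^ 4) f)) x - \<Psi> f x)) \<longlonglongrightarrow> 0"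
      by simp
  qed
  then show ?thesis unfolding \<Psi>_def[abs_def] .
qed

end

text \<open>The bumps are removed one at a time: the inner one by continuity of the operators
  standing to its left, then the outer one acting on the fixed function
  \<open>\<Phi> f\<close>.\<close>

lemma Fourier_binest_in_closed_algebra:
  assumes A: "closed_algebra p A" and T: "T \<in> Fourier_binest_algebra p"
  shows "T \<in> A"
proof -
  interpret closed_algebra p A by fact
  have bk: "binest_kernel p T" by (intro binest_kernel.intro p T)
  define \<Phi> where "\<Phi> f = fn (T (mk f))" for f
  have eq: "binest_kernel.\<Phi> T = \<Phi>" by (simp add: fun_eq_iff binest_kernel.\<Phi>_def[OF bk] \<Phi>_def)
  obtain C where C: "bop p C \<Phi>" "op p \<Phi> = T"
    by (rule binest_kernel.\<Phi>_bop[OF bk]) (simp only: eq)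
  have 1: "inA p A (\<lambda>f. bump_op n1 (\<Phi> (bump_op n2 f)))" for n1 n2
    using binest_kernel.inA_regularised[OF bk A, of n1 n2] by (simp only: eq)
  have 2: "inA p A (\<lambda>f. bump_op n1 (\<Phi> f))" for n1
  proof (rule inA_limit[OF 1])
    note b = bop_compose(1)[OF p1 bump_op_bop[OF p, of n1] C(1)]
    show "bop p (1 * C) (\<lambda>f. bump_op n1 (\<Phi> f))" by (rule b)
    fix f assume f: "LpF p f"
    show "(\<lambda>n. Np p (\<lambda>x. bump_op n1 (\<Phi> (bump_op n f)) x - bump_op n1 (\<Phi> f) x)) \<longlonglongrightarrow> 0"
    proof (rule tendsto_sandwich[OF _ _ tendsto_const])
      show "(\<lambda>n. 1 * C * Np p (\<lambda>x. bump_op n f x - f x)) \<longlonglongrightarrow> 0"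
        using tendsto_mult[OF tendsto_const bump_op_limit[OF p f], of "1 * C"] by simp
    qed (use bop_diff_Np[OF p1 b bopD(2)[OF bump_op_bop[OF p] f] f] in auto)
  qed
  have "inA p A \<Phi>"
    by (rule inA_limit[OF 2 C(1)]) (rule bump_op_limit[OF p bopD(2)[OF C(1)]])
  then show ?thesis using C(2) by (simp add: inA_def)
qed

theorem theorem3p7:
  fixes p :: real
  assumes "1 < p"
  shows "parabolic_algebra p = Fourier_binest_algebra p"
proof
  show "parabolic_algebra p \<subseteq> Fourier_binest_algebra p"
    by (rule parabolic_subset_Fourier[OF assms])
  \<comment> \<open>The hull is the intersection of all closed algebras containing the generators,
    and the binest algebra lies in each of them.\<close>
  show "Fourier_binest_algebra p \<subseteq> parabolic_algebra p"
    unfolding parabolic_algebra_def SOT_closed_algebra_generated_def hull_def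
    using Fourier_binest_in_closed_algebra[OF closed_algebra.intro[OF assms]] by blast
qed

end
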